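(* Let $g\ge 3$ be an integer. Let $\mathbf{r},\mathbf{s}$ be nonnegative integers such that $\mathbf{r}+2\mathbf{s}=g$. Then there exists a $2$-simple complex torus $T$ of dimension $g$ such that the endomorphism algebra $\mathrm{End}^0(T)$ is a number field $E$ with $$[E:\mathbb{Q}]=g,\quad r_E=\mathbf{r},\quad s_E=\mathbf{s}.$$ In particular, if $d$ is an integer such that $\frac{g}{2}-1\le d\le g-1$ then there exists a $g$-dimensional $2$-simple complex torus $T$ such that $$\mathrm{Aut}(T)\cong\mathbb{Z}^{d}\times\{\pm 1\}.$$
   Context: A complex torus of dimension $g$ is $T=V/\Lambda$, with $V$ a $g$-dimensional complex vector space and $\Lambda\subset V$ a discrete subgroup of rank $2g$. Put $\Lambda_{\mathbb{Q}}=\Lambda\otimes\mathbb{Q}=\mathrm{H}_1(T,\mathbb{Q})$. $\mathrm{End}(T)$ is the endomorphism ring of the complex Lie group $T$, $\mathrm{End}^0(T)=\mathrm{End}(T)\otimes\mathbb{Q}$, and $\mathrm{Aut}(T)=\mathrm{End}(T)^*$ is the automorphism group of the complex Lie group $T$. $\mathrm{H}^2(T,\mathbb{Q})=\mathrm{Hom}_{\mathbb{Q}}(\wedge^2_{\mathbb{Q}}\Lambda_{\mathbb{Q}},\mathbb{Q})$ carries its natural rational Hodge structure of weight two, $\mathrm{H}^2(T,\mathbb{C})=\mathrm{H}^{2,0}(T)\oplus\mathrm{H}^{1,1}(T)\oplus\mathrm{H}^{0,2}(T)$, where $\mathrm{H}^{2,0}(T)$ is the space of holomorphic $2$-forms on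 $T$. A complex torus $T$ of dimension $g\ge 2$ is called $2$-simple if for every rational Hodge substructure $H$ of $\mathrm{H}^2(T,\mathbb{Q})$ with $H_{\mathbb{C}}\cap \mathrm{H}^{2,0}(T)\ne\{0\}$ (where $H_{\mathbb{C}}=H\otimes_{\mathbb{Q}}\mathbb{C}$), $H_{\mathbb{C}}$ contains the whole $\mathrm{H}^{2,0}(T)$. For a number field $E$, the nonnegative integers $r_E,s_E$ are defined by $E\otimes_{\mathbb{Q}}\mathbb{R}\cong\mathbb{R}^{r_E}\times\mathbb{C}^{s_E}$. *)

theory Defs
  imports
    "HOL-Analysis.Analysis"
    "HOL-Algebra.Algebra"
    "HOL-Algebra.Algebraic_Closure_Type"
    "HOL-Library.Function_Algebras"
begin

section \<open>Tensor products of rings and number fields\<close>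

text \<open>
  The tensor product \<open>A \<otimes>\<^sub>K B\<close> of two rings along ring homomorphisms \<open>\<phi> : K \<rightarrow> A\<close> and
  \<open>\<psi> : K \<rightarrow> B\<close> with central images, \<open>K\<close> commutative: the free abelian group on
  \<open>A \<times> B\<close>, with \<open>(a, b) (a', b') = (a a', b b')\<close>, modulo the bilinearity and
  balancing relations. The additive subgroup generated by these relations is already an
  ideal, so taking the generated ideal adds nothing.
\<close>

definition pair_ring ::
    "('a, 'x) ring_scheme \<Rightarrow> ('b, 'y) ring_scheme \<Rightarrow> (('a \<times> 'b) \<Rightarrow>\<^sub>0 int) ring" where
  "pair_ring A B =
     \<lparr>carrier = {x. Poly_Mapping.keys x \<subseteq> carrier A \<times> carrier B},
      monoid.mult = (\<lambda>x y. frag_extend (\<lambda>(a, b). frag_extend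
          (\<lambda>(a', b'). frag_of (a \<otimes>\<^bsub>A\<^esub> a', b \<otimes>\<^bsub>B\<^esub> b')) y) x),
      one = frag_of (\<one>\<^bsub>A\<^esub>, \<one>\<^bsub>B\<^esub>),
      ring.zero = 0,
      ring.add = (+)\<rparr>"

definition tensor_relations ::
    "('k, 'z) ring_scheme \<Rightarrow> ('k \<Rightarrow> 'a) \<Rightarrow> ('a, 'x) ring_scheme \<Rightarrow> ('k \<Rightarrow> 'b) \<Rightarrow>
     ('b, 'y) ring_scheme \<Rightarrow> (('a \<times> 'b) \<Rightarrow>\<^sub>0 int) set" where
  "tensor_relations K \<phi> A \<psi> B =
     {frag_of (a \<oplus>\<^bsub>A\<^esub> a', b) - frag_of (a, b) - frag_of (a', b) | a a' b.
        a \<in> carrier A \<and> a' \<in> carrier A \<and> b \<in> carrier B} \<union>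
     {frag_of (a, b \<oplus>\<^bsub>B\<^esub> b') - frag_of (a, b) - frag_of (a, b') | a b b'.
        a \<in> carrier A \<and> b \<in> carrier B \<and> b' \<in> carrier B} \<union>
     {frag_of (a \<otimes>\<^bsub>A\<^esub> \<phi> k, b) - frag_of (a, \<psi> k \<otimes>\<^bsub>B\<^esub> b) | a k b.
        a \<in> carrier A \<and> k \<in> carrier K \<and> b \<in> carrier B}"

definition tensor_ideal ::
    "('k, 'z) ring_scheme \<Rightarrow> ('k \<Rightarrow> 'a) \<Rightarrow> ('a, 'x) ring_scheme \<Rightarrow> ('k \<Rightarrow> 'b) \<Rightarrow>
     ('b, 'y) ring_scheme \<Rightarrow> (('a \<times> 'b) \<Rightarrow>\<^sub>0 int) set" where
  "tensor_ideal K \<phi> A \<psi> B = genideal (pair_ring A B) (tensor_relations K \<phi> A \<psi> B)"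

definition tensor_ring ::
    "('k, 'z) ring_scheme \<Rightarrow> ('k \<Rightarrow> 'a) \<Rightarrow> ('a, 'x) ring_scheme \<Rightarrow> ('k \<Rightarrow> 'b) \<Rightarrow>
     ('b, 'y) ring_scheme \<Rightarrow> (('a \<times> 'b) \<Rightarrow>\<^sub>0 int) set ring" where
  "tensor_ring K \<phi> A \<psi> B = pair_ring A B Quot tensor_ideal K \<phi> A \<psi> B"

definition pure_tensor ::
    "('k, 'z) ring_scheme \<Rightarrow> ('k \<Rightarrow> 'a) \<Rightarrow> ('a, 'x) ring_scheme \<Rightarrow> ('k \<Rightarrow> 'b) \<Rightarrow>
     ('b, 'y) ring_scheme \<Rightarrow> 'a \<Rightarrow> 'b \<Rightarrow> (('a \<times> 'b) \<Rightarrow>\<^sub>0 int) set" where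
  "pure_tensor K \<phi> A \<psi> B a b =
     tensor_ideal K \<phi> A \<psi> B +>\<^bsub>pair_ring A B\<^esub> frag_of (a, b)"

definition rat_ring :: "rat ring" where "rat_ring = ring_of_type_algebra"
definition real_ring :: "real ring" where "real_ring = ring_of_type_algebra"
definition complex_ring :: "complex ring" where "complex_ring = ring_of_type_algebra"

definition int_embed :: "('a, 'x) ring_scheme \<Rightarrow> int \<Rightarrow> 'a" where
  "int_embed R k = add_pow R k \<one>\<^bsub>R\<^esub>"

text \<open>The embedding of the rationals into a field of characteristic zero.\<close>

definition rat_embed :: "('a, 'x) ring_scheme \<Rightarrow> rat \<Rightarrow> 'a" where
  "rat_embed E q =
     int_embed E (fst (quotient_of q)) \<otimes>\<^bsub>E\<^esub> inv\<^bsub>E\<^esub> (int_embed E (snd (quotient_of q)))"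

definition number_field :: "('a, 'x) ring_scheme \<Rightarrow> bool" where
  "number_field E \<longleftrightarrow> field E \<and> (\<forall>n::int. n \<noteq> 0 \<longrightarrow> int_embed E n \<noteq> \<zero>\<^bsub>E\<^esub>) \<and>
     ring.finite_dimension E (range (rat_embed E)) (carrier E)"

definition field_degree :: "('a, 'x) ring_scheme \<Rightarrow> nat" where
  "field_degree E = ring.dim E (range (rat_embed E)) (carrier E)"

definition product_ring :: "'i set \<Rightarrow> ('i \<Rightarrow> ('a, 'x) ring_scheme) \<Rightarrow> ('i \<Rightarrow> 'a) ring" where
  "product_ring I R =
     \<lparr>carrier = (\<Pi>\<^sub>E i\<in>I. carrier (R i)),
      monoid.mult = (\<lambda>x y. \<lambda>i\<in>I. x i \<otimes>\<^bsub>R i\<^esub> y i),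
      one = (\<lambda>i\<in>I. \<one>\<^bsub>R i\<^esub>),
      ring.zero = (\<lambda>i\<in>I. \<zero>\<^bsub>R i\<^esub>),
      ring.add = (\<lambda>x y. \<lambda>i\<in>I. x i \<oplus>\<^bsub>R i\<^esub> y i)\<rparr>"

text \<open>
  \<open>(r, s) = (r\<^sub>E, s\<^sub>E)\<close>: there is an isomorphism of real algebras from
  \<open>E \<otimes>\<^sub>\<rat> \<real>\<close> to \<open>\<real>\<^sup>r \<times> \<complex>\<^sup>s\<close>; the last clause is \<open>\<real>\<close>-linearity.
\<close>

definition has_signature :: "('a, 'x) ring_scheme \<Rightarrow> nat \<Rightarrow> nat \<Rightarrow> bool" where
  "has_signature E r s \<longleftrightarrow>
     (\<exists>h \<in> ring_iso (tensor_ring rat_ring (rat_embed E) E of_rat real_ring)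
              (RDirProd (product_ring {..<r} (\<lambda>_. real_ring))
                        (product_ring {..<s} (\<lambda>_. complex_ring))).
        \<forall>x::real. h (pure_tensor rat_ring (rat_embed E) E of_rat real_ring \<one>\<^bsub>E\<^esub> x)
                  = (\<lambda>i\<in>{..<r}. x, \<lambda>i\<in>{..<s}. complex_of_real x))"


section \<open>Complex tori and their endomorphisms\<close>

definition free_Zmod :: "nat \<Rightarrow> (nat \<Rightarrow> int) monoid" where
  "free_Zmod d = product_group {..<d} (\<lambda>_. integer_group)"

definition sign_group :: "int monoid" where
  "sign_group = \<lparr>carrier = {1, -1}, monoid.mult = (*), one = 1\<rparr>"

definition vec_group :: "(complex ^ 'n::finite) monoid" where
  "vec_group = \<lparr>carrier = UNIV, monoid.mult = (+), one = 0\<rparr>"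

text \<open>The discrete subgroups \<open>\<Lambda>\<close> of rank \<open>2 g\<close> in \<open>V = \<complex>\<^sup>g\<close>, where \<open>g = CARD('n)\<close>.\<close>

definition torus_lattice :: "(complex ^ 'n::finite) set \<Rightarrow> bool" where
  "torus_lattice \<Lambda> \<longleftrightarrow> subgroup \<Lambda> vec_group \<and> discrete \<Lambda> \<and>
     (vec_group\<lparr>carrier := \<Lambda>\<rparr>) \<cong> free_Zmod (2 * CARD('n))"

definition torus :: "(complex ^ 'n::finite) set \<Rightarrow> (complex ^ 'n) set monoid" where
  "torus \<Lambda> = vec_group Mod \<Lambda>"

definition torus_proj :: "(complex ^ 'n::finite) set \<Rightarrow> complex ^ 'n \<Rightarrow> (complex ^ 'n) set" where
  "torus_proj \<Lambda> x = \<Lambda> #>\<^bsub>vec_group\<^esub> x"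

definition holomorphic_vec_on ::
    "(complex ^ 'n::finite) set \<Rightarrow> (complex ^ 'n \<Rightarrow> complex ^ 'n) \<Rightarrow> bool" where
  "holomorphic_vec_on U h \<longleftrightarrow>
     (\<forall>y\<in>U. \<exists>D. Vector_Spaces.linear (*s) (*s) D \<and> (h has_derivative D) (at y))"

text \<open>
  The charts of \<open>T = V/\<Lambda>\<close> are the local inverses of the projection \<open>V \<rightarrow> T\<close>; hence a
  self-map of \<open>T\<close> is holomorphic iff, locally on \<open>V\<close>, it is induced by holomorphic maps
  into \<open>V\<close>.
\<close>

definition torus_holomorphic ::
    "(complex ^ 'n::finite) set \<Rightarrow> ((complex ^ 'n) set \<Rightarrow> (complex ^ 'n) set) \<Rightarrow> bool" where
  "torus_holomorphic \<Lambda> f \<longleftrightarrow>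
     (\<forall>x. \<exists>U h. open U \<and> x \<in> U \<and> holomorphic_vec_on U h \<and>
        (\<forall>y\<in>U. f (torus_proj \<Lambda> y) = torus_proj \<Lambda> (h y)))"

text \<open>The endomorphism ring of the complex Lie group \<open>T\<close>.\<close>

definition torus_End ::
    "(complex ^ 'n::finite) set \<Rightarrow> ((complex ^ 'n) set \<Rightarrow> (complex ^ 'n) set) ring" where
  "torus_End \<Lambda> =
     \<lparr>carrier = {f \<in> hom (torus \<Lambda>) (torus \<Lambda>) \<inter> extensional (carrier (torus \<Lambda>)).
                  torus_holomorphic \<Lambda> f},
      monoid.mult = (\<lambda>f g. compose (carrier (torus \<Lambda>)) f g),
      one = (\<lambda>x\<in>carrier (torus \<Lambda>). x),
      ring.zero = (\<lambda>x\<in>carrier (torus \<Lambda>). \<one>\<^bsub>torus \<Lambda>\<^esub>),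
      ring.add = (\<lambda>f g. \<lambda>x\<in>carrier (torus \<Lambda>). f x \<otimes>\<^bsub>torus \<Lambda>\<^esub> g x)\<rparr>"

definition torus_Aut ::
    "(complex ^ 'n::finite) set \<Rightarrow> ((complex ^ 'n) set \<Rightarrow> (complex ^ 'n) set) monoid" where
  "torus_Aut \<Lambda> = units_of (torus_End \<Lambda>)"

definition torus_End0 ::
    "(complex ^ 'n::finite) set \<Rightarrow>
     ((((complex ^ 'n) set \<Rightarrow> (complex ^ 'n) set) \<times> rat) \<Rightarrow>\<^sub>0 int) set ring" where
  "torus_End0 \<Lambda> =
     tensor_ring int_ring (int_embed (torus_End \<Lambda>)) (torus_End \<Lambda>) of_int rat_ring"


section \<open>The Hodge structure on the second cohomology\<close>

text \<open>\<open>\<Lambda>\<^sub>\<rat>\<close>, realised as the rational span of \<open>\<Lambda>\<close> in \<open>V\<close>.\<close>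

definition lattice_rat :: "(complex ^ 'n::finite) set \<Rightarrow> (complex ^ 'n) set" where
  "lattice_rat \<Lambda> = module.span (\<lambda>(q::rat) x. (of_rat q :: real) *\<^sub>R x) \<Lambda>"

type_synonym 'n form2 = "complex ^ 'n \<Rightarrow> complex ^ 'n \<Rightarrow> complex"

text \<open>
  As \<open>\<Lambda>\<^sub>\<rat> \<otimes>\<^sub>\<rat> \<real> = V\<close>, an alternating \<open>\<rat>\<close>-bilinear form on \<open>\<Lambda>\<^sub>\<rat>\<close> with
  values in \<open>\<rat>\<close> or \<open>\<complex>\<close> extends uniquely to an alternating \<open>\<real>\<close>-bilinear form
  \<open>V \<times> V \<rightarrow> \<complex>\<close>, and is represented by this extension (equivalently, by an
  invariant complex-valued 2-form on \<open>T\<close>). The Hodge decomposition is the decomposition by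
  type coming from \<open>Hom\<^sub>\<real>(V, \<complex>) = V\<^sup>* \<oplus> cnj V\<^sup>*\<close>; its (2,0)-part consists of the
  holomorphic 2-forms on \<open>T\<close>, which are all invariant.
\<close>

definition H2_complex :: "'n::finite form2 set" where
  "H2_complex = {\<omega>. bilinear \<omega> \<and> (\<forall>u. \<omega> u u = 0)}"

definition H2_rat :: "(complex ^ 'n::finite) set \<Rightarrow> 'n form2 set" where
  "H2_rat \<Lambda> = {\<omega> \<in> H2_complex. \<forall>u\<in>lattice_rat \<Lambda>. \<forall>v\<in>lattice_rat \<Lambda>. \<omega> u v \<in> \<rat>}"

definition H20 :: "'n::finite form2 set" where
  "H20 = {\<omega> \<in> H2_complex. \<forall>c u v. \<omega> (c *s u) v = c * \<omega> u v \<and> \<omega> u (c *s v) = c * \<omega> u v}"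

definition H02 :: "'n::finite form2 set" where
  "H02 = {\<omega> \<in> H2_complex. \<forall>c u v.
            \<omega> (c *s u) v = cnj c * \<omega> u v \<and> \<omega> u (c *s v) = cnj c * \<omega> u v}"

text \<open>The (1,1)-forms are the antisymmetrisations of sesquilinear forms.\<close>

definition H11 :: "'n::finite form2 set" where
  "H11 = {\<omega> \<in> H2_complex. \<exists>\<sigma>. bilinear \<sigma> \<and>
            (\<forall>c u v. \<sigma> (c *s u) v = c * \<sigma> u v \<and> \<sigma> u (c *s v) = cnj c * \<sigma> u v) \<and>
            (\<forall>u v. \<omega> u v = \<sigma> u v - \<sigma> v u)}"

definition complexification :: "'n::finite form2 set \<Rightarrow> 'n form2 set" where
  "complexification H = module.span (\<lambda>(c::complex) \<omega> u v. c * \<omega> u v) H"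

definition rat_subspace :: "'n::finite form2 set \<Rightarrow> bool" where
  "rat_subspace H \<longleftrightarrow> module.subspace (\<lambda>(q::rat) \<omega> u v. of_rat q * \<omega> u v) H"

definition rat_Hodge_substructure :: "(complex ^ 'n::finite) set \<Rightarrow> 'n form2 set \<Rightarrow> bool" where
  "rat_Hodge_substructure \<Lambda> H \<longleftrightarrow> H \<subseteq> H2_rat \<Lambda> \<and> rat_subspace H \<and>
     (\<forall>\<omega>\<in>complexification H.
        \<exists>\<alpha> \<in> complexification H \<inter> H20. \<exists>\<beta> \<in> complexification H \<inter> H11.
        \<exists>\<gamma> \<in> complexification H \<inter> H02. \<omega> = \<alpha> + \<beta> + \<gamma>)"

definition two_simple :: "(complex ^ 'n::finite) set \<Rightarrow> bool" where
  "two_simple \<Lambda> \<longleftrightarrow> torus_lattice \<Lambda> \<and> 2 \<le> CARD('n) \<and>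
     (\<forall>H. rat_Hodge_substructure \<Lambda> H \<and> complexification H \<inter> H20 \<noteq> {0}
          \<longrightarrow> H20 \<subseteq> complexification H)"

end

theory Submission
  imports Defs "HOL-Computational_Algebra.Computational_Algebra"
begin

text \<open>
  Let \<open>\<alpha>\<close> be an algebraic integer of degree \<open>g\<close> with \<open>r\<close> real conjugates whose Galois group is large enough that a
  rational bilinear relation satisfied by \<open>(\<alpha>\<^sub>i, \<alpha>\<^sub>j)\<close> and \<open>(\<alpha>\<^sub>j, \<alpha>\<^sub>i)\<close> for one pair \<open>i \<noteq> j\<close> holds for all pairs. Such an
  \<open>\<alpha>\<close> comes from a polynomial with prescribed real roots that is modified modulo two primes: one congruence is of
  Eisenstein type, the other isolates a simple root. Embed \<open>O = \<int>[\<alpha>]\<close> into \<open>\<complex>\<^sup>g\<close> by all conjugates and put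
  \<open>\<Lambda> = O + O t\<close> for a vector \<open>t\<close>. The operator acting on \<open>H\<^sup>1\<close> by \<open>\<plusminus>1\<close> on the two Hodge types is a combination of operators
  defined over \<open>\<rat>(\<alpha>\<^sub>1, \<dots>, \<alpha>\<^sub>g)\<close> whose coefficients are rational functions of \<open>t\<close>; for generic \<open>t\<close> these coefficients
  are linearly independent over that field. Hence a rational Hodge substructure of \<open>H\<^sup>2\<close> is stable under
  \<open>sl\<^sub>2\<close> at every place, and as soon as it meets \<open>H\<^bsup>2,0\<^esup>\<close> it contains the component of one pair of places, and then of
  all pairs. In the same way an endomorphism commutes with all these operators, so it is multiplication by an
  element of \<open>O\<close>. The automorphism group is \<open>O\<^sup>*\<close>, which Dirichlet's unit theorem describes; its torsion is
  \<open>\<plusminus>1\<close> because a unit on the unit circle satisfies a bilinear relation with its complex conjugate.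
\<close>

unbundle no fps_syntax

hide_const (open) Polynomials.degree Polynomials.lead_coeff Divisibility.prime Divisibility.irreducible
  Coset.order up_ring.coeff up_ring.monom Module.smult

section \<open>Norms of polynomial expressions in the roots\<close>

text \<open>No Galois group is constructed. What is needed of it is that the sums \<alpha>_i +
  \<alpha>_j of unordered pairs are pairwise distinct and conjugate to each other, and this is read
  off the integer polynomial \<open>Psi\<close> with roots \<alpha>_i + \<alpha>_j, i \<noteq> j. In
  the code one prime \<open>p\<close> carries both congruences: f is congruent to (X - 1) X^(g-1)
  modulo p, and p divides f(0) exactly once. Every irreducible factor of \<open>Psi\<close> vanishes
  at 1 modulo p and occurs at least twice, while p^3 does not divide Psi(1); so \<open>Psi\<close>
  is the square of one irreducible polynomial. As only unordered pairs are controlled, a relation is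
  transferred only if it is given in both orders. Integrality of products over conjugates comes from
  determinants over any coefficient ring, so that auxiliary indeterminates can be carried along. The
  obstacle in choosing \<open>t\<close> is that the operator involves t_i together with the complex
  conjugate of t_(bar i). The parameters are therefore not independent complex numbers, and real
  places and conjugate pairs of places need different one-parameter families.\<close>

definition ring_closed :: "'a::comm_ring_1 set \<Rightarrow> bool" where
  "ring_closed A \<longleftrightarrow> 1 \<in> A \<and> (\<forall>x\<in>A. \<forall>y\<in>A. x - y \<in> A \<and> x * y \<in> A)"

lemma ring_closedD:
  assumes "ring_closed A"
  shows ring_closed_1: "1 \<in> A" and ring_closed_0: "0 \<in> A"
    and ring_closed_diff: "x \<in> A \<Longrightarrow> y \<in> A \<Longrightarrow> x - y \<in> A"
    and ring_closed_mult: "x \<in> A \<Longrightarrow> y \<in> A \<Longrightarrow> x * y \<in> A"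
    and ring_closed_uminus: "x \<in> A \<Longrightarrow> - x \<in> A"
    and ring_closed_add: "x \<in> A \<Longrightarrow> y \<in> A \<Longrightarrow> x + y \<in> A"
proof -
  show 1: "1 \<in> A" and d: "x \<in> A \<Longrightarrow> y \<in> A \<Longrightarrow> x - y \<in> A" and "x \<in> A \<Longrightarrow> y \<in> A \<Longrightarrow> x * y \<in> A" for x y
    using assms by (auto simp: ring_closed_def)
  show 0: "0 \<in> A" using d[OF 1 1] by simp
  show m: "- x \<in> A" if "x \<in> A" for x using d[OF 0 that] by simp
  show "x + y \<in> A" if "x \<in> A" "y \<in> A" for x y using d[OF that(1) m[OF that(2)]] by simp
qed

lemma ring_closed_sum: "ring_closed A \<Longrightarrow> (\<And>i. i \<in> I \<Longrightarrow> h i \<in> A) \<Longrightarrow> sum h I \<in> A"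
  by (induction I rule: infinite_finite_induct) (auto intro: ring_closed_0 ring_closed_add)

lemma ring_closed_prod: "ring_closed A \<Longrightarrow> (\<And>i. i \<in> I \<Longrightarrow> h i \<in> A) \<Longrightarrow> prod h I \<in> A"
  by (induction I rule: infinite_finite_induct) (auto intro: ring_closed_1 ring_closed_mult)

lemma ring_closed_power: "ring_closed A \<Longrightarrow> x \<in> A \<Longrightarrow> x ^ n \<in> A"
  by (induction n) (auto intro: ring_closed_1 ring_closed_mult)

lemma ring_closed_of_int: "ring_closed A \<Longrightarrow> of_int n \<in> A"
proof -
  assume A: "ring_closed A"
  have "of_nat k \<in> A" for k by (induction k) (auto intro: ring_closed_0 ring_closed_1 ring_closed_add A)
  then show ?thesis using A by (cases n) (auto intro!: ring_closed_uminus ring_closed_diff ring_closed_1)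
qed

lemma ring_closed_det:
  fixes M :: "'a::comm_ring_1^'n::finite^'n"
  assumes A: "ring_closed A" and "\<And>i j. M $ i $ j \<in> A"
  shows "det M \<in> A"
  unfolding det_def
  by (intro ring_closed_sum[OF A] ring_closed_mult[OF A] ring_closed_prod[OF A] ring_closed_of_int[OF A] assms)

lemma ring_closed_Ints: "ring_closed (\<int> :: 'a::comm_ring_1 set)"
  by (auto simp: ring_closed_def)

lemma ring_closed_Rats: "ring_closed (\<rat> :: 'a::field_char_0 set)"
  by (auto simp: ring_closed_def)

text \<open>Subrings are sets inside one type, and \<open>coeffs_in\<close> can be iterated:
  \<open>coeffs_in (coeffs_in A)\<close> is A[X][Y], so one norm lemma serves for numbers and for
  polynomials in auxiliary indeterminates.\<close>

definition coeffs_in :: "'a::comm_ring_1 set \<Rightarrow> 'a poly set" where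
  "coeffs_in A = {q. \<forall>k. coeff q k \<in> A}"

lemma coeffs_inI: "(\<And>k. coeff q k \<in> A) \<Longrightarrow> q \<in> coeffs_in A"
  and coeffs_inD: "q \<in> coeffs_in A \<Longrightarrow> coeff q k \<in> A"
  by (auto simp: coeffs_in_def)

lemma ring_closed_coeffs_in:
  assumes A: "ring_closed A" shows "ring_closed (coeffs_in A)"
  unfolding ring_closed_def
proof (intro conjI ballI)
  show "1 \<in> coeffs_in A" using ring_closed_0[OF A] ring_closed_1[OF A] by (intro coeffs_inI) (simp add: coeff_1)
  fix x y assume xy: "x \<in> coeffs_in A" "y \<in> coeffs_in A"
  show "x - y \<in> coeffs_in A" using xy by (intro coeffs_inI) (simp add: coeffs_inD ring_closed_diff[OF A])
  show "x * y \<in> coeffs_in A" using xy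
    by (intro coeffs_inI) (simp add: coeff_mult coeffs_inD ring_closed_sum[OF A] ring_closed_mult[OF A])
qed

lemma coeffs_in_pCons: "0 \<in> A \<Longrightarrow> pCons c q \<in> coeffs_in A \<longleftrightarrow> c \<in> A \<and> q \<in> coeffs_in A"
  by (auto simp: coeffs_in_def coeff_pCons split: nat.splits)

lemma coeffs_in_0: "0 \<in> A \<Longrightarrow> 0 \<in> coeffs_in A" by (simp add: coeffs_in_def)

lemma coeffs_in_const: "ring_closed A \<Longrightarrow> c \<in> A \<Longrightarrow> [:c:] \<in> coeffs_in A"
  by (simp add: coeffs_in_pCons coeffs_in_0 ring_closed_0)

lemma coeffs_in_X: "ring_closed A \<Longrightarrow> [:0, 1:] \<in> coeffs_in A"
  by (simp add: coeffs_in_pCons coeffs_in_0 ring_closed_0 ring_closed_1)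

lemma coeffs_in_smult: "ring_closed A \<Longrightarrow> c \<in> A \<Longrightarrow> q \<in> coeffs_in A \<Longrightarrow> smult c q \<in> coeffs_in A"
  by (auto simp: coeffs_in_def intro: ring_closed_mult)

lemma coeffs_in_monom: "ring_closed A \<Longrightarrow> c \<in> A \<Longrightarrow> monom c k \<in> coeffs_in A"
  by (auto simp: coeffs_in_def coeff_monom intro: ring_closed_0)

lemma poly_in_ring_closed:
  assumes A: "ring_closed A" and "q \<in> coeffs_in A" and "x \<in> A"
  shows "poly q x \<in> A"
  unfolding poly_altdef using assms
  by (auto intro!: ring_closed_sum ring_closed_mult ring_closed_power simp: coeffs_in_def)

lemma map_poly_const_in:
  "ring_closed A \<Longrightarrow> q \<in> coeffs_in A \<Longrightarrow> map_poly (\<lambda>c. [:c:]) q \<in> coeffs_in (coeffs_in A)"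
  by (rule coeffs_inI) (simp add: coeff_map_poly coeffs_inD coeffs_in_const)

lemma poly_map_poly_const: "poly (map_poly (\<lambda>c. [:c:]) q) [:x:] = [:poly q x:]"
  by (induction q) (auto simp: map_poly_pCons mult.commute)

text \<open>Since \<open>D\<close> is monic, the leading coefficient of \<open>Q\<close> is that of
  the product; strip this term and recurse on the degree. It recovers products over the pairs i
  \<noteq> j by division of norms.\<close>

lemma monic_cofactor_in:
  assumes A: "ring_closed A" and D: "D \<in> coeffs_in A" "lead_coeff D = 1" and "D * Q \<in> coeffs_in A"
  shows "Q \<in> coeffs_in (A :: 'a::idom set)"
  using assms(4)
proof (induction "degree Q" arbitrary: Q rule: less_induct)
  case less
  have lc: "lead_coeff Q \<in> A"
    using less.prems D(2) lead_coeff_mult[of D Q] by (auto simp: coeffs_in_def) (metis mult_1)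
  note mi = coeffs_in_monom[OF A lc, of "degree Q"]
  note RC = ring_closed_coeffs_in[OF A]
  have eq: "Q = monom (lead_coeff Q) (degree Q) + (Q - monom (lead_coeff Q) (degree Q))" by simp
  have "D * (Q - monom (lead_coeff Q) (degree Q)) \<in> coeffs_in A"
    using ring_closed_diff[OF RC less.prems ring_closed_mult[OF RC D(1) mi]] by (simp add: algebra_simps)
  moreover have "Q - monom (lead_coeff Q) (degree Q) = 0 \<or>
      degree (Q - monom (lead_coeff Q) (degree Q)) < degree Q"
  proof (cases "degree Q = 0")
    case True
    then show ?thesis by (metis degree_0_id diff_self monom_0 degree_eq_zeroE lead_coeff_pCons(2) coeff_pCons_0)
  next
    case False
    have "degree (Q - monom (lead_coeff Q) (degree Q)) \<le> degree Q"
      by (intro degree_diff_le) (auto simp: degree_monom_le)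
    moreover have "coeff (Q - monom (lead_coeff Q) (degree Q)) (degree Q) = 0" by simp
    ultimately show ?thesis using eq_zero_or_degree_less by blast
  qed
  ultimately have "Q - monom (lead_coeff Q) (degree Q) \<in> coeffs_in A"
    using less.hyps coeffs_in_0[OF ring_closed_0[OF A]] by auto
  then show ?case using eq ring_closed_add[OF RC mi] by metis
qed

text \<open>Division with remainder by the monic \<open>f\<close>, recorded only through the values
  at the roots.\<close>

lemma reduce_at_roots:
  assumes A: "ring_closed A" and f: "f \<in> coeffs_in A" "lead_coeff f = 1" "degree f = g"
    and root: "\<And>i. poly f (a i) = 0" and "H \<in> coeffs_in A"
  shows "\<exists>b. (\<forall>l. b l \<in> A) \<and> (\<forall>i. poly H (a i) = (\<Sum>l<g. b l * a i ^ l))"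
  using assms(6)
proof (induction "degree H" arbitrary: H rule: less_induct)
  case less
  note RC = ring_closed_coeffs_in[OF A]
  show ?case
  proof (cases "degree H < g")
    case True
    have "poly H x = (\<Sum>l<g. coeff H l * x ^ l)" for x
      unfolding poly_altdef using True
      by (intro sum.mono_neutral_left) (auto simp: coeff_eq_0)
    then show ?thesis using less.prems by (intro exI[of _ "coeff H"]) (auto simp: coeffs_in_def)
  next
    case False
    define H' where "H' = H - monom (lead_coeff H) (degree H - g) * f"
    have lc: "lead_coeff H \<in> A" using less.prems by (auto simp: coeffs_in_def)
    have H': "H' \<in> coeffs_in A" unfolding H'_def
      using less.prems f(1) coeffs_in_monom[OF A lc] by (intro ring_closed_diff[OF RC] ring_closed_mult[OF RC]) auto
    have ev: "poly H' (a i) = poly H (a i)" for i by (simp add: H'_def root)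
    have "degree H' \<le> degree H"
      unfolding H'_def using False f(3)
      by (intro degree_diff_le order.trans[OF degree_mult_le] )
        (auto intro: order.trans[OF add_right_mono[OF degree_monom_le]])
    moreover have "coeff H' (degree H) = 0"
      using False f(2,3) coeff_monom_mult[of "lead_coeff H" "degree H - g" f "degree H"] by (simp add: H'_def)
    ultimately have "H' = 0 \<or> degree H' < degree H" using eq_zero_or_degree_less by blast
    then show ?thesis
    proof
      assume "H' = 0"
      then show ?thesis using ev ring_closed_0[OF A] by (intro exI[of _ "\<lambda>_. 0"]) simp
    next
      assume "degree H' < degree H"
      from less.hyps[OF this H'] show ?thesis by (simp add: ev)
    qed
  qed
qed

text \<open>\<open>W\<close> is a left inverse of the Vandermonde matrix. Over a field it exists
  when the roots are distinct; stated as an identity it carries over to polynomial rings, which are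
  not fields.\<close>

definition splits_over :: "'a::comm_ring_1 set \<Rightarrow> 'a poly \<Rightarrow> ('n::finite \<Rightarrow> 'a) \<Rightarrow> bool" where
  "splits_over A f a \<longleftrightarrow> ring_closed A \<and> f \<in> coeffs_in A \<and> lead_coeff f = 1 \<and> degree f = CARD('n) \<and>
     (\<forall>i. poly f (a i) = 0) \<and>
     (\<exists>W :: 'n \<Rightarrow> nat \<Rightarrow> 'a. \<forall>i j. (\<Sum>k<CARD('n). W i k * a j ^ k) = (if i = j then 1 else 0))"

lemma splits_over_poly:
  fixes a :: "'n::finite \<Rightarrow> 'a::comm_ring_1"
  assumes "splits_over A f a"
  shows "splits_over (coeffs_in A) (map_poly (\<lambda>c. [:c:]) f) (\<lambda>i. [:a i:])"
proof -
  obtain W :: "'n \<Rightarrow> nat \<Rightarrow> 'a" where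
    W: "\<And>i j. (\<Sum>k<CARD('n). W i k * a j ^ k) = (if i = j then 1 else 0)"
    using assms unfolding splits_over_def by blast
  have f0: "f \<noteq> 0" using assms by (auto simp: splits_over_def)
  then have d: "degree (map_poly (\<lambda>c. [:c:]) f) = degree f" by (intro map_poly_degree_eq) auto
  have "(\<Sum>k<CARD('n). [:W i k:] * [:a j:] ^ k) = (if i = j then 1 else 0)" for i j
  proof -
    have "(\<Sum>k<CARD('n). [:W i k:] * [:a j:] ^ k) = (\<Sum>k<CARD('n). [:W i k * a j ^ k:])"
      by (simp add: poly_const_pow mult.commute)
    also have "\<dots> = [:\<Sum>k<CARD('n). W i k * a j ^ k:]"
      by (induction rule: finite_induct[OF finite_lessThan[of "CARD('n)"]]) auto
    finally show ?thesis by (simp add: W one_pCons)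
  qed
  then show ?thesis using assms unfolding splits_over_def
    by (auto simp: ring_closed_coeffs_in map_poly_const_in poly_map_poly_const d coeff_map_poly one_pCons
      intro!: exI[of _ "\<lambda>i k. [:W i k:]"])
qed

text \<open>In the power basis, multiplication by \<open>G\<close> modulo \<open>f\<close> has a
  matrix \<open>B\<close> over \<open>A\<close>, and the Vandermonde matrix \<open>V\<close> turns
  it into the diagonal matrix \<open>D\<close> of values: B V = V D. As det V is a unit, the product
  of the values is det B. This takes the place of the theorem on symmetric polynomials.\<close>

lemma norm_in:
  fixes a :: "'n::finite \<Rightarrow> 'a::comm_ring_1"
  assumes s: "splits_over A f a" and G: "G \<in> coeffs_in A"
  shows "(\<Prod>i\<in>UNIV. poly G (a i)) \<in> A"
proof -
  have A: "ring_closed A" using s by (simp add: splits_over_def)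
  obtain W :: "'n \<Rightarrow> nat \<Rightarrow> 'a" where
    W: "\<And>i j. (\<Sum>k<CARD('n). W i k * a j ^ k) = (if i = j then 1 else 0)"
    using s unfolding splits_over_def by blast
  obtain idx :: "'n \<Rightarrow> nat" where idx: "bij_betw idx UNIV {..<CARD('n)}"
    using ex_bij_betw_finite_nat[of "UNIV :: 'n set"] by (auto simp: atLeast0LessThan)
  have sum_idx: "(\<Sum>r\<in>UNIV. h (idx r)) = (\<Sum>k<CARD('n). h k)" for h :: "nat \<Rightarrow> 'a"
    using sum.reindex_bij_betw[OF idx] .
  have "\<exists>b. (\<forall>l. b l \<in> A) \<and> (\<forall>i. poly (monom 1 k * G) (a i) = (\<Sum>l<CARD('n). b l * a i ^ l))" for k
    using s A G by (intro reduce_at_roots[of A f])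
      (auto simp: splits_over_def intro!: ring_closed_mult ring_closed_coeffs_in coeffs_in_monom ring_closed_1)
  then obtain b where b: "\<And>k l. b k l \<in> A"
    "\<And>k i. poly (monom 1 k * G) (a i) = (\<Sum>l<CARD('n). b k l * a i ^ l)"
    by metis
  define B where "B = (\<chi> r c. b (idx r) (idx c) :: 'a^'n^'n)"
  define V where "V = (\<chi> r j. a j ^ idx r :: 'a^'n^'n)"
  define D where "D = (\<chi> i j. if i = j then poly G (a i) else 0 :: 'a^'n^'n)"
  define U where "U = (\<chi> i r. W i (idx r) :: 'a^'n^'n)"
  have UV: "U ** V = mat 1"
    using sum_idx[of "\<lambda>k. W _ k * a _ ^ k"]
    by (simp add: U_def V_def matrix_matrix_mult_def mat_def vec_eq_iff W)
  have "B ** V = V ** D"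
  proof (simp only: vec_eq_iff, intro allI)
    fix r j
    have "(B ** V) $ r $ j = (\<Sum>c\<in>UNIV. b (idx r) (idx c) * a j ^ idx c)"
      by (simp add: B_def V_def matrix_matrix_mult_def)
    also have "\<dots> = poly (monom 1 (idx r) * G) (a j)"
      unfolding b(2) using sum_idx[of "\<lambda>k. b (idx r) k * a j ^ k"] .
    also have "\<dots> = (V ** D) $ r $ j"
      by (simp add: V_def D_def matrix_matrix_mult_def poly_monom if_distrib cong: if_cong)
    finally show "(B ** V) $ r $ j = (V ** D) $ r $ j" .
  qed
  then have e: "det B * det V = det V * det D" by (metis det_mul)
  have u: "det U * det V = 1" using UV by (metis det_mul det_I)
  have "det B = det D" using e u
    by (metis (no_types, opaque_lifting) mult.assoc mult.commute mult_1)
  also have "det D = (\<Prod>i\<in>UNIV. poly G (a i))"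
    unfolding D_def by (subst det_diagonal) auto
  finally show ?thesis using ring_closed_det[OF A, of B] b(1) by (simp add: B_def)
qed

text \<open>With an indeterminate in place of \<open>c\<close>, the norm is a polynomial over
  \<open>A\<close> whose constant term is the norm of \<open>G\<close>; evaluation at
  \<open>c\<close> adds a multiple of \<open>c\<close>.\<close>

lemma norm_cong:
  fixes a :: "'n::finite \<Rightarrow> 'a::comm_ring_1"
  assumes s: "splits_over A f a" and G: "G \<in> coeffs_in A" "E \<in> coeffs_in A" and c: "c \<in> A"
  shows "\<exists>z\<in>A. (\<Prod>i\<in>UNIV. poly G (a i) + c * poly E (a i)) = (\<Prod>i\<in>UNIV. poly G (a i)) + c * z"
proof -
  have A: "ring_closed A" using s by (simp add: splits_over_def)
  define K where "K = map_poly (\<lambda>c. [:c:]) G + smult [:0, 1:] (map_poly (\<lambda>c. [:c:]) E)"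
  have K: "K \<in> coeffs_in (coeffs_in A)" unfolding K_def
    by (intro ring_closed_add ring_closed_coeffs_in coeffs_in_smult map_poly_const_in A G coeffs_in_X)
  define F where "F = (\<Prod>i\<in>UNIV. poly K [:a i:])"
  have F: "F \<in> coeffs_in A" unfolding F_def
    by (rule norm_in[OF splits_over_poly[OF s] K])
  have ev: "poly F x = (\<Prod>i\<in>UNIV. poly G (a i) + x * poly E (a i))" for x
    by (simp add: F_def K_def poly_prod poly_map_poly_const)
  obtain c0 F1 where F01: "F = pCons c0 F1" by (cases F)
  then have "F1 \<in> coeffs_in A" using F by (simp add: coeffs_in_pCons[OF ring_closed_0[OF A]])
  then have "poly F1 c \<in> A" by (intro poly_in_ring_closed[OF A] c)
  moreover have "poly F c = poly F 0 + c * poly F1 c" by (simp add: F01)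
  ultimately show ?thesis unfolding ev by auto
qed

section \<open>Integer polynomials and their roots\<close>

abbreviation cpoly :: "int poly \<Rightarrow> complex poly" where "cpoly \<equiv> map_poly of_int"

lemma cpoly_simps [simp]:
  "cpoly 0 = 0" "cpoly 1 = 1" "cpoly (p + q) = cpoly p + cpoly q" "cpoly (p - q) = cpoly p - cpoly q"
  "cpoly (- p) = - cpoly p" "cpoly (p * q) = cpoly p * cpoly q" "cpoly (smult c p) = smult (of_int c) (cpoly p)"
  "cpoly (pCons c p) = pCons (of_int c) (cpoly p)" "cpoly (p ^ n) = cpoly p ^ n"
  "cpoly (monom c n) = monom (of_int c) n"
proof -
  show m: "cpoly (p * q) = cpoly p * cpoly q" for p q
    by (rule poly_eqI) (simp add: coeff_map_poly coeff_mult)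
  show "cpoly (p ^ n) = cpoly p ^ n" by (induction n) (auto simp: m map_poly_1')
qed (auto intro!: poly_eqI simp: coeff_map_poly coeff_pCons coeff_1 coeff_monom split: nat.splits)

lemma cpoly_eq_iff [simp]: "cpoly p = cpoly q \<longleftrightarrow> p = q"
  by (auto simp: poly_eq_iff coeff_map_poly)

lemma cpoly_0_iff [simp]: "cpoly p = 0 \<longleftrightarrow> p = 0"
  using cpoly_eq_iff[of p 0] by simp

lemma degree_cpoly [simp]: "degree (cpoly p) = degree p"
  by (cases "p = 0") (auto intro: map_poly_degree_eq)

lemma lead_coeff_cpoly [simp]: "lead_coeff (cpoly p) = of_int (lead_coeff p)"
  by (simp add: coeff_map_poly)

lemma poly_cpoly_of_int [simp]: "poly (cpoly p) (of_int n) = of_int (poly p n)"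
  by (induction p) auto

lemma poly_cpoly_0 [simp]: "poly (cpoly p) 0 = of_int (poly p 0)"
  using poly_cpoly_of_int[of p 0] by simp

lemma poly_cpoly_1 [simp]: "poly (cpoly p) 1 = of_int (poly p 1)"
  using poly_cpoly_of_int[of p 1] by simp

lemma cpoly_in: "cpoly p \<in> coeffs_in \<int>"
  by (simp add: coeffs_in_def coeff_map_poly)

lemma coeffs_in_Ints_cases:
  assumes "q \<in> coeffs_in \<int>" obtains p where "q = cpoly p"
proof -
  have "\<forall>k. \<exists>n. coeff q k = of_int n" using assms by (auto simp: coeffs_in_def elim: Ints_cases)
  then obtain c where c: "\<And>k. coeff q k = of_int (c k)" by metis
  have "(\<lambda>k. c k) \<in> {h. \<forall>\<^sub>\<infinity>n. h n = 0}"
    using MOST_coeff_eq_0[of q] by (simp add: c)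
  then have "coeff (Abs_poly c) = c" using Abs_poly_inverse by blast
  then have "q = cpoly (Abs_poly c)" by (intro poly_eqI) (simp add: coeff_map_poly c)
  then show thesis by (rule that)
qed

text \<open>A nonzero integer polynomial of least degree vanishing at \<open>z\<close>, made
  primitive, divides all others: pseudo-division gives divisibility up to a constant, and Gauss's
  lemma on contents removes the constant. As it divides the monic \<open>F\<close>, its leading
  coefficient is 1 or -1.\<close>

lemma minimal_int_poly:
  assumes F: "poly (cpoly F) z = 0" "lead_coeff F = 1"
  shows "\<exists>m. lead_coeff m = 1 \<and> degree m > 0 \<and> poly (cpoly m) z = 0 \<and>
    (\<forall>h. poly (cpoly h) z = 0 \<longrightarrow> m dvd h)"
proof -
  have "F \<noteq> 0" using F(2) by auto
  then obtain n0 where n0: "n0 \<noteq> 0" "poly (cpoly n0) z = 0"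
    and min: "\<And>h. h \<noteq> 0 \<Longrightarrow> poly (cpoly h) z = 0 \<Longrightarrow> degree n0 \<le> degree h"
    using ex_has_least_nat[of "\<lambda>h. h \<noteq> 0 \<and> poly (cpoly h) z = 0" F degree] F(1) by auto
  define m where "m = primitive_part n0"
  have "n0 = smult (content n0) m" by (simp add: m_def)
  from arg_cong[OF this, of cpoly] have "cpoly n0 = smult (of_int (content n0)) (cpoly m)" by simp
  then have mz: "poly (cpoly m) z = 0" using n0 by auto
  have m0: "m \<noteq> 0" and cm: "content m = 1" and dm: "degree m = degree n0" using n0(1) by (auto simp: m_def)
  have dvd: "m dvd h" if h: "poly (cpoly h) z = 0" for h
  proof -
    obtain c q where c: "c \<noteq> 0" and e: "smult c h = m * q + pseudo_mod h m"
      using pseudo_mod(1)[OF m0] by blast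
    from arg_cong[OF e, of "\<lambda>q. poly (cpoly q) z"]
    have "poly (cpoly (pseudo_mod h m)) z = 0" using h mz by simp
    then have "pseudo_mod h m = 0"
      using pseudo_mod(2)[OF m0, of h] min[of "pseudo_mod h m"] dm by fastforce
    then have e: "smult c h = m * q" using e by simp
    \<comment> \<open>\<open>m\<close> is primitive, so \<open>m * q\<close> has the content of
      \<open>q\<close>; hence the constant \<open>c\<close> can be cancelled from
      \<open>q\<close>.\<close>
    have "content q = \<bar>c\<bar> * content h"
    proof -
      have "content (smult c h) = \<bar>c\<bar> * content h" by (simp add: content_smult)
      then show ?thesis unfolding e content_mult cm by simp
    qed
    then have "c dvd content q" by simp
    then have "[:c:] dvd q" by (simp add: const_poly_dvd_iff_dvd_content)
    then obtain q' where "q = smult c q'" by (auto elim!: dvdE)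
    with e have "smult c h = smult c (m * q')" by simp
    with c have "h = m * q'" by (metis smult_cancel)
    then show ?thesis by simp
  qed
  obtain k where k: "F = m * k" using dvd[OF F(1)] by (auto elim: dvdE)
  then have "lead_coeff m * lead_coeff k = 1" using F(2) lead_coeff_mult[of m k] by simp
  then have u: "lead_coeff m = 1 \<or> lead_coeff m = -1" by (auto simp: zmult_eq_1_iff)
  have "degree m > 0"
  proof (rule ccontr)
    assume "\<not> degree m > 0"
    then obtain c where "m = [:c:]" using degree_eq_zeroE by auto
    then show False using mz m0 by simp
  qed
  moreover obtain n where "n = m \<or> n = - m" "lead_coeff n = 1" using u that[of m] that[of "- m"] by auto
  ultimately show ?thesis using mz dvd by (intro exI[of _ n]) auto
qed

lemma no_common_root_dvd:
  fixes A :: "complex poly"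
  assumes "A dvd M * M'" and nr: "\<And>x. poly A x = 0 \<Longrightarrow> poly M' x \<noteq> 0" and "A \<noteq> 0"
  shows "A dvd M"
proof -
  have "coprime A M'"
  proof (rule ccontr)
    assume "\<not> coprime A M'"
    then have "\<not> is_unit (gcd A M')" by (simp add: coprime_iff_gcd_eq_1 is_unit_gcd)
    moreover have "gcd A M' \<noteq> 0" using assms(3) by simp
    ultimately have "degree (gcd A M') \<noteq> 0" using is_unit_iff_degree by blast
    then obtain x where "poly (gcd A M') x = 0"
      using fundamental_theorem_of_algebra constant_degree by metis
    then have "poly A x = 0" "poly M' x = 0" by (meson dvd_trans gcd_dvd1 gcd_dvd2 poly_eq_0_iff_dvd)+
    then show False using nr by blast
  qed
  then show ?thesis using assms(1) coprime_dvd_mult_left_iff by blast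
qed

lemma monic_degree_0: "lead_coeff (q::'a::comm_ring_1 poly) = 1 \<Longrightarrow> degree q = 0 \<Longrightarrow> q = 1"
  by (elim degree_eq_zeroE) (simp add: one_pCons)

lemma dvd_antisym_monic:
  fixes A B :: "complex poly"
  assumes "A dvd B" "B dvd A" "lead_coeff A = 1" "lead_coeff B = 1"
  shows "A = B"
proof -
  obtain c where c: "B = A * c" using assms(1) by (elim dvdE)
  have "A \<noteq> 0" "B \<noteq> 0" using assms(3,4) by auto
  then have "degree A = degree B" using dvd_imp_degree_le assms(1,2) by (metis le_antisym)
  moreover have "degree B = degree A + degree c" using c \<open>B \<noteq> 0\<close> by (simp add: degree_mult_eq)
  moreover have "lead_coeff c = 1" using c assms(3,4) lead_coeff_mult[of A c] by simp
  ultimately have "c = 1" by (intro monic_degree_0) auto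
  then show ?thesis using c by simp
qed

section \<open>Congruences of integer polynomials modulo a prime\<close>

lemma const_dvd_iff: "[:c::int:] dvd q \<longleftrightarrow> (\<forall>k. c dvd coeff q k)"
  by (simp add: const_poly_dvd_iff)

lemma const_dvd_poly: "[:c:] dvd q \<Longrightarrow> c dvd poly q (x::'a::comm_ring_1)"
  by (auto elim!: dvdE)

lemma prime_const_dvd_mult:
  assumes "prime (p::int)" shows "[:p:] dvd a * b \<longleftrightarrow> [:p:] dvd a \<or> [:p:] dvd b"
proof -
  have "prime_elem [:p:]" using assms unfolding prime_elem_const_poly_iff by (rule prime_imp_prime_elem)
  then show ?thesis by (rule prime_elem_dvd_mult_iff)
qed

lemma monic_not_const_dvd: "prime (p::int) \<Longrightarrow> lead_coeff q = 1 \<Longrightarrow> \<not> [:p:] dvd q"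
  by (metis const_dvd_iff not_prime_unit)

text \<open>The factor theorem modulo p: synthetic division by X - c leaves the constant remainder
  B(c), which vanishes modulo p.\<close>

lemma monic_root_decomp:
  fixes B :: "int poly"
  assumes "lead_coeff B = 1" "p dvd poly B c" "prime p"
  obtains B1 where "lead_coeff B1 = 1" "[:p:] dvd B - [:-c, 1:] * B1" "degree B = Suc (degree B1)"
proof -
  have d: "degree B \<noteq> 0"
  proof
    assume "degree B = 0"
    then have "B = 1" by (rule monic_degree_0[OF assms(1)])
    then show False using assms(2,3) not_prime_unit by auto
  qed
  define B1 where "B1 = synthetic_div B c"
  have e: "B + smult c B1 = pCons (poly B c) B1" unfolding B1_def by (rule synthetic_div_correct)
  have deg: "degree B1 = degree B - 1" by (simp add: B1_def degree_synthetic_div)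
  have "coeff (B + smult c B1) (degree B) = coeff B (degree B)"
    using d deg by (simp add: coeff_eq_0)
  then have "lead_coeff B1 = 1" using e d deg assms(1) by (metis Suc_pred' coeff_pCons_Suc neq0_conv)
  moreover have "B - [:-c, 1:] * B1 = [:poly B c:]" using e by (simp add: algebra_simps)
  ultimately show ?thesis using assms(2) d deg by (intro that[of B1]) (auto simp: const_dvd_iff coeff_pCons split: nat.splits)
qed

lemma const_dvd_trans_mult:
  assumes "[:p:] dvd (B - L * B1 :: int poly)" "[:p:] dvd A * B - L * R" "prime p" "lead_coeff L = 1"
  shows "[:p:] dvd A * B1 - R"
proof -
  have "A * B - L * R = A * (B - L * B1) + L * (A * B1 - R)" by (simp add: algebra_simps)
  then have "[:p:] dvd L * (A * B1 - R)" using assms(1,2) by (metis dvd_add_right_iff dvd_mult)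
  then show ?thesis using prime_const_dvd_mult[OF assms(3)] monic_not_const_dvd[OF assms(3,4)] by blast
qed

text \<open>Unique factorisation over the field with p elements, done by hand: whichever factor
  vanishes at 0 modulo p loses a factor X, and the exponent v drops by one.\<close>

lemma factor_of_X_power_mod:
  fixes A B :: "int poly"
  assumes p: "prime p" and "lead_coeff A = 1" "lead_coeff B = 1" "[:p:] dvd A * B - [:0, 1:] ^ v"
  shows "[:p:] dvd A - [:0, 1:] ^ degree A"
  using assms(2-)
proof (induction v arbitrary: A B)
  case 0
  have l: "lead_coeff (A * B) = 1" using 0 by (simp add: lead_coeff_mult)
  have "degree (A * B) = 0"
  proof (rule ccontr)
    assume "degree (A * B) \<noteq> 0"
    then have "coeff (A * B - [:0, 1:] ^ 0) (degree (A * B)) = 1" using l by (simp add: coeff_1)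
    then show False using 0(3) p by (metis const_dvd_iff not_prime_unit)
  qed
  moreover have "A \<noteq> 0" "B \<noteq> 0" using 0 by auto
  ultimately have "degree A = 0" by (simp add: degree_mult_eq)
  then show ?case using monic_degree_0[OF 0(1)] by simp
next
  case (Suc v)
  have "p dvd poly (A * B - [:0, 1:] ^ Suc v) 0" using Suc(4) by (rule const_dvd_poly)
  then have "p dvd poly A 0 * poly B 0" by simp
  then consider "p dvd poly B 0" | "p dvd poly A 0" using p prime_dvd_multD by blast
  then show ?case
  proof cases
    case 1
    then obtain B1 where B1: "lead_coeff B1 = 1" "[:p:] dvd B - [:-0, 1:] * B1"
      using monic_root_decomp[OF Suc(3) _ p, of 0] by blast
    have "[:p:] dvd A * B1 - [:0, 1:] ^ v"
      using const_dvd_trans_mult[OF B1(2) _ p, of A "[:0,1:] ^ v"] Suc(4) by simp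
    then show ?thesis using Suc.IH Suc.prems B1 by blast
  next
    case 2
    then obtain A1 where A1: "lead_coeff A1 = 1" "[:p:] dvd A - [:-0, 1:] * A1" "degree A = Suc (degree A1)"
      using monic_root_decomp[OF Suc(2) _ p, of 0] by blast
    have "[:p:] dvd B * A1 - [:0, 1:] ^ v"
      using const_dvd_trans_mult[OF A1(2) _ p, of B "[:0,1:] ^ v"] Suc(4) by (simp add: mult.commute)
    then have "[:p:] dvd A1 - [:0, 1:] ^ degree A1"
      using Suc.IH[of A1 B] Suc.prems A1 by (simp add: mult.commute)
    then have "[:p:] dvd [:0, 1:] * (A1 - [:0, 1:] ^ degree A1)" by (rule dvd_mult)
    then have "[:p:] dvd (A - [:0, 1:] * A1) + ([:0, 1:] * A1 - [:0, 1:] * [:0, 1:] ^ degree A1)"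
      using A1(2) by (intro dvd_add) (simp_all only: right_diff_distrib minus_zero)
    then show ?thesis unfolding A1(3) power_Suc by (simp only: diff_add_cancel add_diff_eq)
  qed
qed

text \<open>As \<open>A\<close> does not vanish at 1 modulo p, each factor X - 1 has to be split off
  from \<open>B\<close>, until only a power of X is left.\<close>

lemma factor_mod:
  fixes A B :: "int poly"
  assumes p: "prime p" and "lead_coeff A = 1" "lead_coeff B = 1"
    and "[:p:] dvd A * B - [:-1, 1:] ^ u * [:0, 1:] ^ v" and A1: "\<not> p dvd poly A 1"
  shows "[:p:] dvd A - [:0, 1:] ^ degree A"
  using assms(3,4)
proof (induction u arbitrary: B)
  case 0
  then show ?case using factor_of_X_power_mod[OF p assms(2)] by simp
next
  case (Suc u)
  have "p dvd poly (A * B - [:-1, 1:] ^ Suc u * [:0, 1:] ^ v) 1" using Suc(3) by (rule const_dvd_poly)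
  then have "p dvd poly A 1 * poly B 1" by simp
  then have "p dvd poly B 1" using p A1 prime_dvd_multD by blast
  then obtain B1 where B1: "lead_coeff B1 = 1" "[:p:] dvd B - [:-1, 1:] * B1"
    using monic_root_decomp[OF Suc(2) _ p, of 1] by blast
  have "[:p:] dvd A * B1 - [:-1, 1:] ^ u * [:0, 1:] ^ v"
    using const_dvd_trans_mult[OF B1(2) _ p, of A "[:-1, 1:] ^ u * [:0, 1:] ^ v"] Suc(3)
    unfolding power_Suc mult.assoc by simp
  then show ?case using Suc.IH B1 by blast
qed

text \<open>An Eisenstein criterion: such a polynomial has at most one factor besides a linear one.\<close>

lemma almost_eisenstein_irreducible:
  fixes f :: "int poly"
  assumes p: "prime p" and f: "f = [:-1, 1:] * [:0, 1:] ^ v + smult p e"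
    and c: "\<not> p\<^sup>2 dvd poly f 0" and nr: "\<And>n. poly f n \<noteq> 0"
    and G: "lead_coeff G = 1" "lead_coeff H = 1" "f = G * H"
  shows "degree G = 0 \<or> degree H = 0"
proof (rule ccontr)
  assume "\<not> ?thesis"
  then have "degree G \<noteq> 0" "degree H \<noteq> 0" by auto
  have "p dvd poly f 1" using f by simp
  then have "p dvd poly G 1 * poly H 1" using G(3) by simp
  have *: False if G: "lead_coeff G = 1" "lead_coeff H = 1" "f = G * H" "p dvd poly H 1"
    and dG: "degree G \<noteq> 0" for G H
  proof -
    obtain H1 where H1: "lead_coeff H1 = 1" "[:p:] dvd H - [:-1, 1:] * H1" "degree H = Suc (degree H1)"
      using monic_root_decomp[OF G(2,4) p] by blast
    have "[:p:] dvd G * H - [:-1, 1:] * [:0, 1:] ^ v"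
      using f G(3) by (simp add: const_dvd_iff)
    then have GH1: "[:p:] dvd G * H1 - [:0, 1:] ^ v" using const_dvd_trans_mult[OF H1(2) _ p] by simp
    have "[:p:] dvd G - [:0, 1:] ^ degree G" by (rule factor_of_X_power_mod[OF p G(1) H1(1) GH1])
    from const_dvd_poly[OF this, of 0] have G0: "p dvd poly G 0" using dG by (simp add: power_0_left)
    have "[:p:] dvd H1 - [:0, 1:] ^ degree H1"
      using factor_of_X_power_mod[OF p H1(1) G(1)] GH1 by (simp add: mult.commute)
    from const_dvd_poly[OF this, of 0] const_dvd_poly[OF H1(2), of 0]
    have "degree H1 \<noteq> 0 \<Longrightarrow> p dvd poly H1 0" "p dvd poly H 0 + poly H1 0"
      by (auto simp: power_0_left)
    then have "degree H1 \<noteq> 0 \<Longrightarrow> p dvd poly H 0" using dvd_add_left_iff by blast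
    \<comment> \<open>If \<open>H1\<close> were not constant, both factors of \<open>f\<close> would
      vanish at 0 modulo p, against \<open>c\<close>. So \<open>H\<close> is linear and has an
      integer root.\<close>
    then have "degree H1 \<noteq> 0 \<Longrightarrow> p\<^sup>2 dvd poly f 0"
      using G0 G(3) by (simp add: power2_eq_square mult_dvd_mono)
    then have "degree H = 1" using c H1(3) by auto
    obtain c H' where H: "H = pCons c H'" by (cases H)
    with \<open>degree H = 1\<close> G(2) have "degree H' = 0" "lead_coeff H' = 1" by (auto split: if_splits)
    then have "H' = 1" by (intro monic_degree_0)
    then have "poly H (-c) = 0" by (simp add: H)
    then show False using nr G(3) by simp
  qed
  have "f = H * G" using G(3) by (simp add: mult.commute)
  have "p dvd poly G 1 \<or> p dvd poly H 1" using \<open>p dvd poly G 1 * poly H 1\<close> p prime_dvd_multD by blast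
  then show False
    using *[OF G(1,2,3) _ \<open>degree G \<noteq> 0\<close>] *[OF G(2,1) \<open>f = H * G\<close> _ \<open>degree H \<noteq> 0\<close>] by blast
qed

section \<open>Conjugate roots\<close>

lemma coeff_cpoly [simp]: "coeff (cpoly q) k = of_int (coeff q k)"
  by (simp add: coeff_map_poly)

lemma sum_const_poly: "(\<Sum>k\<in>I. [:h k:]) = [:\<Sum>k\<in>I. h k:]"
  by (induction I rule: infinite_finite_induct) auto

text \<open>Coefficient arrays with one common bound \<open>m\<close> on both exponents: sums and
  transposes of relations between two roots stay of this form.\<close>

definition biv :: "nat \<Rightarrow> (nat \<Rightarrow> nat \<Rightarrow> complex) \<Rightarrow> complex \<Rightarrow> complex \<Rightarrow> complex" where
  "biv m c x y = (\<Sum>k<m. \<Sum>l<m. c k l * x ^ k * y ^ l)"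

lemma biv_of_poly_poly:
  assumes "G \<in> coeffs_in (coeffs_in A)"
  shows "\<exists>m c. (\<forall>k l. c k l \<in> A) \<and> (\<forall>x y. poly (poly G [:y:]) x = biv m c x y)"
proof -
  define m where "m = Suc (max (degree G) (Max (degree ` coeff G ` {..degree G})))"
  have m: "degree G < m" "degree (coeff G l) < m" for l
  proof -
    show "degree G < m" by (simp add: m_def)
    have "degree (coeff G l) \<le> Max (degree ` coeff G ` {..degree G})"
    proof (cases "l \<le> degree G")
      case False
      then have "coeff G l = 0" by (simp add: coeff_eq_0)
      then show ?thesis by simp
    qed (auto intro!: Max_ge)
    then show "degree (coeff G l) < m" by (simp add: m_def)
  qed
  have e: "poly q x = (\<Sum>k<m. coeff q k * x ^ k)" if "degree q < m" for q and x :: "'a::comm_ring_1"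
    unfolding poly_altdef using that by (intro sum.mono_neutral_left) (auto simp: coeff_eq_0)
  have "poly (poly G [:y:]) x = biv m (\<lambda>k l. coeff (coeff G l) k) x y" for x y
  proof -
    have "poly (poly G [:y:]) x = (\<Sum>l<m. poly (coeff G l) x * y ^ l)"
      by (simp add: e[OF m(1)] poly_sum poly_const_pow mult.commute)
    also have "\<dots> = (\<Sum>l<m. \<Sum>k<m. coeff (coeff G l) k * x ^ k * y ^ l)"
      by (simp add: e[OF m(2)] sum_distrib_right)
    also have "\<dots> = biv m (\<lambda>k l. coeff (coeff G l) k) x y"
      unfolding biv_def by (rule sum.swap)
    finally show ?thesis .
  qed
  then show ?thesis using assms
    by (intro exI[of _ m] exI[of _ "\<lambda>k l. coeff (coeff G l) k"]) (auto simp: coeffs_inD)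
qed

text \<open>Irreducibility of \<open>f\<close> enters as \<open>irr\<close>: integer polynomials
  cannot distinguish the roots. With \<open>inj_a\<close> and the degree, \<open>a\<close>
  enumerates all roots.\<close>

locale conj_roots =
  fixes f :: "int poly" and a :: "'n::finite \<Rightarrow> complex" and g :: nat
  assumes g_card: "g = CARD('n)"
    and monic_f: "lead_coeff f = 1" and degree_f: "degree f = g"
    and root: "poly (cpoly f) (a i) = 0" and inj_a: "inj a"
    and irr: "poly (cpoly h) (a i) = 0 \<Longrightarrow> poly (cpoly h) (a j) = 0"
begin

text \<open>Lagrange interpolation polynomials. Their coefficients form the inverse Vandermonde
  matrix and later yield coordinates in the power basis.\<close>

definition lag :: "'n \<Rightarrow> complex poly" where
  "lag i = (\<Prod>j\<in>UNIV - {i}. smult (1 / (a i - a j)) [:- a j, 1:])"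

lemma poly_lag: "poly (lag i) (a j) = (if i = j then 1 else 0)"
proof (cases "i = j")
  case True
  then show ?thesis using inj_a
    by (auto simp: lag_def poly_prod inj_eq divide_simps intro!: prod.neutral)
next
  case False
  then show ?thesis by (auto simp: lag_def poly_prod)
qed

lemma degree_lag: "degree (lag i) < g"
proof -
  have "degree (lag i) \<le> (\<Sum>j\<in>UNIV - {i}. degree (smult (1 / (a i - a j)) [:- a j, 1:]))"
    unfolding lag_def using degree_prod_sum_le[of "UNIV - {i}" "\<lambda>j. smult (1 / (a i - a j)) [:- a j, 1:]"]
    unfolding o_def by (meson finite)
  also have "\<dots> \<le> (\<Sum>j\<in>UNIV - {i}. 1)" by (intro sum_mono) (auto simp: degree_smult_le)
  also have "\<dots> = g - 1" by (simp add: g_card)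
  finally show ?thesis using g_card by (simp add: le_less_trans less_Suc_eq_le[symmetric])
qed

lemma sum_coeff_eq_poly: "degree q < g \<Longrightarrow> (\<Sum>k<g. coeff q k * x ^ k) = poly (q::complex poly) x"
  unfolding poly_altdef by (intro sum.mono_neutral_right) (auto simp: coeff_eq_0)

lemma lag_vandermonde: "(\<Sum>k<g. coeff (lag i) k * a j ^ k) = (if i = j then 1 else 0)"
  using sum_coeff_eq_poly[OF degree_lag] by (simp add: poly_lag)

lemma splits_over_Ints: "splits_over \<int> (cpoly f) a"
  and splits_over_Rats: "splits_over \<rat> (cpoly f) a"
proof -
  have *: "lead_coeff (cpoly f) = 1" "degree (cpoly f) = CARD('n)" using monic_f degree_f g_card by auto
  have W: "\<exists>W. \<forall>i j. (\<Sum>k<CARD('n). W i k * a j ^ k) = (if i = j then 1 else 0)"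
    using lag_vandermonde g_card by (intro exI[of _ "\<lambda>i. coeff (lag i)"]) simp
  show "splits_over \<int> (cpoly f) a"
    unfolding splits_over_def using * W root cpoly_in ring_closed_Ints by blast
  have "cpoly f \<in> coeffs_in \<rat>" by (auto simp: coeffs_in_def coeff_map_poly)
  then show "splits_over \<rat> (cpoly f) a"
    unfolding splits_over_def using * W root ring_closed_Rats by blast
qed

lemma zero_if_roots:
  assumes "degree q < g" "\<And>i. poly q (a i) = 0" shows "q = 0"
proof (rule ccontr)
  assume q: "q \<noteq> 0"
  have "card (range a) \<le> card {x. poly q x = 0}"
    using assms(2) by (intro card_mono poly_roots_finite q) auto
  also have "\<dots> \<le> degree q" using q by (rule card_poly_roots_bound)
  finally show False using assms(1) g_card inj_a by (simp add: card_image)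
qed

lemma cpoly_f_prod: "cpoly f = (\<Prod>i\<in>UNIV. [:- a i, 1:])"
proof -
  define P where "P = (\<Prod>i\<in>UNIV. [:- a i, 1:])"
  have P: "lead_coeff P = 1" "degree P = g"
    unfolding P_def by (subst lead_coeff_prod) (simp_all add: degree_prod_eq_sum_degree g_card)
  have "degree (cpoly f - P) \<le> g" using P degree_f by (intro degree_diff_le) auto
  moreover have "coeff (cpoly f - P) g = 0" using P monic_f degree_f by (simp add: coeff_map_poly)
  ultimately have "cpoly f - P = 0 \<or> degree (cpoly f - P) < g"
    using eq_zero_or_degree_less by blast
  moreover have "poly (cpoly f - P) (a i) = 0" for i
    by (auto simp: root P_def poly_prod intro!: prod_zero)
  ultimately have "cpoly f - P = 0" using zero_if_roots by blast
  then show ?thesis by (simp add: P_def)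
qed

text \<open>The norm over y of T - c(x, y). In \<open>G\<close> the outermost variable is y, the
  middle one x and the innermost T, so \<open>norm_in\<close> is applied to coefficients that are
  polynomials in x and T.\<close>

lemma norm_biv:
  assumes A: "splits_over A (cpoly f) a" and c: "\<And>k l. c k l \<in> A"
  shows "\<exists>N\<in>coeffs_in (coeffs_in A). \<forall>x. poly N [:x:] = (\<Prod>j\<in>UNIV. [:- biv m c x (a j), 1:])"
proof -
  have R: "ring_closed A" using A by (simp add: splits_over_def)
  note R1 = ring_closed_coeffs_in[OF R] and R2 = ring_closed_coeffs_in[OF ring_closed_coeffs_in[OF R]]
  note R3 = ring_closed_coeffs_in[OF R2]
  define G where "G = [:[:[:0, 1:]:]:] - (\<Sum>k<m. \<Sum>l<m. monom (monom [:c k l:] k) l)"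
  have G: "G \<in> coeffs_in (coeffs_in (coeffs_in A))"
    unfolding G_def
    by (intro ring_closed_diff[OF R3] ring_closed_sum[OF R3] coeffs_in_monom coeffs_in_const coeffs_in_X R R1 R2 c)
  have "poly (poly G [:[:y:]:]) [:x:] = [:- biv m c x y, 1:]" for x y
    by (simp add: G_def poly_sum poly_monom poly_const_pow biv_def)
      (simp add: sum_const_poly ac_simps)
  then have "poly (\<Prod>j\<in>UNIV. poly G [:[:a j:]:]) [:x:] = (\<Prod>j\<in>UNIV. [:- biv m c x (a j), 1:])" for x
    by (simp add: poly_prod)
  moreover have "(\<Prod>j\<in>UNIV. poly G [:[:a j:]:]) \<in> coeffs_in (coeffs_in A)"
    using norm_in[OF splits_over_poly[OF splits_over_poly[OF A]] G] by simp
  ultimately show ?thesis by blast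
qed

lemma prod_biv_all:
  assumes A: "splits_over A (cpoly f) a" and c: "\<And>k l. c k l \<in> A"
  shows "(\<Prod>i\<in>UNIV. \<Prod>j\<in>UNIV. [:- biv m c (a i) (a j), 1:]) \<in> coeffs_in A"
proof -
  obtain N where N: "N \<in> coeffs_in (coeffs_in A)"
    "\<And>x. poly N [:x:] = (\<Prod>j\<in>UNIV. [:- biv m c x (a j), 1:])"
    using norm_biv[of A c m, OF A c] by blast
  show ?thesis using norm_in[OF splits_over_poly[OF A] N(1)] by (simp add: N(2))
qed

lemma prod_biv_diag:
  assumes A: "splits_over A (cpoly f) a" and c: "\<And>k l. c k l \<in> A"
  shows "(\<Prod>i\<in>UNIV. [:- biv m c (a i) (a i), 1:]) \<in> coeffs_in A"
proof -
  have R: "ring_closed A" using A by (simp add: splits_over_def)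
  note R1 = ring_closed_coeffs_in[OF R]
  note R2 = ring_closed_coeffs_in[OF R1]
  define G where "G = [:[:0, 1:]:] - (\<Sum>k<m. \<Sum>l<m. monom [:c k l:] (k + l))"
  have G: "G \<in> coeffs_in (coeffs_in A)"
    unfolding G_def
    by (intro ring_closed_diff[OF R2] ring_closed_sum[OF R2] coeffs_in_monom coeffs_in_const coeffs_in_X R R1 c)
  have "poly G [:x:] = [:- biv m c x x, 1:]" for x
    by (simp add: G_def poly_sum poly_monom poly_const_pow biv_def power_add mult.assoc)
      (simp add: sum_const_poly ac_simps)
  then show ?thesis using norm_in[OF splits_over_poly[OF A] G] by simp
qed

lemma prod_UNIV_pairs:
  "(\<Prod>i\<in>UNIV. \<Prod>j\<in>UNIV. h i j) = (\<Prod>i\<in>(UNIV::'n set). h i i) * (\<Prod>(i, j)\<in>{(i, j). i \<noteq> j}. h i j :: 'b::comm_ring_1)"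
proof -
  have "(\<Prod>i\<in>UNIV. \<Prod>j\<in>UNIV. h i j) = (\<Prod>(i, j)\<in>(UNIV :: ('n \<times> 'n) set). h i j)"
    by (simp add: prod.cartesian_product)
  also have "(UNIV :: ('n \<times> 'n) set) = range (\<lambda>i. (i, i)) \<union> {(i, j). i \<noteq> j}" by auto
  also have "(\<Prod>(i, j)\<in>\<dots>. h i j) = (\<Prod>(i, j)\<in>range (\<lambda>i. (i, i)). h i j) * (\<Prod>(i, j)\<in>{(i, j). i \<noteq> j}. h i j)"
    by (rule prod.union_disjoint) auto
  also have "(\<Prod>(i, j)\<in>range (\<lambda>i. (i, i)). h i j) = (\<Prod>i\<in>UNIV. h i i)"
    by (subst prod.reindex) (auto simp: inj_on_def)
  finally show ?thesis .
qed

text \<open>The product over all pairs and the product over the diagonal are norms, and the latter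
  is monic; so their quotient keeps its coefficients in \<open>A\<close>.\<close>

lemma prod_biv_offdiag:
  assumes A: "splits_over A (cpoly f) a" and c: "\<And>k l. c k l \<in> A"
  shows "(\<Prod>(i, j)\<in>{(i, j). i \<noteq> j}. [:- biv m c (a i) (a j), 1:]) \<in> coeffs_in A"
proof -
  have R: "ring_closed A" using A by (simp add: splits_over_def)
  show ?thesis
  proof (rule monic_cofactor_in[OF R])
    show "(\<Prod>i\<in>UNIV. [:- biv m c (a i) (a i), 1:]) \<in> coeffs_in A" by (rule prod_biv_diag[OF A]) (rule c)
    show "lead_coeff (\<Prod>i\<in>UNIV. [:- biv m c (a i) (a i), 1:]) = 1" by (subst lead_coeff_prod) simp
    show "(\<Prod>i\<in>UNIV. [:- biv m c (a i) (a i), 1:]) * (\<Prod>(i, j)\<in>{(i, j). i \<noteq> j}. [:- biv m c (a i) (a j), 1:]) \<in> coeffs_in A"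
      using prod_biv_all[of A c m, OF A c] by (simp only: prod_UNIV_pairs)
  qed
qed

lemma irr_coeffs_in:
  assumes "q \<in> coeffs_in \<int>" "poly q (a i) = 0" shows "poly q (a j) = 0"
  using assms by (elim coeffs_in_Ints_cases) (metis irr)

text \<open>The count is the multiplicity of T = 0 as a root of the norm of T - c(a i, y). The
  coefficients of this norm are integer polynomials in a i, which vanish at all roots or at
  none.\<close>

lemma card_root_of_biv:
  assumes c: "\<And>k l. c k l \<in> \<int>"
  shows "card {j. biv m c (a i) (a j) = 0} = card {j. biv m c (a i') (a j) = 0}"
proof -
  obtain N where N: "N \<in> coeffs_in (coeffs_in \<int>)"
    "\<And>x. poly N [:x:] = (\<Prod>j\<in>UNIV. [:- biv m c x (a j), 1:])"
    using norm_biv[of "\<int>" c m, OF splits_over_Ints c] by blast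
  have ev: "\<exists>q\<in>coeffs_in \<int>. \<forall>x. coeff (poly N [:x:]) r = poly q x" for r
  proof (intro bexI allI)
    show "coeff (poly N [:x:]) r = poly (\<Sum>k\<le>degree N. monom (coeff (coeff N k) r) k) x" for x
      by (simp add: poly_altdef[of N] poly_const_pow coeff_sum poly_sum poly_monom mult.commute)
    show "(\<Sum>k\<le>degree N. monom (coeff (coeff N k) r) k) \<in> coeffs_in \<int>"
      using N(1) by (intro ring_closed_sum ring_closed_coeffs_in coeffs_in_monom ring_closed_Ints) (auto simp: coeffs_in_def)
  qed
  have eq0: "coeff (poly N [:a i:]) r = 0" if "coeff (poly N [:a i':]) r = 0" for r i i'
  proof -
    obtain q where "q \<in> coeffs_in \<int>" "\<And>x. coeff (poly N [:x:]) r = poly q x" using ev by blast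
    then show ?thesis using that irr_coeffs_in[of q i' i] by simp
  qed
  \<comment> \<open>The lowest nonzero coefficient of \<open>poly N [:a i:]\<close> sits at the
    index equal to the count.\<close>
  have low: "coeff (poly N [:a i:]) r = 0 \<longleftrightarrow> r < card {j. biv m c (a i) (a j) = 0}"
    if "r \<le> card {j. biv m c (a i) (a j) = 0}" for i r
  proof -
    define n where "n = card {j. biv m c (a i) (a j) = 0}"
    have "poly N [:a i:] = (\<Prod>j\<in>{j. biv m c (a i) (a j) = 0} \<union> {j. biv m c (a i) (a j) \<noteq> 0}. [:- biv m c (a i) (a j), 1:])"
      unfolding N(2) by (rule arg_cong[where f="prod _"]) auto
    also have "\<dots> = [:0, 1:] ^ n * (\<Prod>j\<in>{j. biv m c (a i) (a j) \<noteq> 0}. [:- biv m c (a i) (a j), 1:])"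
      by (subst prod.union_disjoint) (auto simp: n_def)
    also have "[:0, 1:] ^ n = monom (1::complex) n" by (simp add: monom_altdef)
    finally have e: "poly N [:a i:] = monom 1 n * (\<Prod>j\<in>{j. biv m c (a i) (a j) \<noteq> 0}. [:- biv m c (a i) (a j), 1:])" .
    have nz: "coeff (\<Prod>j\<in>{j. biv m c (a i) (a j) \<noteq> 0}. [:- biv m c (a i) (a j), 1:]) 0 \<noteq> 0"
      by (simp add: poly_0_coeff_0[symmetric] poly_prod)
    show ?thesis using that nz unfolding e coeff_monom_mult n_def[symmetric] by auto
  qed
  show ?thesis
  proof (rule ccontr)
    assume ne: "\<not> ?thesis"
    have *: False if "card {j. biv m c (a i) (a j) = 0} < card {j. biv m c (a i') (a j) = 0}" for i i'
      using low[of "card {j. biv m c (a i) (a j) = 0}" i] low[of "card {j. biv m c (a i) (a j) = 0}" i']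
        eq0[of i' "card {j. biv m c (a i) (a j) = 0}" i] that by simp
    show False using *[of i i'] *[of i' i] ne by linarith
  qed
qed

end

section \<open>Double homogeneity of the conjugates\<close>

definition is_minpoly :: "int poly \<Rightarrow> complex \<Rightarrow> bool" where
  "is_minpoly m z \<longleftrightarrow> lead_coeff m = 1 \<and> degree m > 0 \<and> poly (cpoly m) z = 0 \<and>
    (\<forall>h. poly (cpoly h) z = 0 \<longrightarrow> m dvd h)"

text \<open>The minimal polynomial n of \<open>w\<close> divides \<open>m\<close>, say m = n t. For
  reasons of degree t cannot vanish at \<open>z\<close>, so n does, and m divides n.\<close>

lemma is_minpoly_conj:
  assumes m: "is_minpoly m z" and w: "poly (cpoly m) w = 0"
  shows "is_minpoly m w"
proof -
  have lm: "lead_coeff m = 1" using m by (simp add: is_minpoly_def)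
  obtain n where n: "is_minpoly n w"
    using minimal_int_poly[OF w lm] unfolding is_minpoly_def by blast
  then have "n dvd m" using w by (simp add: is_minpoly_def)
  then obtain t where t: "m = n * t" by (elim dvdE)
  have m0: "m \<noteq> 0" using lm by auto
  have "poly (cpoly n) z * poly (cpoly t) z = 0" using m t by (simp add: is_minpoly_def)
  moreover have "poly (cpoly t) z \<noteq> 0"
  proof
    assume "poly (cpoly t) z = 0"
    then have "m dvd t" using m by (simp add: is_minpoly_def)
    moreover have "t \<noteq> 0" "n \<noteq> 0" using t m0 by auto
    ultimately have "degree m \<le> degree t" by (simp add: dvd_imp_degree_le)
    moreover have "degree m = degree n + degree t" using t \<open>t \<noteq> 0\<close> \<open>n \<noteq> 0\<close> by (simp add: degree_mult_eq)
    ultimately show False using n by (simp add: is_minpoly_def)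
  qed
  ultimately have "m dvd n" using m by (simp add: is_minpoly_def)
  then have "m dvd h" if "poly (cpoly h) w = 0" for h
    using n that dvd_trans[of m n h] by (simp add: is_minpoly_def)
  then show ?thesis using m w by (simp add: is_minpoly_def)
qed

text \<open>At a double root the derivative vanishes too, so it would be a multiple of
  \<open>m\<close> although its degree is smaller.\<close>

lemma is_minpoly_simple_root:
  assumes m: "is_minpoly m z"
  shows "\<not> [:- z, 1:]\<^sup>2 dvd cpoly m"
proof
  assume "[:- z, 1:]\<^sup>2 dvd cpoly m"
  then obtain q where q: "cpoly m = [:- z, 1:]\<^sup>2 * q" by (elim dvdE)
  have "pderiv (cpoly m) = cpoly (pderiv m)"
    by (rule poly_eqI) (simp add: coeff_pderiv)
  then have "cpoly (pderiv m) = pderiv ([:- z, 1:] * ([:- z, 1:] * q))"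
    unfolding q power2_eq_square mult.assoc by (rule sym)
  then have "poly (cpoly (pderiv m)) z = poly (pderiv ([:- z, 1:] * ([:- z, 1:] * q))) z" by (rule arg_cong)
  also have "\<dots> = 0" by (subst pderiv_mult) (simp only: poly_mult poly_add, simp)
  finally have "m dvd pderiv m" using m unfolding is_minpoly_def by blast
  then show False using m by (simp add: is_minpoly_def)
qed

text \<open>The integer coefficients become constants in two variables, so that any polynomial
  \<open>Y\<close> in two variables, such as x + y or X - x, can be substituted.\<close>

lemma poly_const2_eval:
  "poly (poly (poly (map_poly (\<lambda>c. [:[:of_int c:]:]) q) Y) u) v = poly (cpoly q) (poly (poly Y u) v)"
  by (induction q) (auto simp: map_poly_pCons)

lemma poly_const2_in:
  assumes "ring_closed (A :: complex set)" "Y \<in> coeffs_in (coeffs_in A)"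
  shows "poly (map_poly (\<lambda>c. [:[:of_int c:]:]) q) Y \<in> coeffs_in (coeffs_in A)"
proof -
  have "map_poly (\<lambda>c. [:[:of_int c :: complex:]:]) q \<in> coeffs_in (coeffs_in (coeffs_in A))"
    by (rule coeffs_inI) (simp add: coeff_map_poly coeffs_in_const ring_closed_coeffs_in assms ring_closed_of_int)
  then show ?thesis using assms by (intro poly_in_ring_closed ring_closed_coeffs_in)
qed

lemma coeff_prod_linear:
  assumes "finite S" "S \<noteq> {}"
  shows "coeff (\<Prod>s\<in>S. [:- h s, 1 :: complex:]) (card S - 1) = - (\<Sum>s\<in>S. h s)"
  using assms
proof (induction S rule: finite_ne_induct)
  case (insert x F)
  have d: "degree (\<Prod>s\<in>F. [:- h s, 1:]) = card F" by (simp add: degree_prod_eq_sum_degree)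
  have l: "coeff (\<Prod>s\<in>F. [:- h s, 1:]) (card F) = 1"
    using lead_coeff_prod[of "\<lambda>s. [:- h s, 1:]" F] by (simp add: d)
  obtain n where n: "card F = Suc n" using insert by (metis card_0_eq not0_implies_Suc)
  show ?case using insert n l by (simp add: coeff_pCons)
qed simp

lemma clear_denominators:
  assumes "q \<in> coeffs_in \<rat>"
  shows "\<exists>d h. d \<noteq> 0 \<and> smult (of_int d) q = cpoly h"
  using assms
proof (induction q)
  case 0
  show ?case by (intro exI[of _ 1] exI[of _ 0]) simp
next
  case (pCons c q)
  then have "c \<in> \<rat>" "q \<in> coeffs_in \<rat>" by (simp_all add: coeffs_in_pCons)
  then obtain u v :: int where uv: "v \<noteq> 0" "c = of_int u / of_int v"
    by (elim Rats_cases') (metis less_irrefl)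
  obtain d h where d: "d \<noteq> 0" "smult (of_int d) q = cpoly h" using pCons.IH \<open>q \<in> coeffs_in \<rat>\<close> by blast
  have "smult (of_int (v * d)) q = smult (of_int v) (cpoly h)" by (simp add: d(2)[symmetric])
  then show ?case using uv d(1)
    by (intro exI[of _ "v * d"] exI[of _ "pCons (d * u) (smult v h)"]) simp
qed

lemma biv_pad: "m \<le> M \<Longrightarrow> biv M (\<lambda>k l. if k < m \<and> l < m then c k l else 0) x y = biv m c x y"
proof -
  assume m: "m \<le> M"
  have "biv M (\<lambda>k l. if k < m \<and> l < m then c k l else 0) x y
      = (\<Sum>k<M. if k < m then (\<Sum>l<M. if l < m then c k l * x ^ k * y ^ l else 0) else 0)"
    unfolding biv_def by (intro sum.cong refl) (auto intro!: sum.cong)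
  also have "\<dots> = (\<Sum>k<m. \<Sum>l<M. if l < m then c k l * x ^ k * y ^ l else 0)"
    using m by (intro sum.mono_neutral_cong_right) auto
  also have "\<dots> = biv m c x y"
    unfolding biv_def using m by (intro sum.cong refl sum.mono_neutral_cong_right) auto
  finally show ?thesis .
qed

lemma biv_linear: "biv m (\<lambda>k l. s * c k l + t * d k l) x y = s * biv m c x y + t * biv m d x y"
  by (simp add: biv_def distrib_right sum.distrib sum_distrib_left mult.assoc)

lemma biv_swap: "biv m (\<lambda>k l. c l k) x y = biv m c y x"
  unfolding biv_def by (subst sum.swap) (simp add: ac_simps)

lemma biv_plus: "2 \<le> m \<Longrightarrow> biv m (\<lambda>k l. if k + l = 1 then 1 else 0) x y = x + y"
proof -
  assume m: "2 \<le> m"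
  have "biv m (\<lambda>k l. if k < 2 \<and> l < 2 then (if k + l = 1 then 1 else 0) else 0) x y = x + y"
    unfolding biv_pad[OF m] by (simp add: biv_def numeral_2_eq_2)
  moreover have "(\<lambda>k l. if k < 2 \<and> l < 2 then (if k + l = 1 then 1 else 0) else 0) = (\<lambda>k l. if k + l = (1::nat) then 1 else (0::complex))"
    by (intro ext) auto
  ultimately show ?thesis by simp
qed

lemma cpoly_pcompose: "cpoly (pcompose q h) = pcompose (cpoly q) (cpoly h)"
  by (induction q) (auto simp: pcompose_pCons)

section \<open>The polynomial of sums of two roots modulo p\<close>

definition eqm :: "int \<Rightarrow> int poly \<Rightarrow> int poly \<Rightarrow> bool" where
  "eqm p A B \<longleftrightarrow> [:p:] dvd A - B"

lemma eqm_refl: "eqm p A A" by (simp add: eqm_def)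

lemma eqm_sym: "eqm p A B \<Longrightarrow> eqm p B A"
  unfolding eqm_def by (metis dvd_minus_iff minus_diff_eq)

lemma eqm_trans: "eqm p A B \<Longrightarrow> eqm p B C \<Longrightarrow> eqm p A C"
  unfolding eqm_def using dvd_add[of "[:p:]" "A - B" "B - C"] by simp

lemma eqm_mult: "eqm p A B \<Longrightarrow> eqm p C D \<Longrightarrow> eqm p (A * C) (B * D)"
proof -
  assume "eqm p A B" "eqm p C D"
  then have "[:p:] dvd (A - B) * C + B * (C - D)" unfolding eqm_def by (intro dvd_add dvd_mult dvd_mult2)
  then show ?thesis by (simp add: eqm_def algebra_simps)
qed

lemma eqm_power: "eqm p A B \<Longrightarrow> eqm p (A ^ n) (B ^ n)"
  by (induction n) (simp_all add: eqm_mult eqm_refl)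

lemma eqm_smult: "eqm p (A + smult p B) A"
  by (simp add: eqm_def const_dvd_iff)

lemma poly_eqI_eval: "(\<And>x. poly q x = poly h x) \<Longrightarrow> q = h" for q h :: "'a::{idom, ring_char_0} poly"
  using poly_eq_poly_eq_iff[of q h] by (simp add: fun_eq_iff)

lemma pcompose_power: "pcompose (q ^ n) h = pcompose q h ^ n"
  for q h :: "'a::comm_ring_1 poly"
  by (induction n) (auto simp: pcompose_mult pcompose_1)

text \<open>Bookkeeping for \<open>Psi_mod\<close>, with x, y, z standing for X - 2, X - 1, X: the
  factor x z^n belongs to the diagonal sums 2 a i and is cancelled there.\<close>

lemma shuffle_powers:
  fixes x y z :: "'a::comm_ring_1"
  assumes "n \<ge> 1"
  shows "(x * y ^ n) * (y * z ^ n) ^ n = (y ^ (2 * n) * z ^ (n * (n - 1))) * (x * z ^ n)"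
proof -
  have "n * n = n * (n - 1) + n" using assms by (cases n) auto
  then have "z ^ (n * n) = z ^ (n * (n - 1)) * z ^ n" by (simp only: power_add)
  then have "(y * z ^ n) ^ n = y ^ n * (z ^ (n * (n - 1)) * z ^ n)"
    by (simp only: power_mult_distrib power_mult[symmetric])
  moreover have "y ^ (2 * n) = y ^ n * y ^ n" by (simp only: mult_2 power_add)
  ultimately show ?thesis by (simp only: ac_simps)
qed

lemma monic_linear_power: "lead_coeff ([:c, 1:] ^ n :: 'a::idom poly) = 1"
  by (simp only: lead_coeff_power) simp

text \<open>Modulo p one root of \<open>f\<close> is 1 and the others are 0. Since f(0) = p e(0),
  \<open>e0\<close> says that p divides f(0) exactly once. The bound 2 g < p keeps 2 n nonzero
  modulo p for 0 < n \<le> g.\<close>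

locale eisenstein_roots = conj_roots f a g for f :: "int poly" and a :: "'n::finite \<Rightarrow> complex" and g :: nat +
  fixes p :: int and e :: "int poly"
  assumes g3: "g \<ge> 3" and prime_p: "prime p" and p_large: "2 * int g < p"
    and f_eq: "f = [:-1, 1:] * [:0, 1:] ^ (g - 1) + smult p e" and e0: "\<not> p dvd poly e 0"
begin

definition gam :: "'n \<times> 'n \<Rightarrow> complex" where "gam s = a (fst s) + a (snd s)"

text \<open>Ordered pairs are used because \<open>prod_biv_offdiag\<close> gives integral
  coefficients for them; the price is that every root is at least double.\<close>

definition PsiC :: "complex poly" where
  "PsiC = (\<Prod>s\<in>{(i, j). i \<noteq> j}. [:- gam s, 1:])"

lemma gam_biv: "gam (i, j) = biv 2 (\<lambda>k l. if k + l = 1 then 1 else 0) (a i) (a j)"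
  by (simp only: biv_plus[OF order_refl] gam_def fst_conv snd_conv)

lemma PsiC_in: "PsiC \<in> coeffs_in \<int>"
proof -
  have "(\<Prod>(i, j)\<in>{(i, j). i \<noteq> j}. [:- biv 2 (\<lambda>k l. if k + l = 1 then 1 else 0) (a i) (a j), 1:]) \<in> coeffs_in \<int>"
    by (rule prod_biv_offdiag[OF splits_over_Ints]) auto
  then show ?thesis by (simp only: PsiC_def gam_biv[symmetric] case_prod_unfold prod.collapse)
qed

definition Psi :: "int poly" where "Psi = (SOME q. cpoly q = PsiC)"

lemma cpoly_Psi: "cpoly Psi = PsiC"
  unfolding Psi_def by (rule someI_ex) (metis PsiC_in coeffs_in_Ints_cases)

lemma monic_Psi: "lead_coeff Psi = 1"
proof -
  have "lead_coeff PsiC = 1" unfolding PsiC_def by (subst lead_coeff_prod) simp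
  then show ?thesis by (simp add: cpoly_Psi[symmetric])
qed

text \<open>This is 2^g f(X/2), whose roots are the diagonal sums 2 a i.\<close>

definition DgI :: "int poly" where
  "DgI = (\<Sum>k\<le>g. monom (2 ^ (g - k) * coeff f k) k)"

lemma cpoly_sum: "cpoly (sum h I) = (\<Sum>i\<in>I. cpoly (h i))"
  by (induction I rule: infinite_finite_induct) auto

lemma cpoly_DgI: "cpoly DgI = (\<Prod>i\<in>UNIV. [:- gam (i, i), 1:])"
proof (rule poly_eqI_eval)
  fix x
  have "poly (\<Prod>i\<in>UNIV. [:- gam (i, i), 1:]) x = (\<Prod>i\<in>UNIV. 2 * (x / 2 - a i))"
    unfolding poly_prod by (intro prod.cong) (auto simp: gam_def algebra_simps)
  also have "\<dots> = 2 ^ g * poly (cpoly f) (x / 2)"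
    unfolding prod.distrib cpoly_f_prod poly_prod by (simp add: g_card)
  also have "\<dots> = (\<Sum>k\<le>g. 2 ^ g * (of_int (coeff f k) * (x / 2) ^ k))"
    by (simp add: poly_altdef degree_f sum_distrib_left)
  also have "\<dots> = (\<Sum>k\<le>g. 2 ^ (g - k) * of_int (coeff f k) * x ^ k)"
    by (intro sum.cong) (auto simp: power_diff power_divide)
  also have "\<dots> = poly (cpoly DgI) x"
    by (simp add: DgI_def cpoly_sum poly_sum poly_monom)
  finally show "poly (cpoly DgI) x = poly (\<Prod>i\<in>UNIV. [:- gam (i, i), 1:]) x" ..
qed

lemma coeff_f: "coeff f k = (if k = g then 1 else 0) - (if k = g - 1 then 1 else 0) + p * coeff e k"
proof -
  obtain n where n: "g = Suc n" using g3 by (cases g) auto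
  have "[:-1, 1:] * [:0, 1:] ^ (g - 1) = monom (1::int) g - monom 1 (g - 1)"
    by (simp add: n monom_altdef algebra_simps)
  then show ?thesis by (simp add: f_eq)
qed

lemma DgI_mod: "eqm p DgI ([:-2, 1:] * [:0, 1:] ^ (g - 1))"
proof -
  obtain n where n: "g = Suc n" using g3 by (cases g) auto
  have "[:-2, 1:] * [:0, 1:] ^ (g - 1) = monom (1::int) g - monom 2 (g - 1)"
    by (simp add: n monom_altdef algebra_simps)
  moreover have "coeff DgI k = (if k \<le> g then 2 ^ (g - k) * coeff f k else 0)" for k
    unfolding DgI_def coeff_sum coeff_monom by (simp add: sum.delta)
  ultimately show ?thesis unfolding eqm_def const_dvd_iff
    using n by (auto simp: coeff_f)
qed

text \<open>The product over all pairs is prod_i f(X - a i). With Y = X - a i, f(Y) = (Y - 1)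
  Y^(g-1) + p e(Y), and by \<open>norm_cong\<close> the last term contributes only a multiple of p.
  The products of the Y - 1 and of the Y are f(X - 1) and f(X).\<close>

lemma Tot_eq: "\<exists>z. Psi * DgI = pcompose f [:-1, 1:] * f ^ (g - 1) + smult p z"
proof -
  \<comment> \<open>This is X - x, with x as the outer and X as the inner variable.\<close>
  define Y :: "complex poly poly" where "Y = [:[:0, 1:], [:-1:]:]"
  define G where "G = (Y - 1) * Y ^ (g - 1)"
  define E where "E = poly (map_poly (\<lambda>c. [:[:of_int c:]:]) e) Y"
  define F where "F = poly (map_poly (\<lambda>c. [:[:of_int c:]:]) f) Y"
  note R = ring_closed_Ints[where 'a=complex]
  note R1 = ring_closed_coeffs_in[OF R]
  note R2 = ring_closed_coeffs_in[OF R1]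
  have Y: "Y \<in> coeffs_in (coeffs_in \<int>)"
    unfolding Y_def by (simp add: coeffs_in_pCons ring_closed_0[OF R1] coeffs_in_0)
  have G: "G \<in> coeffs_in (coeffs_in \<int>)" unfolding G_def
    by (intro ring_closed_mult[OF R2] ring_closed_power[OF R2] ring_closed_diff[OF R2] ring_closed_1[OF R2] Y)
  have E: "E \<in> coeffs_in (coeffs_in \<int>)" unfolding E_def by (rule poly_const2_in[OF R Y])
  have Yx: "poly Y [:x:] = [:-x, 1:]" for x by (simp add: Y_def)
  have "F = (Y - 1) * Y ^ (g - 1) + smult [:of_int p:] E"
  proof -
    have "poly (map_poly (\<lambda>c. [:[:of_int c:]:]) (u + v)) Y = poly (map_poly (\<lambda>c. [:[:of_int c:]:]) u) Y + poly (map_poly (\<lambda>c. [:[:of_int c :: complex:]:]) v) Y" for u v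
      by (induction u v rule: poly_induct2) (auto simp: map_poly_pCons algebra_simps one_pCons)
    moreover have "poly (map_poly (\<lambda>c. [:[:of_int c:]:]) (smult p v)) Y = smult [:of_int p:] (poly (map_poly (\<lambda>c. [:[:of_int c :: complex:]:]) v) Y)" for v
      by (induction v) (auto simp: map_poly_pCons smult_add_right mult.commute)
    moreover have "poly (map_poly (\<lambda>c. [:[:of_int c:]:]) ([:-1, 1:] * [:0, 1:] ^ n)) Y = (Y - 1) * Y ^ n" for n
    proof -
      have X: "poly (map_poly (\<lambda>c. [:[:of_int c:]:]) ([:0, 1:] * v)) Y = Y * poly (map_poly (\<lambda>c. [:[:of_int c :: complex:]:]) v) Y" for v
        by (simp add: map_poly_pCons)
      show ?thesis
      proof (induction n)
        case 0
        have "smult [:1:] q = q" for q :: "complex poly poly" by (simp flip: one_pCons)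
        then show ?case by (simp add: map_poly_pCons one_pCons diff_conv_add_uminus add.commute del: add_uminus_conv_diff)
      next
        case (Suc n)
        have "[:-1, 1:] * [:0, 1:] ^ Suc n = [:0, 1:] * ([:-1, 1:] * [:0, 1::int:] ^ n)" by (simp only: power_Suc mult.left_commute)
        then show ?case by (simp only: X Suc) (simp add: mult.left_commute)
      qed
    qed
    ultimately show ?thesis unfolding F_def E_def f_eq by simp
  qed
  then have F: "poly F [:x:] = poly G [:x:] + [:of_int p:] * poly E [:x:]" for x
    by (simp add: G_def)
  have Fx: "poly F [:x:] = (\<Prod>j\<in>UNIV. [:- (x + a j), 1:])" for x
  proof (rule poly_eqI_eval)
    fix y
    have "poly (poly F [:x:]) y = poly (cpoly f) (y - x)"
      unfolding F_def poly_const2_eval by (simp add: Yx)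
    then show "poly (poly F [:x:]) y = poly (\<Prod>j\<in>UNIV. [:- (x + a j), 1:]) y"
      by (simp add: cpoly_f_prod poly_prod algebra_simps)
  qed
  obtain z where z: "z \<in> coeffs_in \<int>"
    "(\<Prod>i\<in>UNIV. poly G [:a i:] + [:of_int p:] * poly E [:a i:]) = (\<Prod>i\<in>UNIV. poly G [:a i:]) + [:of_int p:] * z"
    using norm_cong[OF splits_over_poly[OF splits_over_Ints] G E, of "[:of_int p:]"]
    by (auto simp: coeffs_in_const R)
  obtain zi where zi: "z = cpoly zi" using z(1) by (rule coeffs_in_Ints_cases)
  have "cpoly (Psi * DgI) = (\<Prod>i\<in>UNIV. \<Prod>j\<in>UNIV. [:- (a i + a j), 1:])"
    by (simp add: cpoly_Psi PsiC_def cpoly_DgI prod_UNIV_pairs gam_def case_prod_unfold mult.commute)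
  also have "\<dots> = (\<Prod>i\<in>UNIV. poly G [:a i:]) + [:of_int p:] * z"
    by (simp only: z(2)[symmetric] F[symmetric] Fx)
  also have "(\<Prod>i\<in>UNIV. poly G [:a i:]) = (\<Prod>i\<in>UNIV. [:- a i, 1:] - 1) * (\<Prod>i\<in>UNIV. [:- a i, 1:]) ^ (g - 1)"
    by (simp only: G_def poly_mult poly_power poly_diff Yx poly_1 prod.distrib prod_power_distrib[symmetric])
  also have "(\<Prod>i\<in>UNIV. [:- a i, 1:] - 1) = pcompose (cpoly f) [:-1, 1:]"
  proof (rule poly_eqI_eval)
    fix x
    have "poly (\<Prod>i\<in>UNIV. [:- a i, 1:] - 1) x = (\<Prod>i\<in>UNIV. (x - 1) - a i)"
      unfolding poly_prod by (rule prod.cong) simp_all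
    also have "\<dots> = poly (pcompose (cpoly f) [:-1, 1:]) x"
      by (simp add: poly_pcompose cpoly_f_prod poly_prod)
    finally show "poly (\<Prod>i\<in>UNIV. [:- a i, 1:] - 1) x = poly (pcompose (cpoly f) [:-1, 1:]) x" .
  qed
  also have "(\<Prod>i\<in>UNIV. [:- a i, 1:]) = cpoly f" by (simp add: cpoly_f_prod)
  also have "pcompose (cpoly f) [:-1, 1:] * cpoly f ^ (g - 1) + [:of_int p:] * z
      = cpoly (pcompose f [:-1, 1:] * f ^ (g - 1) + smult p zi)"
    by (simp add: cpoly_pcompose zi)
  finally show ?thesis unfolding cpoly_eq_iff ..
qed

text \<open>Cancel the diagonal factor in \<open>Tot_eq\<close>. Modulo p the sum of two roots is 1
  + 0 or 0 + 1 for 2 (g - 1) ordered pairs, and 0 + 0 for the other (g - 1)(g - 2).\<close>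

lemma Psi_mod: "eqm p Psi ([:-1, 1:] ^ (2 * (g - 1)) * [:0, 1:] ^ ((g - 1) * (g - 2)))"
proof -
  obtain z where z: "Psi * DgI = pcompose f [:-1, 1:] * f ^ (g - 1) + smult p z"
    using Tot_eq by blast
  define X2 X1 X0 where X: "X2 = [:-2, 1::int:]" "X1 = [:-1, 1::int:]" "X0 = [:0, 1::int:]"
  have fe: "f = X1 * X0 ^ (g - 1) + smult p e" unfolding X by (rule f_eq)
  have fm: "eqm p f (X1 * X0 ^ (g - 1))" unfolding fe by (rule eqm_smult)
  have pc: "pcompose X1 X1 = X2" "pcompose X0 X1 = X1" by (simp_all add: X pcompose_pCons)
  have "pcompose f X1 = X2 * X1 ^ (g - 1) + smult p (pcompose e X1)"
    unfolding fe pcompose_add pcompose_mult pcompose_smult pcompose_power pc ..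
  then have fc: "eqm p (pcompose f X1) (X2 * X1 ^ (g - 1))"
    using eqm_smult[of p "X2 * X1 ^ (g - 1)" "pcompose e X1"] by (rule ssubst)
  have D: "eqm p DgI (X2 * X0 ^ (g - 1))" unfolding X by (rule DgI_mod)
  have 1: "eqm p (Psi * (X2 * X0 ^ (g - 1))) (Psi * DgI)"
    by (rule eqm_mult[OF eqm_refl eqm_sym[OF D]])
  have 2: "eqm p (Psi * DgI) (pcompose f X1 * f ^ (g - 1))"
    unfolding z X by (rule eqm_smult)
  have 3: "eqm p (pcompose f X1 * f ^ (g - 1)) ((X2 * X1 ^ (g - 1)) * (X1 * X0 ^ (g - 1)) ^ (g - 1))"
    by (rule eqm_mult[OF fc eqm_power[OF fm]])
  have 4: "(X2 * X1 ^ (g - 1)) * (X1 * X0 ^ (g - 1)) ^ (g - 1)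
     = (X1 ^ (2 * (g - 1)) * X0 ^ ((g - 1) * (g - 1 - 1))) * (X2 * X0 ^ (g - 1))"
    by (rule shuffle_powers) (use g3 in simp)
  have g2: "g - 1 - 1 = g - 2" by simp
  have "eqm p (Psi * (X2 * X0 ^ (g - 1))) ((X1 ^ (2 * (g - 1)) * X0 ^ ((g - 1) * (g - 2))) * (X2 * X0 ^ (g - 1)))"
    using eqm_trans[OF eqm_trans[OF 1 2] 3] unfolding 4 g2 .
  then have "[:p:] dvd (Psi - X1 ^ (2 * (g - 1)) * X0 ^ ((g - 1) * (g - 2))) * (X2 * X0 ^ (g - 1))"
    by (simp only: eqm_def left_diff_distrib)
  then have "[:p:] dvd (Psi - X1 ^ (2 * (g - 1)) * X0 ^ ((g - 1) * (g - 2))) \<or> [:p:] dvd (X2 * X0 ^ (g - 1))"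
    by (rule prime_const_dvd_mult[OF prime_p, THEN iffD1])
  moreover have "lead_coeff (X0 ^ (g - 1)) = 1" unfolding X by (rule monic_linear_power)
  then have "lead_coeff (X2 * X0 ^ (g - 1)) = 1"
    by (simp only: lead_coeff_mult) (simp add: X(1))
  then have "\<not> [:p:] dvd (X2 * X0 ^ (g - 1))" by (rule monic_not_const_dvd[OF prime_p])
  ultimately show ?thesis unfolding eqm_def X by blast
qed

end

section \<open>The value of \<open>Psi\<close> at 1 and its irreducible factors modulo p\<close>

context eisenstein_roots
begin

lemma poly_cf: "poly (cpoly f) x = (x - 1) * x ^ (g - 1) + of_int p * poly (cpoly e) x"
proof -
  have "cpoly f = [:-1, 1:] * [:0, 1:] ^ (g - 1) + smult (of_int p) (cpoly e)"
    by (simp only: f_eq cpoly_simps) simp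
  then show ?thesis by (simp only: poly_add poly_mult poly_power poly_smult) (simp add: algebra_simps)
qed

text \<open>Modulo p the conjugates of k(\<alpha>) are k(0), taken g - 1 times, and k(1). Without
  residue fields: at every root (k - c0)^(g-1) (k - c1) is a multiple of p, so k s is congruent to
  -C modulo p, and taking norms makes N M congruent to (-C)^g.\<close>

lemma p_not_dvd_norm:
  assumes k0: "\<not> p dvd poly k 0" and k1: "\<not> p dvd poly k 1"
    and N: "(\<Prod>i\<in>UNIV. poly (cpoly k) (a i)) = of_int N"
  shows "\<not> p dvd N"
proof
  assume pN: "p dvd N"
  define c0 c1 where "c0 = poly k 0" and "c1 = poly k 1"
  define C where "C = (- c0) ^ (g - 1) * (- c1)"
  have "[:-0, 1:] dvd k - [:c0:]" "[:-1, 1:] dvd k - [:c1:]"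
    unfolding poly_eq_0_iff_dvd[symmetric] by (simp_all add: c0_def c1_def)
  then obtain k0' k1' where "k - [:c0:] = [:-0, 1:] * k0'" "k - [:c1:] = [:-1, 1:] * k1'"
    by (elim dvdE)
  then have k0': "k = [:0, 1:] * k0' + [:c0:]" and k1': "k = [:-1, 1:] * k1' + [:c1:]"
    unfolding diff_eq_eq by simp_all
  define Q :: "int poly poly" where "Q = [:- [:c0:], 1:] ^ (g - 1) * [:- [:c1:], 1:]"
  obtain q0 Q1 where Q: "Q = pCons q0 Q1" by (cases Q)
  define s where "s = poly Q1 k"
  have "q0 = poly Q 0" by (simp add: Q)
  also have "\<dots> = [:C:]" by (simp add: Q_def C_def poly_const_pow)
  finally have q0: "q0 = [:C:]" .
  have L: "poly [:- c, 1:] x = x - c" for c x :: "int poly" by (simp add: algebra_simps)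
  have "poly Q k = (k - [:c0:]) ^ (g - 1) * (k - [:c1:])" unfolding Q_def poly_mult poly_power L ..
  then have ks: "(k - [:c0:]) ^ (g - 1) * (k - [:c1:]) = [:C:] + k * s" by (simp add: Q q0 s_def)
  define E where "E = - e * k0' ^ (g - 1) * k1'"
  have ev: "poly (cpoly k) (a i) * poly (cpoly s) (a i) = poly [:of_int (- C):] (a i) + of_int p * poly (cpoly E) (a i)" for i
  proof -
    let ?x = "a i"
    have z: "(?x - 1) * ?x ^ (g - 1) + of_int p * poly (cpoly e) ?x = 0"
      using root[of i] by (simp only: poly_cf)
    have "(poly (cpoly k) ?x - of_int c0) ^ (g - 1) * (poly (cpoly k) ?x - of_int c1)
        = (?x * poly (cpoly k0') ?x) ^ (g - 1) * ((?x - 1) * poly (cpoly k1') ?x)"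
    proof -
      have "poly (cpoly k) ?x - of_int c0 = ?x * poly (cpoly k0') ?x"
        using arg_cong[OF k0', of "\<lambda>q. poly (cpoly q) ?x"] by simp
      moreover have "poly (cpoly k) ?x - of_int c1 = (?x - 1) * poly (cpoly k1') ?x"
        using arg_cong[OF k1', of "\<lambda>q. poly (cpoly q) ?x"] by (simp add: algebra_simps)
      ultimately show ?thesis by simp
    qed
    also have "\<dots> = ((?x - 1) * ?x ^ (g - 1)) * (poly (cpoly k0') ?x ^ (g - 1) * poly (cpoly k1') ?x)"
      by (simp add: power_mult_distrib)
    also have "(?x - 1) * ?x ^ (g - 1) = - of_int p * poly (cpoly e) ?x" using z by (simp add: add_eq_0_iff)
    finally have "(poly (cpoly k) ?x - of_int c0) ^ (g - 1) * (poly (cpoly k) ?x - of_int c1) = of_int p * poly (cpoly E) ?x"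
      by (simp add: E_def)
    moreover have "(poly (cpoly k) ?x - of_int c0) ^ (g - 1) * (poly (cpoly k) ?x - of_int c1)
        = of_int C + poly (cpoly k) ?x * poly (cpoly s) ?x"
      using arg_cong[OF ks, of "\<lambda>q. poly (cpoly q) ?x"] by simp
    ultimately show ?thesis by (simp add: algebra_simps)
  qed
  have "(\<Prod>i\<in>UNIV. poly (cpoly s) (a i)) \<in> \<int>" by (rule norm_in[OF splits_over_Ints cpoly_in])
  then obtain M where M: "(\<Prod>i\<in>UNIV. poly (cpoly s) (a i)) = of_int M" by (elim Ints_cases)
  have "[:of_int (- C) :: complex:] \<in> coeffs_in \<int>"
    by (rule coeffs_in_const[OF ring_closed_Ints]) simp
  from norm_cong[OF splits_over_Ints this cpoly_in, of "of_int p" E]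
  obtain z where z: "z \<in> \<int>"
    "(\<Prod>i\<in>UNIV. poly [:of_int (- C):] (a i) + of_int p * poly (cpoly E) (a i))
      = (\<Prod>i\<in>(UNIV::'n set). poly [:of_int (- C):] (a i)) + of_int p * z"
    by auto
  obtain z' where z': "z = of_int z'" using z(1) by (elim Ints_cases)
  have "complex_of_int (N * M) = (\<Prod>i\<in>UNIV. poly (cpoly k) (a i) * poly (cpoly s) (a i))"
    by (simp add: N[symmetric] M[symmetric] prod.distrib)
  also have "\<dots> = of_int ((- C) ^ g + p * z')"
    unfolding ev z(2) by (simp add: z' g_card)
  finally have "N * M = (- C) ^ g + p * z'" by (simp only: of_int_eq_iff)
  moreover have "p dvd N * M - p * z'" using pN by simp
  ultimately have "p dvd (- C) ^ g" by simp
  then have "p dvd C" using prime_dvd_power[OF prime_p, of "- C" g] by simp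
  then have "p dvd (- c0) ^ (g - 1) \<or> p dvd - c1"
    unfolding C_def by (rule prime_dvd_multD[OF prime_p])
  then have "p dvd - c0 \<or> p dvd - c1" using prime_dvd_power[OF prime_p] by blast
  then show False using k0 k1 unfolding c0_def c1_def by simp
qed

text \<open>At the roots, f(1 - x) x^(g-2) = p k(x), and the norm N of k(x) is prime to p. Taking
  norms, the value of \<open>Psi * DgI\<close> at 1 times (p e(0))^(g-2) equals p^g N up to sign; so
  p^3 in the first factor would give p^(g+1) on the left.\<close>

lemma Psi_1: "\<not> p ^ 3 dvd poly Psi 1"
proof
  assume p3: "p ^ 3 dvd poly Psi 1"
  obtain n where n: "g = Suc (Suc (Suc n))" using that[of "g - 3"] g3 by simp
  \<comment> \<open>Origin of \<open>k\<close>: f(1 - x) = -x (1 - x)^(g-1) + p e(1 - x). Multiply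
    by x^(g-2) and replace (x - 1) x^(g-1) by -p e(x).\<close>
  define k where "k = [:0, 1:] ^ (g - 2) * pcompose e [:1, -1:] - [:1, -1:] ^ (g - 2) * e"
  have k0: "poly k 0 = - poly e 0" and k1: "poly k 1 = poly e 0"
    unfolding k_def poly_diff poly_mult poly_power poly_pcompose by (simp_all add: n)
  have key: "poly (cpoly f) (1 - a i) * a i ^ (g - 2) = of_int p * poly (cpoly k) (a i)" for i
  proof -
    let ?x = "a i"
    have z: "(?x - 1) * ?x ^ (g - 1) = - (of_int p * poly (cpoly e) ?x)"
      using root[of i] by (simp only: poly_cf eq_neg_iff_add_eq_0)
    define W w y where "W = 1 - ?x" and "w = W ^ (g - 2)" and "y = ?x ^ (g - 2)"
    have pw: "W ^ (g - 1) = W * w" "?x ^ (g - 1) = ?x * y" by (simp_all add: n w_def y_def)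
    have A: "1 - ?x - 1 = - ?x" and B: "?x - 1 = - W" by (simp_all add: W_def)
    have "(1 - ?x - 1) * W ^ (g - 1) * y = ((?x - 1) * ?x ^ (g - 1)) * w"
      unfolding pw A B by (simp add: ac_simps)
    then have "poly (cpoly f) W * y = - (of_int p * poly (cpoly e) ?x) * w + of_int p * poly (cpoly e) W * y"
      unfolding z by (simp only: poly_cf W_def distrib_right)
    moreover have "poly (cpoly k) ?x = y * poly (cpoly e) W - w * poly (cpoly e) ?x"
      unfolding k_def cpoly_simps cpoly_pcompose poly_diff poly_mult poly_power poly_pcompose
      by (simp add: W_def w_def y_def)
    ultimately have "poly (cpoly f) W * y = of_int p * poly (cpoly k) ?x"
      by (simp add: right_diff_distrib ac_simps)
    then show ?thesis by (simp only: W_def y_def)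
  qed
  have e0': "poly (cpoly f) 0 = of_int (p * poly e 0)" unfolding poly_cf by (simp add: n)
  have Na: "(\<Prod>i\<in>UNIV. a i) = of_int ((-1) ^ g * p * poly e 0)"
  proof -
    have "poly (cpoly f) 0 = (\<Prod>i\<in>UNIV. - a i)" by (simp only: cpoly_f_prod poly_prod) simp
    also have "\<dots> = (-1) ^ g * (\<Prod>i\<in>UNIV. a i)" by (simp add: prod_uminus g_card)
    finally have "(-1) ^ g * (\<Prod>i\<in>UNIV. a i) = of_int (p * poly e 0)" by (simp only: e0')
    then have "(-1) ^ g * ((-1) ^ g * (\<Prod>i\<in>UNIV. a i)) = of_int ((-1) ^ g * p * poly e 0)" by simp
    moreover have "(-1) ^ g * (-1) ^ g = (1::complex)" by (simp flip: power_mult_distrib)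
    ultimately show ?thesis by (simp only: mult.assoc[symmetric] mult_1)
  qed
  have "(\<Prod>i\<in>UNIV. poly (cpoly k) (a i)) \<in> \<int>" by (rule norm_in[OF splits_over_Ints cpoly_in])
  then obtain N where N: "(\<Prod>i\<in>UNIV. poly (cpoly k) (a i)) = of_int N" by (elim Ints_cases)
  have pN: "\<not> p dvd N" using p_not_dvd_norm[OF _ _ N] k0 k1 e0 by simp
  define T where "T = poly (Psi * DgI) 1"
  have "complex_of_int T = poly (cpoly (Psi * DgI)) 1" by (simp add: T_def)
  also have "cpoly (Psi * DgI) = (\<Prod>i\<in>UNIV. \<Prod>j\<in>UNIV. [:- (a i + a j), 1:])"
    by (simp add: cpoly_Psi PsiC_def cpoly_DgI prod_UNIV_pairs gam_def case_prod_unfold mult.commute)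
  also have "poly \<dots> 1 = (\<Prod>i\<in>UNIV. poly (cpoly f) (1 - a i))"
    by (simp add: poly_prod cpoly_f_prod algebra_simps)
  finally have T: "complex_of_int T = (\<Prod>i\<in>UNIV. poly (cpoly f) (1 - a i))" .
  have "complex_of_int (T * ((-1) ^ g * p * poly e 0) ^ (g - 2)) = of_int T * (\<Prod>i\<in>UNIV. a i) ^ (g - 2)"
    unfolding Na by simp
  also have "\<dots> = (\<Prod>i\<in>UNIV. poly (cpoly f) (1 - a i) * a i ^ (g - 2))"
    unfolding T by (simp only: prod.distrib prod_power_distrib)
  also have "\<dots> = of_int (p ^ g * N)" unfolding key prod.distrib N by (simp add: g_card)
  finally have eq: "T * ((-1) ^ g * p * poly e 0) ^ (g - 2) = p ^ g * N" by (simp only: of_int_eq_iff)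
  have "p ^ 3 dvd T" using p3 by (simp add: T_def)
  moreover have "p ^ (g - 2) dvd ((-1) ^ g * p * poly e 0) ^ (g - 2)" by (intro dvd_power_same) simp
  ultimately have "p ^ 3 * p ^ (g - 2) dvd p ^ g * N" unfolding eq[symmetric] by (rule mult_dvd_mono)
  moreover have "p ^ 3 * p ^ (g - 2) = p ^ g * p"
  proof -
    have "3 + (g - 2) = Suc g" using g3 by simp
    then show ?thesis by (simp only: power_add[symmetric] power_Suc2[symmetric])
  qed
  moreover have "p \<noteq> 0" using prime_p by auto
  ultimately show False using pN by simp
qed

text \<open>Regularity of the graph of pairs whose sum is a root of \<open>m\<close>, obtained from
  the form m(x + y); it will determine the sum of these roots.\<close>

lemma card_conj_root:
  "card {j. poly (cpoly m) (gam (i, j)) = 0} = card {j. poly (cpoly m) (gam (i', j)) = 0}"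
proof -
  define Y :: "complex poly poly" where "Y = [:[:0, 1:], 1:]"
  have Y: "Y \<in> coeffs_in (coeffs_in \<int>)"
    unfolding Y_def by (simp add: coeffs_in_pCons ring_closed_0[OF ring_closed_coeffs_in[OF ring_closed_Ints]]
      ring_closed_1[OF ring_closed_coeffs_in[OF ring_closed_Ints]] coeffs_in_0)
  obtain M c where c: "\<And>k l. c k l \<in> \<int>"
    "\<And>x y. poly (poly (poly (map_poly (\<lambda>c. [:[:of_int c:]:]) m) Y) [:y:]) x = biv M c x y"
    using biv_of_poly_poly[OF poly_const2_in[OF ring_closed_Ints Y, of m]] by blast
  have "biv M c x y = poly (cpoly m) (x + y)" for x y
    unfolding c(2)[symmetric] poly_const2_eval by (simp add: Y_def add.commute)
  then show ?thesis using card_root_of_biv[of c M i i', OF c(1)] by (simp add: gam_def)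
qed

lemma diag_conj_root: "poly (cpoly m) (gam (i, i)) = 0 \<Longrightarrow> poly (cpoly m) (gam (j, j)) = 0"
proof -
  assume "poly (cpoly m) (gam (i, i)) = 0"
  then have "poly (cpoly (pcompose m [:0, 2:])) (a i) = 0"
    by (simp add: cpoly_pcompose poly_pcompose gam_def mult.commute)
  then have "poly (cpoly (pcompose m [:0, 2:])) (a j) = 0" by (rule irr)
  then show ?thesis by (simp add: cpoly_pcompose poly_pcompose gam_def mult.commute)
qed

lemma sum_a: "(\<Sum>i\<in>UNIV. a i) = - of_int (coeff f (g - 1))"
  using coeff_prod_linear[of "UNIV :: 'n set" a]
  by (simp add: cpoly_f_prod[symmetric] g_card)

text \<open>Modulo \<open>p\<close> all conjugates sit at 1 or 0, and one root of \<open>f\<close> sits at 1. If \<open>m\<close> did not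
  vanish at 1 modulo \<open>p\<close>, then all its roots would sit at 0; but their sum is a small
  positive multiple of the trace of \<open>f\<close>.\<close>

lemma p_dvd_minpoly_1:
  assumes m: "is_minpoly m (gam (i0, j0))" and ij: "i0 \<noteq> j0" and Psi: "Psi = m ^ k * Q" and nQ: "\<not> m dvd Q"
  shows "p dvd poly m 1"
proof (rule ccontr)
  assume n1: "\<not> p dvd poly m 1"
  define S where "S = {s. fst s \<noteq> snd s \<and> poly (cpoly m) (gam s) = 0}"
  have lm: "lead_coeff m = 1" using m by (simp add: is_minpoly_def)
  have lk: "lead_coeff (m ^ k) = 1" using lm by (simp add: lead_coeff_power)
  have lQ: "lead_coeff Q = 1" using monic_Psi lk unfolding Psi lead_coeff_mult by simp
  have "PsiC = (\<Prod>s\<in>S. [:- gam s, 1:]) * (\<Prod>s\<in>{(i, j). i \<noteq> j} - S. [:- gam s, 1:])"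
  proof -
    have "{(i, j). i \<noteq> j} = S \<union> ({(i, j). i \<noteq> j} - S)" by (auto simp: S_def)
    then show ?thesis unfolding PsiC_def using prod.union_disjoint[of S "{(i, j). i \<noteq> j} - S" "\<lambda>s. [:- gam s, 1:]"] by simp
  qed
  then have split: "cpoly (m ^ k) * cpoly Q = (\<Prod>s\<in>S. [:- gam s, 1:]) * (\<Prod>s\<in>{(i, j). i \<noteq> j} - S. [:- gam s, 1:])"
    by (simp only: cpoly_Psi[symmetric] Psi cpoly_simps)
  \<comment> \<open>The full power of \<open>m\<close> in \<open>Psi\<close> accounts exactly for
    the pairs in \<open>S\<close>: the other sums are not roots of \<open>m\<close>, and no root of
    \<open>m\<close> is a root of \<open>Q\<close>.\<close>
  have eqS: "cpoly (m ^ k) = (\<Prod>s\<in>S. [:- gam s, 1:])"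
  proof (rule dvd_antisym_monic)
    show "cpoly (m ^ k) dvd (\<Prod>s\<in>S. [:- gam s, 1:])"
    proof (rule no_common_root_dvd)
      show "cpoly (m ^ k) dvd (\<Prod>s\<in>S. [:- gam s, 1:]) * (\<Prod>s\<in>{(i, j). i \<noteq> j} - S. [:- gam s, 1:])"
        unfolding split[symmetric] by simp
      show "cpoly (m ^ k) \<noteq> 0" using lm by auto
      fix x assume "poly (cpoly (m ^ k)) x = 0"
      then have "poly (cpoly m) x = 0" by simp
      then show "poly (\<Prod>s\<in>{(i, j). i \<noteq> j} - S. [:- gam s, 1:]) x \<noteq> 0"
        by (auto simp: poly_prod S_def)
    qed
    show "(\<Prod>s\<in>S. [:- gam s, 1:]) dvd cpoly (m ^ k)"
    proof (rule no_common_root_dvd)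
      show "(\<Prod>s\<in>S. [:- gam s, 1:]) dvd cpoly (m ^ k) * cpoly Q" unfolding split by simp
      show "(\<Prod>s\<in>S. [:- gam s, 1:]) \<noteq> 0" by (simp add: prod_zero_iff)
      fix x assume "poly (\<Prod>s\<in>S. [:- gam s, 1:]) x = 0"
      then have "poly (cpoly m) x = 0" by (auto simp: poly_prod S_def)
      then have "is_minpoly m x" using is_minpoly_conj[OF m] by blast
      then show "poly (cpoly Q) x \<noteq> 0" using nQ unfolding is_minpoly_def by blast
    qed
    show "lead_coeff (\<Prod>s\<in>S. [:- gam s, 1:]) = 1" by (subst lead_coeff_prod) simp
    show "lead_coeff (cpoly (m ^ k)) = 1" using lk by (simp only: lead_coeff_cpoly of_int_1)
  qed
  define n where "n = card {j. (i0, j) \<in> S}"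
  have Si: "{j. (i, j) \<in> S} = {j. poly (cpoly m) (gam (i, j)) = 0} - {i}" for i by (auto simp: S_def)
  \<comment> \<open>Removing the diagonal pair (i, i) changes the count by the same amount for every
    i, because the sums 2 a i are roots of \<open>m\<close> all together or not at all.\<close>
  have cardS: "card {j. (i, j) \<in> S} = n" for i
  proof (cases "poly (cpoly m) (gam (i, i)) = 0")
    case True
    then show ?thesis using diag_conj_root[of m i i0] card_conj_root[of m i i0]
      by (simp add: n_def Si)
  next
    case False
    then have "poly (cpoly m) (gam (i0, i0)) \<noteq> 0" using diag_conj_root by blast
    then show ?thesis using False card_conj_root[of m i i0] by (simp add: n_def Si)
  qed
  have inS: "(i0, j0) \<in> S" using m ij by (simp add: S_def is_minpoly_def)
  then have n_pos: "n > 0" by (auto simp: n_def card_gt_0_iff)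
  have n_le: "n \<le> g" unfolding n_def g_card by (rule card_mono) auto
  have symS: "(i, j) \<in> S \<longleftrightarrow> (j, i) \<in> S" for i j by (auto simp: S_def gam_def add.commute)
  have "(\<Sum>s\<in>S. gam s) = (\<Sum>s\<in>S. a (fst s)) + (\<Sum>s\<in>S. a (snd s))" by (simp add: gam_def sum.distrib)
  also have "(\<Sum>s\<in>S. a (snd s)) = (\<Sum>s\<in>S. a (fst s))"
    by (rule sum.reindex_bij_witness[of _ prod.swap prod.swap]) (auto simp: symS)
  also have "(\<Sum>s\<in>S. a (fst s)) = (\<Sum>i\<in>UNIV. \<Sum>j\<in>{j. (i, j) \<in> S}. a i)"
    by (subst sum.Sigma) (auto intro!: sum.cong)
  also have "\<dots> = of_nat n * (\<Sum>i\<in>UNIV. a i)" by (simp add: cardS sum_distrib_left)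
  finally have sumS: "(\<Sum>s\<in>S. gam s) = - of_int (2 * int n * coeff f (g - 1))"
    by (simp add: sum_a)
  have S0: "S \<noteq> {}" using inS by auto
  have cS: "card S = degree (m ^ k)"
  proof -
    have "degree (\<Prod>s\<in>S. [:- gam s, 1:]) = card S" by (simp add: degree_prod_eq_sum_degree)
    then show ?thesis using arg_cong[OF eqS, of degree] unfolding degree_cpoly by (rule trans[OF sym sym])
  qed
  have "of_int (coeff (m ^ k) (card S - 1)) = - (\<Sum>s\<in>S. gam s)"
    using coeff_prod_linear[of S gam] S0 by (simp add: eqS[symmetric] del: cpoly_simps)
  then have co: "coeff (m ^ k) (card S - 1) = 2 * int n * coeff f (g - 1)"
    unfolding sumS minus_minus by (simp only: of_int_eq_iff)
  have "[:p:] dvd m ^ k - [:0, 1:] ^ degree (m ^ k)"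
  proof (rule factor_mod[OF prime_p lk lQ])
    show "[:p:] dvd m ^ k * Q - [:-1, 1:] ^ (2 * (g - 1)) * [:0, 1:] ^ ((g - 1) * (g - 2))"
      using Psi_mod unfolding Psi eqm_def .
    show "\<not> p dvd poly (m ^ k) 1" using n1 prime_p prime_dvd_power by auto
  qed
  then have "p dvd coeff (m ^ k - monom 1 (card S)) (card S - 1)"
    unfolding const_dvd_iff cS by (simp add: monom_altdef)
  moreover have "card S > 0" using S0 by (simp add: card_gt_0_iff)
  then have "coeff (m ^ k - monom 1 (card S)) (card S - 1) = 2 * int n * coeff f (g - 1)"
    using co by simp
  ultimately have "p dvd 2 * int n * coeff f (g - 1)" by simp
  \<comment> \<open>The subleading coefficient of \<open>f\<close> is -1 modulo p, so p would divide
    2 n, while 0 < 2 n < p.\<close>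
  moreover have cf: "coeff f (g - 1) = -1 + p * coeff e (g - 1)" using g3 by (simp add: coeff_f)
  have "2 * int n * coeff f (g - 1) = 2 * int n * (p * coeff e (g - 1)) - 2 * int n"
    unfolding cf by (simp add: algebra_simps)
  ultimately have "p dvd 2 * int n * (p * coeff e (g - 1)) - 2 * int n" by (rule back_subst)
  moreover have "p dvd 2 * int n * (p * coeff e (g - 1))" by simp
  ultimately have "p dvd 2 * int n" using dvd_diff[of p "2 * int n * (p * coeff e (g - 1))" "2 * int n * (p * coeff e (g - 1)) - 2 * int n"] by simp
  then have "p \<le> 2 * int n" using n_pos by (intro zdvd_imp_le) auto
  then show False using p_large n_le by linarith
qed

end

lemma split_off_power:
  fixes P m :: "int poly"
  assumes "P \<noteq> 0" "degree m > 0"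
  shows "\<exists>k Q. P = m ^ k * Q \<and> \<not> m dvd Q"
  using assms(1)
proof (induction "degree P" arbitrary: P rule: less_induct)
  case less
  show ?case
  proof (cases "m dvd P")
    case False
    then show ?thesis by (intro exI[of _ 0] exI[of _ P]) simp
  next
    case True
    then obtain R where R: "P = m * R" by (elim dvdE)
    with less.prems have "m \<noteq> 0" "R \<noteq> 0" by auto
    then have "degree R < degree P" using R assms(2) by (simp add: degree_mult_eq)
    then obtain k Q where "R = m ^ k * Q" "\<not> m dvd Q" using less.hyps \<open>R \<noteq> 0\<close> by blast
    then show ?thesis using R by (intro exI[of _ "Suc k"] exI[of _ Q]) (simp add: mult.assoc)
  qed
qed

section \<open>\<open>Psi\<close> as a square, and the transfer of bilinear relations\<close>

context eisenstein_roots
begin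

lemma PsiC_root_iff: "poly PsiC z = 0 \<longleftrightarrow> (\<exists>s. fst s \<noteq> snd s \<and> z = gam s)"
  by (auto simp: PsiC_def poly_prod)

lemma minpoly_gam_exists:
  assumes "fst s \<noteq> snd s" shows "\<exists>m. is_minpoly m (gam s)"
proof -
  have "poly (cpoly Psi) (gam s) = 0" unfolding cpoly_Psi PsiC_root_iff using assms by blast
  from minimal_int_poly[OF this monic_Psi] show ?thesis unfolding is_minpoly_def by blast
qed

lemma gam_swap: "gam (prod.swap s) = gam s" by (simp add: gam_def add.commute)

lemma linear_power_dvd_PsiC:
  assumes "T \<subseteq> {s. fst s \<noteq> snd s}" "\<And>s. s \<in> T \<Longrightarrow> gam s = z"
  shows "[:- z, 1:] ^ card T dvd PsiC"
proof -
  have "(\<Prod>s\<in>T. [:- gam s, 1:]) dvd PsiC"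
    unfolding PsiC_def using assms(1) by (intro prod_dvd_prod_subset) auto
  moreover have "(\<Prod>s\<in>T. [:- gam s, 1:]) = [:- z, 1:] ^ card T" using assms(2) by simp
  ultimately show ?thesis by simp
qed

text \<open>The pairs (i, j) and (j, i) produce a double root of \<open>Psi\<close>, while a minimal
  polynomial has simple roots; so \<open>m\<close> has to occur at least twice.\<close>

lemma minpoly_gam_dvd:
  assumes m: "is_minpoly m (gam s)" and s: "fst s \<noteq> snd s"
  shows "\<exists>Q. Psi = m\<^sup>2 * Q \<and> p dvd poly m 1"
proof -
  have dm: "degree m > 0" and m0: "poly (cpoly m) (gam s) = 0" using m by (simp_all add: is_minpoly_def)
  have "Psi \<noteq> 0" using monic_Psi by auto
  then obtain k Q where kQ: "Psi = m ^ k * Q" "\<not> m dvd Q" using split_off_power dm by blast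
  have "p dvd poly m 1"
    using p_dvd_minpoly_1[of m "fst s" "snd s" k Q] m s kQ by simp
  have Qg: "poly (cpoly Q) (gam s) \<noteq> 0" using kQ(2) m by (auto simp: is_minpoly_def)
  have two: "[:- gam s, 1:]\<^sup>2 dvd PsiC"
  proof -
    have "card {s, prod.swap s} = 2" using s by (cases s) auto
    moreover have "[:- gam s, 1:] ^ card {s, prod.swap s} dvd PsiC"
      by (rule linear_power_dvd_PsiC) (use s in \<open>auto simp: gam_swap\<close>)
    ultimately show ?thesis by (simp only:)
  qed
  have "k \<noteq> 0"
  proof
    assume "k = 0"
    then have "poly (cpoly Psi) (gam s) \<noteq> 0" using Qg kQ(1) by simp
    then show False unfolding cpoly_Psi PsiC_root_iff using s by blast
  qed
  moreover have "k \<noteq> 1"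
  proof
    assume "k = 1"
    then have e: "PsiC = cpoly m * cpoly Q" using kQ(1) cpoly_Psi by simp
    have "[:- gam s, 1:]\<^sup>2 dvd cpoly m"
    proof (rule no_common_root_dvd)
      show "[:- gam s, 1:]\<^sup>2 dvd cpoly m * cpoly Q" using two unfolding e .
      show "[:- gam s, 1:]\<^sup>2 \<noteq> 0" by (rule power_not_zero) simp
      show "poly (cpoly Q) x \<noteq> 0" if "poly ([:- gam s, 1:]\<^sup>2) x = 0" for x
        using that Qg by (simp only: poly_power) simp
    qed
    then show False using is_minpoly_simple_root[OF m] by blast
  qed
  ultimately obtain k' where "k = 2 + k'" using that[of "k - 2"] by linarith
  then have "Psi = m\<^sup>2 * (m ^ k' * Q)" using kQ(1) by (simp only: power_add mult.assoc)
  then show ?thesis using \<open>p dvd poly m 1\<close> by blast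
qed

text \<open>Every irreducible factor occurs twice and vanishes at 1 modulo p, so it contributes p^2
  to Psi(1). As p^3 does not divide Psi(1), there is room for one factor only.\<close>

lemma Psi_square: "\<exists>m. Psi = m\<^sup>2 \<and> (\<forall>s. fst s \<noteq> snd s \<longrightarrow> is_minpoly m (gam s))"
proof -
  have "card (UNIV :: 'n set) \<noteq> 1" using g3 g_card by linarith
  then obtain i j :: 'n where ij: "i \<noteq> j" 
    using is_singletonI'[of "UNIV :: 'n set"] by (auto simp: is_singleton_altdef)
  obtain m where m: "is_minpoly m (gam (i, j))" using minpoly_gam_exists[of "(i, j)"] ij by auto
  obtain Q where Q: "Psi = m\<^sup>2 * Q" and pm: "p dvd poly m 1" using minpoly_gam_dvd[OF m] ij by auto
  have lm: "lead_coeff m = 1" using m by (simp add: is_minpoly_def)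
  then have lQ: "lead_coeff Q = 1" using monic_Psi unfolding Q by (simp only: lead_coeff_mult lead_coeff_power) simp
  have nQ: "\<not> p dvd poly Q 1"
  proof
    assume "p dvd poly Q 1"
    then have "p\<^sup>2 * p dvd (poly m 1)\<^sup>2 * poly Q 1" using pm by (intro mult_dvd_mono dvd_power_same)
    then have "p ^ 3 dvd poly Psi 1" unfolding Q by (simp add: power2_eq_square power3_eq_cube)
    then show False using Psi_1 by blast
  qed
  have "degree Q = 0"
  proof (rule ccontr)
    assume "degree Q \<noteq> 0"
    then have "\<not> constant (poly (cpoly Q))" by (simp add: constant_degree)
    then obtain z where z: "poly (cpoly Q) z = 0" using fundamental_theorem_of_algebra by blast
    have "poly (cpoly Psi) z = 0" unfolding Q by (simp add: z)
    then obtain s where s: "fst s \<noteq> snd s" "z = gam s" unfolding cpoly_Psi PsiC_root_iff by blast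
    obtain n where n: "is_minpoly n (gam s)" using minpoly_gam_exists s(1) by blast
    have "p dvd poly n 1" using minpoly_gam_dvd[OF n s(1)] by blast
    moreover have "n dvd Q" using n z s(2) by (simp add: is_minpoly_def)
    then have "poly n 1 dvd poly Q 1" by (auto elim!: dvdE)
    ultimately show False using nQ dvd_trans by blast
  qed
  then have "Q = 1" by (rule monic_degree_0[OF lQ])
  then have P: "Psi = m\<^sup>2" using Q by simp
  have "is_minpoly m (gam s)" if "fst s \<noteq> snd s" for s
  proof (rule is_minpoly_conj[OF m])
    have "poly (cpoly Psi) (gam s) = 0" unfolding cpoly_Psi PsiC_root_iff using that by blast
    then show "poly (cpoly m) (gam s) = 0" unfolding P by simp
  qed
  then show ?thesis using P by blast
qed

text \<open>A third pair with the same sum would be a triple root of \<open>Psi\<close>, hence a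
  multiple root of its square root \<open>m\<close>.\<close>

lemma gam_inj:
  assumes "fst s \<noteq> snd s" "fst t \<noteq> snd t" "gam s = gam t"
  shows "t = s \<or> t = prod.swap s"
proof (rule ccontr)
  assume n: "\<not> ?thesis"
  obtain m where m: "Psi = m\<^sup>2" "is_minpoly m (gam s)" using Psi_square assms(1) by blast
  define L where "L = [:- gam s, 1:]"
  have L0: "L \<noteq> 0" by (simp add: L_def)
  have "card {s, prod.swap s, t} = 3" using n assms(1) by (cases s) auto
  moreover have "L ^ card {s, prod.swap s, t} dvd PsiC" unfolding L_def
    by (rule linear_power_dvd_PsiC) (use assms in \<open>auto simp: gam_swap\<close>)
  ultimately have L3: "L ^ 3 dvd PsiC" by (simp only:)
  have "poly (cpoly m) (gam s) = 0" using m(2) by (simp add: is_minpoly_def)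
  then obtain q where q: "cpoly m = L * q" unfolding L_def by (metis dvdE poly_eq_0_iff_dvd)
  have "PsiC = L\<^sup>2 * q\<^sup>2" using m(1) q by (simp add: cpoly_Psi[symmetric] power_mult_distrib)
  then have "L\<^sup>2 * L dvd L\<^sup>2 * q\<^sup>2" using L3 by (simp only: power3_eq_cube power2_eq_square mult.assoc)
  then have "L dvd q\<^sup>2" using L0 by (simp only: dvd_mult_cancel_left) simp
  then have "poly (q\<^sup>2) (gam s) = 0" unfolding L_def by (simp only: poly_eq_0_iff_dvd)
  then have "L dvd q" unfolding L_def poly_eq_0_iff_dvd[symmetric] by simp
  then have "L\<^sup>2 dvd cpoly m" unfolding q power2_eq_square by (rule mult_dvd_mono[OF dvd_refl])
  then show False using is_minpoly_simple_root[OF m(2)] unfolding L_def by blast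
qed

text \<open>If the form \<open>c\<close> vanishes at one pair, then \<open>x + y + N c(x, y)\<close> takes the same value there
  for all \<open>N\<close>, hence by conjugacy a fixed sum of two roots is of this shape for every \<open>N\<close>.\<close>

lemma biv_zero_transfer:
  assumes c: "\<And>k l. c k l \<in> \<rat>" and ij: "i \<noteq> j" "biv m c (a i) (a j) = 0" and kl: "k \<noteq> l"
  shows "biv m c (a k) (a l) = 0 \<or> biv m c (a l) (a k) = 0"
proof -
  obtain \<mu> where \<mu>: "\<And>s. fst s \<noteq> snd s \<Longrightarrow> is_minpoly \<mu> (gam s)" using Psi_square by blast
  define M where "M = m + 2"
  define c' where "c' = (\<lambda>k l. if k < m \<and> l < m then c k l else 0)"
  define d where "d N k l = 1 * (if k + l = 1 then 1 else 0) + of_nat N * c' k l" for N k l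
  have dv: "biv M (d N) x y = x + y + of_nat N * biv m c x y" for N x y
    unfolding d_def biv_linear c'_def by (subst biv_pad) (simp_all add: M_def biv_plus[unfolded One_nat_def])
  have dQ: "d N k l \<in> \<rat>" for N k l by (auto simp: d_def c'_def c)
  have "\<exists>s. fst s \<noteq> snd s \<and> gam (k, l) = gam s + of_nat N * biv m c (a (fst s)) (a (snd s))" for N
  proof -
    define R where "R = (\<Prod>(i, j)\<in>{(i, j). i \<noteq> j}. [:- biv M (d N) (a i) (a j), 1:])"
    have "R \<in> coeffs_in \<rat>" unfolding R_def by (rule prod_biv_offdiag[OF splits_over_Rats]) (rule dQ)
    then obtain v h where v: "v \<noteq> 0" "smult (of_int v) R = cpoly h" using clear_denominators by blast
    have "poly R (gam (i, j)) = 0"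
    proof -
      have "poly (case (i, j) of (i, j) \<Rightarrow> [:- biv M (d N) (a i) (a j), 1:]) (gam (i, j)) = 0"
        using ij by (simp add: dv gam_def)
      then show ?thesis unfolding R_def poly_prod using ij(1)
        by (intro prod_zero bexI[of _ "(i, j)"]) auto
    qed
    then have "poly (smult (of_int v) R) (gam (i, j)) = 0" by simp
    then have "\<mu> dvd h" unfolding v(2) using \<mu>[of "(i, j)"] ij(1) by (simp add: is_minpoly_def)
    then have "poly (cpoly h) (gam (k, l)) = 0" using \<mu>[of "(k, l)"] kl by (auto simp: is_minpoly_def elim!: dvdE)
    then have "poly R (gam (k, l)) = 0" unfolding v(2)[symmetric] using v(1) by simp
    then have "\<exists>s\<in>{(i, j). i \<noteq> j}. poly (case s of (i, j) \<Rightarrow> [:- biv M (d N) (a i) (a j), 1:]) (gam (k, l)) = 0"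
      unfolding R_def poly_prod by (subst (asm) prod_zero_iff) auto
    then obtain i' j' where "i' \<noteq> j'" "gam (k, l) = biv M (d N) (a i') (a j')" by auto
    then show ?thesis by (intro exI[of _ "(i', j')"]) (simp add: dv gam_def)
  qed
  then obtain F where F: "\<And>N. fst (F N) \<noteq> snd (F N)"
    "\<And>N. gam (k, l) = gam (F N) + of_nat N * biv m c (a (fst (F N))) (a (snd (F N)))"
    by metis
  \<comment> \<open>There are finitely many pairs and infinitely many \<open>N\<close>, so one pair
    serves two values of \<open>N\<close>; this forces the form to vanish on it.\<close>
  have "\<not> inj F"
  proof
    assume "inj F"
    then have "finite (UNIV :: nat set)" using finite_imageD[of F UNIV] by simp
    then show False by simp
  qed
  then obtain N1 N2 where N: "N1 \<noteq> N2" "F N1 = F N2" by (auto simp: inj_def)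
  define s where "s = F N1"
  have A: "gam (k, l) = gam s + of_nat N1 * biv m c (a (fst s)) (a (snd s))"
    unfolding s_def by (rule F(2))
  have B: "gam (k, l) = gam s + of_nat N2 * biv m c (a (fst s)) (a (snd s))"
    unfolding s_def N(2) by (rule F(2))
  have "of_nat N1 * biv m c (a (fst s)) (a (snd s)) = of_nat N2 * biv m c (a (fst s)) (a (snd s))"
    using trans[OF A[symmetric] B] by (rule add_left_imp_eq)
  then have z: "biv m c (a (fst s)) (a (snd s)) = 0" using N(1) by auto
  then have "gam (k, l) = gam s" using A by simp
  then have "s = (k, l) \<or> s = prod.swap (k, l)"
    using kl F(1)[of N1] by (intro gam_inj) (simp_all add: s_def)
  then show ?thesis using z by (elim disjE) simp_all
qed

text \<open>\<open>biv_zero_transfer\<close> yields vanishing in one of the two orders only. Applied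
  to c(x, y) + r c(y, x) with r = 1 and r = 2, it leaves no nonzero pair of values.\<close>

theorem biv_zero_all_pairs:
  assumes c: "\<And>k l. c k l \<in> \<rat>" and ij: "i \<noteq> j" "biv m c (a i) (a j) = 0" "biv m c (a j) (a i) = 0"
    and kl: "k \<noteq> l"
  shows "biv m c (a k) (a l) = 0"
proof -
  define x y where "x = biv m c (a k) (a l)" and "y = biv m c (a l) (a k)"
  have *: "x + of_nat r * y = 0 \<or> y + of_nat r * x = 0" for r
  proof -
    define d where "d k l = 1 * c k l + of_nat r * c l k" for k l
    have dv: "biv m d u v = biv m c u v + of_nat r * biv m c v u" for u v
      unfolding d_def biv_linear by (subst biv_swap) simp
    have "d k l \<in> \<rat>" for k l by (auto simp: d_def c)
    moreover have "biv m d (a i) (a j) = 0" by (simp add: dv ij)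
    ultimately have "biv m d (a k) (a l) = 0 \<or> biv m d (a l) (a k) = 0"
      by (rule biv_zero_transfer[of d i j m k l, OF _ ij(1) _ kl])
    then show ?thesis unfolding dv x_def y_def .
  qed
  have "y = - x" using *[of 1] by (auto simp: add_eq_0_iff add.commute)
  then have "x = 0" using *[of 2] by auto
  then show ?thesis by (simp add: x_def)
qed

end

text \<open>\<open>hom2\<close> is all that the later sections retain of the arithmetic at p. Both
  orders are assumed because conjugation is only known to act transitively on unordered
  pairs.\<close>

locale homog_roots = conj_roots f a g for f :: "int poly" and a :: "'n::finite \<Rightarrow> complex" and g :: nat +
  assumes g3: "g \<ge> 3"
    and hom2: "(\<And>k l. c k l \<in> \<rat>) \<Longrightarrow> i \<noteq> j \<Longrightarrow> biv m c (a i) (a j) = 0 \<Longrightarrow> biv m c (a j) (a i) = 0 \<Longrightarrow>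
      k \<noteq> l \<Longrightarrow> biv m c (a k) (a l) = 0"

lemma (in eisenstein_roots) homog_roots: "homog_roots f a g"
  by unfold_locales (rule g3, rule biv_zero_all_pairs)

section \<open>Existence of suitable polynomials\<close>

lemma rsquarefree_if_minpoly:
  assumes "\<And>z. poly (cpoly f) z = 0 \<Longrightarrow> is_minpoly f z"
  shows "rsquarefree (cpoly f)"
  unfolding rsquarefree_roots
proof (intro allI notI, elim conjE)
  fix z assume z: "poly (cpoly f) z = 0" "poly (pderiv (cpoly f)) z = 0"
  have "pderiv (cpoly f) = cpoly (pderiv f)" by (rule poly_eqI) (simp add: coeff_pderiv)
  then have "poly (cpoly (pderiv f)) z = 0" using z(2) by simp
  then have "f dvd pderiv f" using assms[OF z(1)] unfolding is_minpoly_def by blast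
  then show False using assms[OF z(1)] by (simp add: is_minpoly_def)
qed

lemma poly_of_int_real: "poly (cpoly f) (of_real x) = of_real (poly (map_poly of_int f) x)"
  by (induction f) (auto simp: map_poly_pCons)

text \<open>The Eisenstein condition and the absence of integer roots make \<open>f\<close>
  irreducible, so it is the minimal polynomial of each of its roots and has g distinct ones to
  enumerate.\<close>

lemma eisenstein_roots_exist:
  fixes f e :: "int poly" and p :: int
  assumes g: "g = CARD('n::finite)" "g \<ge> 3"
    and f: "lead_coeff f = 1" "degree f = g" "f = [:-1, 1:] * [:0, 1:] ^ (g - 1) + smult p e"
    and p: "prime p" "2 * int g < p" and e0: "\<not> p dvd poly e 0" and nr: "\<And>n. poly f n \<noteq> 0"
  shows "\<exists>a :: 'n \<Rightarrow> complex. homog_roots f a g \<and>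
    card {i. a i \<in> \<real>} = card {x::real. poly (map_poly of_int f) x = 0}"
proof -
  have f0: "\<not> p\<^sup>2 dvd poly f 0"
  proof -
    have "poly f 0 = p * poly e 0" unfolding f(3) poly_add poly_mult poly_power poly_smult using g(2) by simp
    then show ?thesis using e0 p(1) by (auto simp: power2_eq_square)
  qed
  have min: "is_minpoly f z" if z: "poly (cpoly f) z = 0" for z
  proof -
    obtain m where m: "is_minpoly m z" using minimal_int_poly[OF z f(1)] unfolding is_minpoly_def by blast
    then obtain t where t: "f = m * t" using z by (auto simp: is_minpoly_def elim: dvdE)
    have lm: "lead_coeff m = 1" "degree m \<noteq> 0" using m by (auto simp: is_minpoly_def)
    then have lt: "lead_coeff t = 1" using f(1) unfolding t lead_coeff_mult by simp
    have "degree t = 0"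
      using almost_eisenstein_irreducible[OF p(1) f(3) f0 nr lm(1) lt t] lm(2) by blast
    then show ?thesis using m t monic_degree_0[OF lt] by simp
  qed
  define Z where "Z = {z. poly (cpoly f) z = 0}"
  have f_nz: "cpoly f \<noteq> 0" using f(1) by auto
  have finZ: "finite Z" unfolding Z_def using f_nz by (rule poly_roots_finite)
  have "cpoly f = (\<Prod>z\<in>Z. [:-z, 1:])"
    using complex_poly_decompose_rsquarefree[OF rsquarefree_if_minpoly[OF min]] f(1)
    by (simp add: Z_def)
  from arg_cong[OF this, of degree] have "card Z = g"
    using f(2) by (simp add: degree_prod_eq_sum_degree)
  then obtain a :: "'n \<Rightarrow> complex" where a: "bij_betw a UNIV Z"
    using finite_same_card_bij[of "UNIV :: 'n set" Z] finZ g(1) by auto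
  then have inj: "inj a" and img: "range a = Z" by (auto simp: bij_betw_def)
  have root: "poly (cpoly f) (a i) = 0" for i using img by (auto simp: Z_def)
  interpret eisenstein_roots f a g p e
  proof unfold_locales
    fix h i j assume "poly (cpoly h) (a i) = 0"
    then have "f dvd h" using min[OF root[of i]] by (simp add: is_minpoly_def)
    then show "poly (cpoly h) (a j) = 0" using root[of j] by (auto elim!: dvdE)
  qed (use assms inj root in auto)
  have "bij_betw (\<lambda>x. inv_into UNIV a (complex_of_real x)) {x. poly (map_poly of_int f) x = 0} {i. a i \<in> \<real>}"
  proof (rule bij_betw_byWitness[where f' = "\<lambda>i. Re (a i)"])
    have Zr: "complex_of_real x \<in> range a" if "poly (map_poly of_int f) x = 0" for x
      using that unfolding img Z_def by (simp add: poly_of_int_real)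
    show "\<forall>x\<in>{x. poly (map_poly of_int f) x = 0}. Re (a (inv_into UNIV a (complex_of_real x))) = x"
      using f_inv_into_f[OF Zr] by simp
    show "\<forall>i\<in>{i. a i \<in> \<real>}. inv_into UNIV a (complex_of_real (Re (a i))) = i"
      by (auto simp: inv_f_f[OF inj])
    show "(\<lambda>x. inv_into UNIV a (complex_of_real x)) ` {x. poly (map_poly of_int f) x = 0} \<subseteq> {i. a i \<in> \<real>}"
      using f_inv_into_f[OF Zr] by auto
    show "(\<lambda>i. Re (a i)) ` {i. a i \<in> \<real>} \<subseteq> {x. poly (map_poly of_int f) x = 0}"
    proof safe
      fix i assume "a i \<in> \<real>"
      then have "complex_of_real (Re (a i)) = a i" by simp
      then have "complex_of_real (poly (map_poly of_int f) (Re (a i))) = 0"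
        using root[of i] by (simp add: poly_of_int_real[symmetric])
      then show "poly (map_poly of_int f) (Re (a i)) = 0" by simp
    qed
  qed
  then have "card {i. a i \<in> \<real>} = card {x::real. poly (map_poly of_int f) x = 0}"
    by (simp add: bij_betw_same_card)
  then show ?thesis using homog_roots by blast
qed

section \<open>Real roots of a perturbed product of linear factors\<close>

lemma zero_between_opposite_signs:
  fixes F :: "real \<Rightarrow> real"
  assumes "l \<le> u" "continuous_on {l..u} F" "F l * F u < 0"
  shows "\<exists>x. l < x \<and> x < u \<and> F x = 0"
proof -
  have "\<exists>x\<ge>l. x \<le> u \<and> F x = 0"
  proof (cases "F l \<le> 0")
    case True
    then have "0 \<le> F u" using assms(3) by (auto simp: mult_less_0_iff)
    then show ?thesis using IVT'[of F l 0 u] True assms by auto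
  next
    case False
    then have "F u \<le> 0" using assms(3) by (auto simp: mult_less_0_iff)
    then show ?thesis using IVT2'[of F u 0 l] False assms by auto
  qed
  then obtain x where "l \<le> x" "x \<le> u" "F x = 0" by blast
  then show ?thesis using assms(3) by (intro exI[of _ x]) (auto simp: less_le)
qed

lemma same_sign_on_interval:
  fixes G :: "real \<Rightarrow> real"
  assumes "l \<le> u" "continuous_on {l..u} G" "\<And>x. l \<le> x \<Longrightarrow> x \<le> u \<Longrightarrow> G x \<noteq> 0"
  shows "G l * G u > 0"
proof (rule ccontr)
  assume "\<not> ?thesis"
  moreover have "G l \<noteq> 0" "G u \<noteq> 0" using assms by auto
  then have "G l * G u \<noteq> 0" by simp
  ultimately have "G l * G u < 0" by linarith
  then obtain x where "l < x" "x < u" "G x = 0" using zero_between_opposite_signs[OF assms(1,2)] by blast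
  then show False using assms(3)[of x] by simp
qed

text \<open>\<open>G\<close> keeps its sign on the interval, so (x - c) G(x) has opposite signs at
  the two ends, and there its absolute value exceeds that of \<open>q\<close>.\<close>

lemma perturbed_root_near:
  fixes G :: "real \<Rightarrow> real"
  assumes "\<delta> > 0" "continuous_on {c - \<delta>..c + \<delta>} G" "\<And>x. \<bar>x - c\<bar> \<le> \<delta> \<Longrightarrow> G x \<noteq> 0"
    and big: "\<delta> * \<bar>G (c - \<delta>)\<bar> > \<bar>q\<bar>" "\<delta> * \<bar>G (c + \<delta>)\<bar> > \<bar>q\<bar>"
  shows "\<exists>x. \<bar>x - c\<bar> < \<delta> \<and> (x - c) * G x + q = 0"
proof -
  define F where "F x = (x - c) * G x + q" for x
  have pos: "G (c - \<delta>) * G (c + \<delta>) > 0"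
    using assms(1,2,3) by (intro same_sign_on_interval) (auto simp: abs_le_iff)
  have "F (c - \<delta>) * F (c + \<delta>) < 0"
  proof (cases "G (c - \<delta>) > 0")
    case True
    then have "G (c + \<delta>) > 0" using pos by (simp add: zero_less_mult_iff)
    then have "F (c - \<delta>) < 0" "F (c + \<delta>) > 0" using True big by (auto simp: F_def)
    then show ?thesis by (simp add: mult_less_0_iff)
  next
    case False
    then have "G (c - \<delta>) < 0" "G (c + \<delta>) < 0" using pos by (auto simp: zero_less_mult_iff)
    then have "F (c - \<delta>) > 0" "F (c + \<delta>) < 0" using big by (auto simp: F_def)
    then show ?thesis by (simp add: mult_less_0_iff)
  qed
  moreover have "continuous_on {c - \<delta>..c + \<delta>} F"
    unfolding F_def using assms(2) by (intro continuous_intros)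
  ultimately obtain x where "c - \<delta> < x" "x < c + \<delta>" "F x = 0"
    using zero_between_opposite_signs[of "c - \<delta>" "c + \<delta>" F] assms(1) by auto
  then show ?thesis by (intro exI[of _ x]) (auto simp: F_def abs_less_iff)
qed

lemma log_derivative_step: "v * c + c * d * u = (u * c) * (v / u + d)" if "u \<noteq> (0::real)"
proof -
  have "u * (v / u) = v" using that by simp
  moreover have "(u * c) * (v / u + d) = (u * (v / u)) * c + c * d * u"
    by (simp only: distrib_left ac_simps)
  ultimately show ?thesis by simp
qed

lemma DERIV_prod_log:
  fixes h :: "'i \<Rightarrow> real \<Rightarrow> real"
  assumes "finite I" "\<And>i. i \<in> I \<Longrightarrow> (h i has_real_derivative h' i) (at x)" "\<And>i. i \<in> I \<Longrightarrow> h i x \<noteq> 0"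
  shows "((\<lambda>x. \<Prod>i\<in>I. h i x) has_real_derivative (\<Prod>i\<in>I. h i x) * (\<Sum>i\<in>I. h' i / h i x)) (at x)"
  using assms
proof (induction I rule: finite_induct)
  case (insert i I)
  have "((\<lambda>x. h i x * (\<Prod>i\<in>I. h i x)) has_real_derivative
      h' i * (\<Prod>i\<in>I. h i x) + (\<Prod>i\<in>I. h i x) * (\<Sum>i\<in>I. h' i / h i x) * h i x) (at x)"
    using insert by (intro DERIV_mult) auto
  moreover have "h' i * (\<Prod>i\<in>I. h i x) + (\<Prod>i\<in>I. h i x) * (\<Sum>i\<in>I. h' i / h i x) * h i x
      = (\<Prod>i\<in>insert i I. h i x) * (\<Sum>i\<in>insert i I. h' i / h i x)"
    unfolding prod.insert[OF insert.hyps] sum.insert[OF insert.hyps]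
    by (rule log_derivative_step) (use insert.prems in simp)
  ultimately show ?case unfolding prod.insert[OF insert.hyps] by (rule back_subst)
qed simp

text \<open>Near a root of one factor the logarithmic derivative is dominated by that factor, so a
  perturbed product has at most one root there.\<close>

lemma perturbed_root_unique:
  fixes G :: "real \<Rightarrow> real"
  assumes G: "\<And>x. \<bar>x - c\<bar> < \<delta> \<Longrightarrow> (G has_real_derivative G x * L x) (at x)"
    and nz: "\<And>x. \<bar>x - c\<bar> < \<delta> \<Longrightarrow> G x \<noteq> 0" and L: "\<And>x. \<bar>x - c\<bar> < \<delta> \<Longrightarrow> \<delta> * \<bar>L x\<bar> < 1"
    and xy: "\<bar>x - c\<bar> < \<delta>" "\<bar>y - c\<bar> < \<delta>" "(x - c) * G x + q = 0" "(y - c) * G y + q = 0"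
  shows "x = y"
proof -
  have *: False if xy: "\<bar>x - c\<bar> < \<delta>" "\<bar>y - c\<bar> < \<delta>" "(x - c) * G x + q = 0" "(y - c) * G y + q = 0" "x < y" for x y
  proof -
    have near: "\<bar>z - c\<bar> < \<delta>" if "x \<le> z" "z \<le> y" for z using that xy by linarith
    have d: "((\<lambda>z. (z - c) * G z + q) has_real_derivative (G z * (1 + (z - c) * L z))) (at z)"
      if "x \<le> z" "z \<le> y" for z
    proof -
      have "((\<lambda>z. (z - c) * G z + q) has_real_derivative ((1 - 0) * G z + G z * L z * (z - c) + 0)) (at z)"
        by (intro DERIV_add DERIV_mult DERIV_diff DERIV_ident DERIV_const G[OF near[OF that]])
      moreover have "(1 - 0) * G z + G z * L z * (z - c) + 0 = G z * (1 + (z - c) * L z)"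
        by (simp add: algebra_simps)
      ultimately show ?thesis by simp
    qed
    obtain z where z: "x < z" "z < y" "((\<lambda>z. (z - c) * G z + q) y - (\<lambda>z. (z - c) * G z + q) x) = (y - x) * (G z * (1 + (z - c) * L z))"
      using MVT2[OF xy(5) d] by blast
    then have "G z * (1 + (z - c) * L z) = 0" using xy by simp
    moreover have nr: "\<bar>z - c\<bar> < \<delta>" using near z by simp
    ultimately have "1 + (z - c) * L z = 0" using nz[OF nr] by simp
    then have "(z - c) * L z = -1" by linarith
    then have "\<bar>z - c\<bar> * \<bar>L z\<bar> = 1" unfolding abs_mult[symmetric] by simp
    moreover have "\<bar>z - c\<bar> * \<bar>L z\<bar> \<le> \<delta> * \<bar>L z\<bar>" using nr by (intro mult_right_mono) auto
    ultimately show False using L[OF nr] by linarith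
  qed
  show ?thesis
    using *[OF xy] *[OF xy(2,1,4,3)] less_linear[of x y] by blast
qed

lemma real_prod_remove:
  "finite I \<Longrightarrow> i \<in> I \<Longrightarrow> (\<Prod>j\<in>I. x - c j) * t = (x - c i) * ((\<Prod>j\<in>I - {i}. x - c j) * (t::real))"
  by (subst prod.remove) (auto simp: mult.assoc)

lemma perturbed_roots:
  fixes c :: "'i \<Rightarrow> real" and t t' :: "real \<Rightarrow> real"
  assumes I: "finite I" and sep: "\<And>i j. i \<in> I \<Longrightarrow> j \<in> I \<Longrightarrow> i \<noteq> j \<Longrightarrow> 1 \<le> \<bar>c i - c j\<bar>"
    and t: "\<And>x. t x > 0" "\<And>x. (t has_real_derivative t' x) (at x)"
    and big: "\<And>i x. i \<in> I \<Longrightarrow> \<bar>x - c i\<bar> = \<delta> \<Longrightarrow> \<bar>q\<bar> < \<bar>(\<Prod>i\<in>I. x - c i) * t x\<bar>"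
    and \<delta>: "0 < \<delta>" "\<delta> < 1/2"
  shows "\<exists>z. inj_on z I \<and> (\<forall>i\<in>I. \<bar>z i - c i\<bar> < \<delta> \<and> (\<Prod>j\<in>I. z i - c j) * t (z i) + q = 0)"
proof -
  have "\<exists>z. \<bar>z - c i\<bar> < \<delta> \<and> (\<Prod>j\<in>I. z - c j) * t z + q = 0" if i: "i \<in> I" for i
  proof -
    define G where "G x = (\<Prod>j\<in>I - {i}. x - c j) * t x" for x
    have split: "(\<Prod>j\<in>I. x - c j) * t x = (x - c i) * G x" for x
      unfolding G_def by (rule real_prod_remove[OF I i])
    have contt: "continuous_on A t" for A
      using t(2) by (meson DERIV_isCont continuous_at_imp_continuous_on)
    have "\<exists>x. \<bar>x - c i\<bar> < \<delta> \<and> (x - c i) * G x + q = 0"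
    proof (rule perturbed_root_near)
      show "continuous_on {c i - \<delta>..c i + \<delta>} G" unfolding G_def by (intro continuous_intros contt)
      show "G x \<noteq> 0" if "\<bar>x - c i\<bar> \<le> \<delta>" for x
      proof -
        have "x \<noteq> c j" if "j \<in> I - {i}" for j using sep[OF i, of j] that \<open>\<bar>x - c i\<bar> \<le> \<delta>\<close> \<delta> by auto
        then show ?thesis unfolding G_def using I t(1)[of x] by auto
      qed
      show "\<bar>q\<bar> < \<delta> * \<bar>G (c i - \<delta>)\<bar>" "\<bar>q\<bar> < \<delta> * \<bar>G (c i + \<delta>)\<bar>"
        using big[OF i, of "c i - \<delta>"] big[OF i, of "c i + \<delta>"] \<delta>(1) unfolding split by (simp_all add: abs_mult)
    qed (rule \<delta>(1))
    then show ?thesis unfolding split .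
  qed
  then obtain z where z: "\<And>i. i \<in> I \<Longrightarrow> \<bar>z i - c i\<bar> < \<delta>" "\<And>i. i \<in> I \<Longrightarrow> (\<Prod>j\<in>I. z i - c j) * t (z i) + q = 0"
    by metis
  have "inj_on z I"
  proof (rule inj_onI, rule ccontr)
    fix i j assume ij: "i \<in> I" "j \<in> I" "z i = z j" "i \<noteq> j"
    then show False using z(1)[of i] z(1)[of j] sep[of i j] \<delta> by linarith
  qed
  then show ?thesis using z by blast
qed

text \<open>Near c i every other linear factor contributes at most 2 to the logarithmic derivative,
  since its root is at distance at least 1/2, and \<open>t\<close> contributes at most
  \<open>M\<close>.\<close>

lemma perturbed_roots_only:
  fixes c :: "'i \<Rightarrow> real" and t t' :: "real \<Rightarrow> real"
  assumes I: "finite I" and sep: "\<And>i j. i \<in> I \<Longrightarrow> j \<in> I \<Longrightarrow> i \<noteq> j \<Longrightarrow> 1 \<le> \<bar>c i - c j\<bar>"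
    and t: "\<And>x. t x > 0" "\<And>x. (t has_real_derivative t' x) (at x)" "\<And>x. \<bar>t' x / t x\<bar> \<le> M"
    and \<delta>: "0 < \<delta>" "\<delta> < 1/2" "\<delta> * (2 * real (card I - 1) + M) < 1"
    and i: "i \<in> I" and xy: "\<bar>x - c i\<bar> < \<delta>" "\<bar>y - c i\<bar> < \<delta>"
      "(\<Prod>j\<in>I. x - c j) * t x + q = 0" "(\<Prod>j\<in>I. y - c j) * t y + q = 0"
  shows "x = y"
proof -
  define G where "G x = (\<Prod>j\<in>I - {i}. x - c j) * t x" for x
  define L where "L x = (\<Sum>j\<in>I - {i}. 1 / (x - c j)) + t' x / t x" for x
  have split: "(\<Prod>j\<in>I. x - c j) * t x = (x - c i) * G x" for x
    unfolding G_def by (rule real_prod_remove[OF I i])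
  have far: "\<bar>x - c j\<bar> \<ge> 1/2" if "j \<in> I - {i}" "\<bar>x - c i\<bar> < \<delta>" for x j
    using sep[OF i, of j] that \<delta>(2) by (auto simp: abs_if split: if_splits)
  show ?thesis
  proof (rule perturbed_root_unique[where c = "c i" and \<delta> = \<delta> and G = G and L = L and q = q])
    show "\<bar>x - c i\<bar> < \<delta>" "\<bar>y - c i\<bar> < \<delta>" "(x - c i) * G x + q = 0" "(y - c i) * G y + q = 0"
      using xy unfolding split by simp_all
    fix x assume x: "\<bar>x - c i\<bar> < \<delta>"
    have nz: "x - c j \<noteq> 0" if "j \<in> I - {i}" for j using far[OF that x] by auto
    show "G x \<noteq> 0" unfolding G_def using nz I t(1)[of x] by auto
    have d1: "((\<lambda>x. \<Prod>j\<in>I - {i}. x - c j) has_real_derivative (\<Prod>j\<in>I - {i}. x - c j) * (\<Sum>j\<in>I - {i}. 1 / (x - c j))) (at x)"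
    proof (rule DERIV_prod_log)
      show "((\<lambda>x. x - c j) has_real_derivative 1) (at x)" for j
        by (auto intro!: derivative_eq_intros)
    qed (use I nz in auto)
    have "(G has_real_derivative ((\<Prod>j\<in>I - {i}. x - c j) * (\<Sum>j\<in>I - {i}. 1 / (x - c j))) * t x + t' x * (\<Prod>j\<in>I - {i}. x - c j)) (at x)"
      unfolding G_def by (rule DERIV_mult[OF d1 t(2)])
    moreover have "((\<Prod>j\<in>I - {i}. x - c j) * (\<Sum>j\<in>I - {i}. 1 / (x - c j))) * t x + t' x * (\<Prod>j\<in>I - {i}. x - c j) = G x * L x"
    proof -
      have "(P * S) * u + v * P = (P * u) * (S + v / u)" if "u \<noteq> 0" for P S u v :: real
        using log_derivative_step[of u v P S] that by (simp add: ac_simps)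
      then show ?thesis unfolding G_def L_def using t(1)[of x] by simp
    qed
    ultimately show "(G has_real_derivative G x * L x) (at x)" by simp
    have "\<bar>L x\<bar> \<le> (\<Sum>j\<in>I - {i}. \<bar>1 / (x - c j)\<bar>) + \<bar>t' x / t x\<bar>"
      unfolding L_def by (rule order.trans[OF abs_triangle_ineq]) (intro add_right_mono sum_abs)
    also have "(\<Sum>j\<in>I - {i}. \<bar>1 / (x - c j)\<bar>) \<le> (\<Sum>j\<in>I - {i}. 2)"
    proof (rule sum_mono)
      fix j assume "j \<in> I - {i}"
      from far[OF this x] show "\<bar>1 / (x - c j)\<bar> \<le> 2" by (simp add: abs_divide divide_le_eq)
    qed
    also have "(\<Sum>j\<in>I - {i}. 2) = 2 * real (card I - 1)" using i I by simp
    finally have "\<bar>L x\<bar> \<le> 2 * real (card I - 1) + M" using t(3)[of x] by linarith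
    then have "\<delta> * \<bar>L x\<bar> \<le> \<delta> * (2 * real (card I - 1) + M)" using \<delta>(1) by (intro mult_left_mono) auto
    then show "\<delta> * \<bar>L x\<bar> < 1" using \<delta>(3) by linarith
  qed
qed

section \<open>Explicit polynomials with a prescribed number of real roots\<close>

lemma eqm_prod: "(\<And>i. i \<in> I \<Longrightarrow> eqm p (A i) (B i)) \<Longrightarrow> eqm p (prod A I) (prod B I)"
  by (induction I rule: infinite_finite_induct) (auto intro: eqm_refl eqm_mult)

abbreviation rpoly :: "int poly \<Rightarrow> real poly" where "rpoly \<equiv> map_poly of_int"

lemma poly_rpoly_of_int: "poly (rpoly f) (of_int n) = of_int (poly f n)"
  by (induction f) (auto simp: map_poly_pCons)

lemma poly_rpoly_simps:
  "poly (rpoly (f + h)) x = poly (rpoly f) x + poly (rpoly h) x"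
  "poly (rpoly (f * h)) x = poly (rpoly f) x * poly (rpoly h) x"
  "poly (rpoly [:c:]) x = of_int c"
  "poly (rpoly [:c, d:]) x = of_int c + x * of_int d"
  "poly (rpoly (monom c n)) x = of_int c * x ^ n"
  "poly (rpoly 1) x = 1"
  "poly (rpoly (f ^ n)) x = poly (rpoly f) x ^ n"
  "poly (rpoly (smult c f)) x = of_int c * poly (rpoly f) x"
proof -
  have "of_real (poly (rpoly (f + h)) x) = complex_of_real (poly (rpoly f) x + poly (rpoly h) x)"
    by (simp only: poly_of_int_real[symmetric] cpoly_simps poly_add of_real_add)
  then show "poly (rpoly (f + h)) x = poly (rpoly f) x + poly (rpoly h) x" by (simp only: of_real_eq_iff)
  have m: "poly (rpoly (f * h)) x = poly (rpoly f) x * poly (rpoly h) x" for f h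
  proof -
    have "of_real (poly (rpoly (f * h)) x) = complex_of_real (poly (rpoly f) x * poly (rpoly h) x)"
      by (simp only: poly_of_int_real[symmetric] cpoly_simps poly_mult of_real_mult)
    then show ?thesis by (simp only: of_real_eq_iff)
  qed
  then show "poly (rpoly (f * h)) x = poly (rpoly f) x * poly (rpoly h) x" .
  show 1: "poly (rpoly 1) x = 1" by (simp add: map_poly_1')
  show "poly (rpoly (f ^ n)) x = poly (rpoly f) x ^ n" by (induction n) (simp_all add: m 1)
  have "of_real (poly (rpoly (smult c f)) x) = complex_of_real (of_int c * poly (rpoly f) x)"
    by (simp only: poly_of_int_real[symmetric] cpoly_simps poly_smult of_real_mult of_real_of_int_eq)
  then show "poly (rpoly (smult c f)) x = of_int c * poly (rpoly f) x" by (simp only: of_real_eq_iff)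
  show "poly (rpoly (monom c n)) x = of_int c * x ^ n" by (simp add: map_poly_monom poly_monom)
qed (simp_all add: map_poly_pCons)

lemma poly_rpoly_prod: "poly (rpoly (prod h I)) x = (\<Prod>i\<in>I. poly (rpoly (h i)) x)"
  by (induction I rule: infinite_finite_induct) (simp_all add: poly_rpoly_simps)

text \<open>Take f = X^g - X^(g-1) + p. For even g the function (x - 1) x^(g-1) never falls below
  -1, so \<open>f\<close> is positive on the real line.\<close>

lemma homog_roots_exist_totally_complex:
  assumes g: "g = CARD('n::finite)" "g \<ge> 3" "even g"
  shows "\<exists>(f :: int poly) (a :: 'n \<Rightarrow> complex). homog_roots f a g \<and> card {i. a i \<in> \<real>} = 0"
proof -
  obtain q :: nat where q: "prime q" "q > 2 * g" using bigger_prime by blast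
  define p where "p = int q"
  have p: "prime p" "2 * int g < p" using q by (auto simp: p_def)
  define f where "f = [:-1, 1:] * [:0, 1:] ^ (g - 1) + smult p 1"
  have f': "f = monom 1 g - monom 1 (g - 1) + [:p:]"
  proof -
    obtain n where n: "g = Suc n" using g(2) by (cases g) auto
    show ?thesis by (simp add: f_def n monom_altdef algebra_simps)
  qed
  have cf: "coeff f k = (if k = g then 1 else 0)" if "k \<ge> g" for k
    using that g(2) unfolding f' by (auto simp: coeff_pCons split: nat.splits)
  have "degree f = g"
  proof (rule antisym)
    show "degree f \<le> g" using cf by (intro degree_le) auto
    show "g \<le> degree f" using cf[of g] by (intro le_degree) auto
  qed
  moreover have "lead_coeff f = 1" unfolding \<open>degree f = g\<close> using cf[of g] by simp
  moreover have ev: "poly (rpoly f) x = (x - 1) * x ^ (g - 1) + of_int p" for x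
    unfolding f_def poly_rpoly_simps by simp
  have nz: "poly (rpoly f) x \<noteq> 0" for x
  proof -
    have "(x - 1) * x ^ (g - 1) \<ge> -1"
    proof (cases "x \<ge> 1")
      case True
      then have "(x - 1) * x ^ (g - 1) \<ge> 0" by (intro mult_nonneg_nonneg) auto
      then show ?thesis by linarith
    next
      case False
      show ?thesis
      proof (cases "x \<ge> 0")
        case True
        have "(1 - x) * x ^ (g - 1) \<le> 1 * 1" using True False by (intro mult_mono power_le_one) auto
        then show ?thesis by (simp add: algebra_simps)
      next
        case neg: False
        have "odd (g - 1)" using g(2,3) by simp
        then have "x ^ (g - 1) \<le> 0" using neg by (intro less_imp_le) (simp add: power_less_zero_eq)
        moreover have "x - 1 \<le> 0" using False by simp
        ultimately have "(x - 1) * x ^ (g - 1) \<ge> 0" by (intro mult_nonpos_nonpos)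
        then show ?thesis by linarith
      qed
    qed
    moreover have "of_int p > (1::real)" using p(2) g(2) by linarith
    ultimately show ?thesis unfolding ev by linarith
  qed
  have nr: "poly f n \<noteq> 0" for n using nz[of "of_int n"] by (simp add: poly_rpoly_of_int)
  have e0: "\<not> p dvd poly 1 0" using p(1) not_prime_unit by auto
  have "\<exists>a :: 'n \<Rightarrow> complex. homog_roots f a g \<and> card {i. a i \<in> \<real>} = card {x::real. poly (rpoly f) x = 0}"
    by (rule eisenstein_roots_exist[OF g(1,2) \<open>lead_coeff f = 1\<close> \<open>degree f = g\<close> f_def p e0 nr])
  then show ?thesis using nz by auto
qed

lemma abs_prod_ge_power:
  fixes h :: "'i \<Rightarrow> real"
  assumes "\<And>i. i \<in> I \<Longrightarrow> b \<le> \<bar>h i\<bar>" "0 \<le> b"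
  shows "b ^ card I \<le> \<bar>\<Prod>i\<in>I. h i\<bar>"
  unfolding abs_prod prod_constant[symmetric] using assms by (intro prod_mono) auto

text \<open>Add p to the product of T and the X - c i, where the c i are well separated integers and
  T is positive. The constant supplies the Eisenstein condition at 0 and is too small to create,
  destroy or merge real roots.\<close>

lemma homog_roots_exist_real:
  assumes g: "g = CARD('n::finite)" "g \<ge> 3" "r + 2 * s = g" "r \<ge> 1"
  shows "\<exists>(f :: int poly) (a :: 'n \<Rightarrow> complex). homog_roots f a g \<and> card {i. a i \<in> \<real>} = r"
proof -
  obtain q :: nat where q: "prime q" "q > 2 * g + 2" using bigger_prime by blast
  define p where "p = int q"
  have p: "prime p" "2 * int g < p" and p3: "2 * int g + 3 \<le> p" using q by (auto simp: p_def)
  \<comment> \<open>c 1 provides the simple root 1 modulo p, and all other c i reduce to 0; distinct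
    values differ by at least p.\<close>
  define c where "c i = (if i = 1 then 1 else p * int i)" for i :: nat
  define I where "I = {1..r}"
  \<comment> \<open>\<open>K\<close> is \<delta>^(-r) for the radius \<delta> = 1/(2 g) chosen
    below. If s > 0 it keeps the product larger than p outside the \<delta>-neighbourhoods of the c
    i.\<close>
  define K where "K = (2 * int g) ^ r"
  define T where "T = (if s = 0 then 1 else monom 1 (2 * s) + [:p\<^sup>2 * K:])"
  define h where "h = (\<Prod>i\<in>I. [:- c i, 1:]) * T"
  define f where "f = h + [:p:]"
  have I: "finite I" "card I = r" by (auto simp: I_def)
  have dT: "degree T = 2 * s" and lT: "lead_coeff T = 1"
  proof -
    have "degree T = 2 * s \<and> lead_coeff T = 1"
    proof (cases "s = 0")
      case False
      then have "degree (monom (1::int) (2 * s) + [:p\<^sup>2 * K:]) = 2 * s"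
        by (subst degree_add_eq_left) (auto simp: degree_monom_eq)
      then show ?thesis using False by (auto simp: T_def coeff_pCons split: nat.splits)
    qed (simp add: T_def)
    then show "degree T = 2 * s" "lead_coeff T = 1" by auto
  qed
  have lP: "lead_coeff (\<Prod>i\<in>I. [:- c i, 1:]) = 1" by (subst lead_coeff_prod) simp
  have lh: "lead_coeff h = 1" unfolding h_def lead_coeff_mult lT lP by simp
  have dh: "degree h = g"
  proof -
    have "(\<Prod>i\<in>I. [:- c i, 1:]) \<noteq> 0" "T \<noteq> 0" using lT lP by auto
    then show ?thesis unfolding h_def using g(3) I by (simp add: degree_mult_eq dT degree_prod_eq_sum_degree)
  qed
  have df: "degree f = g" unfolding f_def using dh g(2) by (subst degree_add_eq_left) auto
  have lf: "lead_coeff f = 1" unfolding df unfolding f_def using lh dh g(2)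
    by (auto simp: coeff_pCons split: nat.splits)
  have "eqm p (\<Prod>i\<in>I. [:- c i, 1:]) (\<Prod>i\<in>I. if i = 1 then [:-1, 1:] else [:0, 1:])"
    by (rule eqm_prod) (auto simp: c_def eqm_def const_dvd_iff coeff_pCons split: nat.splits)
  moreover have "(\<Prod>i\<in>I. if i = 1 then [:-1, 1:] else [:0, 1::int:]) = [:-1, 1:] * [:0, 1:] ^ (r - 1)"
  proof -
    have "I = insert 1 {2..r}" using g(4) by (auto simp: I_def)
    moreover have "(\<Prod>i\<in>{2..r}. if i = 1 then [:-1, 1:] else [:0, 1::int:]) = (\<Prod>i\<in>{2..r}. [:0, 1:])"
      by (rule prod.cong) auto
    ultimately show ?thesis by (simp add: numeral_2_eq_2 del: mult_pCons_left)
  qed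
  ultimately have m1: "eqm p (\<Prod>i\<in>I. [:- c i, 1:]) ([:-1, 1:] * [:0, 1:] ^ (r - 1))" by (simp only:)
  have m2: "eqm p T ([:0, 1:] ^ (2 * s))"
    by (auto simp: T_def eqm_def const_dvd_iff coeff_pCons monom_altdef power2_eq_square split: nat.splits)
  have "eqm p h (([:-1, 1:] * [:0, 1:] ^ (r - 1)) * [:0, 1:] ^ (2 * s))"
    unfolding h_def by (rule eqm_mult[OF m1 m2])
  moreover have "([:-1, 1:] * [:0, 1:] ^ (r - 1)) * [:0, 1:] ^ (2 * s) = [:-1, 1:] * [:0, 1::int:] ^ (g - 1)"
  proof -
    have "g - 1 = (r - 1) + 2 * s" using g(3,4) by linarith
    then show ?thesis by (simp only: power_add mult.assoc)
  qed
  ultimately have mh: "eqm p h ([:-1, 1:] * [:0, 1:] ^ (g - 1))" by (simp only:)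
  have "eqm p f h" unfolding f_def by (auto simp: eqm_def)
  then have "eqm p f ([:-1, 1:] * [:0, 1:] ^ (g - 1))" using mh by (rule eqm_trans)
  then obtain e where "f - [:-1, 1:] * [:0, 1:] ^ (g - 1) = [:p:] * e" unfolding eqm_def by (elim dvdE)
  then have fe: "f = [:-1, 1:] * [:0, 1:] ^ (g - 1) + smult p e"
    unfolding diff_eq_eq by (simp only: add.commute) simp
  \<comment> \<open>Two factors p in h(0) make f(0) congruent to p modulo p^2. They come from c 2
    and c 3 if s = 0, and from the constant term of T otherwise.\<close>
  have "p\<^sup>2 dvd poly h 0"
  proof (cases "s = 0")
    case True
    then have r: "r \<ge> 3" using g by simp
    have "(\<Prod>i\<in>{2,3}. - c i) dvd (\<Prod>i\<in>I. - c i)" using r by (intro prod_dvd_prod_subset I) (auto simp: I_def)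
    moreover have "p\<^sup>2 dvd (\<Prod>i\<in>{2,3}. - c i)" by (simp add: c_def power2_eq_square)
    ultimately show ?thesis unfolding h_def poly_mult poly_prod by (auto intro: dvd_trans)
  next
    case False
    then have "poly T 0 = p\<^sup>2 * K" by (simp add: T_def poly_monom power_0_left)
    then show ?thesis unfolding h_def poly_mult by simp
  qed
  have e0: "\<not> p dvd poly e 0"
  proof
    assume "p dvd poly e 0"
    moreover have "poly f 0 = p * poly e 0" unfolding fe poly_add poly_mult poly_power poly_smult using g(2) by simp
    ultimately have "p\<^sup>2 dvd poly f 0" by (simp add: power2_eq_square)
    then have "p\<^sup>2 dvd poly h 0 + p" by (simp add: f_def)
    then have "p * p dvd p * 1" using \<open>p\<^sup>2 dvd poly h 0\<close> by (simp add: dvd_add_right_iff power2_eq_square)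
    then have "p dvd 1" using p(1) by (simp only: dvd_mult_cancel_left) auto
    then show False using p(1) not_prime_unit by blast
  qed
  define t where "t x = (if s = 0 then 1 else x ^ (2 * s) + of_int (p\<^sup>2 * K))" for x :: real
  define t' where "t' x = (if s = 0 then 0 else real (2 * s) * x ^ (2 * s - 1))" for x :: real
  \<comment> \<open>Small enough for the uniqueness criterion, because 2 (r - 1) + 2 s < 2
    g.\<close>
  define \<delta> where "\<delta> = 1 / (2 * real g)"
  have ev: "poly (rpoly f) x = (\<Prod>i\<in>I. x - of_int (c i)) * t x + of_int p" for x
    by (simp add: f_def h_def T_def t_def poly_rpoly_simps poly_rpoly_prod)
  have K0: "K \<ge> 1" unfolding K_def using g(2) by (intro one_le_power) simp
  have p2K: "1 \<le> p\<^sup>2 * K" using K0 p3 mult_mono[of 1 "p\<^sup>2" 1 K] by simp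
  have tpos: "t x > 0" for x
  proof -
    have "0 < real_of_int (p\<^sup>2 * K)" using p2K by linarith
    moreover have "0 \<le> x ^ (2 * s)" by simp
    ultimately have "0 < x ^ (2 * s) + real_of_int (p\<^sup>2 * K)" by linarith
    then show ?thesis unfolding t_def by (simp only: split: if_split) simp
  qed
  have tder: "(t has_real_derivative t' x) (at x)" for x
  proof (cases "s = 0")
    case True
    then have "t = (\<lambda>x. 1)" by (auto simp: t_def)
    then show ?thesis using True by (simp add: t'_def)
  next
    case False
    then have "t = (\<lambda>x. x ^ (2 * s) + of_int (p\<^sup>2 * K))" by (auto simp: t_def)
    moreover have "((\<lambda>x. x ^ (2 * s) + of_int (p\<^sup>2 * K)) has_real_derivative (real (2 * s) * x ^ (2 * s - 1) + 0)) (at x)"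
      by (rule DERIV_cong[OF DERIV_add[OF DERIV_pow DERIV_const]]) simp
    ultimately show ?thesis using False by (simp add: t'_def)
  qed
  have sepI: "p \<le> \<bar>c i - c j\<bar>" if ij: "i \<in> I" "j \<in> I" "i \<noteq> j" for i j
  proof -
    have *: "p \<le> p * int j - 1" if "2 \<le> j" for j
      using mult_left_mono[of 2 "int j" p] that p3 by linarith
    have **: "p \<le> \<bar>p * int i - p * int j\<bar>"
    proof -
      have "\<bar>p * int i - p * int j\<bar> = p * \<bar>int i - int j\<bar>" using p3 by (simp add: abs_mult right_diff_distrib[symmetric])
      moreover have "1 \<le> \<bar>int i - int j\<bar>" using ij(3) by linarith
      ultimately show ?thesis using mult_left_mono[of 1 "\<bar>int i - int j\<bar>" p] p3 by simp
    qed
    show ?thesis using ij *[of i] *[of j] ** by (auto simp: c_def I_def)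
  qed
  have sepR: "real_of_int p \<le> \<bar>of_int (c i) - of_int (c j)\<bar>" if "i \<in> I" "j \<in> I" "i \<noteq> j" for i j
    using sepI[OF that] by (metis of_int_abs of_int_diff of_int_le_iff)
  have pR: "real_of_int p \<ge> 2 * real g + 3" using p3 by linarith
  have \<delta>: "0 < \<delta>" "\<delta> < 1/2" "\<delta> \<le> 1" using g(2) by (auto simp: \<delta>_def divide_simps)
  have gR: "real g \<ge> 3" using g(2) by simp
  have faraway: "of_int p < \<bar>(\<Prod>i\<in>I. x - of_int (c i)) * t x\<bar>"
    if "s \<noteq> 0" "\<And>i. i \<in> I \<Longrightarrow> \<delta> \<le> \<bar>x - of_int (c i)\<bar>" for x
  proof -
    have "\<delta> ^ r * of_int (p\<^sup>2 * K) \<le> \<bar>\<Prod>i\<in>I. x - of_int (c i)\<bar> * t x"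
      using abs_prod_ge_power[of I \<delta> "\<lambda>i. x - of_int (c i)"] that \<delta>(1) K0 I(2)
      by (intro mult_mono) (auto simp: t_def)
    moreover have "\<delta> ^ r * of_int (p\<^sup>2 * K) = of_int p * of_int p"
    proof -
      have "\<delta> ^ r * of_int K = (1::real)" unfolding K_def \<delta>_def of_int_power power_mult_distrib[symmetric]
        using g(2) by (simp flip: power_mult_distrib)
      then show ?thesis by (simp add: power2_eq_square)
    qed
    moreover have "real_of_int p * 1 < of_int p * of_int p" using pR gR by (intro mult_strict_left_mono) auto
    ultimately show ?thesis using tpos[of x] by (simp add: abs_mult)
  qed
  have big: "\<bar>of_int p\<bar> < \<bar>(\<Prod>i\<in>I. x - of_int (c i)) * t x\<bar>" if i: "i \<in> I" "\<bar>x - of_int (c i)\<bar> = \<delta>" for i x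
  proof -
    have far: "real_of_int p - 1 \<le> \<bar>x - of_int (c j)\<bar>" if "j \<in> I - {i}" for j
      using sepR[OF i(1), of j] that i(2) \<delta>(3) by auto
    show ?thesis
    proof (cases "s = 0")
      case True
      \<comment> \<open>Here T = 1 gives no help, but r = g \<ge> 3, so at least two further factors
        of size p - 1 or more are present.\<close>
      have "(real_of_int p - 1) ^ card (I - {i}) \<le> \<bar>\<Prod>j\<in>I - {i}. x - of_int (c j)\<bar>"
        using far pR gR by (intro abs_prod_ge_power) auto
      moreover have "(real_of_int p - 1)\<^sup>2 \<le> (real_of_int p - 1) ^ card (I - {i})"
        using pR gR i(1) I True g by (intro power_increasing) auto
      ultimately have "\<delta> * (real_of_int p - 1)\<^sup>2 \<le> \<delta> * \<bar>\<Prod>j\<in>I - {i}. x - of_int (c j)\<bar>"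
        using \<delta>(1) by (intro mult_left_mono) auto
      also have "\<dots> = \<bar>(\<Prod>j\<in>I. x - of_int (c j)) * t x\<bar>"
        using i I True by (simp add: prod.remove[OF I(1) i(1)] abs_mult t_def)
      finally have "\<delta> * (real_of_int p - 1)\<^sup>2 \<le> \<bar>(\<Prod>j\<in>I. x - of_int (c j)) * t x\<bar>" .
      moreover have "of_int p < \<delta> * (real_of_int p - 1)\<^sup>2"
      proof -
        have "(2 * real g + 3) * real_of_int p \<le> of_int p * of_int p" using pR gR by (intro mult_right_mono) auto
        then have "2 * real g * of_int p < (real_of_int p - 1)\<^sup>2" using pR gR
          by (simp add: power2_eq_square algebra_simps)
        then show ?thesis using gR by (simp add: \<delta>_def field_simps)
      qed
      ultimately show ?thesis using pR by simp
    next
      case False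
      have "\<delta> \<le> \<bar>x - of_int (c j)\<bar>" if "j \<in> I" for j
        using far[of j] i(2) that pR gR \<delta>(3) by (cases "j = i") auto
      then show ?thesis using faraway[OF False] pR by simp
    qed
  qed
  have sep1: "1 \<le> \<bar>real_of_int (c i) - of_int (c j)\<bar>" if "i \<in> I" "j \<in> I" "i \<noteq> j" for i j
    using sepR[OF that] pR by linarith
  have "\<exists>z. inj_on z I \<and> (\<forall>i\<in>I. \<bar>z i - of_int (c i)\<bar> < \<delta> \<and> (\<Prod>j\<in>I. z i - of_int (c j)) * t (z i) + of_int p = 0)"
  proof (rule perturbed_roots[where t' = t'])
    show "finite I" by (rule I(1))
    show "1 \<le> \<bar>real_of_int (c i) - of_int (c j)\<bar>" if "i \<in> I" "j \<in> I" "i \<noteq> j" for i j by (rule sep1[OF that])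
    show "0 < t x" for x by (rule tpos)
    show "(t has_real_derivative t' x) (at x)" for x by (rule tder)
    show "\<bar>of_int p\<bar> < \<bar>(\<Prod>i\<in>I. x - of_int (c i)) * t x\<bar>" if "i \<in> I" "\<bar>x - of_int (c i)\<bar> = \<delta>" for i x
      by (rule big[OF that])
  qed (rule \<delta>(1), rule \<delta>(2))
  then obtain z where z: "inj_on z I" "\<And>i. i \<in> I \<Longrightarrow> \<bar>z i - of_int (c i)\<bar> < \<delta>"
    "\<And>i. i \<in> I \<Longrightarrow> (\<Prod>j\<in>I. z i - of_int (c j)) * t (z i) + of_int p = 0"
    by blast
  define Z where "Z = {x::real. poly (rpoly f) x = 0}"
  have f0: "rpoly f \<noteq> 0" using lf by (metis coeff_0 coeff_map_poly of_int_0 of_int_1 zero_neq_one)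
  have finZ: "finite Z" unfolding Z_def by (rule poly_roots_finite[OF f0])
  have sub: "z ` I \<subseteq> Z" using z(3) by (auto simp: Z_def ev)
  have cz: "card (z ` I) = r" using z(1) I(2) by (simp add: card_image)
  \<comment> \<open>For s = 0 there are already as many roots as the degree allows. For s > 0 a real
    root has to lie close to some c i, where it is unique.\<close>
  have Zeq: "Z = z ` I"
  proof (cases "s = 0")
    case True
    have "card Z \<le> degree (rpoly f)" unfolding Z_def using f0 by (rule card_poly_roots_bound)
    also have "\<dots> \<le> r" using df True g(3) map_poly_degree_leq[of of_int f] by simp
    finally show ?thesis using cz card_seteq[OF finZ sub] by simp
  next
    case False
    have "x \<in> z ` I" if x: "x \<in> Z" for x
    proof -
      have x0: "(\<Prod>j\<in>I. x - of_int (c j)) * t x + of_int p = 0" using x by (simp add: Z_def ev)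
      have "\<exists>i\<in>I. \<bar>x - of_int (c i)\<bar> < \<delta>"
      proof (rule ccontr)
        assume "\<not> ?thesis"
        then have "of_int p < \<bar>(\<Prod>i\<in>I. x - of_int (c i)) * t x\<bar>" by (intro faraway False) auto
        then show False using x0 pR gR by (simp add: add_eq_0_iff2)
      qed
      then obtain i where i: "i \<in> I" "\<bar>x - of_int (c i)\<bar> < \<delta>" by blast
      have tM: "\<bar>t' y / t y\<bar> \<le> 2 * real s" for y
      proof -
        have "\<bar>y\<bar> ^ (2 * s - 1) \<le> y ^ (2 * s) + 1"
        proof (cases "\<bar>y\<bar> \<ge> 1")
          case True
          then have "\<bar>y\<bar> ^ (2 * s - 1) \<le> \<bar>y\<bar> ^ (2 * s)" by (intro power_increasing) auto
          then show ?thesis by (simp add: power_even_abs)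
        next
          case False
          then have "\<bar>y\<bar> ^ (2 * s - 1) \<le> 1" by (intro power_le_one) auto
          then show ?thesis by (simp add: add_increasing)
        qed
        moreover have "1 \<le> real_of_int (p\<^sup>2 * K)" using p2K by linarith
        ultimately have "\<bar>y\<bar> ^ (2 * s - 1) \<le> t y" using False unfolding t_def by simp
        then have "\<bar>t' y\<bar> \<le> 2 * real s * t y" using False
          by (simp add: t'_def abs_mult power_abs mult_left_mono)
        then show ?thesis using tpos[of y] by (simp add: abs_divide divide_le_eq)
      qed
      have \<delta>3: "\<delta> * (2 * real (card I - 1) + 2 * real s) < 1"
        using g I(2) by (simp add: \<delta>_def divide_less_eq of_nat_diff)
      have "x = z i"
      proof (rule perturbed_roots_only[where t' = t'])
        show "\<delta> * (2 * real (card I - 1) + 2 * real s) < 1" by (rule \<delta>3)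
        show "finite I" by (rule I(1))
        show "1 \<le> \<bar>real_of_int (c i) - of_int (c j)\<bar>" if "i \<in> I" "j \<in> I" "i \<noteq> j" for i j by (rule sep1[OF that])
        show "0 < t x" for x by (rule tpos)
        show "(t has_real_derivative t' x) (at x)" for x by (rule tder)
        show "\<bar>t' y / t y\<bar> \<le> 2 * real s" for y by (rule tM)
        show "i \<in> I" by (rule i(1))
        show "\<bar>x - of_int (c i)\<bar> < \<delta>" by (rule i(2))
        show "\<bar>z i - of_int (c i)\<bar> < \<delta>" by (rule z(2)[OF i(1)])
        show "(\<Prod>j\<in>I. x - of_int (c j)) * t x + of_int p = 0" by (rule x0)
        show "(\<Prod>j\<in>I. z i - of_int (c j)) * t (z i) + of_int p = 0" by (rule z(3)[OF i(1)])
        show "\<delta> < 1/2" "0 < \<delta>" using \<delta> by simp_all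
      qed
      show ?thesis using i(1) \<open>x = z i\<close> by blast
    qed
    then show ?thesis using sub by blast
  qed
  \<comment> \<open>An integer root would be closer than 1/2 to some c i, hence equal to it, but f(c
    i) = p.\<close>
  have nr: "poly f n \<noteq> 0" for n
  proof
    assume n: "poly f n = 0"
    then have "of_int n \<in> Z" by (simp add: Z_def poly_rpoly_of_int)
    then obtain i where i: "i \<in> I" "of_int n = z i" unfolding Zeq by blast
    then have "\<bar>real_of_int n - of_int (c i)\<bar> < 1/2" using z(2)[OF i(1)] \<delta>(2) by simp
    then have "n = c i" by linarith
    then have "poly h n = 0" unfolding h_def poly_mult poly_prod using i(1) I(1) by (auto intro!: prod_zero)
    then show False using n p3 by (simp add: f_def)
  qed
  have "\<exists>a :: 'n \<Rightarrow> complex. homog_roots f a g \<and> card {i. a i \<in> \<real>} = card {x::real. poly (rpoly f) x = 0}"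
    by (rule eisenstein_roots_exist[OF g(1,2) lf df fe p e0 nr])
  then show ?thesis using cz Zeq unfolding Z_def by metis
qed

theorem homog_roots_exist:
  assumes "g = CARD('n::finite)" "g \<ge> 3" "r + 2 * s = g"
  shows "\<exists>(f :: int poly) (a :: 'n \<Rightarrow> complex). homog_roots f a g \<and> card {i. a i \<in> \<real>} = r"
proof (cases "r = 0")
  case True
  then show ?thesis using homog_roots_exist_totally_complex[OF assms(1,2)] assms(3) by auto
next
  case False
  then show ?thesis using homog_roots_exist_real[OF assms] by simp
qed

no_notation fps_nth (infixl "$" 75)

section \<open>The order generated by a root\<close>

context conj_roots
begin

text \<open>Complex conjugation as an involution of the index set; its fixed points are the real
  embeddings.\<close>

definition bar :: "'n \<Rightarrow> 'n" where "bar i = (SOME j. a j = cnj (a i))"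

lemma cnj_poly_cpoly: "cnj (poly (cpoly h) x) = poly (cpoly h) (cnj x)"
  by (induction h) auto

lemma root_iff: "poly (cpoly f) x = 0 \<longleftrightarrow> (\<exists>i. x = a i)"
  by (auto simp: cpoly_f_prod poly_prod)

lemma a_bar: "a (bar i) = cnj (a i)"
proof -
  have "poly (cpoly f) (cnj (a i)) = 0" by (simp add: cnj_poly_cpoly[symmetric] root)
  then have "\<exists>j. a j = cnj (a i)" unfolding root_iff by metis
  then show ?thesis unfolding bar_def by (rule someI_ex)
qed

lemma a_eq_iff: "a i = a j \<longleftrightarrow> i = j" using inj_a by (auto simp: inj_def)

lemma bar_bar [simp]: "bar (bar i) = i"
  by (simp add: a_eq_iff[symmetric] a_bar)

lemma bar_eq_iff [simp]: "bar i = bar j \<longleftrightarrow> i = j"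
  by (metis bar_bar)

lemma bar_fixed_iff: "bar i = i \<longleftrightarrow> a i \<in> \<real>"
  by (simp add: a_eq_iff[symmetric] a_bar complex_is_Real_iff complex_eq_iff eq_neg_iff_add_eq_0)

text \<open>The canonical embedding of Z[\<alpha>]. Products of vectors are componentwise, so its
  image \<open>Ord\<close> is a subring of C^g.\<close>

definition ov :: "int poly \<Rightarrow> complex ^ 'n" where "ov h = (\<chi> i. poly (cpoly h) (a i))"

definition Ord :: "(complex ^ 'n) set" where "Ord = range ov"

lemma ov_nth [simp]: "ov h $ i = poly (cpoly h) (a i)" by (simp add: ov_def)

lemma ov_simps: "ov (h + k) = ov h + ov k" "ov (h - k) = ov h - ov k" "ov (h * k) = ov h * ov k" "ov 1 = 1"
  "ov 0 = 0" "ov (- h) = - ov h" "ov [:c:] = of_int c"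
  by (simp_all add: vec_eq_iff)
    (induction c rule: int_induct[of _ 0], simp_all add: vec_eq_iff)

lemma Ord_closed: "v \<in> Ord \<Longrightarrow> w \<in> Ord \<Longrightarrow> v + w \<in> Ord" "v \<in> Ord \<Longrightarrow> w \<in> Ord \<Longrightarrow> v - w \<in> Ord"
  "v \<in> Ord \<Longrightarrow> w \<in> Ord \<Longrightarrow> v * w \<in> Ord" "1 \<in> Ord" "0 \<in> Ord" "v \<in> Ord \<Longrightarrow> - v \<in> Ord" "of_int c \<in> Ord"
  unfolding Ord_def by (auto simp: ov_simps[symmetric])

lemma Ord_bar: "v \<in> Ord \<Longrightarrow> v $ bar i = cnj (v $ i)"
  by (auto simp: Ord_def a_bar cnj_poly_cpoly)

lemma Ord_zero_iff: "v \<in> Ord \<Longrightarrow> v $ i = 0 \<Longrightarrow> v = 0"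
  unfolding Ord_def vec_eq_iff using irr by auto

definition cv :: "(nat \<Rightarrow> int) \<Rightarrow> complex ^ 'n" where "cv m = (\<chi> i. \<Sum>k<g. of_int (m k) * a i ^ k)"

lemma cv_nth: "cv m $ i = (\<Sum>k<g. of_int (m k) * a i ^ k)" by (simp add: cv_def)

lemma cv_in_Ord: "cv m \<in> Ord"
proof -
  have "cv m = ov (\<Sum>k<g. monom (m k) k)"
  proof -
    have "cpoly (\<Sum>k<g. monom (m k) k) = (\<Sum>k<g. monom (of_int (m k)) k)"
      by (rule poly_eqI) (simp add: coeff_sum coeff_monom of_int_sum if_distrib cong: if_cong)
    then show ?thesis by (simp add: vec_eq_iff cv_nth poly_sum poly_monom)
  qed
  then show ?thesis by (simp add: Ord_def)
qed

lemma Ord_cv: assumes "v \<in> Ord" obtains m where "v = cv m"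
proof -
  obtain h where h: "v = ov h" using assms by (auto simp: Ord_def)
  have "\<exists>b. (\<forall>l. b l \<in> \<int>) \<and> (\<forall>i. poly (cpoly h) (a i) = (\<Sum>l<g. b l * a i ^ l))"
    by (rule reduce_at_roots[OF ring_closed_Ints cpoly_in[of f] _ _ root cpoly_in])
      (use monic_f degree_f in simp_all)
  then obtain b where b: "\<And>l. b l \<in> \<int>" "\<And>i. poly (cpoly h) (a i) = (\<Sum>l<g. b l * a i ^ l)" by blast
  have "\<forall>l. \<exists>n. b l = of_int n" using b(1) by (metis Ints_cases)
  then obtain m where m: "\<And>l. b l = of_int (m l)" by metis
  show thesis by (rule that[of m]) (simp add: h vec_eq_iff cv_nth b(2) m)
qed

lemma cv_coeff: "k < g \<Longrightarrow> of_int (m k) = (\<Sum>i\<in>UNIV. coeff (lag i) k * cv m $ i)"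
proof -
  assume k: "k < g"
  define q1 where "q1 = (\<Sum>l<g. monom (complex_of_int (m l)) l)"
  define q2 where "q2 = (\<Sum>i\<in>UNIV. smult (cv m $ i) (lag i))"
  have g0: "0 < g" using k by simp
  have d1: "degree q1 < g" unfolding q1_def
    by (rule degree_sum_less) (use g0 in \<open>auto intro: le_less_trans[OF degree_monom_le]\<close>)
  have d2: "degree q2 < g" unfolding q2_def
    by (rule degree_sum_less) (use g0 in \<open>auto simp: degree_lag\<close>)
  have "q1 - q2 = 0"
  proof (rule zero_if_roots)
    show "degree (q1 - q2) < g" using d1 d2 by (rule degree_diff_less)
    show "poly (q1 - q2) (a j) = 0" for j
      by (simp add: q1_def q2_def poly_sum poly_monom cv_nth poly_lag if_distrib cong: if_cong)
  qed
  then have "coeff q1 k = coeff q2 k" by simp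
  moreover have "coeff q1 k = of_int (m k)" using k by (simp add: q1_def coeff_sum coeff_monom)
  ultimately show ?thesis by (simp add: q2_def coeff_sum mult.commute)
qed

lemma cv_inj: "cv m = cv n \<Longrightarrow> k < g \<Longrightarrow> m k = n k"
  using cv_coeff[of k m] cv_coeff[of k n] by (metis of_int_eq_iff)

lemma cv_cong: "(\<And>k. k < g \<Longrightarrow> m k = n k) \<Longrightarrow> cv m = cv n"
  by (simp add: vec_eq_iff cv_nth)

text \<open>By Lagrange interpolation the integer coordinates in the power basis are bounded in
  terms of the conjugates.\<close>

lemma finite_bounded_Ord: "finite {v\<in>Ord. \<forall>i. cmod (v $ i) \<le> B}"
proof -
  define C where "C k = (\<Sum>i\<in>UNIV. cmod (coeff (lag i) k) * B)" for k
  define F where "F = PiE {..<g} (\<lambda>k. {-\<lceil>C k\<rceil>..\<lceil>C k\<rceil>})"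
  have "{v\<in>Ord. \<forall>i. cmod (v $ i) \<le> B} \<subseteq> cv ` F"
  proof safe
    fix v assume v: "v \<in> Ord" "\<forall>i. cmod (v $ i) \<le> B"
    obtain m where m: "v = cv m" using Ord_cv[OF v(1)] .
    have "- \<lceil>C k\<rceil> \<le> m k \<and> m k \<le> \<lceil>C k\<rceil>" if k: "k < g" for k
    proof -
      have "real_of_int \<bar>m k\<bar> = cmod (of_int (m k))" by simp
      also have "\<dots> \<le> (\<Sum>i\<in>UNIV. cmod (coeff (lag i) k * v $ i))"
        unfolding cv_coeff[OF k] m by (rule norm_sum)
      also have "\<dots> \<le> C k" unfolding C_def norm_mult using v(2) by (intro sum_mono mult_left_mono) auto
      finally show ?thesis by linarith
    qed
    then have "restrict m {..<g} \<in> F" by (auto simp: F_def)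
    moreover have "v = cv (restrict m {..<g})" unfolding m by (rule cv_cong) simp
    ultimately show "v \<in> cv ` F" by blast
  qed
  moreover have "finite F" unfolding F_def by (intro finite_PiE) auto
  ultimately show ?thesis by (meson finite_imageI finite_subset)
qed

lemma norm_Ord:
  assumes "v \<in> Ord" obtains N :: int where "(\<Prod>i\<in>UNIV. v $ i) = of_int N" "v \<noteq> 0 \<Longrightarrow> N \<noteq> 0"
proof -
  obtain h where h: "v = ov h" using assms by (auto simp: Ord_def)
  have "(\<Prod>i\<in>UNIV. poly (cpoly h) (a i)) \<in> \<int>" by (rule norm_in[OF splits_over_Ints cpoly_in])
  then obtain N where N: "(\<Prod>i\<in>UNIV. poly (cpoly h) (a i)) = of_int N" by (elim Ints_cases)
  have "N \<noteq> 0" if "v \<noteq> 0"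
  proof
    assume "N = 0"
    then have "(\<Prod>i\<in>UNIV. v $ i) = 0" using N h by simp
    then obtain i where "v $ i = 0" by auto
    then show False using Ord_zero_iff[OF assms] that by blast
  qed
  then show thesis using that N h by simp
qed

text \<open>The characteristic polynomial of \<open>v\<close> is integral and annihilates \<open>v\<close>, so the norm of \<open>v\<close> is
  a multiple of \<open>v\<close> in the order.\<close>

lemma norm_cofactor:
  assumes v: "v \<in> Ord" and N: "(\<Prod>i\<in>UNIV. v $ i) = of_int N"
  obtains w where "w \<in> Ord" "v * w = of_int N"
proof -
  obtain h where h: "v = ov h" using v by (auto simp: Ord_def)
  define G where "G = [:[:0, 1:]:] - map_poly (\<lambda>c. [:c:]) (cpoly h)"
  note R = ring_closed_Ints[where 'a = complex]
  have G: "G \<in> coeffs_in (coeffs_in \<int>)" unfolding G_def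
    by (intro ring_closed_diff[OF ring_closed_coeffs_in[OF ring_closed_coeffs_in[OF R]]]
      coeffs_in_const[OF ring_closed_coeffs_in[OF R]] coeffs_in_X[OF R] map_poly_const_in[OF R] cpoly_in)
  have "poly G [:a i:] = [:- v $ i, 1:]" for i
    by (simp add: G_def poly_map_poly_const h)
  then have "(\<Prod>i\<in>UNIV. [:- v $ i, 1:]) \<in> coeffs_in \<int>"
    using norm_in[OF splits_over_poly[OF splits_over_Ints] G] by simp
  then obtain q where q: "(\<Prod>i\<in>UNIV. [:- v $ i, 1:]) = cpoly q" by (rule coeffs_in_Ints_cases)
  obtain q0 q1 where q01: "q = pCons q0 q1" by (cases q)
  have "poly (cpoly q) 0 = (\<Prod>i\<in>UNIV. - v $ i)" unfolding q[symmetric] poly_prod by simp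
  also have "\<dots> = (-1) ^ g * of_int N" by (simp add: prod_uminus N g_card)
  finally have q0: "complex_of_int q0 = of_int ((-1) ^ g * N)" by (simp add: q01)
  have ev: "poly (cpoly q) (v $ i) = 0" for i
    unfolding q[symmetric] poly_prod by (rule prod_zero) (auto intro!: bexI[of _ i])
  define w where "w = ov (smult (- ((-1) ^ g)) (pcompose q1 h))"
  have "v $ i * w $ i = of_int N" for i
  proof -
    have "v $ i * poly (cpoly q1) (v $ i) = - of_int q0" using ev[of i] by (simp add: q01 add_eq_0_iff2)
    moreover have "w $ i = - ((-1) ^ g) * poly (cpoly q1) (v $ i)"
      by (simp add: w_def cpoly_pcompose poly_pcompose h)
    then have "v $ i * w $ i = - ((-1) ^ g) * (v $ i * poly (cpoly q1) (v $ i))"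
      by (simp only: mult.left_commute)
    ultimately have "v $ i * w $ i = - ((-1) ^ g) * - of_int q0" by (simp only:)
    also have "\<dots> = ((-1) ^ g * (-1) ^ g) * of_int N" unfolding q0 by simp
    also have "(-1) ^ g * (-1) ^ g = (1::complex)" by (simp flip: power_mult_distrib)
    finally show ?thesis by simp
  qed
  moreover have "(of_int N :: complex ^ 'n) $ i = of_int N" for i
    by (induction N rule: int_induct[of _ 0]) simp_all
  ultimately have "v * w = of_int N" by (simp add: vec_eq_iff)
  then show thesis using that[of w] by (simp add: w_def Ord_def)
qed

lemma of_int_vec_nth [simp]: "(of_int N :: complex ^ 'n) $ i = of_int N"
  by (induction N rule: int_induct[of _ 0]) simp_all

definition OU :: "(complex ^ 'n) set" where "OU = {v\<in>Ord. \<exists>w\<in>Ord. v * w = 1}"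

text \<open>The norm of a unit is an integer dividing 1; conversely \<open>norm_cofactor\<close>
  provides the inverse up to sign.\<close>

lemma OU_iff: "v \<in> OU \<longleftrightarrow> v \<in> Ord \<and> cmod (\<Prod>i\<in>UNIV. v $ i) = 1"
proof safe
  assume v: "v \<in> OU"
  then obtain w where w: "v \<in> Ord" "w \<in> Ord" "v * w = 1" by (auto simp: OU_def)
  obtain N where N: "(\<Prod>i\<in>UNIV. v $ i) = of_int N" using norm_Ord[OF w(1)] by blast
  obtain M where M: "(\<Prod>i\<in>UNIV. w $ i) = of_int M" using norm_Ord[OF w(2)] by blast
  have "(\<Prod>i\<in>UNIV. v $ i * w $ i) = 1" using w(3) by (simp add: vec_eq_iff)
  then have "of_int (N * M) = (1::complex)" by (simp add: prod.distrib N M)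
  then have "N * M = 1" by (simp only: of_int_eq_1_iff)
  then have "\<bar>N\<bar> = 1" using zmult_eq_1_iff by auto
  then show "cmod (\<Prod>i\<in>UNIV. v $ i) = 1" unfolding N by (simp add: norm_of_int)
  show "v \<in> Ord" using w by simp
next
  assume v: "v \<in> Ord" "cmod (\<Prod>i\<in>UNIV. v $ i) = 1"
  obtain N where N: "(\<Prod>i\<in>UNIV. v $ i) = of_int N" using norm_Ord[OF v(1)] by blast
  then have "real_of_int \<bar>N\<bar> = 1" using v(2) by (simp add: norm_of_int)
  then have "N = 1 \<or> N = -1" by linarith
  obtain w where w: "w \<in> Ord" "v * w = of_int N" using norm_cofactor[OF v(1) N] .
  have "v * (of_int N * w) = of_int N * of_int N" using w(2) by (metis mult.left_commute)
  also have "\<dots> = 1" using \<open>N = 1 \<or> N = -1\<close> by auto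
  finally show "v \<in> OU" using v(1) w(1) Ord_closed(3)[OF Ord_closed(7) w(1)] by (auto simp: OU_def)
qed

lemma OU_closed: "u \<in> OU \<Longrightarrow> v \<in> OU \<Longrightarrow> u * v \<in> OU" "1 \<in> OU" "-1 \<in> OU"
  by (simp_all add: OU_iff Ord_closed prod.distrib norm_mult norm_power)

lemma OU_nonzero: "u \<in> OU \<Longrightarrow> u $ i \<noteq> 0"
proof
  assume u: "u \<in> OU" "u $ i = 0"
  have "(\<Prod>i\<in>UNIV. u $ i) = 0" by (rule prod_zero) (use u in auto)
  moreover have "cmod (\<Prod>i\<in>UNIV. u $ i) = 1" using u(1) by (simp only: OU_iff)
  ultimately show False by (simp only: norm_zero zero_neq_one)
qed

lemma OU_inverse: "u \<in> OU \<Longrightarrow> (\<chi> i. inverse (u $ i)) \<in> OU"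
proof -
  assume u: "u \<in> OU"
  then obtain w where w: "w \<in> Ord" "u * w = 1" "u \<in> Ord" by (auto simp: OU_def)
  have "w = (\<chi> i. inverse (u $ i))"
    using w(2) by (auto simp: vec_eq_iff intro!: inverse_unique[symmetric])
  moreover have "w \<in> OU" using w by (auto simp: OU_def mult.commute intro!: bexI[of _ u])
  ultimately show ?thesis by simp
qed

end

section \<open>Complex conjugation and representatives of the places\<close>

context conj_roots
begin

lemma lag_bar: "coeff (lag (bar i)) k = cnj (coeff (lag i) k)"
proof -
  have m: "poly (map_poly cnj p) z = cnj (poly p (cnj z))" for p z
    by (induction p) (simp_all add: map_poly_pCons)
  have "map_poly cnj (lag i) - lag (bar i) = 0"
  proof (rule zero_if_roots)
    have "degree (map_poly cnj (lag i)) < g" using map_poly_degree_leq[of cnj "lag i"] degree_lag[of i] by simp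
    then show "degree (map_poly cnj (lag i) - lag (bar i)) < g" using degree_lag by (rule degree_diff_less)
    show "poly (map_poly cnj (lag i) - lag (bar i)) (a j) = 0" for j
      by (simp add: m a_bar[symmetric] poly_lag) (metis bar_bar)
  qed
  then have "coeff (map_poly cnj (lag i)) k = coeff (lag (bar i)) k" by simp
  then show ?thesis by (simp add: coeff_map_poly)
qed

text \<open>An injective numbering selects one index from each conjugate pair. The count is
  inclusion-exclusion for P and its conjugate: their union has g elements and their intersection r,
  so 2 |P| = g + r.\<close>

lemma representatives:
  assumes rs: "card {i. a i \<in> \<real>} = r" "r + 2 * s = g"
  obtains P where "\<And>i. i \<in> P \<or> bar i \<in> P" "\<And>p. p \<in> P \<Longrightarrow> bar p \<in> P \<Longrightarrow> bar p = p" "card P = r + s"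
proof -
  obtain idx :: "'n \<Rightarrow> nat" where idx: "inj idx" using finite_imp_inj_to_nat_seg[of "UNIV :: 'n set"] by auto
  define P where "P = {i. idx i \<le> idx (bar i)}"
  define Fx where "Fx = {i. bar i = i}"
  have Pfix: "bar p = p" if "p \<in> P" "bar p \<in> P" for p using that injD[OF idx, of p "bar p"] by (auto simp: P_def)
  have cover: "i \<in> P \<or> bar i \<in> P" for i by (auto simp: P_def)
  have Fr: "card Fx = r" using rs(1) by (simp add: Fx_def bar_fixed_iff)
  have "card (P \<union> bar ` P) + card (P \<inter> bar ` P) = card P + card (bar ` P)"
    by (rule card_Un_Int[symmetric]) auto
  moreover have "card (bar ` P) = card P" by (rule card_image) (auto simp: inj_on_def)
  moreover have "P \<union> bar ` P = UNIV" using cover by (metis UNIV_eq_I UnI1 UnI2 bar_bar imageI)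
  moreover have "P \<inter> bar ` P = Fx"
  proof
    show "P \<inter> bar ` P \<subseteq> Fx"
    proof
      fix x assume x: "x \<in> P \<inter> bar ` P"
      then have "bar x \<in> P" by auto
      then show "x \<in> Fx" using x Pfix[of x] by (simp add: Fx_def)
    qed
    show "Fx \<subseteq> P \<inter> bar ` P"
    proof
      fix x assume "x \<in> Fx"
      then have b: "bar x = x" by (simp add: Fx_def)
      then have "x \<in> P" by (simp add: P_def)
      then show "x \<in> P \<inter> bar ` P" using b by (metis IntI imageI)
    qed
  qed
  ultimately have "card P = r + s" using Fr rs(2) g_card by simp
  then show thesis using that cover Pfix by blast
qed

end

section \<open>Generic parameters\<close>

text \<open>Names for the elements of the subring generated by a sequence; countability of the names
  makes that subring countable.\<close>

datatype ring_term = Gen nat | Diff ring_term ring_term | Mult ring_term ring_term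

instance ring_term :: countable by countable_datatype

primrec ring_eval :: "(nat \<Rightarrow> 'a::comm_ring_1) \<Rightarrow> ring_term \<Rightarrow> 'a" where
  "ring_eval v (Gen n) = v n"
| "ring_eval v (Diff x y) = ring_eval v x - ring_eval v y"
| "ring_eval v (Mult x y) = ring_eval v x * ring_eval v y"

lemma countable_ring_closed:
  assumes "countable (B :: 'a::comm_ring_1 set)"
  obtains K where "countable K" "ring_closed K" "B \<subseteq> K"
proof
  define v where "v = from_nat_into (insert 1 B)"
  have v: "range v = insert 1 B" unfolding v_def using assms by (intro range_from_nat_into) auto
  show "countable (range (ring_eval v))" by (rule countable_image) (rule countableI_type)
  have gen: "insert 1 B \<subseteq> range (ring_eval v)"
  proof
    fix x assume "x \<in> insert 1 B"
    then obtain n where "x = v n" using v by (metis imageE)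
    then have "x = ring_eval v (Gen n)" by simp
    then show "x \<in> range (ring_eval v)" by (rule range_eqI)
  qed
  then show "B \<subseteq> range (ring_eval v)" by blast
  show "ring_closed (range (ring_eval v))"
    unfolding ring_closed_def
  proof (intro conjI ballI)
    show "1 \<in> range (ring_eval v)" using gen by blast
    fix x y assume "x \<in> range (ring_eval v)" "y \<in> range (ring_eval v)"
    then obtain x' y' where "x = ring_eval v x'" "y = ring_eval v y'" by blast
    then have "x - y = ring_eval v (Diff x' y')" "x * y = ring_eval v (Mult x' y')" by simp_all
    then show "x - y \<in> range (ring_eval v)" "x * y \<in> range (ring_eval v)" by (metis rangeI)+
  qed
qed

text \<open>Each nonzero polynomial excludes finitely many reals, so a countable family cannot
  exhaust the interval from 0 to 1.\<close>

lemma avoid_roots: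
  assumes "countable (\<P> :: complex poly set)"
  obtains \<theta> :: real where "\<theta> > 0" "\<And>p. p \<in> \<P> \<Longrightarrow> poly p (of_real \<theta>) = 0 \<Longrightarrow> p = 0"
proof -
  define Z where "Z = (\<Union>p\<in>\<P> - {0}. {x::real. poly p (of_real x) = 0})"
  have "countable Z" unfolding Z_def
  proof (rule countable_UN)
    show "countable (\<P> - {0})" using assms by simp
    fix p :: "complex poly" assume "p \<in> \<P> - {0}"
    then have "finite {z. poly p z = 0}" by (intro poly_roots_finite) simp
    then have "finite (of_real -` {z. poly p z = 0} :: real set)"
      by (rule finite_vimageI) (rule inj_of_real)
    then show "countable {x::real. poly p (of_real x) = 0}" by (intro countable_finite) (simp add: vimage_def)
  qed
  then have "\<exists>\<theta>\<in>{0<..<1::real}. \<theta> \<notin> Z"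
    using uncountable_open_interval[of "0::real" 1] by (metis countable_subset subsetI zero_less_one)
  then obtain \<theta> where "0 < \<theta>" "\<theta> \<notin> Z" by auto
  then show thesis by (intro that[of \<theta>]) (auto simp: Z_def)
qed

text \<open>Up to signs and factors 2 these are the matrix entries of the operator with eigenvalues
  1 and -1 on the two Hodge types, see \<open>ef_ii\<close>.\<close>

definition gp :: "complex \<Rightarrow> complex \<Rightarrow> complex" where "gp t u = 1 / (t - u)"
definition gq :: "complex \<Rightarrow> complex \<Rightarrow> complex" where "gq t u = (t + u) / (t - u)"
definition gr :: "complex \<Rightarrow> complex \<Rightarrow> complex" where "gr t u = t * u / (t - u)"

text \<open>At a real place t is paired with its own conjugate. For t = \<theta> + i/\<theta>,
  multiplication by 2 i \<theta> turns the three functions into \<theta>^2, 2 \<theta>^3 and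
  \<theta>^4 + 1 and the constant e into 2 i e \<theta>. These polynomials are independent, and only
  countably many \<theta> have to be avoided.\<close>

lemma generic_real:
  assumes "countable K" "ring_closed K"
  obtains t where "t \<noteq> cnj t"
    "\<And>e A B C. e \<in> K \<Longrightarrow> A \<in> K \<Longrightarrow> B \<in> K \<Longrightarrow> C \<in> K \<Longrightarrow>
      e + A * gp t (cnj t) + B * gq t (cnj t) + C * gr t (cnj t) = 0 \<Longrightarrow> A = 0 \<and> B = 0 \<and> C = 0"
proof -
  define Q where "Q = (\<lambda>(e, A, B, C). [:C, 2 * \<i> * e, A, 2 * B, C:])"
  have "countable (Q ` (K \<times> K \<times> K \<times> K))" using assms by (intro countable_image countable_SIGMA) auto
  then obtain \<theta> :: real where \<theta>: "\<theta> > 0" "\<And>p. p \<in> Q ` (K \<times> K \<times> K \<times> K) \<Longrightarrow> poly p (of_real \<theta>) = 0 \<Longrightarrow> p = 0"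
    using avoid_roots by blast
  define t where "t = of_real \<theta> + \<i> / of_real \<theta>"
  have th: "complex_of_real \<theta> \<noteq> 0" using \<theta>(1) by simp
  have ct: "cnj t = of_real \<theta> - \<i> / of_real \<theta>" by (simp add: t_def)
  have d: "t - cnj t = 2 * \<i> / of_real \<theta>" unfolding ct by (simp add: t_def)
  have p: "gp t (cnj t) = of_real \<theta> / (2 * \<i>)" unfolding gp_def d by simp
  have q: "gq t (cnj t) = of_real \<theta> ^ 2 / \<i>" unfolding gq_def d using th
    by (simp add: t_def power2_eq_square)
  have tc: "t * cnj t = of_real \<theta> ^ 2 + 1 / of_real \<theta> ^ 2" unfolding ct
    by (simp add: t_def algebra_simps power2_eq_square)
  have r: "gr t (cnj t) * of_real \<theta> = (of_real \<theta> ^ 4 + 1) / (2 * \<i>)" unfolding gr_def d tc using th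
    by (simp add: field_simps power2_eq_square power4_eq_xxxx)
  show thesis
  proof (rule that[of t])
    show "t \<noteq> cnj t" using d th by (metis diff_self divide_eq_0_iff complex_i_not_zero mult_eq_0_iff zero_neq_numeral)
    fix e A B C assume K: "e \<in> K" "A \<in> K" "B \<in> K" "C \<in> K"
      and z: "e + A * gp t (cnj t) + B * gq t (cnj t) + C * gr t (cnj t) = 0"
    have "poly (Q (e, A, B, C)) (of_real \<theta>) = 
      2 * \<i> * (e + A * (of_real \<theta> / (2 * \<i>)) + B * (of_real \<theta> ^ 2 / \<i>)) * of_real \<theta> + C * (2 * \<i> * ((of_real \<theta> ^ 4 + 1) / (2 * \<i>)))"
      by (simp add: Q_def algebra_simps power2_eq_square power4_eq_xxxx)
    also have "\<dots> = 2 * \<i> * of_real \<theta> * (e + A * gp t (cnj t) + B * gq t (cnj t) + C * gr t (cnj t))"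
      unfolding r[symmetric] p[symmetric] q[symmetric] by (simp only: algebra_simps)
    finally have "poly (Q (e, A, B, C)) (of_real \<theta>) = 0" using z by simp
    then have "Q (e, A, B, C) = 0" using K by (intro \<theta>(2)) auto
    then show "A = 0 \<and> B = 0 \<and> C = 0" by (simp add: Q_def)
  qed
qed

text \<open>Each function of (t', cnj t) is minus the complex conjugate of the same function of (t,
  cnj t'). The family is built so that gp t (cnj t') = P = \<theta> + i \<theta>^2, whose real and
  imaginary parts have different degrees; so A - A' and A + A' appear in different coefficients, and
  likewise for B and C.\<close>

lemma generic_pair:
  assumes "countable K" "ring_closed K"
  obtains t t' where "t \<noteq> cnj t'"
    "\<And>e A B C A' B' C'. e \<in> K \<Longrightarrow> A \<in> K \<Longrightarrow> B \<in> K \<Longrightarrow> C \<in> K \<Longrightarrow> A' \<in> K \<Longrightarrow> B' \<in> K \<Longrightarrow> C' \<in> K \<Longrightarrow>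
      e + (A * gp t (cnj t') + B * gq t (cnj t') + C * gr t (cnj t'))
        + (A' * gp t' (cnj t) + B' * gq t' (cnj t) + C' * gr t' (cnj t)) = 0 \<Longrightarrow>
      A = 0 \<and> B = 0 \<and> C = 0 \<and> A' = 0 \<and> B' = 0 \<and> C' = 0"
proof -
  define Q where "Q = (\<lambda>(e, A, B, C, A', B', C'). [:e + B - B', A - A', \<i> * (A + A') + C - C', 2 * (B - B'),
    2 * \<i> * (B + B'), C - C', \<i> * (C + C'):])"
  have "countable (Q ` (K \<times> K \<times> K \<times> K \<times> K \<times> K \<times> K))" using assms by (intro countable_image countable_SIGMA) auto
  then obtain \<theta> :: real where \<theta>: "\<theta> > 0"
    "\<And>p. p \<in> Q ` (K \<times> K \<times> K \<times> K \<times> K \<times> K \<times> K) \<Longrightarrow> poly p (of_real \<theta>) = 0 \<Longrightarrow> p = 0"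
    using avoid_roots by blast
  define x where "x = complex_of_real \<theta>"
  have x: "x \<noteq> 0" "cnj x = x" using \<theta>(1) by (simp_all add: x_def)
  define P where "P = x * (1 + \<i> * x)"
  have i1: "1 + \<i> * x \<noteq> 0" by (simp add: x_def complex_eq_iff)
  have P: "P \<noteq> 0" "cnj P = x * (1 - \<i> * x)" using x i1 by (simp_all add: P_def)
  define t where "t = x ^ 2 + 1 / P"
  define t' where "t' = x ^ 2"
  have ct': "cnj t' = x ^ 2" by (simp add: t'_def x)
  have ct: "cnj t = x ^ 2 + 1 / cnj P" by (simp add: t_def x)
  have cP: "cnj P \<noteq> 0" using P(1) by simp
  have d: "t - cnj t' = 1 / P" by (simp add: ct' t_def)
  have d': "t' - cnj t = - 1 / cnj P" by (simp add: ct t'_def)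
  have e1: "gp t (cnj t') = P" unfolding gp_def d by simp
  have e2: "gq t (cnj t') = 1 + 2 * P * x ^ 2" unfolding gq_def d ct' t_def using P(1) by (simp add: algebra_simps)
  have e3: "gr t (cnj t') = x ^ 2 + P * x ^ 4" unfolding gr_def d ct' t_def using P(1)
    by (simp add: algebra_simps power4_eq_xxxx power2_eq_square)
  have f1: "gp t' (cnj t) = - cnj P" unfolding gp_def d' by simp
  have f2: "gq t' (cnj t) = - (1 + 2 * cnj P * x ^ 2)" unfolding gq_def d' ct t'_def using cP by (simp add: algebra_simps)
  have f3: "gr t' (cnj t) = - (x ^ 2 + cnj P * x ^ 4)" unfolding gr_def d' ct t'_def using cP
    by (simp add: algebra_simps power4_eq_xxxx power2_eq_square)
  show thesis
  proof (rule that[of t t'])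
    show "t \<noteq> cnj t'" using d P(1) by (metis diff_self divide_eq_0_iff zero_neq_one)
    fix e A B C A' B' C' assume K: "e \<in> K" "A \<in> K" "B \<in> K" "C \<in> K" "A' \<in> K" "B' \<in> K" "C' \<in> K"
      and z: "e + (A * gp t (cnj t') + B * gq t (cnj t') + C * gr t (cnj t'))
        + (A' * gp t' (cnj t) + B' * gq t' (cnj t) + C' * gr t' (cnj t)) = 0"
    have "poly (Q (e, A, B, C, A', B', C')) x = e + (A * (x * (1 + \<i> * x)) + B * (1 + 2 * (x * (1 + \<i> * x)) * x ^ 2)
        + C * (x ^ 2 + (x * (1 + \<i> * x)) * x ^ 4))
      + (A' * - (x * (1 - \<i> * x)) + B' * - (1 + 2 * (x * (1 - \<i> * x)) * x ^ 2) + C' * - (x ^ 2 + (x * (1 - \<i> * x)) * x ^ 4))"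
      by (simp add: Q_def algebra_simps power2_eq_square power4_eq_xxxx)
    then have "poly (Q (e, A, B, C, A', B', C')) (of_real \<theta>) = 0"
      using z unfolding e1 e2 e3 f1 f2 f3 P(2) by (simp add: P_def x_def)
    then have "Q (e, A, B, C, A', B', C') = 0" using K by (intro \<theta>(2)) auto
    then have q: "A - A' = 0" "\<i> * (A + A') + C - C' = 0" "2 * (B - B') = 0" "2 * \<i> * (B + B') = 0" "C - C' = 0" "\<i> * (C + C') = 0"
      by (simp_all only: Q_def prod.case pCons_eq_0_iff)
    have "C + C' = 0" "B + B' = 0" using q(4,6) by simp_all
    moreover have "A + A' = 0" using q(2,5) by simp
    ultimately show "A = 0 \<and> B = 0 \<and> C = 0 \<and> A' = 0 \<and> B' = 0 \<and> C' = 0"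
      using q(1,3,5) by (auto simp: add_eq_0_iff)
  qed
qed

section \<open>Simultaneous genericity at all places\<close>

context conj_roots
begin

definition gsum :: "('n \<Rightarrow> complex) \<Rightarrow> ('n \<Rightarrow> complex) \<Rightarrow> ('n \<Rightarrow> complex) \<Rightarrow> ('n \<Rightarrow> complex) \<Rightarrow> 'n \<Rightarrow> complex" where
  "gsum t A B C i = A i * gp (t i) (cnj (t (bar i))) + B i * gq (t i) (cnj (t (bar i))) + C i * gr (t i) (cnj (t (bar i)))"

text \<open>Induction over the conjugation orbits. \<open>K2\<close> is \<open>K\<close> with the
  function values at the chosen parameters adjoined and is still countable, so a relation over F
  becomes a relation at the new orbit whose constant term absorbs the old orbits. Once the new
  coefficients vanish, the induction hypothesis over \<open>K\<close> finishes.\<close>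

lemma generic_on:
  assumes "finite F" "bar ` F \<subseteq> F" "countable K" "ring_closed K"
  shows "\<exists>t. (\<forall>i\<in>F. t i \<noteq> cnj (t (bar i))) \<and>
    (\<forall>e A B C. e \<in> K \<longrightarrow> (\<forall>i. A i \<in> K \<and> B i \<in> K \<and> C i \<in> K) \<longrightarrow> e + (\<Sum>i\<in>F. gsum t A B C i) = 0 \<longrightarrow>
      (\<forall>i\<in>F. A i = 0 \<and> B i = 0 \<and> C i = 0))"
  using assms
proof (induction F rule: finite_psubset_induct)
  case (psubset F)
  show ?case
  proof (cases "F = {}")
    case False
    then obtain s where s: "s \<in> F" by blast
    define F' where "F' = F - {s, bar s}"
    have bs: "bar s \<in> F" using s psubset.prems(1) by blast
    have F'b: "bar ` F' \<subseteq> F'" using psubset.prems(1) unfolding F'_def by (auto simp: image_subset_iff)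
    obtain t where t: "\<And>i. i \<in> F' \<Longrightarrow> t i \<noteq> cnj (t (bar i))"
      "\<And>e A B C. e \<in> K \<Longrightarrow> (\<forall>i. A i \<in> K \<and> B i \<in> K \<and> C i \<in> K) \<Longrightarrow> e + (\<Sum>i\<in>F'. gsum t A B C i) = 0 \<Longrightarrow>
        (\<forall>i\<in>F'. A i = 0 \<and> B i = 0 \<and> C i = 0)"
      using psubset.IH[of F'] F'b psubset.prems s unfolding F'_def by blast
    obtain K2 where K2: "countable K2" "ring_closed K2"
      "K \<union> (\<Union>i. {gp (t i) (cnj (t (bar i))), gq (t i) (cnj (t (bar i))), gr (t i) (cnj (t (bar i)))}) \<subseteq> K2"
    proof (rule countable_ring_closed)
      show "countable (K \<union> (\<Union>i. {gp (t i) (cnj (t (bar i))), gq (t i) (cnj (t (bar i))), gr (t i) (cnj (t (bar i)))}))"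
        by (intro countable_Un[OF psubset.prems(2)] countable_UN) (auto intro: countable_finite)
    qed
    have KK2: "\<And>x. x \<in> K \<Longrightarrow> x \<in> K2" using K2(3) by blast
    have gK2: "e + (\<Sum>i\<in>F'. gsum t A B C i) \<in> K2" if "e \<in> K" "\<forall>i. A i \<in> K \<and> B i \<in> K \<and> C i \<in> K" for e A B C
    proof -
      have q: "gp (t i) (cnj (t (bar i))) \<in> K2" "gq (t i) (cnj (t (bar i))) \<in> K2" "gr (t i) (cnj (t (bar i))) \<in> K2" for i
        using K2(3) by blast+
      show ?thesis unfolding gsum_def
        by (intro ring_closed_add[OF K2(2)] ring_closed_sum[OF K2(2)] ring_closed_mult[OF K2(2)]) (simp_all add: q KK2 that)
    qed
    have step: ?thesis if t2: "\<And>i. i \<in> F' \<Longrightarrow> t2 i = t i" "t2 s \<noteq> cnj (t2 (bar s))" "t2 (bar s) \<noteq> cnj (t2 s)"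
      and new: "\<And>e A B C. e \<in> K2 \<Longrightarrow> (\<forall>i. A i \<in> K2 \<and> B i \<in> K2 \<and> C i \<in> K2) \<Longrightarrow>
          e + (\<Sum>i\<in>{s, bar s}. gsum t2 A B C i) = 0 \<Longrightarrow> \<forall>i\<in>{s, bar s}. A i = 0 \<and> B i = 0 \<and> C i = 0" for t2
    proof (intro exI[of _ t2] conjI ballI allI impI)
      fix i assume "i \<in> F"
      then show "t2 i \<noteq> cnj (t2 (bar i))" using t(1)[of i] t2 F'b by (cases "i \<in> F'") (auto simp: F'_def)
    next
      fix e A B C i assume e: "e \<in> K" "\<forall>i. A i \<in> K \<and> B i \<in> K \<and> C i \<in> K" and z: "e + (\<Sum>i\<in>F. gsum t2 A B C i) = 0"
        and i: "i \<in> F"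
      have un: "F = F' \<union> {s, bar s}" using s bs by (auto simp: F'_def)
      have "(\<Sum>i\<in>F. gsum t2 A B C i) = (\<Sum>i\<in>F'. gsum t2 A B C i) + (\<Sum>i\<in>{s, bar s}. gsum t2 A B C i)"
        unfolding un by (rule sum.union_disjoint) (use psubset.hyps in \<open>auto simp: F'_def\<close>)
      also have "(\<Sum>i\<in>F'. gsum t2 A B C i) = (\<Sum>i\<in>F'. gsum t A B C i)"
        by (rule sum.cong) (use t2(1) F'b in \<open>auto simp: gsum_def image_subset_iff\<close>)
      finally have z2: "(e + (\<Sum>i\<in>F'. gsum t A B C i)) + (\<Sum>i\<in>{s, bar s}. gsum t2 A B C i) = 0" using z by (simp add: add.assoc)
      have AK2: "\<forall>i. A i \<in> K2 \<and> B i \<in> K2 \<and> C i \<in> K2" using e(2) KK2 by blast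
      have z3: "\<forall>i\<in>{s, bar s}. A i = 0 \<and> B i = 0 \<and> C i = 0" by (rule new[OF gK2[OF e] AK2 z2])
      then have "(\<Sum>i\<in>{s, bar s}. gsum t2 A B C i) = 0" by (intro sum.neutral) (auto simp: gsum_def)
      then have "e + (\<Sum>i\<in>F'. gsum t A B C i) = 0" using z2 by simp
      then have "\<forall>i\<in>F'. A i = 0 \<and> B i = 0 \<and> C i = 0" by (rule t(2)[OF e])
      then show "A i = 0" "B i = 0" "C i = 0" using z3 i un by blast+
    qed
    show ?thesis
    proof (cases "bar s = s")
      case True
      obtain \<tau> where \<tau>: "\<tau> \<noteq> cnj \<tau>" "\<And>e A B C. e \<in> K2 \<Longrightarrow> A \<in> K2 \<Longrightarrow> B \<in> K2 \<Longrightarrow> C \<in> K2 \<Longrightarrow>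
        e + A * gp \<tau> (cnj \<tau>) + B * gq \<tau> (cnj \<tau>) + C * gr \<tau> (cnj \<tau>) = 0 \<Longrightarrow> A = 0 \<and> B = 0 \<and> C = 0"
        using generic_real[OF K2(1,2)] by blast
      show ?thesis
      proof (rule step[of "t(s := \<tau>)"])
        fix e A B C assume "e \<in> K2" "\<forall>i. A i \<in> K2 \<and> B i \<in> K2 \<and> C i \<in> K2"
          "e + (\<Sum>i\<in>{s, bar s}. gsum (t(s := \<tau>)) A B C i) = 0"
        then show "\<forall>i\<in>{s, bar s}. A i = 0 \<and> B i = 0 \<and> C i = 0"
          using \<tau>(2)[of e "A s" "B s" "C s"] True by (simp add: gsum_def add.assoc)
      qed (use \<tau>(1) True in \<open>auto simp: F'_def\<close>)
    next
      case False
      obtain \<tau> \<tau>' where \<tau>: "\<tau> \<noteq> cnj \<tau>'" "\<And>e A B C A' B' C'. e \<in> K2 \<Longrightarrow> A \<in> K2 \<Longrightarrow> B \<in> K2 \<Longrightarrow> C \<in> K2 \<Longrightarrow>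
        A' \<in> K2 \<Longrightarrow> B' \<in> K2 \<Longrightarrow> C' \<in> K2 \<Longrightarrow>
        e + (A * gp \<tau> (cnj \<tau>') + B * gq \<tau> (cnj \<tau>') + C * gr \<tau> (cnj \<tau>'))
          + (A' * gp \<tau>' (cnj \<tau>) + B' * gq \<tau>' (cnj \<tau>) + C' * gr \<tau>' (cnj \<tau>)) = 0 \<Longrightarrow>
        A = 0 \<and> B = 0 \<and> C = 0 \<and> A' = 0 \<and> B' = 0 \<and> C' = 0"
        using generic_pair[OF K2(1,2)] by blast
      have "\<tau>' \<noteq> cnj \<tau>" using \<tau>(1) by auto
      show ?thesis
      proof (rule step[of "t(s := \<tau>, bar s := \<tau>')"])
        fix e A B C assume "e \<in> K2" "\<forall>i. A i \<in> K2 \<and> B i \<in> K2 \<and> C i \<in> K2"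
          "e + (\<Sum>i\<in>{s, bar s}. gsum (t(s := \<tau>, bar s := \<tau>')) A B C i) = 0"
        then show "\<forall>i\<in>{s, bar s}. A i = 0 \<and> B i = 0 \<and> C i = 0"
          using \<tau>(2)[of e "A s" "B s" "C s" "A (bar s)" "B (bar s)" "C (bar s)"] False not_sym[OF False]
          by (simp add: gsum_def add.assoc)
      qed (use \<tau>(1) \<open>\<tau>' \<noteq> cnj \<tau>\<close> False in \<open>auto simp: F'_def\<close>)
    qed
  qed auto
qed

lemma generic_parameters:
  assumes "countable B"
  obtains K t where "ring_closed K" "B \<subseteq> K" "\<And>i. t i \<noteq> cnj (t (bar i))"
    "\<And>A B C i. (\<And>i. A i \<in> K \<and> B i \<in> K \<and> C i \<in> K) \<Longrightarrow> (\<Sum>i\<in>UNIV. gsum t A B C i) = 0 \<Longrightarrow> A i = 0 \<and> B i = 0 \<and> C i = 0"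
proof -
  obtain K where K: "countable K" "ring_closed K" "B \<subseteq> K" using countable_ring_closed[OF assms] .
  from generic_on[OF finite subset_UNIV K(1,2)] obtain t where t: "\<forall>i\<in>UNIV. t i \<noteq> cnj (t (bar i))"
    "\<forall>e A B C. e \<in> K \<longrightarrow> (\<forall>i. A i \<in> K \<and> B i \<in> K \<and> C i \<in> K) \<longrightarrow> e + (\<Sum>i\<in>UNIV. gsum t A B C i) = 0 \<longrightarrow>
      (\<forall>i\<in>UNIV. A i = 0 \<and> B i = 0 \<and> C i = 0)"
    by (elim exE conjE) (rule that)
  show thesis
  proof (rule that[of K t])
    fix A B C i assume "\<And>i. A i \<in> K \<and> B i \<in> K \<and> C i \<in> K" "(\<Sum>i\<in>UNIV. gsum t A B C i) = 0"
    then show "A i = 0 \<and> B i = 0 \<and> C i = 0" using t(2)[rule_format, of 0 A B C i] ring_closed_0[OF K(2)] by simp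
  qed (use K t(1) in auto)
qed

end

section \<open>The lattice and its coordinates\<close>

lemmas complex_scaleR_of_real = scaleR_conv_of_real[where 'a = complex]

text \<open>\<open>K\<close> replaces the field of all conjugates: with the roots and the Lagrange
  coefficients it contains every coordinate of a rational object. By \<open>t_ne\<close>,
  coordinates with respect to 1 and t determine v_i and the conjugate of v_(bar i), and
  conversely.\<close>

locale generic_torus = homog_roots f a g for f :: "int poly" and a :: "'n::finite \<Rightarrow> complex" and g :: nat +
  fixes K :: "complex set" and t :: "'n \<Rightarrow> complex"
  assumes K: "ring_closed K" and Rats_K: "x \<in> \<rat> \<Longrightarrow> x \<in> K" and a_K: "a i \<in> K" and lag_K: "coeff (lag i) k \<in> K"
    and t_ne: "t i \<noteq> cnj (t (bar i))"
    and generic: "(\<And>i. A i \<in> K \<and> B i \<in> K \<and> C i \<in> K) \<Longrightarrow> (\<Sum>i\<in>UNIV. gsum t A B C i) = 0 \<Longrightarrow>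
      A j = 0 \<and> B j = 0 \<and> C j = 0"

lemma (in homog_roots) generic_torus_exists: "\<exists>K t. generic_torus f a g K t"
proof -
  let ?B = "\<rat> \<union> (range a \<union> (\<Union>i k. {coeff (lag i) k}))"
  have c: "countable ?B" unfolding Rats_def by (intro countable_Un countable_UN countable_image countableI_type) simp
  show ?thesis
  proof (rule generic_parameters[OF c])
    fix K t assume h: "ring_closed K" "?B \<subseteq> K" "\<And>i. t i \<noteq> cnj (t (bar i))"
      "\<And>A B C i. (\<And>i. A i \<in> K \<and> B i \<in> K \<and> C i \<in> K) \<Longrightarrow> (\<Sum>i\<in>UNIV. gsum t A B C i) = 0 \<Longrightarrow> A i = 0 \<and> B i = 0 \<and> C i = 0"
    have "generic_torus f a g K t"
    proof unfold_locales
      show "x \<in> K" if "x \<in> \<rat>" for x using that h(2) by blast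
      show "a i \<in> K" for i using h(2) by blast
      show "coeff (lag i) k \<in> K" for i k using h(2) by blast
      show "A j = 0 \<and> B j = 0 \<and> C j = 0"
        if "\<And>i. A i \<in> K \<and> B i \<in> K \<and> C i \<in> K" "(\<Sum>i\<in>UNIV. gsum t A B C i) = 0" for A B C j
        using that by (rule h(4))
    qed (rule h(1), rule h(3))
    then show ?thesis by blast
  qed
qed

lemma sum_bool_pair:
  fixes h :: "'i::finite \<times> bool \<Rightarrow> 'c::comm_monoid_add"
  shows "(\<Sum>x\<in>UNIV. h x) = (\<Sum>i\<in>UNIV. h (i, False) + h (i, True))"
proof -
  have "(\<Sum>x\<in>UNIV. h x) = (\<Sum>i\<in>UNIV. \<Sum>b\<in>UNIV. h (i, b))"
    by (simp only: sum.cartesian_product UNIV_Times_UNIV) (simp add: case_prod_unfold)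
  also have "\<dots> = (\<Sum>i\<in>UNIV. h (i, False) + h (i, True))" by (intro sum.cong) (simp_all add: UNIV_bool)
  finally show ?thesis .
qed

section \<open>Coordinates adapted to the action of the field\<close>

context generic_torus
begin

definition u :: "'n \<Rightarrow> complex" where "u i = cnj (t (bar i))"

text \<open>Real-linear coordinates that take the values x_i and y_i on x + y t for x, y in the
  order. They are a basis of H^1 with complex coefficients consisting of eigenvectors of the field,
  two for each embedding.\<close>

definition ef :: "'n \<times> bool \<Rightarrow> complex ^ 'n \<Rightarrow> complex" where
  "ef x v = (if snd x then v $ fst x - cnj (v $ bar (fst x))
             else t (fst x) * cnj (v $ bar (fst x)) - u (fst x) * v $ fst x) / (t (fst x) - u (fst x))"

lemma tu: "t i - u i \<noteq> 0" using t_ne[of i] by (simp add: u_def)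

lemma linear_ef: "linear (ef x)"
  by (rule linearI) (simp_all add: ef_def add_divide_distrib[symmetric] complex_scaleR_of_real algebra_simps)

lemma ef_decomp: "v $ i = ef (i, False) v + t i * ef (i, True) v" "cnj (v $ bar i) = ef (i, False) v + u i * ef (i, True) v"
  using tu[of i] by (simp_all add: ef_def divide_simps) (simp_all add: algebra_simps)

text \<open>Pullback by multiplication by i, scaled by -i, is 1 on v_i and -1 on the conjugate of
  v_(bar i); here this operator is rewritten in the coordinates \<open>ef\<close>.\<close>

lemma ef_ii:
  "- \<i> * ef (i, True) (\<i> *s v) = 2 * gp (t i) (u i) * ef (i, False) v + gq (t i) (u i) * ef (i, True) v"
  "- \<i> * ef (i, False) (\<i> *s v) = - gq (t i) (u i) * ef (i, False) v - 2 * gr (t i) (u i) * ef (i, True) v"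
proof -
  define z w d where "z = v $ i" and "w = cnj (v $ bar i)" and "d = t i - u i"
  have d: "d \<noteq> 0" "t i = u i + d" using tu[of i] by (simp_all add: d_def)
  have e: "ef (i, False) v = (t i * w - u i * z) / d" "ef (i, True) v = (z - w) / d"
    by (simp_all add: ef_def z_def w_def d_def)
  have e': "ef (i, False) (\<i> *s v) = (t i * (- \<i> * w) - u i * (\<i> * z)) / d" "ef (i, True) (\<i> *s v) = (\<i> * z - (- \<i> * w)) / d"
    by (simp_all add: ef_def z_def w_def d_def)
  have g: "gp (t i) (u i) = 1 / d" "gq (t i) (u i) = (t i + u i) / d" "gr (t i) (u i) = t i * u i / d"
    by (simp_all add: gp_def gq_def gr_def d_def)
  have "- \<i> * ((\<i> * z - (- \<i> * w)) / d) = (z + w) / d" by (simp add: divide_simps d(1)) (simp add: algebra_simps)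
  also have "\<dots> = 2 * (1 / d) * ((t i * w - u i * z) / d) + (t i + u i) / d * ((z - w) / d)"
    unfolding d(2) using d(1) by (simp add: divide_simps) (simp add: algebra_simps)
  finally show "- \<i> * ef (i, True) (\<i> *s v) = 2 * gp (t i) (u i) * ef (i, False) v + gq (t i) (u i) * ef (i, True) v"
    unfolding e e' g .
  have "- \<i> * ((t i * (- \<i> * w) - u i * (\<i> * z)) / d) = - (t i * w + u i * z) / d"
    by (simp add: divide_simps d(1)) (simp add: algebra_simps)
  also have "\<dots> = - ((t i + u i) / d) * ((t i * w - u i * z) / d) - 2 * (t i * u i / d) * ((z - w) / d)"
    unfolding d(2) using d(1) by (simp add: divide_simps) (simp add: algebra_simps)
  finally show "- \<i> * ef (i, False) (\<i> *s v) = - gq (t i) (u i) * ef (i, False) v - 2 * gr (t i) (u i) * ef (i, True) v"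
    unfolding e e' g .
qed

definition tv :: "complex ^ 'n" where "tv = (\<chi> i. t i)"

definition Lam :: "(complex ^ 'n) set" where "Lam = {x + y * tv | x y. x \<in> Ord \<and> y \<in> Ord}"

lemma ef_Lam: "x \<in> Ord \<Longrightarrow> y \<in> Ord \<Longrightarrow> ef (i, False) (x + y * tv) = x $ i"
  "x \<in> Ord \<Longrightarrow> y \<in> Ord \<Longrightarrow> ef (i, True) (x + y * tv) = y $ i"
proof -
  assume xy: "x \<in> Ord" "y \<in> Ord"
  have v: "(x + y * tv) $ i = x $ i + y $ i * t i" "cnj ((x + y * tv) $ bar i) = x $ i + y $ i * u i"
    by (simp_all add: tv_def u_def Ord_bar[OF xy(1)] Ord_bar[OF xy(2)])
  show "ef (i, False) (x + y * tv) = x $ i" "ef (i, True) (x + y * tv) = y $ i"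
    unfolding ef_def fst_conv snd_conv v using tu[of i] by (simp_all add: divide_simps) (simp_all add: algebra_simps)
qed

text \<open>For k < g these are the basis vectors of the lattice that come from the power basis of
  the order.\<close>

definition lam :: "nat \<Rightarrow> bool \<Rightarrow> complex ^ 'n" where
  "lam k b = (\<chi> i. a i ^ k * (if b then t i else 1))"

lemma a_power_Ord: "(\<chi> i. a i ^ k) \<in> Ord"
proof -
  have "cpoly (monom 1 k) = monom 1 k" by (rule poly_eqI) (simp add: coeff_monom)
  then have "(\<chi> i. a i ^ k) = ov (monom 1 k)" by (simp add: vec_eq_iff poly_monom)
  then show ?thesis by (simp add: Ord_def)
qed

lemma lam_alt: "lam k b = (if b then 0 else (\<chi> i. a i ^ k)) + (if b then (\<chi> i. a i ^ k) else 0) * tv"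
  by (simp add: vec_eq_iff lam_def tv_def)

lemma lam_Lam: "lam k b \<in> Lam"
  unfolding Lam_def lam_alt using a_power_Ord[of k] Ord_closed(5)
  by (intro CollectI exI conjI) (rule refl, auto)

lemma ef_lam: "ef (i, b) (lam k c) = (if b = c then a i ^ k else 0)"
  unfolding lam_alt
  using ef_Lam[of 0 "\<chi> i. a i ^ k" i] ef_Lam[of "\<chi> i. a i ^ k" 0 i] a_power_Ord[of k] Ord_closed(5)
  by (cases b; cases c) simp_all

definition co :: "nat \<Rightarrow> bool \<Rightarrow> complex ^ 'n \<Rightarrow> complex" where
  "co k b v = (\<Sum>i\<in>UNIV. coeff (lag i) k * ef (i, b) v)"

lemma linear_co: "linear (co k b)"
  unfolding co_def
  by (rule linearI) (simp_all add: linear_add[OF linear_ef] linear_cmul[OF linear_ef] distrib_left sum.distrib complex_scaleR_of_real sum_distrib_left mult.left_commute)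

lemma ef_bar: "ef (bar i, b) v = cnj (ef (i, b) v)"
proof -
  have swap: "(x - y) / (p - q) = (y - x) / (q - p)" for x y p q :: complex by (metis minus_diff_eq minus_divide_divide)
  show ?thesis
  proof (cases b)
    case True
    then show ?thesis using swap[of "v $ bar i" "cnj (v $ i)" "t (bar i)" "cnj (t i)"] by (simp add: ef_def u_def)
  next
    case False
    then show ?thesis using swap[of "t (bar i) * cnj (v $ i)" "cnj (t i) * v $ bar i" "t (bar i)" "cnj (t i)"]
      by (simp add: ef_def u_def mult.commute)
  qed
qed

lemma co_real: "of_real (Re (co k b v)) = co k b v"
proof -
  have "cnj (co k b v) = (\<Sum>i\<in>UNIV. coeff (lag (bar i)) k * ef (bar i, b) v)"
    by (simp add: co_def lag_bar ef_bar)
  also have "\<dots> = co k b v" unfolding co_def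
    by (rule sum.reindex_bij_witness[of _ bar bar]) simp_all
  finally show ?thesis by (simp add: complex_eq_iff)
qed

lemma ef_co: "ef (i, b) v = (\<Sum>k<g. co k b v * a i ^ k)"
proof -
  have "(\<Sum>k<g. co k b v * a i ^ k) = (\<Sum>k<g. \<Sum>j\<in>UNIV. ef (j, b) v * (coeff (lag j) k * a i ^ k))"
    unfolding co_def sum_distrib_right by (intro sum.cong refl) (simp only: ac_simps)
  also have "\<dots> = (\<Sum>j\<in>UNIV. ef (j, b) v * (\<Sum>k<g. coeff (lag j) k * a i ^ k))"
    by (subst sum.swap) (simp only: sum_distrib_left)
  also have "\<dots> = ef (i, b) v" by (simp add: lag_vandermonde if_distrib cong: if_cong)
  finally show ?thesis by simp
qed

lemma lam_expansion:
  "v = (\<Sum>k<g. Re (co k False v) *\<^sub>R lam k False + Re (co k True v) *\<^sub>R lam k True)"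
proof -
  have "(\<Sum>k<g. Re (co k False v) *\<^sub>R lam k False + Re (co k True v) *\<^sub>R lam k True) $ i = v $ i" for i
  proof -
    have "(\<Sum>k<g. Re (co k False v) *\<^sub>R lam k False + Re (co k True v) *\<^sub>R lam k True) $ i =
      (\<Sum>k<g. co k False v * a i ^ k + t i * (co k True v * a i ^ k))"
      by (simp add: complex_scaleR_of_real co_real lam_def ac_simps)
    also have "\<dots> = v $ i" unfolding ef_decomp(1)[of v i] ef_co[of i] by (simp add: sum.distrib sum_distrib_left)
    finally show ?thesis .
  qed
  then show ?thesis by (simp add: vec_eq_iff)
qed

lemma linear_expansion:
  fixes \<phi> :: "complex ^ 'n \<Rightarrow> complex"
  assumes "linear \<phi>"
  shows "\<phi> v = (\<Sum>k<g. co k False v * \<phi> (lam k False) + co k True v * \<phi> (lam k True))"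
proof -
  have "\<phi> v = \<phi> (\<Sum>k<g. Re (co k False v) *\<^sub>R lam k False + Re (co k True v) *\<^sub>R lam k True)"
    by (simp only: lam_expansion[symmetric])
  also have "\<dots> = (\<Sum>k<g. co k False v * \<phi> (lam k False) + co k True v * \<phi> (lam k True))"
    by (simp add: linear_sum[OF assms] linear_add[OF assms] linear_cmul[OF assms] complex_scaleR_of_real co_real)
  finally show ?thesis .
qed

text \<open>Coordinates of a functional in the basis \<open>ef\<close>, computed from its values on
  the lattice basis; so rational values give coordinates in \<open>K\<close>.\<close>

definition dual :: "(complex ^ 'n \<Rightarrow> complex) \<Rightarrow> 'n \<times> bool \<Rightarrow> complex" where
  "dual \<phi> x = (\<Sum>k<g. coeff (lag (fst x)) k * \<phi> (lam k (snd x)))"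

lemma linear_dual:
  assumes "linear \<phi>" shows "\<phi> v = (\<Sum>x\<in>UNIV. dual \<phi> x * ef x v)"
proof -
  have *: "(\<Sum>k<g. co k b v * \<phi> (lam k b)) = (\<Sum>i\<in>UNIV. dual \<phi> (i, b) * ef (i, b) v)" for b
    unfolding co_def dual_def sum_distrib_right fst_conv snd_conv
    by (subst sum.swap) (intro sum.cong refl, simp only: ac_simps)
  show ?thesis unfolding sum_bool_pair
    by (rule trans[OF linear_expansion[OF assms]]) (simp only: sum.distrib *)
qed

lemma dual_ef: "dual (\<lambda>v. \<Sum>x\<in>UNIV. m x * ef x v) y = m y"
proof -
  have "dual (\<lambda>v. \<Sum>x\<in>UNIV. m x * ef x v) y =
    (\<Sum>k<g. coeff (lag (fst y)) k * (\<Sum>i\<in>UNIV. m (i, snd y) * a i ^ k))"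
    unfolding dual_def sum_bool_pair by (cases "snd y") (simp_all add: ef_lam)
  also have "\<dots> = (\<Sum>i\<in>UNIV. m (i, snd y) * (\<Sum>k<g. coeff (lag (fst y)) k * a i ^ k))"
    unfolding sum_distrib_left by (subst sum.swap) (intro sum.cong refl, simp only: ac_simps)
  also have "\<dots> = m y" by (simp add: lag_vandermonde if_distrib cong: if_cong)
  finally show ?thesis .
qed

lemma LamI: "x \<in> Ord \<Longrightarrow> y \<in> Ord \<Longrightarrow> x + y * tv \<in> Lam"
  unfolding Lam_def by blast

lemma LamE: assumes "v \<in> Lam" obtains x y where "v = x + y * tv" "x \<in> Ord" "y \<in> Ord"
  using assms unfolding Lam_def by blast

lemma Lam_closed: "0 \<in> Lam" "v \<in> Lam \<Longrightarrow> w \<in> Lam \<Longrightarrow> v + w \<in> Lam" "v \<in> Lam \<Longrightarrow> w \<in> Lam \<Longrightarrow> v - w \<in> Lam"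
  "v \<in> Lam \<Longrightarrow> - v \<in> Lam" "x \<in> Ord \<Longrightarrow> x \<in> Lam" "x \<in> Ord \<Longrightarrow> v \<in> Lam \<Longrightarrow> x * v \<in> Lam"
proof -
  have O: "x \<in> Lam" if "x \<in> Ord" for x using LamI[OF that Ord_closed(5)] by simp
  then show "x \<in> Ord \<Longrightarrow> x \<in> Lam" .
  show z: "0 \<in> Lam" using O Ord_closed(5) .
  have d: "v - w \<in> Lam" if vw: "v \<in> Lam" "w \<in> Lam" for v w
  proof -
    obtain x y where v: "v = x + y * tv" "x \<in> Ord" "y \<in> Ord" using vw(1) by (rule LamE)
    obtain x' y' where w: "w = x' + y' * tv" "x' \<in> Ord" "y' \<in> Ord" using vw(2) by (rule LamE)
    have "v - w = (x - x') + (y - y') * tv" unfolding v w by (simp add: algebra_simps)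
    then show ?thesis using LamI[OF Ord_closed(2)[OF v(2) w(2)] Ord_closed(2)[OF v(3) w(3)]] by simp
  qed
  then show "v \<in> Lam \<Longrightarrow> w \<in> Lam \<Longrightarrow> v - w \<in> Lam" .
  have n: "- v \<in> Lam" if "v \<in> Lam" for v using d[OF z that] by simp
  then show "v \<in> Lam \<Longrightarrow> - v \<in> Lam" .
  show "v + w \<in> Lam" if "v \<in> Lam" "w \<in> Lam" using d[OF that(1) n[OF that(2)]] by simp
  show "x * v \<in> Lam" if xv: "x \<in> Ord" "v \<in> Lam"
  proof -
    obtain x' y' where v: "v = x' + y' * tv" "x' \<in> Ord" "y' \<in> Ord" using xv(2) by (rule LamE)
    have "x * v = x * x' + (x * y') * tv" unfolding v by (simp add: algebra_simps)
    then show ?thesis using LamI[OF Ord_closed(3)[OF xv(1) v(2)] Ord_closed(3)[OF xv(1) v(3)]] by simp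
  qed
qed

text \<open>Coordinates in the lattice basis are linear, hence bounded by a constant C times the
  norm, and integral on \<open>Lam\<close>; so a nonzero lattice vector is longer than 1/C.\<close>

lemma Lam_discrete: "discrete Lam"
proof -
  have "\<forall>k b. \<exists>B. \<forall>v. norm (co k b v) \<le> B * norm v" using linear_bounded[OF linear_co] by blast
  then obtain B where B: "\<And>k b v. norm (co k b v) \<le> B k b * norm v" by metis
  define C where "C = 1 + (\<Sum>k<g. \<bar>B k False\<bar> + \<bar>B k True\<bar>)"
  have C: "C > 0" unfolding C_def by (intro add_pos_nonneg sum_nonneg) auto
  have B': "norm (co k b v) < C * norm v" if "k < g" "v \<noteq> 0" for k b v
  proof -
    have "\<bar>B k False\<bar> + \<bar>B k True\<bar> \<le> (\<Sum>k<g. \<bar>B k False\<bar> + \<bar>B k True\<bar>)"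
      using that by (intro member_le_sum) auto
    then have "B k b < C" using abs_ge_self[of "B k b"] abs_ge_zero[of "B k (\<not> b)"] unfolding C_def by (cases b) simp_all
    then have "B k b * norm v < C * norm v" using that by simp
    then show ?thesis using B[of k b v] by linarith
  qed
  have big: "C * norm v > 1" if v: "v \<in> Lam" "v \<noteq> 0" for v
  proof -
    obtain x y where xy: "v = x + y * tv" "x \<in> Ord" "y \<in> Ord" using v(1) by (rule LamE)
    obtain m where m: "x = cv m" using Ord_cv[OF xy(2)] .
    obtain n where n: "y = cv n" using Ord_cv[OF xy(3)] .
    have c: "co k False v = of_int (m k)" "co k True v = of_int (n k)" if "k < g" for k
      unfolding co_def xy(1) m n ef_Lam[OF cv_in_Ord cv_in_Ord] using cv_coeff[OF that] by simp_all
    have "\<exists>k<g. m k \<noteq> 0 \<or> n k \<noteq> 0"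
    proof (rule ccontr)
      assume "\<not> ?thesis"
      then have "x = cv (\<lambda>k. 0)" "y = cv (\<lambda>k. 0)" unfolding m n by (auto intro: cv_cong)
      then show False using v(2) xy(1) by (simp add: cv_def zero_vec_def[symmetric])
    qed
    then obtain k where k: "k < g" "m k \<noteq> 0 \<or> n k \<noteq> 0" by blast
    then have "\<exists>b. norm (co k b v) \<ge> 1"
    proof (cases "m k = 0")
      case False
      then show ?thesis using c(1)[OF k(1)] by (intro exI[of _ False]) (simp add: norm_of_int)
    next
      case True
      then show ?thesis using c(2)[OF k(1)] k(2) by (intro exI[of _ True]) (simp add: norm_of_int)
    qed
    then show ?thesis using B'[OF k(1) v(2)] by (metis le_less_trans)
  qed
  show ?thesis unfolding discrete_def isolated_in_dist_Ex_iff
  proof (intro ballI conjI exI[of _ "1 / C"] impI)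
    fix v w assume vw: "v \<in> Lam" "w \<in> Lam" "dist v w < 1 / C"
    show "w = v"
    proof (rule ccontr)
      assume "w \<noteq> v"
      then have "1 < C * norm (v - w)" using Lam_closed(3)[OF vw(1,2)] by (intro big) auto
      moreover have "C * norm (v - w) < 1" using vw(3) C by (simp add: dist_norm field_simps)
      ultimately show False by simp
    qed
  qed (use C in auto)
qed

definition emb :: "(nat \<Rightarrow> int) \<Rightarrow> complex ^ 'n" where "emb m = cv m + cv (\<lambda>k. m (g + k)) * tv"

lemma emb_iso: "emb \<in> iso (free_Zmod (2 * g)) (vec_group\<lparr>carrier := Lam\<rparr>)"
proof (rule isoI)
  have car: "carrier (free_Zmod d) = PiE {..<d} (\<lambda>_. UNIV)" for d by (simp add: free_Zmod_def integer_group_def)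
  show "emb \<in> hom (free_Zmod (2 * g)) (vec_group\<lparr>carrier := Lam\<rparr>)"
  proof (rule homI)
    fix x assume "x \<in> carrier (free_Zmod (2 * g))"
    show "emb x \<in> carrier (vec_group\<lparr>carrier := Lam\<rparr>)" using LamI[OF cv_in_Ord cv_in_Ord] by (auto simp: emb_def)
    fix y
    have "cv (x \<otimes>\<^bsub>free_Zmod (2 * g)\<^esub> y) = cv x + cv y"
      by (simp add: vec_eq_iff cv_nth free_Zmod_def integer_group_def sum.distrib[symmetric] distrib_right)
    moreover have "cv (\<lambda>k. (x \<otimes>\<^bsub>free_Zmod (2 * g)\<^esub> y) (g + k)) = cv (\<lambda>k. x (g + k)) + cv (\<lambda>k. y (g + k))"
      by (simp add: vec_eq_iff cv_nth free_Zmod_def integer_group_def sum.distrib[symmetric] distrib_right)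
    ultimately show "emb (x \<otimes>\<^bsub>free_Zmod (2 * g)\<^esub> y) = emb x \<otimes>\<^bsub>vec_group\<lparr>carrier := Lam\<rparr>\<^esub> emb y"
      by (simp add: emb_def vec_group_def algebra_simps)
  qed
  show "bij_betw emb (carrier (free_Zmod (2 * g))) (carrier (vec_group\<lparr>carrier := Lam\<rparr>))"
    unfolding bij_betw_def
  proof
    show "inj_on emb (carrier (free_Zmod (2 * g)))"
    proof (rule inj_onI)
      fix m n assume mn: "m \<in> carrier (free_Zmod (2 * g))" "n \<in> carrier (free_Zmod (2 * g))" "emb m = emb n"
      have "ef (i, b) (emb m) = ef (i, b) (emb n)" for i b using mn(3) by simp
      from this[of _ False] this[of _ True]
      have "cv m = cv n" "cv (\<lambda>k. m (g + k)) = cv (\<lambda>k. n (g + k))"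
        unfolding emb_def ef_Lam[OF cv_in_Ord cv_in_Ord] by (simp_all add: vec_eq_iff)
      then have e: "m k = n k" "m (g + k) = n (g + k)" if "k < g" for k using cv_inj[OF _ that] by blast+
      have "m j = n j" if "j < 2 * g" for j
        using e(1)[of j] e(2)[of "j - g"] that by (cases "j < g") auto
      then show "m = n" using mn(1,2) unfolding car by (intro PiE_ext) auto
    qed
    show "emb ` carrier (free_Zmod (2 * g)) = carrier (vec_group\<lparr>carrier := Lam\<rparr>)"
    proof
      show "emb ` carrier (free_Zmod (2 * g)) \<subseteq> carrier (vec_group\<lparr>carrier := Lam\<rparr>)"
        using LamI[OF cv_in_Ord cv_in_Ord] by (auto simp: emb_def)
      show "carrier (vec_group\<lparr>carrier := Lam\<rparr>) \<subseteq> emb ` carrier (free_Zmod (2 * g))"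
      proof
        fix v assume "v \<in> carrier (vec_group\<lparr>carrier := Lam\<rparr>)"
        then have "v \<in> Lam" by simp
        then obtain x y where xy: "v = x + y * tv" "x \<in> Ord" "y \<in> Ord" by (rule LamE)
        obtain m where m: "x = cv m" using Ord_cv[OF xy(2)] .
        obtain n where n: "y = cv n" using Ord_cv[OF xy(3)] .
        let ?h = "\<lambda>j\<in>{..<2 * g}. if j < g then m j else n (j - g)"
        have "cv ?h = cv m" "cv (\<lambda>k. ?h (g + k)) = cv n" by (auto intro!: cv_cong)
        then have "v = emb ?h" by (simp only: emb_def xy(1) m n)
        moreover have "?h \<in> carrier (free_Zmod (2 * g))" unfolding car by auto
        ultimately show "v \<in> emb ` carrier (free_Zmod (2 * g))" by blast
      qed
    qed
  qed
qed

lemma torus_lattice_Lam: "torus_lattice Lam"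
  unfolding torus_lattice_def
proof (intro conjI Lam_discrete)
  have vg: "group vec_group"
    by (rule groupI) (auto simp: vec_group_def add.assoc intro: exI[of _ "- _"])
  show "subgroup Lam vec_group"
  proof (rule group.subgroupI[OF vg])
    have inv: "inv\<^bsub>vec_group\<^esub> x = - x" for x
      by (rule group.inv_equality[OF vg]) (simp_all add: vec_group_def)
    show "inv\<^bsub>vec_group\<^esub> x \<in> Lam" if "x \<in> Lam" for x unfolding inv using that by (rule Lam_closed)
    show "x \<otimes>\<^bsub>vec_group\<^esub> y \<in> Lam" if "x \<in> Lam" "y \<in> Lam" for x y using that Lam_closed(2) by (simp add: vec_group_def)
  qed (use Lam_closed(1) in \<open>auto simp: vec_group_def\<close>)
  have "group (free_Zmod (2 * g))" by (simp add: free_Zmod_def)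
  moreover have "free_Zmod (2 * g) \<cong> vec_group\<lparr>carrier := Lam\<rparr>" using emb_iso by (auto simp: is_iso_def)
  ultimately show "vec_group\<lparr>carrier := Lam\<rparr> \<cong> free_Zmod (2 * CARD('n))"
    unfolding g_card[symmetric] by (rule group.iso_sym)
qed

end

section \<open>Hodge substructures of the second cohomology\<close>

text \<open>The double annihilator theorem for a rational space and a complex vector, with rational
  functionals as tests. Gaussian elimination on the coordinates: either all of \<open>W\<close>
  vanishes at j, or a pivot \<open>w1\<close> reduces the problem to \<open>W0\<close>.\<close>

lemma rational_span:
  fixes W :: "('i \<Rightarrow> complex) set" and x :: "'i \<Rightarrow> complex"
  assumes "finite I" "\<And>w i. w \<in> W \<Longrightarrow> i \<in> I \<Longrightarrow> w i \<in> \<rat>"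
    and "\<And>w q v. w \<in> W \<Longrightarrow> v \<in> W \<Longrightarrow> q \<in> \<rat> \<Longrightarrow> (\<lambda>i. v i - q * w i) \<in> W"
    and "\<And>c. (\<And>i. c i \<in> \<rat>) \<Longrightarrow> (\<And>w. w \<in> W \<Longrightarrow> (\<Sum>i\<in>I. c i * w i) = 0) \<Longrightarrow> (\<Sum>i\<in>I. c i * x i) = 0"
  shows "\<exists>n z w. (\<forall>k<n::nat. w k \<in> W) \<and> (\<forall>i\<in>I. x i = (\<Sum>k<n. z k * w k i))"
  using assms
proof (induction I arbitrary: W x rule: finite_induct)
  case empty
  show ?case by (rule exI[of _ 0]) simp
next
  case (insert j I)
  show ?case
  proof (cases "\<forall>w\<in>W. w j = 0")
    case True
    have xj: "x j = 0"
    proof -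
      have "(\<Sum>i\<in>insert j I. (if i = j then 1 else 0) * x i) = 0"
        by (rule insert.prems(3)) (use True insert.hyps in \<open>simp_all add: if_distrib[of "\<lambda>q. q * _"] cong: if_cong\<close>)
      then show ?thesis using insert.hyps by (simp add: if_distrib[of "\<lambda>q. q * _"] cong: if_cong)
    qed
    have "\<exists>n z w. (\<forall>k<n::nat. w k \<in> W) \<and> (\<forall>i\<in>I. x i = (\<Sum>k<n. z k * w k i))"
    proof (rule insert.IH)
      fix c :: "'i \<Rightarrow> complex" assume c: "\<And>i. c i \<in> \<rat>" "\<And>w. w \<in> W \<Longrightarrow> (\<Sum>i\<in>I. c i * w i) = 0"
      have "(\<Sum>i\<in>insert j I. c i * x i) = 0"
        by (rule insert.prems(3)) (use c True insert.hyps in simp_all)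
      then show "(\<Sum>i\<in>I. c i * x i) = 0" using xj insert.hyps by simp
    qed (use insert.prems(1,2) in auto)
    then obtain n z w where w: "\<forall>k<n::nat. w k \<in> W" "\<forall>i\<in>I. x i = (\<Sum>k<n. z k * w k i)" by blast
    moreover have "(\<Sum>k<n. z k * w k j) = 0" using w(1) True by (intro sum.neutral) auto
    ultimately show ?thesis using xj by (intro exI[of _ n] exI[of _ z] exI[of _ w]) simp
  next
    case False
    then obtain w1 where w1: "w1 \<in> W" "w1 j \<noteq> 0" by blast
    define W0 where "W0 = {w\<in>W. w j = 0}"
    define r where "r = x j / w1 j"
    have sub: "(\<lambda>i. w i - w j / w1 j * w1 i) \<in> W0" if "w \<in> W" for w
    proof -
      have "w j \<in> \<rat>" "w1 j \<in> \<rat>" using insert.prems(1) that w1 by auto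
      then show ?thesis using insert.prems(2)[OF w1(1) that, of "w j / w1 j"] w1(2) unfolding W0_def by simp
    qed
    have "\<exists>n z w. (\<forall>k<n::nat. w k \<in> W0) \<and> (\<forall>i\<in>I. x i - r * w1 i = (\<Sum>k<n. z k * w k i))"
    proof (rule insert.IH)
      fix c :: "'i \<Rightarrow> complex" assume c: "\<And>i. c i \<in> \<rat>" "\<And>w. w \<in> W0 \<Longrightarrow> (\<Sum>i\<in>I. c i * w i) = 0"
      \<comment> \<open>With this coefficient at j the extended functional kills the pivot
        \<open>w1\<close>; as it kills \<open>W0\<close> too, it kills \<open>W\<close>.\<close>
      define cj where "cj = - (\<Sum>i\<in>I. c i * w1 i) / w1 j"
      have w1r: "w1 i \<in> \<rat>" if "i \<in> insert j I" for i using insert.prems(1)[OF w1(1) that] .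
      have cjr: "cj \<in> \<rat>" unfolding cj_def
        by (intro Rats_divide Rats_minus_iff[THEN iffD2] ring_closed_sum[OF ring_closed_Rats] Rats_mult c w1r) auto
      have sum_ins: "(\<Sum>i\<in>insert j I. (c(j := cj)) i * y i) = cj * y j + (\<Sum>i\<in>I. c i * y i)" for y :: "'i \<Rightarrow> complex"
      proof -
        have "(\<Sum>i\<in>I. (c(j := cj)) i * y i) = (\<Sum>i\<in>I. c i * y i)"
          by (rule sum.cong) (use insert.hyps in auto)
        then show ?thesis using insert.hyps by simp
      qed
      have "(\<Sum>i\<in>insert j I. (c(j := cj)) i * x i) = 0"
      proof (rule insert.prems(3))
        show "(c(j := cj)) i \<in> \<rat>" for i using c(1) cjr by simp
        fix w assume w: "w \<in> W"
        have "(\<Sum>i\<in>I. c i * (w i - w j / w1 j * w1 i)) = 0" by (rule c(2)[OF sub[OF w]])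
        then have "(\<Sum>i\<in>I. c i * w i) = w j / w1 j * (\<Sum>i\<in>I. c i * w1 i)"
          by (simp add: right_diff_distrib sum_subtractf sum_distrib_left mult.left_commute)
        then show "(\<Sum>i\<in>insert j I. (c(j := cj)) i * w i) = 0" unfolding sum_ins by (simp add: cj_def)
      qed
      then have "(\<Sum>i\<in>I. c i * x i) = r * (\<Sum>i\<in>I. c i * w1 i)"
        unfolding sum_ins by (simp add: cj_def r_def)
      then show "(\<Sum>i\<in>I. c i * (x i - r * w1 i)) = 0"
        by (simp add: right_diff_distrib sum_subtractf sum_distrib_left mult.left_commute)
    qed (use insert.prems(1,2) in \<open>auto simp: W0_def\<close>)
    then obtain n z w where w: "\<forall>k<n::nat. w k \<in> W0" "\<forall>i\<in>I. x i - r * w1 i = (\<Sum>k<n. z k * w k i)" by blast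
    show ?thesis
    proof (intro exI[of _ "Suc n"] exI[of _ "z(n := r)"] exI[of _ "w(n := w1)"] conjI allI impI ballI)
      fix k assume "k < Suc n"
      then show "(w(n := w1)) k \<in> W" using w(1) w1 by (auto simp: W0_def less_Suc_eq)
    next
      fix i assume i: "i \<in> insert j I"
      have s: "(\<Sum>k<Suc n. (z(n := r)) k * (w(n := w1)) k i) = (\<Sum>k<n. z k * w k i) + r * w1 i" by simp
      show "x i = (\<Sum>k<Suc n. (z(n := r)) k * (w(n := w1)) k i)"
      proof (cases "i = j")
        case True
        have "(\<Sum>k<n. z k * w k j) = 0" using w(1) by (intro sum.neutral) (auto simp: W0_def)
        then show ?thesis unfolding s True using w1(2) by (simp add: r_def)
      next
        case False
        then have "x i - r * w1 i = (\<Sum>k<n. z k * w k i)" using w(2) i by blast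
        then show ?thesis unfolding s by (metis diff_add_cancel)
      qed
    qed
  qed
qed

section \<open>2-forms as matrices and the sl2 operators at the places\<close>

context generic_torus
begin

definition frm :: "('n \<times> bool \<Rightarrow> 'n \<times> bool \<Rightarrow> complex) \<Rightarrow> 'n form2" where
  "frm M v w = (\<Sum>y\<in>UNIV. (\<Sum>x\<in>UNIV. M x y * ef x v) * ef y w)"

definition mat :: "'n form2 \<Rightarrow> 'n \<times> bool \<Rightarrow> 'n \<times> bool \<Rightarrow> complex" where
  "mat \<omega> x y = dual (\<lambda>v. dual (\<omega> v) y) x"

lemma linear_dual_left: "bilinear \<omega> \<Longrightarrow> linear (\<lambda>v. dual (\<omega> v) y)"
  unfolding dual_def
  by (rule linearI) (simp_all add: bilinear_ladd bilinear_lmul complex_scaleR_of_real distrib_left sum.distrib sum_distrib_left mult.left_commute)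

lemma frm_mat: assumes "bilinear \<omega>" shows "frm (mat \<omega>) = \<omega>"
proof (intro ext)
  fix v w
  have lin: "linear (\<omega> v)" for v using assms by (simp add: bilinear_def)
  show "frm (mat \<omega>) v w = \<omega> v w"
    unfolding frm_def mat_def linear_dual[OF linear_dual_left[OF assms], symmetric] linear_dual[OF lin, symmetric] ..
qed

lemma mat_frm: "mat (frm M) = M"
proof (intro ext)
  fix x y
  have "dual (frm M v) y = (\<Sum>x\<in>UNIV. M x y * ef x v)" for v
    unfolding frm_def by (rule dual_ef)
  then show "mat (frm M) x y = M x y" unfolding mat_def by (simp add: dual_ef)
qed

lemma bilinear_frm: "bilinear (frm M)"
  unfolding bilinear_def frm_def
  by (intro conjI allI linearI)
    (simp_all add: linear_add[OF linear_ef] linear_cmul[OF linear_ef] complex_scaleR_of_real distrib_left distrib_right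
      sum.distrib sum_distrib_left sum_distrib_right mult.left_commute mult.assoc)

lemma frm_linear: "frm (\<lambda>x y. M x y + M' x y) v w = frm M v w + frm M' v w"
  "frm (\<lambda>x y. c * M x y) v w = c * frm M v w"
  by (simp_all add: frm_def distrib_right sum.distrib sum_distrib_left sum_distrib_right mult.assoc)

lemma frm_sum: "frm (\<lambda>x y. \<Sum>i\<in>F. M i x y) v w = (\<Sum>i\<in>F. frm (M i) v w)"
proof (induction F rule: infinite_finite_induct)
  case (insert i F)
  then show ?case by (simp add: frm_linear)
qed (simp_all add: frm_def)

text \<open>The derivation on bilinear forms induced by 2 by 2 matrices s i acting on the two
  coordinates at i.\<close>

definition Dr :: "('n \<Rightarrow> bool \<Rightarrow> bool \<Rightarrow> complex) \<Rightarrow> ('n \<times> bool \<Rightarrow> 'n \<times> bool \<Rightarrow> complex) \<Rightarrow> 'n \<times> bool \<Rightarrow> 'n \<times> bool \<Rightarrow> complex" where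
  "Dr s M x y = (s (fst x) False (snd x) * M (fst x, False) y + s (fst x) True (snd x) * M (fst x, True) y)
    + (s (fst y) False (snd y) * M x (fst y, False) + s (fst y) True (snd y) * M x (fst y, True))"

text \<open>\<open>pP\<close>, \<open>qQ\<close>, \<open>rR\<close> are a basis of sl2 with rational
  entries in the coordinates \<open>ef\<close>; \<open>single\<close> confines such a matrix to one
  index.\<close>

definition pP :: "bool \<Rightarrow> bool \<Rightarrow> complex" where "pP b c = (if b \<and> \<not> c then 2 else 0)"
definition qQ :: "bool \<Rightarrow> bool \<Rightarrow> complex" where "qQ b c = (if b \<and> c then 1 else if \<not> b \<and> \<not> c then - 1 else 0)"
definition rR :: "bool \<Rightarrow> bool \<Rightarrow> complex" where "rR b c = (if \<not> b \<and> c then - 2 else 0)"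

definition single :: "'n \<Rightarrow> (bool \<Rightarrow> bool \<Rightarrow> complex) \<Rightarrow> 'n \<Rightarrow> bool \<Rightarrow> bool \<Rightarrow> complex" where
  "single i s = (\<lambda>j b c. if j = i then s b c else 0)"

definition nN :: "'n \<Rightarrow> bool \<Rightarrow> bool \<Rightarrow> complex" where
  "nN i b c = gp (t i) (u i) * pP b c + gq (t i) (u i) * qQ b c + gr (t i) (u i) * rR b c"

lemma ef_nN: "- \<i> * ef (i, b) (\<i> *s v) = nN i b False * ef (i, False) v + nN i b True * ef (i, True) v"
  using ef_ii[of i v] by (cases b) (simp_all add: nN_def pP_def qQ_def rR_def)

lemma sum_ef_nN: "(\<Sum>x\<in>UNIV. m x * (- \<i> * ef x (\<i> *s v))) =
    (\<Sum>x\<in>UNIV. (nN (fst x) False (snd x) * m (fst x, False) + nN (fst x) True (snd x) * m (fst x, True)) * ef x v)"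
  unfolding sum_bool_pair ef_nN by (intro sum.cong refl) (simp add: algebra_simps)

text \<open>The derivation of the sign operator on H^1 acts on the types (2,0), (1,1), (0,2) by 2,
  0, -2; this is its form without coordinates.\<close>

lemma frm_Dr_nN: "frm (Dr nN M) v w = - \<i> * (frm M (\<i> *s v) w + frm M v (\<i> *s w))"
proof -
  let ?l = "\<lambda>x y. nN (fst x) False (snd x) * M (fst x, False) y + nN (fst x) True (snd x) * M (fst x, True) y"
  let ?r = "\<lambda>x y. nN (fst y) False (snd y) * M x (fst y, False) + nN (fst y) True (snd y) * M x (fst y, True)"
  have "- \<i> * frm M (\<i> *s v) w = (\<Sum>y\<in>UNIV. (\<Sum>x\<in>UNIV. M x y * (- \<i> * ef x (\<i> *s v))) * ef y w)"
    unfolding frm_def by (simp add: sum_distrib_left sum_distrib_right ac_simps)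
  also have "\<dots> = frm ?l v w" unfolding sum_ef_nN frm_def ..
  finally have 1: "- \<i> * frm M (\<i> *s v) w = frm ?l v w" .
  have "- \<i> * frm M v (\<i> *s w) = (\<Sum>y\<in>UNIV. (\<Sum>x\<in>UNIV. M x y * ef x v) * (- \<i> * ef y (\<i> *s w)))"
    unfolding frm_def by (simp add: sum_distrib_left ac_simps)
  also have "\<dots> = frm ?r v w" unfolding sum_ef_nN frm_def
    by (intro sum.cong refl arg_cong2[of _ _ _ _ "(*)"])
      (simp add: sum.distrib sum_distrib_left sum_distrib_right distrib_right mult.assoc)
  finally have 2: "- \<i> * frm M v (\<i> *s w) = frm ?r v w" .
  have "Dr nN M = (\<lambda>x y. ?l x y + ?r x y)" by (intro ext) (simp only: Dr_def)
  then have "frm (Dr nN M) v w = frm ?l v w + frm ?r v w" by (simp only: frm_linear)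
  then show ?thesis using 1 2 by (simp only: distrib_left)
qed

lemma Dr_nN: "Dr nN M x y = (\<Sum>i\<in>UNIV. gp (t i) (u i) * Dr (single i pP) M x y
    + gq (t i) (u i) * Dr (single i qQ) M x y + gr (t i) (u i) * Dr (single i rR) M x y)"
proof -
  have d: "(\<Sum>i\<in>UNIV. h i * (if j = i then c else 0)) = h j * c" for h :: "'n \<Rightarrow> complex" and j c
    by (simp add: if_distrib cong: if_cong)
  have dd: "(\<Sum>i\<in>UNIV. h i * Dr (single i s) M x y) = Dr (\<lambda>i b c. h i * s b c) M x y" for h s
  proof -
    have "(\<Sum>i\<in>UNIV. h i * Dr (single i s) M x y) =
      (\<Sum>i\<in>UNIV. h i * (if fst x = i then s False (snd x) * M (fst x, False) y + s True (snd x) * M (fst x, True) y else 0))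
      + (\<Sum>i\<in>UNIV. h i * (if fst y = i then s False (snd y) * M x (fst y, False) + s True (snd y) * M x (fst y, True) else 0))"
      unfolding sum.distrib[symmetric] distrib_left[symmetric]
      by (intro sum.cong refl arg_cong2[of _ _ _ _ "(*)"]) (simp add: Dr_def single_def)
    then show ?thesis unfolding d by (simp add: Dr_def algebra_simps)
  qed
  show ?thesis unfolding sum.distrib dd by (simp add: Dr_def nN_def algebra_simps)
qed

text \<open>With rational \<open>c\<close> this is a rational functional on 2-forms; those vanishing
  on a rational subspace detect its complex span.\<close>

definition ell :: "(nat \<Rightarrow> nat \<Rightarrow> bool \<Rightarrow> bool \<Rightarrow> complex) \<Rightarrow> 'n form2 \<Rightarrow> complex" where
  "ell c \<omega> = (\<Sum>k<g. \<Sum>l<g. \<Sum>b\<in>UNIV. \<Sum>d\<in>UNIV. c k l b d * \<omega> (lam k b) (lam l d))"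

lemma ell_linear: "ell c (\<lambda>v w. \<omega> v w + \<omega>' v w) = ell c \<omega> + ell c \<omega>'" "ell c (\<lambda>v w. z * \<omega> v w) = z * ell c \<omega>"
  "ell c (\<lambda>v w. 0) = 0"
  by (simp_all add: ell_def distrib_left sum.distrib sum_distrib_left mult.left_commute)

lemma ell_sum: "ell c (\<lambda>v w. \<Sum>i\<in>F. \<omega> i v w) = (\<Sum>i\<in>F. ell c (\<omega> i))"
  by (induction F rule: infinite_finite_induct) (simp_all add: ell_linear)

text \<open>Brings the value at the Hodge operator into the shape of \<open>generic\<close>: one
  coefficient for each index and each basis element of sl2.\<close>

lemma ell_Dr_nN: "ell c (frm (Dr nN M)) = (\<Sum>i\<in>UNIV. gsum t (\<lambda>i. ell c (frm (Dr (single i pP) M)))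
    (\<lambda>i. ell c (frm (Dr (single i qQ) M))) (\<lambda>i. ell c (frm (Dr (single i rR) M))) i)"
proof -
  have "frm (Dr nN M) = (\<lambda>v w. \<Sum>i\<in>UNIV. gp (t i) (u i) * frm (Dr (single i pP) M) v w
    + gq (t i) (u i) * frm (Dr (single i qQ) M) v w + gr (t i) (u i) * frm (Dr (single i rR) M) v w)"
    unfolding Dr_nN[abs_def] by (intro ext) (simp only: frm_sum frm_linear)
  then show ?thesis by (simp only: ell_sum ell_linear gsum_def u_def mult.commute)
qed

lemma lag_dual_K: "(\<And>k b. \<phi> (lam k b) \<in> K) \<Longrightarrow> dual \<phi> x \<in> K"
  unfolding dual_def by (intro ring_closed_sum[OF K] ring_closed_mult[OF K] lag_K)

lemma ell_K:
  assumes "\<And>k l b d. c k l b d \<in> \<rat>" "\<And>x y. M x y \<in> K" shows "ell c (frm M) \<in> K"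
proof -
  have "ef x (lam k b) \<in> K" for x k b
    using ring_closed_power[OF K a_K] ring_closed_0[OF K] by (cases x) (auto simp: ef_lam)
  moreover have "c k l b d \<in> K" for k l b d by (rule Rats_K[OF assms(1)])
  ultimately show ?thesis unfolding ell_def frm_def
    by (intro ring_closed_sum[OF K] ring_closed_mult[OF K] assms(2))
qed

lemma mat_K:
  assumes "\<And>k l b d. \<omega> (lam k b) (lam l d) \<in> \<rat>" shows "mat \<omega> x y \<in> K"
  unfolding mat_def by (intro lag_dual_K Rats_K assms)

lemma Dr_K: assumes "\<And>b c. s b c \<in> \<rat>" "\<And>x y. M x y \<in> K" shows "Dr (single i s) M x y \<in> K"
  unfolding Dr_def single_def using ring_closed_0[OF K]
  by (intro ring_closed_add[OF K] ring_closed_mult[OF K] assms(2)) (auto intro: Rats_K assms)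

lemma bilinear_eq_on_lam:
  fixes \<omega> \<omega>' :: "'n form2"
  assumes "bilinear \<omega>" "bilinear \<omega>'" "\<And>k l b d. k < g \<Longrightarrow> l < g \<Longrightarrow> \<omega> (lam k b) (lam l d) = \<omega>' (lam k b) (lam l d)"
  shows "\<omega> = \<omega>'"
proof -
  have "mat \<omega> = mat \<omega>'" unfolding mat_def dual_def using assms(3) by (intro ext) (auto intro!: sum.cong)
  then show ?thesis using frm_mat[OF assms(1)] frm_mat[OF assms(2)] by metis
qed

interpretation mc: Modules.module "\<lambda>(c::complex) (\<omega>::'n form2) v w. c * \<omega> v w"
  by unfold_locales (auto simp: fun_eq_iff algebra_simps)

lemma lam_lattice_rat: "lam k b \<in> lattice_rat Lam"
proof -
  interpret m: Modules.module "\<lambda>(q::rat) (x::complex ^ 'n). (of_rat q :: real) *\<^sub>R x"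
    by unfold_locales (auto simp: algebra_simps of_rat_add of_rat_mult)
  show ?thesis unfolding lattice_rat_def by (rule m.span_base[OF lam_Lam])
qed

lemma cpl_closed:
  fixes \<omega> \<omega>' :: "'n form2"
  shows
  "\<omega> \<in> H \<Longrightarrow> \<omega> \<in> complexification H" "(\<lambda>v w. 0) \<in> complexification H"
  "\<omega> \<in> complexification H \<Longrightarrow> \<omega>' \<in> complexification H \<Longrightarrow> (\<lambda>v w. \<omega> v w + \<omega>' v w) \<in> complexification H"
  "\<omega> \<in> complexification H \<Longrightarrow> (\<lambda>v w. c * \<omega> v w) \<in> complexification H"
  unfolding complexification_def
  using mc.span_base[of \<omega> H] mc.span_zero[of H] mc.span_add[of \<omega> H \<omega>'] mc.span_scale[of \<omega> H c]
  by (simp_all add: zero_fun_def plus_fun_def)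

lemma cpl_induct [consumes 1, case_names base zero add scale]:
  fixes \<omega> :: "'n form2"
  assumes "\<omega> \<in> complexification H" "\<And>\<omega>. \<omega> \<in> H \<Longrightarrow> P \<omega>" "P (\<lambda>v w. 0)"
    "\<And>\<omega> \<omega>'. P \<omega> \<Longrightarrow> P \<omega>' \<Longrightarrow> P (\<lambda>v w. \<omega> v w + \<omega>' v w)" "\<And>c \<omega>. P \<omega> \<Longrightarrow> P (\<lambda>v w. c * \<omega> v w)"
  shows "P \<omega>"
proof -
  have "mc.subspace (Collect P)" using assms(3-5) by (intro mc.subspaceI) (auto simp: zero_fun_def plus_fun_def)
  then show ?thesis using mc.span_induct[of \<omega> H P] assms(1,2) unfolding complexification_def by blast
qed

lemma cpl_sum:
  fixes \<omega> :: "'b \<Rightarrow> 'n form2"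
  shows "(\<And>i. i \<in> F \<Longrightarrow> \<omega> i \<in> complexification H) \<Longrightarrow> (\<lambda>v w. \<Sum>i\<in>F. \<omega> i v w) \<in> complexification H"
  by (induction F rule: infinite_finite_induct) (auto intro: cpl_closed)

text \<open>The matrix of the wedge product of two coordinates of \<open>ef\<close>.\<close>

definition wW :: "'n \<times> bool \<Rightarrow> 'n \<times> bool \<Rightarrow> 'n \<times> bool \<Rightarrow> 'n \<times> bool \<Rightarrow> complex" where
  "wW x' y' x y = (if x = x' \<and> y = y' then 1 else 0) - (if x = y' \<and> y = x' then 1 else 0)"

lemma Dr_pP: "Dr (single i pP) M x y = (if x = (i, False) then 2 * M (i, True) y else 0) + (if y = (i, False) then 2 * M x (i, True) else 0)"
  by (cases x; cases y) (simp add: Dr_def single_def pP_def)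

lemma Dr_rR: "Dr (single i rR) M x y = (if x = (i, True) then - 2 * M (i, False) y else 0) + (if y = (i, True) then - 2 * M x (i, False) else 0)"
  by (cases x; cases y) (simp add: Dr_def single_def rR_def)

lemma Dr_wW: "i \<noteq> j \<Longrightarrow> Dr (single i pP) (wW (i, True) (j, b)) = (\<lambda>x y. 2 * wW (i, False) (j, b) x y)"
  "i \<noteq> j \<Longrightarrow> Dr (single j pP) (wW (i, b) (j, True)) = (\<lambda>x y. 2 * wW (i, b) (j, False) x y)"
  by (intro ext; simp add: Dr_pP wW_def)+

text \<open>\<open>rR\<close> at i keeps only the terms with the coordinate (i, False) and moves
  them to (i, True). Applied at two indices it leaves a single wedge product, however many indices
  the form involves.\<close>

lemma Dr_rR_rR:
  assumes ij: "i \<noteq> j" and M: "M (j, False) (i, False) = - M (i, False) (j, False)"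
  shows "Dr (single j rR) (Dr (single i rR) M) = (\<lambda>x y. 4 * M (i, False) (j, False) * wW (i, True) (j, True) x y)"
proof (intro ext)
  fix x y
  consider "x = (j, True)" "y = (i, True)" | "x = (i, True)" "y = (j, True)" | "\<not> (x = (j, True) \<and> y = (i, True))" "\<not> (x = (i, True) \<and> y = (j, True))"
    by blast
  then show "Dr (single j rR) (Dr (single i rR) M) x y = 4 * M (i, False) (j, False) * wW (i, True) (j, True) x y"
    by cases (use ij in \<open>simp_all add: Dr_rR wW_def M\<close>)
qed

lemma frm_wW: "frm (wW x y) v w = ef x v * ef y w - ef y v * ef x w"
proof -
  have 1: "(\<Sum>x\<in>UNIV. wW x' y' x y * ef x v) = (if y = y' then ef x' v else 0) - (if y = x' then ef y' v else 0)" for x' y' y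
    unfolding wW_def left_diff_distrib sum_subtractf
    by (cases "y = y'"; cases "y = x'") (simp_all add: if_distrib[of "\<lambda>q. q * _"] cong: if_cong)
  show ?thesis unfolding frm_def 1 left_diff_distrib sum_subtractf
    by (simp add: if_distrib[of "\<lambda>q. q * _"] cong: if_cong)
qed

text \<open>On a wedge product at i and j a rational functional is a rational polynomial in (a i, a
  j); this opens the way for \<open>hom2\<close>.\<close>

lemma ell_wW: "ell c (frm (wW (i, b) (j, d))) = biv g (\<lambda>k l. c k l b d - c l k d b) (a i) (a j)"
proof -
  have 1: "(\<Sum>b'\<in>UNIV. \<Sum>d'\<in>UNIV. c k l b' d' * (frm (wW (i, b) (j, d)) (lam k b') (lam l d')))
    = c k l b d * (a i ^ k * a j ^ l) - c k l d b * (a j ^ k * a i ^ l)" for k l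
    unfolding frm_wW ef_lam by (cases b; cases d) (simp_all add: UNIV_bool algebra_simps)
  have "ell c (frm (wW (i, b) (j, d))) = (\<Sum>k<g. \<Sum>l<g. c k l b d * (a i ^ k * a j ^ l)) - (\<Sum>k<g. \<Sum>l<g. c k l d b * (a j ^ k * a i ^ l))"
    unfolding ell_def 1 by (simp only: sum_subtractf)
  also have "(\<Sum>k<g. \<Sum>l<g. c k l d b * (a j ^ k * a i ^ l)) = (\<Sum>k<g. \<Sum>l<g. c l k d b * (a i ^ k * a j ^ l))"
    by (subst sum.swap) (simp only: mult.commute)
  finally show ?thesis unfolding biv_def by (simp add: sum_subtractf left_diff_distrib mult.assoc)
qed

text \<open>A (2,0)-form is a combination of products of v_i and v_j, and v_i is
  \<open>ef (i, False)\<close> plus t_i times \<open>ef (i, True)\<close>; so the entries with both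
  flags False determine the rest.\<close>

lemma H20_expansion:
  assumes "\<omega> \<in> H20"
  shows "mat \<omega> (i, b) (j, d) = mat \<omega> (i, False) (j, False) * (if b then t i else 1) * (if d then t j else 1)"
    and "mat \<omega> x y = - mat \<omega> y x"
proof -
  have bil: "bilinear \<omega>" and alt: "\<And>v. \<omega> v v = 0"
    and clin: "\<And>c v w. \<omega> (c *s v) w = c * \<omega> v w" "\<And>c v w. \<omega> v (c *s w) = c * \<omega> v w"
    using assms by (auto simp: H20_def H2_complex_def)
  define e where "e i = (axis i 1 :: complex ^ 'n)" for i
  have ve: "v = (\<Sum>i\<in>UNIV. v $ i *s e i)" for v unfolding e_def by (rule basis_expansion[symmetric])
  define M where "M x y = \<omega> (e (fst x)) (e (fst y)) * (if snd x then t (fst x) else 1) * (if snd y then t (fst y) else 1)"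
    for x y :: "'n \<times> bool"
  have lin: "linear (\<omega> v)" "linear (\<lambda>v. \<omega> v w)" for v w using bil by (simp_all add: bilinear_def)
  have s1: "(\<Sum>x\<in>UNIV. M x y * ef x v) = \<omega> v (e (fst y)) * (if snd y then t (fst y) else 1)" for y v
  proof -
    have "\<omega> v (e (fst y)) = (\<Sum>i\<in>UNIV. v $ i * \<omega> (e i) (e (fst y)))"
      by (subst ve[of v]) (simp only: linear_sum[OF lin(2)] clin)
    then show ?thesis unfolding sum_bool_pair M_def ef_decomp(1)
      by (simp add: sum_distrib_left sum_distrib_right algebra_simps)
  qed
  have "frm M v w = \<omega> v w" for v w
  proof -
    have "\<omega> v w = (\<Sum>i\<in>UNIV. w $ i * \<omega> v (e i))"
      by (subst ve[of w]) (simp only: linear_sum[OF lin(1)] clin)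
    then show ?thesis unfolding frm_def s1 sum_bool_pair ef_decomp(1) by (simp add: algebra_simps)
  qed
  then have "frm M = \<omega>" by (intro ext)
  then have M: "mat \<omega> = M" using mat_frm by metis
  have anti: "\<omega> v w = - \<omega> w v" for v w
    using alt[of "v + w"] alt[of v] alt[of w] bil by (simp add: bilinear_ladd bilinear_radd eq_neg_iff_add_eq_0)
  show "mat \<omega> (i, b) (j, d) = mat \<omega> (i, False) (j, False) * (if b then t i else 1) * (if d then t j else 1)"
    by (simp add: M M_def)
  show "mat \<omega> x y = - mat \<omega> y x" unfolding M M_def by (subst anti) simp
qed

end

section \<open>Rational Hodge substructures that meet the (2,0)-part\<close>

context generic_torus
begin

interpretation mr: Modules.module "\<lambda>(q::rat) (\<omega>::'n form2) v w. of_rat q * \<omega> v w"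
  by unfold_locales (auto simp: fun_eq_iff algebra_simps of_rat_add of_rat_mult)

text \<open>Membership in the complexification is tested by the rational functionals that vanish on
  H. Both the splitting of the Hodge operator and the passage from one pair of places to all others
  happen on the values of these functionals, where genericity over \<open>K\<close> and
  \<open>hom2\<close> apply.\<close>

theorem two_simple_Lam: "two_simple Lam"
  unfolding two_simple_def
proof (intro conjI torus_lattice_Lam allI impI)
  show "2 \<le> CARD('n)" using g3 g_card by simp
  fix H :: "'n form2 set"
  assume "rat_Hodge_substructure Lam H \<and> complexification H \<inter> H20 \<noteq> {0}"
  then have HR: "H \<subseteq> H2_rat Lam" and sub: "rat_subspace H"
    and Hodge: "\<And>\<omega>. \<omega> \<in> complexification H \<Longrightarrow>
        \<exists>\<alpha> \<in> complexification H \<inter> H20. \<exists>\<beta> \<in> complexification H \<inter> H11.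
        \<exists>\<gamma> \<in> complexification H \<inter> H02. \<omega> = \<alpha> + \<beta> + \<gamma>"
    and ne: "complexification H \<inter> H20 \<noteq> {0}"
    unfolding rat_Hodge_substructure_def by blast+
  let ?C = "complexification H"
  have Hbil: "bilinear \<omega>" and Hrat: "\<omega> (lam k b) (lam l d) \<in> \<rat>" if "\<omega> \<in> H" for \<omega> k b l d
    using that HR lam_lattice_rat by (auto simp: H2_rat_def H2_complex_def)
  have Cbil: "bilinear \<omega>" if "\<omega> \<in> ?C" for \<omega> using that
  proof (induction rule: cpl_induct)
    case (add \<omega> \<omega>')
    then show ?case by (auto simp: bilinear_def intro: linear_compose_add)
  next
    case (scale c \<omega>)
    then have b: "bilinear \<omega>" .
    show ?case unfolding bilinear_def using b
      by (auto intro!: linearI simp: bilinear_ladd bilinear_lmul bilinear_radd bilinear_rmul complex_scaleR_of_real algebra_simps)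
  next
    case (base \<omega>)
    then show ?case by (rule Hbil)
  qed (auto simp: bilinear_def linear_zero)
  \<comment> \<open>Evaluation on the lattice basis reduces this to \<open>rational_span\<close>,
    because a bilinear form is determined by these values.\<close>
  have member: "\<eta> \<in> ?C" if bil: "bilinear \<eta>"
    and kill: "\<And>c. (\<And>k l b d. c k l b d \<in> \<rat>) \<Longrightarrow> (\<And>\<omega>. \<omega> \<in> H \<Longrightarrow> ell c \<omega> = 0) \<Longrightarrow> ell c \<eta> = 0" for \<eta>
  proof -
    let ?J = "{..<g} \<times> {..<g} \<times> UNIV \<times> UNIV"
    define ev where "ev = (\<lambda>\<omega> :: 'n form2. \<lambda>(k, l, b, d). \<omega> (lam k b) (lam l d))"
    have ev: "ev \<omega> (k, l, b, d) = \<omega> (lam k b) (lam l d)" for \<omega> k l b d by (simp add: ev_def)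
    have ell_J: "(\<Sum>z\<in>?J. c z * ev \<omega> z) = ell (\<lambda>k l b d. c (k, l, b, d)) \<omega>" for c and \<omega> :: "'n form2"
      unfolding ell_def sum.cartesian_product by (rule sum.cong) (auto simp: ev)
    have "\<exists>n z w. (\<forall>k<n::nat. w k \<in> ev ` H) \<and> (\<forall>i\<in>?J. ev \<eta> i = (\<Sum>k<n. z k * w k i))"
    proof (rule rational_span)
      fix w :: "nat \<times> nat \<times> bool \<times> bool \<Rightarrow> complex" and i :: "nat \<times> nat \<times> bool \<times> bool"
      assume "w \<in> ev ` H"
      then obtain \<omega> where "w = ev \<omega>" "\<omega> \<in> H" by (rule imageE)
      moreover obtain k l b d where "i = (k, l, b, d)" by (cases i)
      ultimately show "w i \<in> \<rat>" using Hrat[of \<omega>] by (simp add: ev)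
    next
      fix w v :: "nat \<times> nat \<times> bool \<times> bool \<Rightarrow> complex" and q :: complex
      assume "w \<in> ev ` H" "v \<in> ev ` H" "q \<in> \<rat>"
      then obtain \<omega> \<omega>' q' where o: "w = ev \<omega>" "v = ev \<omega>'" "\<omega> \<in> H" "\<omega>' \<in> H" "q = of_rat q'" by (elim imageE Rats_cases) (rule that)
      have in_H: "(\<lambda>v w. \<omega>' v w + of_rat (- q') * \<omega> v w) \<in> H"
        using mr.subspace_add[OF sub[unfolded rat_subspace_def] o(4) mr.subspace_scale[OF sub[unfolded rat_subspace_def] o(3), of "- q'"]]
        by (simp add: plus_fun_def of_rat_minus)
      have eq: "(\<lambda>i. v i - q * w i) = ev (\<lambda>v w. \<omega>' v w + of_rat (- q') * \<omega> v w)"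
      proof
        fix i :: "nat \<times> nat \<times> bool \<times> bool"
        obtain k l b d where "i = (k, l, b, d)" by (cases i)
        then show "v i - q * w i = ev (\<lambda>v w. \<omega>' v w + of_rat (- q') * \<omega> v w) i" by (simp add: o ev of_rat_minus)
      qed
      show "(\<lambda>i. v i - q * w i) \<in> ev ` H" by (rule image_eqI[where f = ev, OF eq in_H])
    next
      fix c :: "nat \<times> nat \<times> bool \<times> bool \<Rightarrow> complex"
      assume c: "\<And>i. c i \<in> \<rat>" "\<And>w. w \<in> ev ` H \<Longrightarrow> (\<Sum>i\<in>?J. c i * w i) = 0"
      have "ell (\<lambda>k l b d. c (k, l, b, d)) \<eta> = 0"
      proof (rule kill)
        show "c (k, l, b, d) \<in> \<rat>" for k l b d by (rule c(1))
        show "ell (\<lambda>k l b d. c (k, l, b, d)) \<omega> = 0" if "\<omega> \<in> H" for \<omega>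
          using c(2)[OF imageI[of \<omega> H ev, OF that]] unfolding ell_J .
      qed
      then show "(\<Sum>i\<in>?J. c i * ev \<eta> i) = 0" unfolding ell_J .
    qed simp
    then obtain n z w where w: "\<forall>k<n::nat. w k \<in> ev ` H" "\<forall>i\<in>?J. ev \<eta> i = (\<Sum>k<n. z k * w k i)" by blast
    have "\<forall>k. \<exists>\<omega>. k < n \<longrightarrow> \<omega> \<in> H \<and> w k = ev \<omega>"
    proof
      fix k
      show "\<exists>\<omega>. k < n \<longrightarrow> \<omega> \<in> H \<and> w k = ev \<omega>"
      proof (cases "k < n")
        case True
        have "w k \<in> ev ` H" by (rule w(1)[rule_format, OF True])
        then obtain \<omega> where "w k = ev \<omega>" "\<omega> \<in> H" by (rule imageE)
        then show ?thesis by (intro exI[of _ \<omega>] impI conjI)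
      qed simp
    qed
    from choice[OF this] obtain \<omega> where \<omega>0: "\<forall>k. k < n \<longrightarrow> \<omega> k \<in> H \<and> w k = ev (\<omega> k)" by (rule exE)
    have \<omega>: "\<omega> k \<in> H" "w k = ev (\<omega> k)" if "k < n" for k
      by (rule conjunct1[OF \<omega>0[rule_format, OF that]], rule conjunct2[OF \<omega>0[rule_format, OF that]])
    have C: "(\<lambda>v v'. \<Sum>k<n. z k * \<omega> k v v') \<in> ?C"
    proof (rule cpl_sum[where \<omega> = "\<lambda>k v v'. z k * \<omega> k v v'"])
      fix k assume "k \<in> {..<n}"
      then have "k < n" by simp
      show "(\<lambda>v v'. z k * \<omega> k v v') \<in> ?C" by (rule cpl_closed(4)[OF cpl_closed(1)[OF \<omega>(1)[OF \<open>k < n\<close>]]])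
    qed
    have "\<eta> = (\<lambda>v v'. \<Sum>k<n. z k * \<omega> k v v')"
    proof (rule bilinear_eq_on_lam[OF bil Cbil[OF C]])
      fix k l :: nat and b d :: bool assume "k < g" "l < g"
      then have "(k, l, b, d) \<in> ?J" by simp
      from bspec[OF w(2) this] have "ev \<eta> (k, l, b, d) = (\<Sum>m<n. z m * w m (k, l, b, d))" .
      also have "\<dots> = (\<Sum>m<n. z m * \<omega> m (lam k b) (lam l d))"
        by (intro sum.cong refl arg_cong2[of _ _ _ _ "(*)"]) (simp add: \<omega>(2) ev)
      finally show "\<eta> (lam k b) (lam l d) = (\<Sum>m<n. z m * \<omega> m (lam k b) (lam l d))" by (simp only: ev)
    qed
    then show ?thesis using C by simp
  qed
  \<comment> \<open>The Hodge operator sends \<omega> to 2 \<alpha> - 2 \<gamma>, and both parts lie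
    in the complexification.\<close>
  have stable: "(\<lambda>v w. - \<i> * (\<omega> (\<i> *s v) w + \<omega> v (\<i> *s w))) \<in> ?C" if \<omega>: "\<omega> \<in> ?C" for \<omega>
  proof -
    obtain \<alpha> \<beta> \<gamma> where abc: "\<alpha> \<in> ?C" "\<alpha> \<in> H20" "\<beta> \<in> H11" "\<gamma> \<in> ?C" "\<gamma> \<in> H02" "\<omega> = \<alpha> + \<beta> + \<gamma>" using Hodge[OF \<omega>] by blast
    obtain \<sigma> where \<sigma>: "\<And>c u v. \<sigma> (c *s u) v = c * \<sigma> u v \<and> \<sigma> u (c *s v) = cnj c * \<sigma> u v" "\<And>u v. \<beta> u v = \<sigma> u v - \<sigma> v u"
      using abc(3) unfolding H11_def by blast
    have om: "\<omega> v w = \<alpha> v w + \<beta> v w + \<gamma> v w" for v w by (simp add: abc(6) plus_fun_def)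
    have al: "\<alpha> (\<i> *s v) w = \<i> * \<alpha> v w" "\<alpha> v (\<i> *s w) = \<i> * \<alpha> v w" for v w
      using abc(2) by (simp_all add: H20_def)
    have ga: "\<gamma> (\<i> *s v) w = - \<i> * \<gamma> v w" "\<gamma> v (\<i> *s w) = - \<i> * \<gamma> v w" for v w
      using abc(5) by (simp_all add: H02_def)
    have be: "\<beta> v (\<i> *s w) = - \<beta> (\<i> *s v) w" for v w by (simp add: \<sigma> algebra_simps)
    have "(\<lambda>v w. - \<i> * (\<omega> (\<i> *s v) w + \<omega> v (\<i> *s w))) = (\<lambda>v w. 2 * \<alpha> v w + - 2 * \<gamma> v w)"
      by (intro ext) (simp add: om al ga be algebra_simps)
    moreover have "(\<lambda>v w. 2 * \<alpha> v w + - 2 * \<gamma> v w) \<in> ?C"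
      by (rule cpl_closed(3)[OF cpl_closed(4)[OF abc(1)] cpl_closed(4)[OF abc(4)]])
    ultimately show ?thesis by (simp only:)
  qed
  have kill_C: "ell c \<omega> = 0" if "\<omega> \<in> ?C" "\<And>\<omega>. \<omega> \<in> H \<Longrightarrow> ell c \<omega> = 0" for c \<omega>
    using that(1) by (induction rule: cpl_induct) (simp_all add: that(2) ell_linear)
  have pqr: "pP b c \<in> \<rat>" "qQ b c \<in> \<rat>" "rR b c \<in> \<rat>" for b c by (simp_all add: pP_def qQ_def rR_def)
  \<comment> \<open>For \<omega> in \<open>H\<close> the matrix and all tested values lie in
    \<open>K\<close>, so by genericity the vanishing of the total makes every sl2 component vanish
    separately.\<close>
  have baseG: "frm (Dr (single i pP) (mat \<omega>)) \<in> ?C \<and> frm (Dr (single i rR) (mat \<omega>)) \<in> ?C" if \<omega>: "\<omega> \<in> H" for \<omega> i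
  proof -
    have z: "ell c (frm (Dr (single i pP) (mat \<omega>))) = 0 \<and> ell c (frm (Dr (single i qQ) (mat \<omega>))) = 0 \<and>
      ell c (frm (Dr (single i rR) (mat \<omega>))) = 0"
      if c: "\<And>k l b d. c k l b d \<in> \<rat>" "\<And>\<omega>. \<omega> \<in> H \<Longrightarrow> ell c \<omega> = 0" for c
    proof -
      have "frm (Dr nN (mat \<omega>)) = (\<lambda>v w. - \<i> * (\<omega> (\<i> *s v) w + \<omega> v (\<i> *s w)))"
        by (intro ext) (simp only: frm_Dr_nN frm_mat[OF Hbil[OF \<omega>]])
      then have "ell c (frm (Dr nN (mat \<omega>))) = 0" using kill_C[OF stable[OF cpl_closed(1)[OF \<omega>]] c(2)] by (simp only:)
      then have z: "(\<Sum>i\<in>UNIV. gsum t (\<lambda>i. ell c (frm (Dr (single i pP) (mat \<omega>))))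
        (\<lambda>i. ell c (frm (Dr (single i qQ) (mat \<omega>)))) (\<lambda>i. ell c (frm (Dr (single i rR) (mat \<omega>)))) i) = 0"
        unfolding ell_Dr_nN .
      show ?thesis
        by (rule generic[OF _ z]) (intro conjI ell_K Dr_K mat_K Hrat[OF \<omega>] c(1) pqr)
    qed
    show ?thesis
    proof
      show "frm (Dr (single i pP) (mat \<omega>)) \<in> ?C"
      proof (rule member[OF bilinear_frm])
        fix c :: "nat \<Rightarrow> nat \<Rightarrow> bool \<Rightarrow> bool \<Rightarrow> complex"
        assume c: "\<And>k l b d. c k l b d \<in> \<rat>" "\<And>\<omega>. \<omega> \<in> H \<Longrightarrow> ell c \<omega> = 0"
        show "ell c (frm (Dr (single i pP) (mat \<omega>))) = 0" by (rule conjunct1[OF z[OF c]])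
      qed
      show "frm (Dr (single i rR) (mat \<omega>)) \<in> ?C"
      proof (rule member[OF bilinear_frm])
        fix c :: "nat \<Rightarrow> nat \<Rightarrow> bool \<Rightarrow> bool \<Rightarrow> complex"
        assume c: "\<And>k l b d. c k l b d \<in> \<rat>" "\<And>\<omega>. \<omega> \<in> H \<Longrightarrow> ell c \<omega> = 0"
        show "ell c (frm (Dr (single i rR) (mat \<omega>))) = 0" by (rule conjunct2[OF conjunct2[OF z[OF c]]])
      qed
    qed
  qed
  \<comment> \<open>From \<open>H\<close> to its complexification by linearity of
    \<open>G\<close>.\<close>
  have step: "frm (Dr (single i s) (mat \<omega>)) \<in> ?C" if \<omega>: "\<omega> \<in> ?C" and s: "s = pP \<or> s = rR" for \<omega> i s
  proof -
    define G where "G \<omega> = frm (Dr (single i s) (mat \<omega>))" for \<omega>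
    have dual_lin: "dual (\<lambda>v. \<phi> v + \<psi> v) x = dual \<phi> x + dual \<psi> x" "dual (\<lambda>v. c * \<phi> v) x = c * dual \<phi> x" "dual (\<lambda>v. 0) x = 0"
      for \<phi> \<psi> c x by (simp_all add: dual_def distrib_left sum.distrib sum_distrib_left mult.left_commute)
    have mat_lin: "mat (\<lambda>v w. \<omega> v w + \<omega>' v w) x y = mat \<omega> x y + mat \<omega>' x y" "mat (\<lambda>v w. c * \<omega> v w) x y = c * mat \<omega> x y"
      "mat (\<lambda>v w. 0) x y = 0" for \<omega> \<omega>' c x y by (simp_all add: mat_def dual_lin)
    have G1: "G (\<lambda>v w. \<omega> v w + \<omega>' v w) = (\<lambda>v w. G \<omega> v w + G \<omega>' v w)" for \<omega> \<omega>'
    proof -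
      have "Dr (single i s) (mat (\<lambda>v w. \<omega> v w + \<omega>' v w)) = (\<lambda>x y. Dr (single i s) (mat \<omega>) x y + Dr (single i s) (mat \<omega>') x y)"
        by (intro ext) (simp add: Dr_def mat_lin algebra_simps)
      then show ?thesis unfolding G_def by (intro ext) (simp only: frm_linear)
    qed
    have G2: "G (\<lambda>v w. c * \<omega> v w) = (\<lambda>v w. c * G \<omega> v w)" for \<omega> c
    proof -
      have "Dr (single i s) (mat (\<lambda>v w. c * \<omega> v w)) = (\<lambda>x y. c * Dr (single i s) (mat \<omega>) x y)"
        by (intro ext) (simp add: Dr_def mat_lin algebra_simps)
      then show ?thesis unfolding G_def by (intro ext) (simp only: frm_linear)
    qed
    have G3: "G (\<lambda>v w. 0) = (\<lambda>v w. 0)" using G2[of 0 "\<lambda>v w. 0"] by simp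
    have "G \<omega> \<in> ?C" using \<omega>
    proof (induction rule: cpl_induct)
      case (base \<omega>)
      show ?case unfolding G_def using baseG[OF base] s by (elim disjE) simp_all
    next
      case zero
      then show ?case unfolding G3 by (rule cpl_closed)
    next
      case (add \<omega> \<omega>')
      then show ?case unfolding G1 by (rule cpl_closed)
    next
      case (scale c \<omega>)
      then show ?case unfolding G2 by (rule cpl_closed)
    qed
    then show ?thesis by (simp add: G_def)
  qed
  have stepM: "frm (Dr (single i s) M) \<in> ?C" if "frm M \<in> ?C" "s = pP \<or> s = rR" for M i s
    using step[OF that] unfolding mat_frm .
  have unscale: "frm M \<in> ?C" if "frm (\<lambda>x y. c * M x y) \<in> ?C" "c \<noteq> 0" for c M
    using cpl_closed(4)[OF that(1), of "1 / c"] that(2) by (simp add: frm_linear)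
  have "(0 :: 'n form2) \<in> ?C \<inter> H20" using cpl_closed(2)
    by (auto simp: H20_def H2_complex_def zero_fun_def bilinear_def linear_zero)
  then obtain \<omega> where \<omega>: "\<omega> \<in> ?C" "\<omega> \<in> H20" "\<omega> \<noteq> 0" using ne by blast
  obtain i j where ij: "mat \<omega> (i, False) (j, False) \<noteq> 0"
  proof -
    have "\<exists>i j. mat \<omega> (i, False) (j, False) \<noteq> 0"
    proof (rule ccontr)
      assume "\<not> ?thesis"
      then have "mat \<omega> x y = 0" for x y using H20_expansion(1)[OF \<omega>(2), of "fst x" "snd x" "fst y" "snd y"] by simp
      then have "frm (mat \<omega>) = 0" by (intro ext) (simp add: frm_def)
      then show False using frm_mat[OF Cbil[OF \<omega>(1)]] \<omega>(3) by simp
    qed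
    then show thesis using that by blast
  qed
  have "i \<noteq> j" using ij H20_expansion(2)[OF \<omega>(2), of "(i, False)" "(j, False)"] by (auto simp: eq_neg_iff_add_eq_0)
  have w0: "frm (mat \<omega>) \<in> ?C" using frm_mat[OF Cbil[OF \<omega>(1)]] \<omega>(1) by simp
  \<comment> \<open>One wedge product with both flags True survives; \<open>pP\<close> at i and at j
    then turns it into those with the other flags.\<close>
  have "frm (Dr (single j rR) (Dr (single i rR) (mat \<omega>))) \<in> ?C" by (intro stepM w0) simp_all
  then have "frm (\<lambda>x y. 4 * mat \<omega> (i, False) (j, False) * wW (i, True) (j, True) x y) \<in> ?C"
    unfolding Dr_rR_rR[where M = "mat \<omega>", OF \<open>i \<noteq> j\<close> H20_expansion(2)[OF \<omega>(2)]] .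
  then have TT: "frm (wW (i, True) (j, True)) \<in> ?C" by (rule unscale) (use ij in simp)
  have sp: "frm (Dr (single k pP) M) \<in> ?C" if "frm M \<in> ?C" for k M by (rule stepM[OF that]) simp
  have dn2: "frm (wW (i, b) (j, False)) \<in> ?C" if "frm (wW (i, b) (j, True)) \<in> ?C" for b
  proof -
    have "frm (\<lambda>x y. 2 * wW (i, b) (j, False) x y) \<in> ?C" using sp[OF that, of j] unfolding Dr_wW(2)[OF \<open>i \<noteq> j\<close>] .
    then show ?thesis by (rule unscale) simp
  qed
  have FT: "frm (wW (i, False) (j, True)) \<in> ?C"
  proof -
    have "frm (\<lambda>x y. 2 * wW (i, False) (j, True) x y) \<in> ?C" using sp[OF TT, of i] unfolding Dr_wW(1)[OF \<open>i \<noteq> j\<close>] .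
    then show ?thesis by (rule unscale) simp
  qed
  note TF = dn2[OF TT] and FF = dn2[OF FT]
  have all: "frm (wW (i, b) (j, d)) \<in> ?C" for b d using TT TF FT FF by (cases b; cases d) simp_all
  show "H20 \<subseteq> ?C"
  proof
    fix \<eta> :: "'n form2" assume \<eta>: "\<eta> \<in> H20"
    then have bil: "bilinear \<eta>" by (simp add: H20_def H2_complex_def)
    show "\<eta> \<in> ?C"
    proof (rule member[OF bil])
      fix c :: "nat \<Rightarrow> nat \<Rightarrow> bool \<Rightarrow> bool \<Rightarrow> complex"
      assume c: "\<And>k l b d. c k l b d \<in> \<rat>" "\<And>\<omega>. \<omega> \<in> H \<Longrightarrow> ell c \<omega> = 0"
      \<comment> \<open>\<open>hom2\<close> asks for both orders. Exchanging i and j gives, up to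
        sign, the wedge product with the flags exchanged, which is why all flags were
        produced.\<close>
      have w_zero: "ell c (frm (wW (k, b) (l, d))) = 0" if kl: "k \<noteq> l" for k l b d
        unfolding ell_wW
      proof (rule hom2[OF _ \<open>i \<noteq> j\<close> _ _ kl])
        show "c k l b d - c l k d b \<in> \<rat>" for k l by (rule Rats_diff[OF c(1) c(1)])
        show "biv g (\<lambda>k l. c k l b d - c l k d b) (a i) (a j) = 0" using kill_C[OF all[of b d] c(2)] unfolding ell_wW .
        have "frm (wW (j, b) (i, d)) = (\<lambda>v w. - 1 * frm (wW (i, d) (j, b)) v w)" by (intro ext) (simp add: frm_wW)
        then have "frm (wW (j, b) (i, d)) \<in> ?C" using cpl_closed(4)[OF all[of d b], of "- 1"] by simp
        then have "ell c (frm (wW (j, b) (i, d))) = 0" by (rule kill_C[OF _ c(2)])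
        then show "biv g (\<lambda>k l. c k l b d - c l k d b) (a j) (a i) = 0" unfolding ell_wW .
      qed
      \<comment> \<open>Every unordered pair is counted twice, whence the factor 1/2.\<close>
      have half: "mat \<eta> x y = (\<Sum>x'\<in>UNIV. \<Sum>y'\<in>UNIV. mat \<eta> x' y' / 2 * wW x' y' x y)" for x y
      proof -
        have "(\<Sum>x'\<in>UNIV. \<Sum>y'\<in>UNIV. mat \<eta> x' y' / 2 * wW x' y' x y) = mat \<eta> x y / 2 - mat \<eta> y x / 2"
        proof -
          have 1: "(\<Sum>y'\<in>UNIV. mat \<eta> x' y' / 2 * wW x' y' x y) =
            (if x' = x then mat \<eta> x y / 2 else 0) - (if x' = y then mat \<eta> y x / 2 else 0)" for x'
            unfolding wW_def right_diff_distrib sum_subtractf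
            by (cases "x = x'"; cases "y = x'") (auto simp: if_distrib[of "\<lambda>q. _ * q"] cong: if_cong)
          show ?thesis unfolding 1 sum_subtractf by simp
        qed
        then show ?thesis using H20_expansion(2)[OF \<eta>, of y x] by simp
      qed
      have "\<eta> = frm (\<lambda>x y. \<Sum>x'\<in>UNIV. \<Sum>y'\<in>UNIV. mat \<eta> x' y' / 2 * wW x' y' x y)"
        unfolding half[symmetric] using frm_mat[OF bil] by simp
      also have "\<dots> = (\<lambda>v w. \<Sum>x'\<in>UNIV. \<Sum>y'\<in>UNIV. mat \<eta> x' y' / 2 * frm (wW x' y') v w)"
        by (intro ext) (simp only: frm_sum frm_linear)
      finally have "ell c \<eta> = ell c (\<lambda>v w. \<Sum>x'\<in>UNIV. \<Sum>y'\<in>UNIV. mat \<eta> x' y' / 2 * frm (wW x' y') v w)"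
        by (rule arg_cong)
      also have "\<dots> = (\<Sum>x'\<in>UNIV. \<Sum>y'\<in>UNIV. mat \<eta> x' y' / 2 * ell c (frm (wW x' y')))"
        by (simp only: ell_sum ell_linear)
      also have "\<dots> = 0"
      proof (intro sum.neutral ballI)
        fix x y :: "'n \<times> bool"
        show "mat \<eta> x y / 2 * ell c (frm (wW x y)) = 0"
        proof (cases "fst x = fst y")
          case True
          have "mat \<eta> (fst x, False) (fst x, False) = 0" using H20_expansion(2)[OF \<eta>, of "(fst x, False)" "(fst x, False)"]
            by (simp add: eq_neg_iff_add_eq_0)
          then have "mat \<eta> (fst x, snd x) (fst y, snd y) = 0"
            by (subst H20_expansion(1)[OF \<eta>]) (simp add: True[symmetric])
          then have "mat \<eta> x y = 0" by simp
          then show ?thesis by simp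
        next
          case False
          then show ?thesis using w_zero[of "fst x" "fst y" "snd x" "snd y"] by simp
        qed
      qed
      finally show "ell c \<eta> = 0" .
    qed
  qed
qed

end

section \<open>Lattices in Euclidean space\<close>

definition int_span :: "'a::real_vector set \<Rightarrow> 'a set" where
  "int_span B = {\<Sum>b\<in>B. of_int (m b) *\<^sub>R b | m. True}"

definition add_closed :: "'a::ab_group_add set \<Rightarrow> bool" where
  "add_closed G \<longleftrightarrow> 0 \<in> G \<and> (\<forall>x\<in>G. \<forall>y\<in>G. x - y \<in> G)"

lemma add_closedD:
  assumes "add_closed G"
  shows "0 \<in> G" "x \<in> G \<Longrightarrow> y \<in> G \<Longrightarrow> x - y \<in> G" "x \<in> G \<Longrightarrow> - x \<in> G" "x \<in> G \<Longrightarrow> y \<in> G \<Longrightarrow> x + y \<in> G"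
proof -
  show 0: "0 \<in> G" and d: "x \<in> G \<Longrightarrow> y \<in> G \<Longrightarrow> x - y \<in> G" for x y using assms by (auto simp: add_closed_def)
  show m: "- x \<in> G" if "x \<in> G" for x using d[OF 0 that] by simp
  show "x + y \<in> G" if "x \<in> G" "y \<in> G" for x y using d[OF that(1) m[OF that(2)]] by simp
qed

lemma add_closed_of_int:
  fixes G :: "'a::real_vector set"
  assumes G: "add_closed G" and x: "x \<in> G"
  shows "of_int n *\<^sub>R x \<in> G"
proof -
  have "of_nat k *\<^sub>R x \<in> G" for k
    by (induction k) (auto intro: add_closedD(1)[OF G] add_closedD(4)[OF G x] simp: scaleR_add_left)
  then have "of_nat (nat n) *\<^sub>R x \<in> G" "- (of_nat (nat (- n)) *\<^sub>R x) \<in> G"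
    by (auto intro: add_closedD(3)[OF G])
  then show ?thesis by (cases "n \<ge> 0") auto
qed

lemma add_closed_sum:
  "add_closed G \<Longrightarrow> (\<And>i. i \<in> I \<Longrightarrow> h i \<in> G) \<Longrightarrow> sum h I \<in> G"
  by (induction I rule: infinite_finite_induct) (auto intro: add_closedD)

lemma int_span_subset: "add_closed G \<Longrightarrow> B \<subseteq> G \<Longrightarrow> int_span B \<subseteq> (G :: 'a::real_vector set)"
  unfolding int_span_def by (auto intro!: add_closed_sum add_closed_of_int)

lemma add_closed_int_span: "add_closed (int_span (B :: 'a::real_vector set))"
  unfolding add_closed_def int_span_def
proof (safe)
  show "\<exists>m. 0 = (\<Sum>b\<in>B. real_of_int (m b) *\<^sub>R b) \<and> True" by (intro exI[of _ "\<lambda>_. 0"]) simp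
  fix m n :: "'a \<Rightarrow> int"
  show "\<exists>k. (\<Sum>b\<in>B. real_of_int (m b) *\<^sub>R b) - (\<Sum>b\<in>B. real_of_int (n b) *\<^sub>R b) = (\<Sum>b\<in>B. real_of_int (k b) *\<^sub>R b) \<and> True"
    by (intro exI[of _ "\<lambda>b. m b - n b"]) (simp add: scaleR_left_diff_distrib sum_subtractf)
qed

lemma int_span_base: "finite B \<Longrightarrow> b \<in> B \<Longrightarrow> b \<in> int_span (B :: 'a::real_vector set)"
  unfolding int_span_def
proof (intro CollectI exI[of _ "\<lambda>c. if c = b then 1 else 0"] conjI TrueI)
  assume b: "finite B" "b \<in> B"
  have "(\<Sum>c\<in>B. real_of_int (if c = b then 1 else 0) *\<^sub>R c) = (\<Sum>c\<in>B. if c = b then c else 0)"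
    by (rule sum.cong) auto
  then show "b = (\<Sum>c\<in>B. real_of_int (if c = b then 1 else 0) *\<^sub>R c)" using b by simp
qed

lemma int_span_mono: "finite C \<Longrightarrow> B \<subseteq> C \<Longrightarrow> int_span B \<subseteq> int_span (C :: 'a::real_vector set)"
  by (rule int_span_subset[OF add_closed_int_span]) (auto intro: int_span_base)

text \<open>Reduction of the coefficients modulo the integers.\<close>

lemma reduce_mod_int_span:
  fixes B :: "'a::euclidean_space set"
  assumes "finite B" "x \<in> span B"
  shows "\<exists>y\<in>int_span B. norm (x - y) \<le> (\<Sum>b\<in>B. norm b)"
proof -
  obtain u where u: "x = (\<Sum>b\<in>B. u b *\<^sub>R b)" using assms span_finite[of B] by auto
  define y where "y = (\<Sum>b\<in>B. of_int \<lfloor>u b\<rfloor> *\<^sub>R b)"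
  have "x - y = (\<Sum>b\<in>B. frac (u b) *\<^sub>R b)"
    by (simp add: u y_def frac_def scaleR_left_diff_distrib sum_subtractf)
  also have "norm \<dots> \<le> (\<Sum>b\<in>B. norm (frac (u b) *\<^sub>R b))" by (rule norm_sum)
  also have "\<dots> \<le> (\<Sum>b\<in>B. norm b)"
    by (intro sum_mono) (auto intro!: mult_left_le_one_le less_imp_le[OF frac_lt_1])
  finally show ?thesis by (intro bexI[of _ y]) (auto simp: y_def int_span_def)
qed

text \<open>The vectors of \<open>B0\<close> are adjoined one at a time. Choose \<open>v\<close> in
  the group whose coordinate along the new vector \<open>w\<close> is the least positive one;
  division with remainder by it, followed by reduction modulo \<open>int_span B\<close>, brings
  every element into the span of \<open>insert v B\<close>.\<close>

theorem discrete_group_int_basis: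
  fixes G :: "'a::euclidean_space set"
  assumes G: "add_closed G" and fin: "\<And>R. finite {x\<in>G. norm x \<le> R}"
    and B0: "finite B0" "independent B0" "B0 \<subseteq> G"
  shows "\<exists>B. finite B \<and> independent B \<and> B \<subseteq> G \<and> card B = card B0 \<and> span B = span B0 \<and> G \<inter> span B0 = int_span B"
  using B0
proof (induction B0 rule: finite_induct)
  case empty
  have e: "int_span {} = {0::'a}" by (simp add: int_span_def)
  have "G \<inter> {0} = {0}" using add_closedD(1)[OF G] by blast
  then show ?case unfolding e[symmetric] by (intro exI[of _ "{}"]) (simp add: e independent_empty)
next
  case (insert w B0)
  have w: "w \<in> G" "w \<notin> span B0" "independent B0" "B0 \<subseteq> G"
    using insert.prems insert.hyps by (simp_all add: independent_insert)
  obtain B where B: "finite B" "independent B" "B \<subseteq> G" "card B = card B0" "span B = span B0" "G \<inter> span B0 = int_span B"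
    using insert.IH[OF w(3,4)] by blast
  have w': "w \<notin> span B" using w B(5) by simp
  have ex: "\<exists>y. x - y *\<^sub>R w \<in> span B" if "x \<in> span (insert w B)" for x
    by (rule span_breakdown_eq[THEN iffD1, OF that])
  define co where "co x = (SOME y. x - y *\<^sub>R w \<in> span B)" for x
  have co: "x - co x *\<^sub>R w \<in> span B" if "x \<in> span (insert w B)" for x
    unfolding co_def using someI_ex[OF ex[OF that]] .
  have uniq: "y = z" if "x - y *\<^sub>R w \<in> span B" "x - z *\<^sub>R w \<in> span B" for x y z
  proof (rule ccontr)
    assume "y \<noteq> z"
    have "(x - z *\<^sub>R w) - (x - y *\<^sub>R w) \<in> span B" by (rule span_diff[OF that(2,1)])
    then have "(y - z) *\<^sub>R w \<in> span B" by (simp add: scaleR_left_diff_distrib)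
    then have "(1 / (y - z)) *\<^sub>R (y - z) *\<^sub>R w \<in> span B" by (rule span_scale)
    then show False using w' \<open>y \<noteq> z\<close> by simp
  qed
  have coI: "co x = y" if "x - y *\<^sub>R w \<in> span B" for x y
  proof -
    have "y *\<^sub>R w \<in> span (insert w B)" by (simp add: span_scale span_base)
    moreover have "x - y *\<^sub>R w \<in> span (insert w B)" using that span_mono[of B "insert w B"] by blast
    ultimately have "x \<in> span (insert w B)" using span_add by fastforce
    then show ?thesis using uniq co that by blast
  qed
  \<comment> \<open>Bounds a vector whose coordinate along \<open>w\<close> lies between 0 and 1 and
    whose part in span B has been reduced. So a minimum over vectors of norm at most
    \<open>K\<close> suffices, and there are finitely many of them.\<close>
  define K where "K = (\<Sum>b\<in>B. norm b) + norm w"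
  define Y where "Y = co ` {x\<in>G \<inter> span (insert w B). norm x \<le> K \<and> 0 < co x}"
  have finY: "finite Y" unfolding Y_def by (rule finite_imageI, rule finite_subset[OF _ fin[of K]]) auto
  have "co w = 1" by (rule coI) (simp add: span_zero)
  then have "1 \<in> Y" using w(1) unfolding Y_def K_def
    by (intro image_eqI[of _ _ w]) (auto simp: span_base sum_nonneg)
  define t where "t = Min Y"
  have "t \<in> Y" unfolding t_def using finY \<open>1 \<in> Y\<close> by (intro Min_in) auto
  then obtain v where v: "v \<in> G" "v \<in> span (insert w B)" "co v = t" "t > 0" by (auto simp: Y_def)
  have "t \<le> 1" unfolding t_def using finY \<open>1 \<in> Y\<close> by (rule Min_le)
  have vB: "v - t *\<^sub>R w \<in> span B" using co[OF v(2)] v(3) by simp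
  have v_notin: "v \<notin> span B"
  proof
    assume "v \<in> span B"
    then have "co v = 0" by (intro coI) simp
    then show False using v by simp
  qed
  have spv: "span (insert v B) = span (insert w B)"
  proof (rule span_subspace)
    show "insert v B \<subseteq> span (insert w B)" using v(2) by (auto simp: span_base)
    show "span (insert w B) \<subseteq> span (insert v B)"
    proof (rule span_minimal)
      have "t *\<^sub>R w = v - (v - t *\<^sub>R w)" by simp
      also have "\<dots> \<in> span (insert v B)"
        by (rule span_diff) (use vB span_mono[of B "insert v B"] in \<open>auto simp: span_base\<close>)
      finally have "(1 / t) *\<^sub>R t *\<^sub>R w \<in> span (insert v B)" by (rule span_scale)
      then show "insert w B \<subseteq> span (insert v B)" using v(4) by (auto simp: span_base)
    qed simp
  qed simp
  have main: "x \<in> int_span (insert v B)" if x: "x \<in> G" "x \<in> span (insert w B)" for x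
  proof -
    define q where "q = \<lfloor>co x / t\<rfloor>"
    have x1: "x - of_int q *\<^sub>R v \<in> G" using x(1) v(1) G by (intro add_closedD(2) add_closed_of_int)
    define s where "s = co x - of_int q * t"
    have "of_int q \<le> co x / t" "co x / t < of_int q + 1" by (auto simp: q_def)
    then have "of_int q * t \<le> co x" "co x < (of_int q + 1) * t"
      by (simp_all only: pos_le_divide_eq[OF v(4)] pos_divide_less_eq[OF v(4)])
    then have s: "0 \<le> s" "s < t" by (auto simp: s_def algebra_simps)
    have "(x - co x *\<^sub>R w) - of_int q *\<^sub>R (v - t *\<^sub>R w) \<in> span B"
      by (rule span_diff[OF co[OF x(2)] span_scale[OF vB]])
    moreover have "(x - co x *\<^sub>R w) - of_int q *\<^sub>R (v - t *\<^sub>R w) = (x - of_int q *\<^sub>R v) - s *\<^sub>R w"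
      by (simp add: s_def algebra_simps)
    ultimately have xs: "(x - of_int q *\<^sub>R v) - s *\<^sub>R w \<in> span B" by simp
    obtain y where y: "y \<in> int_span B" "norm ((x - of_int q *\<^sub>R v) - s *\<^sub>R w - y) \<le> (\<Sum>b\<in>B. norm b)"
      using reduce_mod_int_span[OF B(1) xs] by blast
    define z where "z = x - of_int q *\<^sub>R v - y"
    have yG: "y \<in> G" "y \<in> span B" using y(1) B(6,5) by auto
    have zG: "z \<in> G" unfolding z_def by (rule add_closedD(2)[OF G x1 yG(1)])
    have zs: "z - s *\<^sub>R w \<in> span B" 
    proof -
      have "z - s *\<^sub>R w = (x - of_int q *\<^sub>R v) - s *\<^sub>R w - y" by (simp add: z_def)
      then show ?thesis using span_diff[OF xs yG(2)] by (simp only:)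
    qed
    have coz: "co z = s" using zs by (rule coI)
    have "norm z \<le> norm (z - s *\<^sub>R w) + norm (s *\<^sub>R w)" using norm_triangle_ineq[of "z - s *\<^sub>R w" "s *\<^sub>R w"] by simp
    also have "norm (s *\<^sub>R w) \<le> norm w" using s \<open>t \<le> 1\<close> by (auto intro!: mult_left_le_one_le)
    also have "norm (z - s *\<^sub>R w) \<le> (\<Sum>b\<in>B. norm b)" using y(2) by (simp add: z_def algebra_simps)
    finally have zK: "norm z \<le> K" by (simp add: K_def)
    have zspan: "z \<in> span (insert w B)"
    proof -
      have "s *\<^sub>R w \<in> span (insert w B)" by (simp add: span_scale span_base)
      moreover have "z - s *\<^sub>R w \<in> span (insert w B)" using zs span_mono[of B "insert w B"] by blast
      ultimately show ?thesis using span_add by fastforce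
    qed
    have "s = 0"
    proof (rule ccontr)
      assume "s \<noteq> 0"
      then have "s \<in> Y" using s zG zK zspan coz unfolding Y_def by (intro image_eqI[of _ _ z]) auto
      then have "t \<le> s" unfolding t_def using finY by (intro Min_le)
      then show False using s by simp
    qed
    then have "z \<in> int_span B" using zs zG B(5,6) by auto
    then have "y + z \<in> int_span B" using y(1) add_closedD(4)[OF add_closed_int_span] by blast
    then have "y + z \<in> int_span (insert v B)" using int_span_mono[of "insert v B" B] B(1) by blast
    moreover have "of_int q *\<^sub>R v \<in> int_span (insert v B)"
      using B(1) by (intro add_closed_of_int add_closed_int_span int_span_base) auto
    ultimately have "of_int q *\<^sub>R v + (y + z) \<in> int_span (insert v B)"
      using add_closedD(4)[OF add_closed_int_span, where x = "of_int q *\<^sub>R v" and y = "y + z"] by blast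
    then show ?thesis by (simp add: z_def)
  qed
  have vB': "v \<notin> B" using v_notin span_base by blast
  have spw: "span (insert w B) = span (insert w B0)" using B(5) by (simp add: span_insert)
  show ?case
  proof (intro exI[of _ "insert v B"] conjI)
    show "independent (insert v B)" using v_notin B(2) by (simp add: independent_insert vB')
    show "insert v B \<subseteq> G" using v(1) B(3) by simp
    show "card (insert v B) = card (insert w B0)" using vB' B(1,4) insert.hyps by simp
    show "span (insert v B) = span (insert w B0)" using spv spw by simp
    show "G \<inter> span (insert w B0) = int_span (insert v B)"
    proof
      show "G \<inter> span (insert w B0) \<subseteq> int_span (insert v B)" using main spw by auto
      have "int_span (insert v B) \<subseteq> G" using v(1) B(3) by (intro int_span_subset[OF G]) auto
      moreover have "int_span (insert v B) \<subseteq> span (insert v B)"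
        unfolding int_span_def by (auto intro!: span_sum span_scale intro: span_base)
      ultimately show "int_span (insert v B) \<subseteq> G \<inter> span (insert w B0)" using spv spw by auto
    qed
  qed (use B(1) in simp)
qed

section \<open>Units\<close>

context homog_roots
begin

text \<open>Dirichlet's box principle: there are (A + 1)^g integer vectors with entries in {0..A}
  but only A^g boxes. Smallness away from k and bar k is paid for by growth there, and the two
  effects cancel in the norm.\<close>

lemma close_elements:
  obtains C c :: real where "C > 0" "\<And>m::nat. m \<ge> 1 \<Longrightarrow>
    \<exists>v\<in>Ord. v \<noteq> 0 \<and> (\<forall>j. j \<noteq> k \<longrightarrow> j \<noteq> bar k \<longrightarrow> cmod (v $ j) \<le> C / real m) \<and> cmod (\<Prod>i\<in>UNIV. v $ i) \<le> c"
proof -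
  define Rs where "Rs = UNIV - {k, bar k}"
  define D where "D = card Rs"
  define nk where "nk = card {k, bar k}"
  \<comment> \<open>The summand 1 makes the bound A (C - 1) on the conjugates strictly smaller than
    A C, so every box index stays below m^g.\<close>
  define C where "C = 1 + (\<Sum>i\<in>UNIV. \<Sum>l<g. cmod (a i) ^ l)"
  have C1: "C \<ge> 1" unfolding C_def by (simp add: sum_nonneg)
  have Dn: "D + nk = g"
    using card_Diff_subset[of "{k, bar k}" UNIV] card_mono[of UNIV "{k, bar k}"]
    by (simp add: D_def nk_def Rs_def g_card)
  have nk: "nk \<ge> 1" "nk \<le> 2" by (auto simp: nk_def card_insert_if)
  obtain idx :: "'n \<Rightarrow> nat" where idx: "inj idx" using finite_imp_inj_to_nat_seg[of "UNIV :: 'n set"] by auto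
  \<comment> \<open>One real coordinate per index: of two conjugate indices one records the real
    part and the other the imaginary part.\<close>
  define \<rho> where "\<rho> t (v :: complex ^ 'n) = (if idx t \<le> idx (bar t) then Re (v $ t) else Im (v $ t))" for t v
  have \<rho>_diff: "\<rho> t (v - w) = \<rho> t v - \<rho> t w" for t v w by (simp add: \<rho>_def)
  have \<rho>_le: "\<bar>\<rho> t v\<bar> \<le> cmod (v $ t)" for t v by (simp add: \<rho>_def abs_Re_le_cmod abs_Im_le_cmod)
  have \<rho>_ge: "cmod (v $ t) \<le> \<bar>\<rho> t v\<bar> + \<bar>\<rho> (bar t) v\<bar>" if v: "v \<in> Ord" for t v
  proof (cases "bar t = t")
    case True
    then have "v $ t \<in> \<real>" using Ord_bar[OF v, of t] by (simp add: Reals_cnj_iff)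
    then have "cmod (v $ t) = \<bar>Re (v $ t)\<bar>" using True by (metis complex_is_Real_iff cmod_eq_Re)
    then show ?thesis using True by (simp add: \<rho>_def)
  next
    case False
    then have "idx t \<noteq> idx (bar t)" using idx by (metis injD)
    then have "\<bar>\<rho> t v\<bar> + \<bar>\<rho> (bar t) v\<bar> = \<bar>Re (v $ t)\<bar> + \<bar>Im (v $ t)\<bar>"
      using Ord_bar[OF v, of t] by (auto simp: \<rho>_def)
    then show ?thesis using cmod_le[of "v $ t"] by simp
  qed
  have main: "\<exists>v\<in>Ord. v \<noteq> 0 \<and> (\<forall>j. j \<noteq> k \<longrightarrow> j \<noteq> bar k \<longrightarrow> cmod (v $ j) \<le> 4 * C / real m) \<and>
      cmod (\<Prod>i\<in>UNIV. v $ i) \<le> (4 * C) ^ g" if m: "m \<ge> 1" for m :: nat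
  proof -
    \<comment> \<open>m^g subdivisions in each of D directions give (m^g)^D = A^g boxes.\<close>
    define A where "A = m ^ D"
    have A1: "A \<ge> 1" using m by (simp add: A_def)
    define Xs where "Xs = PiE {..<g} (\<lambda>_. {0..int A})"
    define Y where "Y = PiE Rs (\<lambda>_. {..<m ^ g})"
    have bnd: "cmod (cv x $ i) \<le> real A * (C - 1)" if x: "x \<in> Xs" for x i
    proof -
      have "cmod (cv x $ i) \<le> (\<Sum>l<g. cmod (of_int (x l) * a i ^ l))" unfolding cv_nth by (rule norm_sum)
      also have "\<dots> \<le> (\<Sum>l<g. real A * cmod (a i) ^ l)"
      proof (rule sum_mono)
        fix l assume "l \<in> {..<g}"
        then have "x l \<in> {0..int A}" using x unfolding Xs_def by (rule PiE_mem[rotated])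
        then have "0 \<le> x l" "x l \<le> int A" by simp_all
        then have "\<bar>real_of_int (x l)\<bar> \<le> real A" by linarith
        then show "cmod (of_int (x l) * a i ^ l) \<le> real A * cmod (a i) ^ l"
          by (simp add: norm_mult norm_power mult_right_mono)
      qed
      also have "\<dots> = real A * (\<Sum>l<g. cmod (a i) ^ l)" by (simp add: sum_distrib_left)
      also have "\<dots> \<le> real A * (\<Sum>i\<in>UNIV. \<Sum>l<g. cmod (a i) ^ l)"
        by (intro mult_left_mono member_le_sum) (auto intro!: sum_nonneg)
      finally show ?thesis by (simp add: C_def)
    qed
    define cell where "cell x = (\<lambda>t\<in>Rs. nat \<lfloor>(\<rho> t (cv x) + real A * C) / (2 * real A * C) * real (m ^ g)\<rfloor>)" for x
    have AC: "real A * C > 0" using A1 C1 by simp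
    have range: "0 \<le> (\<rho> t (cv x) + real A * C) / (2 * real A * C) \<and> (\<rho> t (cv x) + real A * C) / (2 * real A * C) < 1"
      if x: "x \<in> Xs" for x t
    proof -
      have "\<bar>\<rho> t (cv x)\<bar> \<le> real A * (C - 1)" using \<rho>_le[of t "cv x"] bnd[OF x, of t] by linarith
      also have "\<dots> < real A * C" using A1 by simp
      finally have "\<bar>\<rho> t (cv x)\<bar> < real A * C" .
      then have b: "- (real A * C) < \<rho> t (cv x)" "\<rho> t (cv x) < real A * C" by linarith+
      have p: "0 < 2 * (real A * C)" using AC by linarith
      have "0 \<le> (\<rho> t (cv x) + real A * C) / (2 * (real A * C))"
        using b p by (intro divide_nonneg_pos) linarith+
      moreover have "(\<rho> t (cv x) + real A * C) / (2 * (real A * C)) < 1"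
        unfolding pos_divide_less_eq[OF p] using b by linarith
      ultimately show ?thesis by (simp only: mult.assoc)
    qed
    have mg: "real (m ^ g) > 0" using m by simp
    have cellY: "cell ` Xs \<subseteq> Y"
    proof safe
      fix x assume x: "x \<in> Xs"
      show "cell x \<in> Y" unfolding Y_def cell_def
      proof (intro restrict_PiE_iff[THEN iffD2] ballI)
        fix t assume "t \<in> Rs"
        let ?q = "(\<rho> t (cv x) + real A * C) / (2 * real A * C)"
        have "?q * real (m ^ g) < real (m ^ g)" 
          using mult_strict_right_mono[OF conjunct2[OF range[OF x, of t]] mg] by (simp only: mult_1)
        then have "\<lfloor>?q * real (m ^ g)\<rfloor> < int (m ^ g)" by (simp add: floor_less_iff)
        then show "nat \<lfloor>?q * real (m ^ g)\<rfloor> \<in> {..<m ^ g}"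

        proof -
          have "nat z < n" if "z < int n" "0 < n" for z n using that by linarith
          moreover have "0 < m ^ g" using m by simp
          ultimately show ?thesis using \<open>\<lfloor>?q * real (m ^ g)\<rfloor> < int (m ^ g)\<close> by blast
        qed
      qed
    qed
    have finX: "finite Xs" "finite Y" unfolding Xs_def Y_def by (auto intro!: finite_PiE)
    have "card (cell ` Xs) \<le> card Y" using cellY finX by (intro card_mono)
    also have "card Y = (m ^ g) ^ D" unfolding Y_def by (subst card_PiE) (auto simp: D_def)
    also have "\<dots> = A ^ g" by (simp add: A_def power_mult[symmetric] mult.commute)
    also have "\<dots> < (A + 1) ^ g" using g3 by (intro power_strict_mono) auto
    also have "\<dots> = card Xs" unfolding Xs_def by (subst card_PiE) (auto simp: nat_add_distrib)
    finally have "card (cell ` Xs) < card Xs" .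
    then have "\<not> inj_on cell Xs" using card_image by fastforce
    then obtain x y where xy: "x \<in> Xs" "y \<in> Xs" "x \<noteq> y" "cell x = cell y" by (auto simp: inj_on_def)
    define v where "v = cv x - cv y"
    have vO: "v \<in> Ord" unfolding v_def by (intro Ord_closed cv_in_Ord)
    have "v \<noteq> 0"
    proof
      assume "v = 0"
      then have "x l = y l" if "l < g" for l using cv_inj that by (simp add: v_def)
      then have "x = y" using xy(1,2) unfolding Xs_def by (intro PiE_ext[of x "{..<g}" _ y]) auto
      then show False using xy(3) by simp
    qed
    have \<rho>v: "\<bar>\<rho> t v\<bar> \<le> 2 * C / real m ^ nk" if t: "t \<in> Rs" for t
    proof -
      let ?q = "\<lambda>x. (\<rho> t (cv x) + real A * C) / (2 * real A * C) * real (m ^ g)"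
      have "cell x t = cell y t" using xy(4) by simp
      then have "nat \<lfloor>?q x\<rfloor> = nat \<lfloor>?q y\<rfloor>" using t by (simp add: cell_def)
      moreover have "0 \<le> ?q x" "0 \<le> ?q y"
        by (rule mult_nonneg_nonneg[OF conjunct1[OF range[OF xy(1), of t]] less_imp_le[OF mg]],
          rule mult_nonneg_nonneg[OF conjunct1[OF range[OF xy(2), of t]] less_imp_le[OF mg]])
      ultimately have "\<lfloor>?q x\<rfloor> = \<lfloor>?q y\<rfloor>" by (simp add: nat_eq_iff)
      then have lt: "\<bar>?q x - ?q y\<bar> < 1" by linarith
      define Z where "Z = real (m ^ g) / (2 * real A * C)"
      have Z: "Z > 0" unfolding Z_def using AC mg by (intro divide_pos_pos) (simp_all add: mult.assoc)
      have eq: "?q x - ?q y = \<rho> t v * Z"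
        unfolding v_def \<rho>_diff Z_def
        by (simp only: left_diff_distrib[symmetric] diff_divide_distrib[symmetric] times_divide_eq_left times_divide_eq_right) simp
      have "\<bar>\<rho> t v * Z\<bar> < 1" using lt unfolding eq .
      then have "\<bar>\<rho> t v\<bar> * Z < 1" using Z by (simp add: abs_mult)
      then have "\<bar>\<rho> t v\<bar> < 1 / Z" using Z by (simp only: pos_less_divide_eq)
      also have "1 / Z = 2 * real A * C / real (m ^ g)" by (simp add: Z_def)
      also have "\<dots> = 2 * C / real m ^ nk"
        using m by (simp add: A_def Dn[symmetric] power_add)
      finally show ?thesis by simp
    qed
    have Rs_bar: "bar t \<in> Rs" if "t \<in> Rs" for t using that by (auto simp: Rs_def)
    have vj: "cmod (v $ j) \<le> 4 * C / real m ^ nk" if "j \<in> Rs" for j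
      using \<rho>_ge[OF vO, of j] \<rho>v[OF that] \<rho>v[OF Rs_bar[OF that]] by simp
    have vk: "cmod (v $ j) \<le> 4 * C * real m ^ D" for j
    proof -
      have "cmod (v $ j) \<le> cmod (cv x $ j) + cmod (cv y $ j)" unfolding v_def by (simp add: norm_triangle_ineq4)
      also have "\<dots> \<le> real A * (C - 1) + real A * (C - 1)" using bnd xy by (intro add_mono)
      also have "\<dots> \<le> 4 * C * real m ^ D" using A1 C1 by (simp add: A_def algebra_simps)
      finally show ?thesis .
    qed
    have m1: "real m ^ nk \<ge> real m" using m nk(1) power_increasing[of 1 nk "real m"] by simp
    have "cmod (v $ j) \<le> 4 * C / real m" if "j \<noteq> k" "j \<noteq> bar k" for j
    proof -
      have "cmod (v $ j) \<le> 4 * C / real m ^ nk" using vj[of j] that by (simp add: Rs_def)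
      also have "\<dots> \<le> 4 * C / real m" using m1 m C1 by (intro divide_left_mono) auto
      finally show ?thesis .
    qed
    moreover have "cmod (\<Prod>i\<in>UNIV. v $ i) \<le> (4 * C) ^ g"
    proof -
      have "(UNIV :: 'n set) = Rs \<union> {k, bar k}" by (auto simp: Rs_def)
      then have prod_split: "(\<Prod>i\<in>UNIV. cmod (v $ i)) = (\<Prod>i\<in>Rs \<union> {k, bar k}. cmod (v $ i))" by (rule prod.cong) (rule refl)
      have "cmod (\<Prod>i\<in>UNIV. v $ i) = (\<Prod>i\<in>UNIV. cmod (v $ i))" by (rule prod_norm[symmetric])
      also note prod_split
      also have "(\<Prod>i\<in>Rs \<union> {k, bar k}. cmod (v $ i)) = (\<Prod>i\<in>Rs. cmod (v $ i)) * (\<Prod>i\<in>{k, bar k}. cmod (v $ i))"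
        by (rule prod.union_disjoint) (auto simp: Rs_def)
      also have "\<dots> \<le> (\<Prod>i\<in>Rs. 4 * C / real m ^ nk) * (\<Prod>i\<in>{k, bar k}. 4 * C * real m ^ D)"
        using vj vk C1 by (intro mult_mono prod_mono) (auto intro!: prod_nonneg)
      also have "\<dots> = (4 * C / real m ^ nk) ^ D * (4 * C * real m ^ D) ^ nk"
        by (simp only: prod_constant D_def nk_def)
      also have "\<dots> = (4 * C) ^ g"
      proof -
        have "(real m ^ nk) ^ D = (real m ^ D) ^ nk" by (simp flip: power_mult add: mult.commute)
        then show ?thesis using m by (simp add: power_divide power_mult_distrib Dn[symmetric] power_add)
      qed
      finally show ?thesis .
    qed
    ultimately show ?thesis using vO \<open>v \<noteq> 0\<close> by blast
  qed
  show thesis by (rule that[of "4 * C" "(4 * C) ^ g"]) (use C1 main in auto)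
qed

text \<open>Among infinitely many elements of bounded norm, two have the same norm n and agree
  modulo n, and the later one is smaller away from k. As n is a multiple of the first in the order,
  the quotient is integral, and its norm is 1.\<close>

lemma dirichlet_unit: "\<exists>u\<in>OU. \<forall>j. j \<noteq> k \<longrightarrow> j \<noteq> bar k \<longrightarrow> cmod (u $ j) < 1"
proof -
  obtain C c :: real where C: "C > 0" and ex: "\<And>m::nat. m \<ge> 1 \<Longrightarrow>
    \<exists>v\<in>Ord. v \<noteq> 0 \<and> (\<forall>j. j \<noteq> k \<longrightarrow> j \<noteq> bar k \<longrightarrow> cmod (v $ j) \<le> C / real m) \<and> cmod (\<Prod>i\<in>UNIV. v $ i) \<le> c"
    using close_elements[of k] by blast
  define P where "P m v M N \<longleftrightarrow> v = cv M \<and> v \<noteq> 0 \<and> (\<forall>j. j \<noteq> k \<longrightarrow> j \<noteq> bar k \<longrightarrow> cmod (v $ j) \<le> C / real (Suc m))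
    \<and> (\<Prod>i\<in>UNIV. v $ i) = of_int N \<and> N \<noteq> 0 \<and> \<bar>real_of_int N\<bar> \<le> c" for m v M N
  have "\<exists>v M N. P m v M N" for m
  proof -
    obtain v where v: "v \<in> Ord" "v \<noteq> 0" "\<forall>j. j \<noteq> k \<longrightarrow> j \<noteq> bar k \<longrightarrow> cmod (v $ j) \<le> C / real (Suc m)"
      "cmod (\<Prod>i\<in>UNIV. v $ i) \<le> c" using ex[of "Suc m"] by auto
    obtain M where "v = cv M" using Ord_cv[OF v(1)] .
    moreover obtain N where N: "(\<Prod>i\<in>UNIV. v $ i) = of_int N" using norm_Ord[OF v(1)] by blast
    moreover have "N \<noteq> 0"
    proof
      assume "N = 0"
      then obtain i where "v $ i = 0" using N by auto
      then show False using Ord_zero_iff[OF v(1)] v(2) by blast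
    qed
    ultimately show ?thesis using v unfolding P_def
      by (intro exI[of _ v] exI[of _ M] exI[of _ N]) (simp add: norm_of_int)
  qed
  then obtain V M N where V: "\<And>m. P m (V m) (M m) (N m)" by metis
  define cls where "cls m = (N m, \<lambda>l\<in>{..<g}. M m l mod N m)" for m
  define B where "B = \<lceil>c\<rceil>"
  have NB: "\<bar>N m\<bar> \<le> B" for m using V[of m] unfolding P_def B_def by linarith
  have "range cls \<subseteq> {-B..B} \<times> PiE {..<g} (\<lambda>_. {-B..B})"
  proof (rule image_subsetI)
    fix m
    have "\<bar>x mod N m\<bar> \<le> B" for x using V[of m] NB[of m] abs_mod_less[of "N m" x] unfolding P_def by linarith
    then have "\<And>x. - B \<le> x mod N m \<and> x mod N m \<le> B" by (simp add: abs_le_iff minus_le_iff)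
    then show "cls m \<in> {-B..B} \<times> PiE {..<g} (\<lambda>_. {-B..B})"
      using NB[of m] by (auto simp: cls_def abs_le_iff)
  qed
  moreover have "finite ({-B..B} \<times> PiE {..<g} (\<lambda>_. {-B..B}))" by (intro finite_cartesian_product finite_PiE) auto
  ultimately have "finite (range cls)" by (rule finite_subset)
  then obtain m1 where m1: "infinite {m. cls m = cls m1}"
    using pigeonhole_infinite[of "UNIV :: nat set" cls] by auto
  define v1 where "v1 = V m1"
  have v1: "v1 \<in> Ord" "v1 \<noteq> 0" using V[of m1] cv_in_Ord by (auto simp: P_def v1_def)
  have nz: "v1 $ j \<noteq> 0" for j using Ord_zero_iff v1 by blast
  define \<epsilon> where "\<epsilon> = Min (range (\<lambda>j. cmod (v1 $ j)))"
  have \<epsilon>: "\<epsilon> > 0" "\<And>j. \<epsilon> \<le> cmod (v1 $ j)" unfolding \<epsilon>_def using nz by (auto simp: Min_gr_iff)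
  \<comment> \<open>Far enough in the infinite class, all conjugates away from k are smaller than
    the least conjugate of \<open>v1\<close>.\<close>
  obtain m2 where m2: "m2 > nat \<lceil>C / \<epsilon>\<rceil>" "cls m2 = cls m1" 
    using infinite_nat_iff_unbounded[THEN iffD1, OF m1, rule_format, of "nat \<lceil>C / \<epsilon>\<rceil>"] by blast
  define v2 where "v2 = V m2"
  have v2: "v2 \<in> Ord" using V[of m2] cv_in_Ord by (auto simp: P_def v2_def)
  have small: "cmod (v2 $ j) < cmod (v1 $ j)" if "j \<noteq> k" "j \<noteq> bar k" for j
  proof -
    have "C / \<epsilon> < real (Suc m2)" using m2(1) by linarith
    then have "C / real (Suc m2) < \<epsilon>" using \<epsilon>(1) by (simp add: field_simps)
    moreover have "cmod (v2 $ j) \<le> C / real (Suc m2)" using V[of m2] that unfolding P_def v2_def by blast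
    ultimately show ?thesis using \<epsilon>(2)[of j] by linarith
  qed
  define n where "n = N m1"
  have ce0: "N m2 = N m1 \<and> (\<lambda>l\<in>{..<g}. M m2 l mod N m2) = (\<lambda>l\<in>{..<g}. M m1 l mod N m1)"
    using m2(2) unfolding cls_def prod.inject .
  note ce = conjunct1[OF ce0] conjunct2[OF ce0]
  have n: "N m2 = n" "n \<noteq> 0" using ce(1) V[of m1] by (simp_all add: n_def P_def)
  have cong: "M m2 l mod n = M m1 l mod n" if "l < g" for l
    using fun_cong[OF ce(2), of l] that ce(1) by (simp add: n_def)
  have "\<exists>d. M m2 l = M m1 l + n * d" if "l < g" for l
  proof -
    have "n dvd M m2 l - M m1 l" using cong[OF that] by (simp add: mod_eq_dvd_iff)
    then obtain d where "M m2 l - M m1 l = n * d" by (elim dvdE)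
    then show ?thesis by (intro exI[of _ d]) simp
  qed
  then obtain d where d: "\<And>l. l < g \<Longrightarrow> M m2 l = M m1 l + n * d l" by metis
  have v21: "v2 = v1 + of_int n * cv d"
  proof -
    have "v2 = cv (\<lambda>l. M m1 l + n * d l)" using V[of m2] cv_cong[of "M m2"] d by (simp add: P_def v2_def)
    also have "\<dots> = v1 + of_int n * cv d" using V[of m1]
      by (simp add: P_def v1_def vec_eq_iff cv_nth sum.distrib sum_distrib_left algebra_simps)
    finally show ?thesis .
  qed
  have pr: "(\<Prod>i\<in>UNIV. V m $ i) = of_int (N m)" for m using V[of m] unfolding P_def by (elim conjE)
  have N1: "(\<Prod>i\<in>UNIV. v1 $ i) = of_int n" using pr[of m1] unfolding v1_def n_def .
  have N2: "(\<Prod>i\<in>UNIV. v2 $ i) = of_int n" using pr[of m2] unfolding v2_def n(1) .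
  obtain w where w: "w \<in> Ord" "v1 * w = of_int n" using norm_cofactor[OF v1(1) N1] .
  \<comment> \<open>This is v2/v1: v2 = v1 + n d with d in the order, and n = v1 w.\<close>
  define u where "u = 1 + w * cv d"
  have u: "u \<in> Ord" unfolding u_def by (intro Ord_closed w cv_in_Ord)
  have vu: "v1 * u = v2" unfolding u_def v21 w(2)[symmetric] by (simp add: algebra_simps)
  then have comp: "v1 $ i * u $ i = v2 $ i" for i by (metis vector_mult_component)
  have "(\<Prod>i\<in>UNIV. v1 $ i) * (\<Prod>i\<in>UNIV. u $ i) = (\<Prod>i\<in>UNIV. v2 $ i)"
    by (simp add: comp prod.distrib[symmetric])
  then have "(\<Prod>i\<in>UNIV. u $ i) = 1" using N1 N2 n(2) by simp
  then have "u \<in> OU" using u by (simp add: OU_iff)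
  moreover have "cmod (u $ j) < 1" if "j \<noteq> k" "j \<noteq> bar k" for j
  proof -
    have "cmod (v1 $ j) * cmod (u $ j) < cmod (v1 $ j) * 1" using small[OF that] comp[of j] by (simp add: norm_mult[symmetric])
    then show ?thesis by (rule mult_left_less_imp_less) simp
  qed
  ultimately show ?thesis by blast
qed

end

section \<open>Tensor products as rings of vectors\<close>

text \<open>Bridges the subsets of type-class rings used so far and the rings with explicit carrier
  in which the tensor product is defined.\<close>

definition vring :: "'c::comm_ring_1 set \<Rightarrow> 'c ring" where
  "vring S = \<lparr>carrier = S, monoid.mult = (*), one = 1, ring.zero = 0, ring.add = (+)\<rparr>"

lemma vring_simps [simp]:
  "carrier (vring S) = S" "x \<otimes>\<^bsub>vring S\<^esub> y = x * y" "\<one>\<^bsub>vring S\<^esub> = 1" "\<zero>\<^bsub>vring S\<^esub> = 0" "x \<oplus>\<^bsub>vring S\<^esub> y = x + y"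
  by (simp_all add: vring_def)

lemma cring_vring:
  assumes S: "ring_closed S" shows "cring (vring S)"
proof (rule cringI)
  show "abelian_group (vring S)"
  proof (rule abelian_groupI)
    show "\<exists>y\<in>carrier (vring S). y \<oplus>\<^bsub>vring S\<^esub> x = \<zero>\<^bsub>vring S\<^esub>" if "x \<in> carrier (vring S)" for x
      using that ring_closed_uminus[OF S] by (intro bexI[of _ "- x"]) auto
  qed (use S in \<open>auto simp: ring_closed_0 ring_closed_add ac_simps\<close>)
  show "comm_monoid (vring S)"
    by (rule comm_monoidI) (use S in \<open>auto simp: ring_closed_1 ring_closed_mult ac_simps\<close>)
qed (auto simp: distrib_right)

section \<open>The free ring on pairs\<close>

lemma frag_extend_plus_fun: "frag_extend (\<lambda>p. u p + v p) x = frag_extend u x + frag_extend v x"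
  by (rule frag_induction[of x UNIV]) (auto simp: frag_extend_diff)

lemma frag_extend_zero_fun: "frag_extend (\<lambda>p. 0) x = 0"
  by (rule frag_induction[of x UNIV]) (auto simp: frag_extend_diff)

lemma frag_extend_minus_fun: "frag_extend (\<lambda>p. u p - v p) x = frag_extend u x - frag_extend v x"
  by (rule frag_induction[of x UNIV]) (auto simp: frag_extend_diff)

definition pmul :: "('a, 'x) ring_scheme \<Rightarrow> ('b, 'y) ring_scheme \<Rightarrow> (('a \<times> 'b) \<Rightarrow>\<^sub>0 int) \<Rightarrow> (('a \<times> 'b) \<Rightarrow>\<^sub>0 int) \<Rightarrow> (('a \<times> 'b) \<Rightarrow>\<^sub>0 int)" where
  "pmul A B x y = frag_extend (\<lambda>(a, b). frag_extend
          (\<lambda>(a', b'). frag_of (a \<otimes>\<^bsub>A\<^esub> a', b \<otimes>\<^bsub>B\<^esub> b')) y) x"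

lemma pmul_of: "pmul A B (frag_of (a, b)) (frag_of (a', b')) = frag_of (a \<otimes>\<^bsub>A\<^esub> a', b \<otimes>\<^bsub>B\<^esub> b')"
  by (simp add: pmul_def)

lemma pmul_linear:
  "pmul A B (x - x') y = pmul A B x y - pmul A B x' y" "pmul A B x (y - y') = pmul A B x y - pmul A B x y'"
  "pmul A B (x + x') y = pmul A B x y + pmul A B x' y" "pmul A B x (y + y') = pmul A B x y + pmul A B x y'"
  "pmul A B 0 y = 0" "pmul A B x 0 = 0"
  by (simp_all add: pmul_def frag_extend_diff frag_extend_add case_prod_unfold frag_extend_minus_fun
      frag_extend_plus_fun frag_extend_zero_fun)

definition pset :: "'a set \<Rightarrow> ('a \<Rightarrow>\<^sub>0 int) set" where "pset P = {x. Poly_Mapping.keys x \<subseteq> P}"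

lemma pset_closed: "0 \<in> pset P" "p \<in> P \<Longrightarrow> frag_of p \<in> pset P"
  "x \<in> pset P \<Longrightarrow> y \<in> pset P \<Longrightarrow> x - y \<in> pset P" "x \<in> pset P \<Longrightarrow> y \<in> pset P \<Longrightarrow> x + y \<in> pset P"
  "x \<in> pset P \<Longrightarrow> - x \<in> pset P"
  using keys_diff[of x y] keys_add[of x y] by (auto simp: pset_def keys_frag_of)

lemma pset_induct [consumes 1, case_names zero base diff]:
  assumes "x \<in> pset P" "Q 0" "\<And>p. p \<in> P \<Longrightarrow> Q (frag_of p)" "\<And>x y. Q x \<Longrightarrow> Q y \<Longrightarrow> Q (x - y)"
  shows "Q x"
  using assms by (intro frag_induction[of x P Q]) (auto simp: pset_def)

lemma pair_ring_simps:
  "carrier (pair_ring A B) = pset (carrier A \<times> carrier B)" "x \<otimes>\<^bsub>pair_ring A B\<^esub> y = pmul A B x y"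
  "\<one>\<^bsub>pair_ring A B\<^esub> = frag_of (\<one>\<^bsub>A\<^esub>, \<one>\<^bsub>B\<^esub>)" "\<zero>\<^bsub>pair_ring A B\<^esub> = 0" "x \<oplus>\<^bsub>pair_ring A B\<^esub> y = x + y"
  by (simp_all add: pair_ring_def pset_def pmul_def)

lemma pmul_closed:
  assumes "ring A" "ring B" "x \<in> pset (carrier A \<times> carrier B)" "y \<in> pset (carrier A \<times> carrier B)"
  shows "pmul A B x y \<in> pset (carrier A \<times> carrier B)"
proof -
  interpret A: ring A by fact
  interpret B: ring B by fact
  show ?thesis using assms(3)
  proof (induction rule: pset_induct)
    case (base p)
    show ?case using assms(4)
    proof (induction rule: pset_induct)
      case (base q)
      then show ?case using \<open>p \<in> _\<close> by (cases p; cases q) (auto simp: pmul_of intro!: pset_closed)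
    qed (auto simp: pmul_linear pset_closed)
  qed (auto simp: pmul_linear pset_closed)
qed

lemma ring_pair_ring:
  assumes A: "ring A" and B: "ring B" shows "ring (pair_ring A B)"
proof -
  interpret A: ring A by fact
  interpret B: ring B by fact
  let ?P = "pset (carrier A \<times> carrier B)"
  have one: "frag_of (\<one>\<^bsub>A\<^esub>, \<one>\<^bsub>B\<^esub>) \<in> ?P" by (intro pset_closed) auto
  show ?thesis
  proof (rule ringI)
    show "abelian_group (pair_ring A B)"
    proof (rule abelian_groupI)
      show "\<exists>y\<in>carrier (pair_ring A B). y \<oplus>\<^bsub>pair_ring A B\<^esub> x = \<zero>\<^bsub>pair_ring A B\<^esub>" if "x \<in> carrier (pair_ring A B)" for x
        using that by (intro bexI[of _ "- x"]) (auto simp: pair_ring_simps pset_closed)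
    qed (auto simp: pair_ring_simps pset_closed ac_simps)
    show "monoid (pair_ring A B)"
    proof (rule monoidI)
      show "x \<otimes>\<^bsub>pair_ring A B\<^esub> y \<in> carrier (pair_ring A B)"
        if "x \<in> carrier (pair_ring A B)" "y \<in> carrier (pair_ring A B)" for x y
        using that pmul_closed[OF A B] by (simp add: pair_ring_simps)
      show "\<one>\<^bsub>pair_ring A B\<^esub> \<in> carrier (pair_ring A B)" using one by (simp add: pair_ring_simps)
      show "(x \<otimes>\<^bsub>pair_ring A B\<^esub> y) \<otimes>\<^bsub>pair_ring A B\<^esub> z = x \<otimes>\<^bsub>pair_ring A B\<^esub> (y \<otimes>\<^bsub>pair_ring A B\<^esub> z)"
        if x: "x \<in> carrier (pair_ring A B)" and y: "y \<in> carrier (pair_ring A B)" and z: "z \<in> carrier (pair_ring A B)" for x y z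
      proof -
        have "pmul A B (pmul A B x y) z = pmul A B x (pmul A B y z)"
          using x unfolding pair_ring_simps
        proof (induction rule: pset_induct)
          case (base p)
          show ?case using y unfolding pair_ring_simps
          proof (induction rule: pset_induct)
            case (base q)
            show ?case using z unfolding pair_ring_simps
            proof (induction rule: pset_induct)
              case (base w)
              then show ?case using \<open>p \<in> _\<close> \<open>q \<in> _\<close>
                by (cases p; cases q; cases w) (auto simp: pmul_of A.m_assoc B.m_assoc)
            qed (simp_all add: pmul_linear)
          qed (simp_all add: pmul_linear)
        qed (simp_all add: pmul_linear)
        then show ?thesis by (simp add: pair_ring_simps)
      qed
      fix x assume "x \<in> carrier (pair_ring A B)"
      then have x: "x \<in> ?P" by (simp add: pair_ring_simps)
      show "\<one>\<^bsub>pair_ring A B\<^esub> \<otimes>\<^bsub>pair_ring A B\<^esub> x = x"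
        unfolding pair_ring_simps using x by (induction rule: pset_induct) (auto simp: pmul_linear pmul_of)
      show "x \<otimes>\<^bsub>pair_ring A B\<^esub> \<one>\<^bsub>pair_ring A B\<^esub> = x"
        unfolding pair_ring_simps using x by (induction rule: pset_induct) (auto simp: pmul_linear pmul_of)
    qed
  qed (simp_all add: pair_ring_simps pmul_linear)
qed

text \<open>Recursion lets congruences modulo the relations be proved one summand at a time.\<close>

primrec lincomb :: "('a, 'x) ring_scheme \<Rightarrow> (nat \<Rightarrow> 'a) \<Rightarrow> nat \<Rightarrow> 'a" where
  "lincomb A u 0 = \<zero>\<^bsub>A\<^esub>"
| "lincomb A u (Suc n) = lincomb A u n \<oplus>\<^bsub>A\<^esub> u n"

definition frag_eval :: "('p \<Rightarrow> 'c::comm_ring_1) \<Rightarrow> ('p \<Rightarrow>\<^sub>0 int) \<Rightarrow> 'c" where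
  "frag_eval u x = (\<Sum>p\<in>Poly_Mapping.keys x. of_int (Poly_Mapping.lookup x p) * u p)"

lemma frag_eval_superset:
  "finite F \<Longrightarrow> Poly_Mapping.keys x \<subseteq> F \<Longrightarrow> frag_eval u x = (\<Sum>p\<in>F. of_int (Poly_Mapping.lookup x p) * u p)"
  unfolding frag_eval_def by (rule sum.mono_neutral_left) (auto simp: in_keys_iff)

lemma frag_eval_simps: "frag_eval u 0 = 0" "frag_eval u (frag_of p) = u p"
  "frag_eval u (x + y) = frag_eval u x + frag_eval u y" "frag_eval u (x - y) = frag_eval u x - frag_eval u y"
proof -
  show "frag_eval u 0 = 0" by (simp add: frag_eval_def)
  show "frag_eval u (frag_of p) = u p"
    by (subst frag_eval_superset[of "{p}"]) (auto simp: keys_frag_of)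
  let ?F = "Poly_Mapping.keys x \<union> Poly_Mapping.keys y"
  have F: "frag_eval u x = (\<Sum>p\<in>?F. of_int (Poly_Mapping.lookup x p) * u p)"
    "frag_eval u y = (\<Sum>p\<in>?F. of_int (Poly_Mapping.lookup y p) * u p)"
    by (rule frag_eval_superset, auto)+
  have "frag_eval u (x + y) = (\<Sum>p\<in>?F. of_int (Poly_Mapping.lookup (x + y) p) * u p)"
    by (rule frag_eval_superset) (use keys_add[of x y] in auto)
  then show "frag_eval u (x + y) = frag_eval u x + frag_eval u y"
    unfolding F by (simp add: lookup_add distrib_right sum.distrib)
  have "frag_eval u (x - y) = (\<Sum>p\<in>?F. of_int (Poly_Mapping.lookup (x - y) p) * u p)"
    by (rule frag_eval_superset) (use keys_diff[of x y] in auto)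
  then show "frag_eval u (x - y) = frag_eval u x - frag_eval u y"
    unfolding F by (simp add: lookup_minus left_diff_distrib sum_subtractf)
qed

text \<open>If \<open>A\<close> has a \<open>K\<close>-basis \<open>\<omega>\<close> whose image stays independent over \<open>B\<close>, then every tensor is
  congruent to some \<open>\<Sum> \<omega>\<^sub>l \<otimes> b\<^sub>l\<close>, so the evaluation map has no larger kernel than the ideal of relations.\<close>

theorem tensor_ring_iso:
  fixes \<theta> :: "'a \<Rightarrow> 'c::comm_ring_1" and \<eta> :: "'b \<Rightarrow> 'c" and g :: nat and \<omega> :: "nat \<Rightarrow> 'a"
  assumes A: "cring A" and B: "cring B"
    and \<theta>: "\<And>x y. x \<in> carrier A \<Longrightarrow> y \<in> carrier A \<Longrightarrow> \<theta> (x \<oplus>\<^bsub>A\<^esub> y) = \<theta> x + \<theta> y"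
      "\<And>x y. x \<in> carrier A \<Longrightarrow> y \<in> carrier A \<Longrightarrow> \<theta> (x \<otimes>\<^bsub>A\<^esub> y) = \<theta> x * \<theta> y" "\<theta> \<one>\<^bsub>A\<^esub> = 1" "inj_on \<theta> (carrier A)"
    and \<eta>: "\<And>x y. x \<in> carrier B \<Longrightarrow> y \<in> carrier B \<Longrightarrow> \<eta> (x \<oplus>\<^bsub>B\<^esub> y) = \<eta> x + \<eta> y"
      "\<And>x y. x \<in> carrier B \<Longrightarrow> y \<in> carrier B \<Longrightarrow> \<eta> (x \<otimes>\<^bsub>B\<^esub> y) = \<eta> x * \<eta> y" "\<eta> \<one>\<^bsub>B\<^esub> = 1"
    and K: "\<And>k. k \<in> carrier K \<Longrightarrow> \<phi> k \<in> carrier A" "\<And>k. k \<in> carrier K \<Longrightarrow> \<psi> k \<in> carrier B"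
      "\<And>k. k \<in> carrier K \<Longrightarrow> \<theta> (\<phi> k) = \<eta> (\<psi> k)"
    and \<omega>: "\<And>l. l < g \<Longrightarrow> \<omega> l \<in> carrier A"
    and span: "\<And>x. x \<in> carrier A \<Longrightarrow> \<exists>c. (\<forall>l<g. c l \<in> carrier K) \<and> \<theta> x = (\<Sum>l<g. \<theta> (\<omega> l) * \<theta> (\<phi> (c l)))"
    and indep: "\<And>b l. (\<forall>l<g. b l \<in> carrier B) \<Longrightarrow> (\<Sum>l<g. \<theta> (\<omega> l) * \<eta> (b l)) = 0 \<Longrightarrow> l < g \<Longrightarrow> b l = \<zero>\<^bsub>B\<^esub>"
    and S: "ring_closed S" "S = {\<Sum>l<g. \<theta> (\<omega> l) * \<eta> (b l) | b. \<forall>l<g. b l \<in> carrier B}"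
  shows "\<exists>h \<in> ring_iso (tensor_ring K \<phi> A \<psi> B) (vring S).
    \<forall>a\<in>carrier A. \<forall>b\<in>carrier B. h (pure_tensor K \<phi> A \<psi> B a b) = \<theta> a * \<eta> b"
proof -
  interpret A: cring A by fact
  interpret B: cring B by fact
  let ?P = "pair_ring A B"
  let ?R = "tensor_relations K \<phi> A \<psi> B"
  let ?J = "tensor_ideal K \<phi> A \<psi> B"
  have PR: "ring ?P" by (rule ring_pair_ring[OF A.ring_axioms B.ring_axioms])
  interpret P: ring ?P by (rule PR)
  have \<theta>0: "\<theta> \<zero>\<^bsub>A\<^esub> = 0" using \<theta>(1)[of "\<zero>\<^bsub>A\<^esub>" "\<zero>\<^bsub>A\<^esub>"] by simp
  have \<eta>0: "\<eta> \<zero>\<^bsub>B\<^esub> = 0" using \<eta>(1)[of "\<zero>\<^bsub>B\<^esub>" "\<zero>\<^bsub>B\<^esub>"] by simp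
  have \<eta>m: "\<eta> (\<ominus>\<^bsub>B\<^esub> y) = - \<eta> y" if "y \<in> carrier B" for y
    using \<eta>(1)[of "\<ominus>\<^bsub>B\<^esub> y" y] that by (simp add: B.l_neg \<eta>0 eq_neg_iff_add_eq_0)
  define ev where "ev = frag_eval (\<lambda>p. \<theta> (fst p) * \<eta> (snd p))"
  have ev_of: "ev (frag_of (a, b)) = \<theta> a * \<eta> b" for a b by (simp add: ev_def frag_eval_simps)
  have ev_lin: "ev (x + y) = ev x + ev y" "ev (x - y) = ev x - ev y" "ev 0 = 0" for x y
    by (simp_all add: ev_def frag_eval_simps)
  have ev_mult: "ev (pmul A B x y) = ev x * ev y" if "x \<in> carrier ?P" "y \<in> carrier ?P" for x y
    using that(1) unfolding pair_ring_simps
  proof (induction rule: pset_induct)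
    case (base p)
    show ?case using that(2) unfolding pair_ring_simps
    proof (induction rule: pset_induct)
      case (base q)
      then show ?case using \<open>p \<in> _\<close> by (cases p; cases q) (auto simp: pmul_of ev_of \<theta> \<eta>)
    qed (simp_all add: pmul_linear ev_lin algebra_simps)
  qed (simp_all add: pmul_linear ev_lin algebra_simps)
  have R_sub: "?R \<subseteq> carrier ?P"
    unfolding tensor_relations_def pair_ring_simps using K by (auto intro!: pset_closed)
  have J: "ideal ?J ?P" unfolding tensor_ideal_def by (rule P.genideal_ideal[OF R_sub])
  interpret J: ideal ?J ?P by (rule J)
  have RJ: "?R \<subseteq> ?J" unfolding tensor_ideal_def by (rule P.genideal_self[OF R_sub])
  have J_P: "x \<in> ?J \<Longrightarrow> x \<in> carrier ?P" for x using J.a_subset by blast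
  have J0: "0 \<in> ?J" using J.zero_closed by (simp add: pair_ring_simps)
  have Jadd: "x + y \<in> ?J" if "x \<in> ?J" "y \<in> ?J" for x y using J.a_closed[OF that] by (simp add: pair_ring_simps)
  have minus: "\<ominus>\<^bsub>?P\<^esub> x = - x" if "x \<in> carrier ?P" for x
    by (rule P.minus_equality) (use that in \<open>auto simp: pair_ring_simps pset_closed\<close>)
  have Jneg: "- x \<in> ?J" if "x \<in> ?J" for x using J.a_inv_closed[OF that] minus[OF J_P[OF that]] by simp
  have Jdiff: "x - y \<in> ?J" if "x \<in> ?J" "y \<in> ?J" for x y using Jadd[OF that(1) Jneg[OF that(2)]] by simp
  have r1: "frag_of (a \<oplus>\<^bsub>A\<^esub> a', b) - frag_of (a, b) - frag_of (a', b) \<in> ?J"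
    if "a \<in> carrier A" "a' \<in> carrier A" "b \<in> carrier B" for a a' b
    using RJ that unfolding tensor_relations_def by blast
  have r2: "frag_of (a, b \<oplus>\<^bsub>B\<^esub> b') - frag_of (a, b) - frag_of (a, b') \<in> ?J"
    if "a \<in> carrier A" "b \<in> carrier B" "b' \<in> carrier B" for a b b'
    using RJ that unfolding tensor_relations_def by blast
  have r3: "frag_of (a \<otimes>\<^bsub>A\<^esub> \<phi> k, b) - frag_of (a, \<psi> k \<otimes>\<^bsub>B\<^esub> b) \<in> ?J"
    if "a \<in> carrier A" "k \<in> carrier K" "b \<in> carrier B" for a k b
    using RJ that unfolding tensor_relations_def by blast
  have zl: "frag_of (\<zero>\<^bsub>A\<^esub>, b) \<in> ?J" if "b \<in> carrier B" for b
    using Jneg[OF r1[OF A.zero_closed A.zero_closed that]] by simp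
  have zr: "frag_of (a, \<zero>\<^bsub>B\<^esub>) \<in> ?J" if "a \<in> carrier A" for a
    using Jneg[OF r2[OF that B.zero_closed B.zero_closed]] by simp
  define Sm where "Sm b = (\<Sum>l<g. frag_of (\<omega> l, b l))" for b :: "nat \<Rightarrow> 'b"
  have sumJ: "(\<Sum>l<n. u l) \<in> ?J" if "\<And>l. l < n \<Longrightarrow> u l \<in> ?J" for n :: nat and u
    using that by (induction n) (auto intro: J0 Jadd)
  \<comment> \<open>Normal form: expand the left factor in the basis \<omega> and move its
    coefficients to the right by balancing.\<close>
  have canon: "\<exists>b. (\<forall>l<g. b l \<in> carrier B) \<and> x - Sm b \<in> ?J" if "x \<in> carrier ?P" for x
    using that unfolding pair_ring_simps
  proof (induction rule: pset_induct)
    case zero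
    have "(\<Sum>l<g. frag_of (\<omega> l, \<zero>\<^bsub>B\<^esub>)) \<in> ?J" by (intro sumJ zr \<omega>)
    from Jneg[OF this] show ?case by (intro exI[of _ "\<lambda>_. \<zero>\<^bsub>B\<^esub>"]) (simp add: Sm_def)
  next
    case (base p)
    then obtain a b where p: "p = (a, b)" "a \<in> carrier A" "b \<in> carrier B" by auto
    obtain c where c: "\<And>l. l < g \<Longrightarrow> c l \<in> carrier K" "\<theta> a = (\<Sum>l<g. \<theta> (\<omega> l) * \<theta> (\<phi> (c l)))"
      using span[OF p(2)] by blast
    let ?u = "\<lambda>l. \<omega> l \<otimes>\<^bsub>A\<^esub> \<phi> (c l)"
    have lc: "lincomb A ?u n \<in> carrier A \<and> \<theta> (lincomb A ?u n) = (\<Sum>l<n. \<theta> (\<omega> l) * \<theta> (\<phi> (c l)))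
        \<and> frag_of (lincomb A ?u n, b) - (\<Sum>l<n. frag_of (\<omega> l, \<psi> (c l) \<otimes>\<^bsub>B\<^esub> b)) \<in> ?J" if "n \<le> g" for n
      using that
    proof (induction n)
      case 0
      then show ?case using zl[OF p(3)] by (simp add: \<theta>0)
    next
      case (Suc n)
      then have n: "n < g" and IH: "lincomb A ?u n \<in> carrier A" "\<theta> (lincomb A ?u n) = (\<Sum>l<n. \<theta> (\<omega> l) * \<theta> (\<phi> (c l)))"
        "frag_of (lincomb A ?u n, b) - (\<Sum>l<n. frag_of (\<omega> l, \<psi> (c l) \<otimes>\<^bsub>B\<^esub> b)) \<in> ?J" by auto
      have u: "?u n \<in> carrier A" using \<omega>[OF n] K(1)[OF c(1)[OF n]] by simp
      have "frag_of (lincomb A ?u (Suc n), b) - (\<Sum>l<Suc n. frag_of (\<omega> l, \<psi> (c l) \<otimes>\<^bsub>B\<^esub> b))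
         = (frag_of (lincomb A ?u n \<oplus>\<^bsub>A\<^esub> ?u n, b) - frag_of (lincomb A ?u n, b) - frag_of (?u n, b))
          + (frag_of (lincomb A ?u n, b) - (\<Sum>l<n. frag_of (\<omega> l, \<psi> (c l) \<otimes>\<^bsub>B\<^esub> b)))
          + (frag_of (?u n, b) - frag_of (\<omega> n, \<psi> (c n) \<otimes>\<^bsub>B\<^esub> b))" by simp
      also have "\<dots> \<in> ?J"
        by (rule Jadd[OF Jadd[OF r1[OF IH(1) u p(3)] IH(3)] r3[OF \<omega>[OF n] c(1)[OF n] p(3)]])
      finally show ?case using IH u \<omega>[OF n] K(1)[OF c(1)[OF n]] by (simp add: \<theta>)
    qed
    have "lincomb A ?u g = a"
      using lc[of g] c(2) p(2) by (intro inj_onD[OF \<theta>(4)]) auto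
    then have "frag_of p - Sm (\<lambda>l. \<psi> (c l) \<otimes>\<^bsub>B\<^esub> b) \<in> ?J" using lc[of g] by (simp add: p(1) Sm_def)
    moreover have "\<forall>l<g. \<psi> (c l) \<otimes>\<^bsub>B\<^esub> b \<in> carrier B" using K(2) c(1) p(3) by simp
    ultimately show ?case by (intro exI[of _ "\<lambda>l. \<psi> (c l) \<otimes>\<^bsub>B\<^esub> b"] conjI)
  next
    case (diff x y)
    then obtain b b' where b: "\<And>l. l < g \<Longrightarrow> b l \<in> carrier B" "x - Sm b \<in> ?J"
      "\<And>l. l < g \<Longrightarrow> b' l \<in> carrier B" "y - Sm b' \<in> ?J" by blast
    define d where "d l = b l \<ominus>\<^bsub>B\<^esub> b' l" for l
    have "Sm b - Sm b' - Sm d = (\<Sum>l<g. frag_of (\<omega> l, b l) - frag_of (\<omega> l, b' l) - frag_of (\<omega> l, d l))"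
      by (simp add: Sm_def sum_subtractf)
    also have "\<dots> \<in> ?J"
    proof (rule sumJ)
      fix l assume l: "l < g"
      have bl: "b l \<in> carrier B" "b' l \<in> carrier B" using b l by auto
      have "d l \<oplus>\<^bsub>B\<^esub> b' l = b l" using bl by (simp add: d_def B.minus_eq B.a_assoc B.l_neg)
      then show "frag_of (\<omega> l, b l) - frag_of (\<omega> l, b' l) - frag_of (\<omega> l, d l) \<in> ?J"
        using r2[OF \<omega>[OF l], of "d l" "b' l"] bl by (simp add: d_def algebra_simps)
    qed
    finally have 1: "Sm b - Sm b' - Sm d \<in> ?J" .
    have "(x - y) - Sm d = ((x - Sm b) - (y - Sm b')) + (Sm b - Sm b' - Sm d)" by simp
    also have "\<dots> \<in> ?J" by (rule Jadd[OF Jdiff[OF b(2,4)] 1])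
    finally have "(x - y) - Sm d \<in> ?J" .
    moreover have "\<forall>l<g. d l \<in> carrier B" using b by (auto simp: d_def)
    ultimately show ?case by blast
  qed
  have ev_Sm: "ev (Sm b) = (\<Sum>l<g. \<theta> (\<omega> l) * \<eta> (b l))" for b
  proof -
    have "ev (\<Sum>l<n. frag_of (\<omega> l, b l)) = (\<Sum>l<n. \<theta> (\<omega> l) * \<eta> (b l))" for n :: nat
      by (induction n) (simp_all add: ev_lin ev_of)
    then show ?thesis by (simp add: Sm_def)
  qed
  define V where "V = vring (UNIV :: 'c set)"
  have "ring V" unfolding V_def by (rule cring.axioms(1)[OF cring_vring]) (simp add: ring_closed_def)
  have hV: "ring_hom_ring ?P V ev"
  proof (rule ring_hom_ringI2[OF PR \<open>ring V\<close>], rule ring_hom_memI)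
    show "ev \<one>\<^bsub>?P\<^esub> = \<one>\<^bsub>V\<^esub>" by (simp add: pair_ring_simps ev_of \<theta> \<eta> V_def)
  qed (auto simp: V_def pair_ring_simps(2,5) ev_mult ev_lin)
  have ker: "ideal (a_kernel ?P V ev) ?P" by (rule ring_hom_ring.kernel_is_ideal[OF hV])
  have R_ker: "?R \<subseteq> a_kernel ?P V ev"
  proof
    fix x assume x: "x \<in> ?R"
    have "\<forall>x\<in>?R. ev x = 0"
      unfolding tensor_relations_def
      by (intro ballI, elim UnE CollectE exE conjE) (simp_all add: ev_lin ev_of \<theta> \<eta> K distrib_left distrib_right)
    then have "ev x = 0" using x by blast
    then show "x \<in> a_kernel ?P V ev" using x R_sub by (auto simp: a_kernel_def' V_def)
  qed
  have J_ker: "?J \<subseteq> a_kernel ?P V ev" unfolding tensor_ideal_def by (rule P.genideal_minimal[OF ker R_ker])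
  have J0ev: "ev x = 0" if "x \<in> ?J" for x using J_ker that by (auto simp: a_kernel_def' V_def)
  have range: "ev x \<in> S" if x: "x \<in> carrier ?P" for x
  proof -
    obtain b where b: "\<forall>l<g. b l \<in> carrier B" "x - Sm b \<in> ?J" using canon[OF x] by blast
    have "ev x = ev (Sm b)" using J0ev[OF b(2)] by (simp add: ev_lin)
    then show ?thesis unfolding S(2) ev_Sm using b(1) by blast
  qed
  have hS: "ring_hom_ring ?P (vring S) ev"
  proof (rule ring_hom_ringI2[OF PR cring.axioms(1)[OF cring_vring[OF S(1)]]], rule ring_hom_memI)
    show "ev \<one>\<^bsub>?P\<^esub> = \<one>\<^bsub>vring S\<^esub>" by (simp add: pair_ring_simps ev_of \<theta> \<eta>)
  qed (auto simp: range pair_ring_simps(2,5) ev_mult ev_lin)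
  \<comment> \<open>By \<open>indep\<close> the evaluation kills only the normal form with zero
    coefficients, so its kernel is the ideal itself.\<close>
  have kerS: "a_kernel ?P (vring S) ev = ?J"
  proof
    show "?J \<subseteq> a_kernel ?P (vring S) ev" using J0ev J_P by (auto simp: a_kernel_def')
    show "a_kernel ?P (vring S) ev \<subseteq> ?J"
    proof
      fix x assume "x \<in> a_kernel ?P (vring S) ev"
      then have x: "x \<in> carrier ?P" "ev x = 0" by (auto simp: a_kernel_def')
      obtain b where b: "\<forall>l<g. b l \<in> carrier B" "x - Sm b \<in> ?J" using canon[OF x(1)] by blast
      have "(\<Sum>l<g. \<theta> (\<omega> l) * \<eta> (b l)) = 0" using J0ev[OF b(2)] x(2) by (simp add: ev_lin ev_Sm)
      then have "b l = \<zero>\<^bsub>B\<^esub>" if "l < g" for l using indep[OF b(1) _ that] by blast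
      then have "Sm b \<in> ?J" unfolding Sm_def using zr \<omega> by (intro sumJ) simp
      from Jadd[OF b(2) this] show "x \<in> ?J" by simp
    qed
  qed
  have surj: "ev ` carrier ?P = carrier (vring S)"
  proof
    show "ev ` carrier ?P \<subseteq> carrier (vring S)" using range by auto
    show "carrier (vring S) \<subseteq> ev ` carrier ?P"
    proof
      fix y assume "y \<in> carrier (vring S)"
      then obtain b where b: "\<forall>l<g. b l \<in> carrier B" "y = (\<Sum>l<g. \<theta> (\<omega> l) * \<eta> (b l))" using S(2) by auto
      have "(\<Sum>l<n. frag_of (\<omega> l, b l)) \<in> pset (carrier A \<times> carrier B)" if "n \<le> g" for n
        using that by (induction n) (use b(1) \<omega> in \<open>auto intro!: pset_closed\<close>)
      then have "Sm b \<in> carrier ?P" by (simp add: Sm_def pair_ring_simps)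
      then show "y \<in> ev ` carrier ?P" using b(2) ev_Sm by (metis imageI)
    qed
  qed
  define h where "h = (\<lambda>Xs. the_elem (ev ` Xs))"
  have "h \<in> ring_iso (tensor_ring K \<phi> A \<psi> B) (vring S)"
    using ring_hom_ring.FactRing_iso_set[OF hS surj] unfolding h_def tensor_ring_def kerS .
  moreover have "h (pure_tensor K \<phi> A \<psi> B a b) = \<theta> a * \<eta> b" if "a \<in> carrier A" "b \<in> carrier B" for a b
  proof -
    have "frag_of (a, b) \<in> carrier ?P" using that by (auto simp: pair_ring_simps intro!: pset_closed)
    from ring_hom_ring.the_elem_simp[OF hS this] show ?thesis
      unfolding h_def pure_tensor_def kerS by (simp add: ev_of)
  qed
  ultimately show ?thesis by blast
qed

section \<open>The number field generated by a root\<close>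

lemma add_pow_hom:
  fixes h :: "'a \<Rightarrow> 'c::comm_ring_1"
  assumes R: "ring R" and h: "h \<in> ring_hom R (vring S)"
  shows "int_embed R n \<in> carrier R \<and> h (int_embed R n) = of_int n"
proof -
  interpret ring R by fact
  let ?e = "\<lambda>n::int. add_pow R n \<one>\<^bsub>R\<^esub>"
  have c: "?e n \<in> carrier R" for n using add.int_pow_closed[of "\<one>\<^bsub>R\<^esub>" n] by simp
  have s: "?e (n + 1) = ?e n \<oplus>\<^bsub>R\<^esub> \<one>\<^bsub>R\<^esub>" for n
    using add.int_pow_mult[of "\<one>\<^bsub>R\<^esub>" n 1] add.int_pow_1[of "\<one>\<^bsub>R\<^esub>"] by simp
  have hs: "h (?e (n + 1)) = h (?e n) + 1" for n
    unfolding s using ring_hom_add[OF h c one_closed, of n] ring_hom_one[OF h] by simp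
  have "h (?e n) = of_int n"
  proof (induction n rule: int_induct[where k = 0])
    case base
    have "?e 1 = \<one>\<^bsub>R\<^esub>" using add.int_pow_1[of "\<one>\<^bsub>R\<^esub>"] by simp
    then have "h (?e 1) = 1" using ring_hom_one[OF h] by simp
    then show ?case using hs[of 0] by simp
  next
    case (step1 i)
    then show ?case by (simp only: hs of_int_add of_int_1)
  next
    case (step2 i)
    then show ?case using hs[of "i - 1"] by simp
  qed
  then show ?thesis using c by (simp add: int_embed_def)
qed

context conj_roots
begin

definition vpow :: "nat \<Rightarrow> complex ^ 'n" where "vpow l = (\<chi> i. a i ^ l)"

definition cst :: "complex \<Rightarrow> complex ^ 'n" where "cst z = (\<chi> i. z)"

lemma cst_simps: "cst (x + y) = cst x + cst y" "cst (x * y) = cst x * cst y" "cst 1 = 1" "cst 0 = 0" "cst (of_int n) = of_int n"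
  by (simp_all add: cst_def vec_eq_iff of_int_vec_nth)

lemma vandermonde_zero: assumes "\<And>i. (\<Sum>k<g. b k * a i ^ k) = 0" "k < g" shows "b k = 0"
proof -
  define q where "q = (\<Sum>k<g. monom (b k) k)"
  have "degree q < g" unfolding q_def
    by (rule degree_sum_less) (use assms(2) in \<open>auto intro: le_less_trans[OF degree_monom_le]\<close>)
  then have "q = 0" by (rule zero_if_roots) (simp add: q_def poly_sum poly_monom assms(1))
  then have "coeff q k = 0" by simp
  then show ?thesis using assms(2) by (simp add: q_def coeff_sum coeff_monom)
qed

lemma vpow_independent:
  assumes "(\<Sum>l<g. vpow l * cst (b l)) = 0" "l < g" shows "b l = 0"
proof (rule vandermonde_zero[OF _ assms(2)])
  fix i
  have "(\<Sum>l<g. vpow l * cst (b l)) $ i = 0" using assms(1) by simp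
  then show "(\<Sum>k<g. b k * a i ^ k) = 0" by (simp add: vpow_def cst_def mult.commute)
qed

text \<open>The real algebra E \<otimes> R inside C^g: the vectors compatible with complex
  conjugation.\<close>

definition SR :: "(complex ^ 'n) set" where "SR = {v. \<forall>i. v $ bar i = cnj (v $ i)}"

lemma SR_alt: "SR = {\<Sum>l<g. vpow l * cst (of_real (q l)) | q. True}"
proof
  show "SR \<subseteq> {\<Sum>l<g. vpow l * cst (of_real (q l)) | q. True}"
  proof
    fix v assume v: "v \<in> SR"
    define b where "b l = (\<Sum>i\<in>UNIV. coeff (lag i) l * v $ i)" for l
    have "cnj (b l) = (\<Sum>i\<in>UNIV. coeff (lag (bar i)) l * v $ bar i)" for l
      using v by (simp add: b_def lag_bar SR_def)
    also have "\<dots> l = b l" for l unfolding b_def by (rule sum.reindex_bij_witness[of _ bar bar]) simp_all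
    finally have br: "of_real (Re (b l)) = b l" for l by (simp add: complex_eq_iff)
    have "(\<Sum>l<g. a j ^ l * b l) = v $ j" for j
    proof -
      have "(\<Sum>l<g. a j ^ l * b l) = (\<Sum>i\<in>UNIV. v $ i * (\<Sum>l<g. coeff (lag i) l * a j ^ l))"
        unfolding b_def sum_distrib_left by (subst sum.swap) (intro sum.cong refl, simp only: ac_simps)
      then show ?thesis by (simp add: lag_vandermonde if_distrib cong: if_cong)
    qed
    then have "v = (\<Sum>l<g. vpow l * cst (of_real (Re (b l))))" by (simp add: vec_eq_iff vpow_def cst_def br)
    then show "v \<in> {\<Sum>l<g. vpow l * cst (of_real (q l)) | q. True}" by (intro CollectI exI conjI) simp_all
  qed
  show "{\<Sum>l<g. vpow l * cst (of_real (q l)) | q. True} \<subseteq> SR"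
    by (auto simp: SR_def vpow_def cst_def a_bar)
qed

text \<open>The number field Q(\<alpha>) under all its complex embeddings at once.\<close>

definition Fld :: "(complex ^ 'n) set" where "Fld = {\<chi> i. poly h (a i) | h. h \<in> coeffs_in \<rat>}"

lemma ring_closed_Fld: "ring_closed Fld"
proof -
  show ?thesis unfolding ring_closed_def
  proof (intro conjI ballI)
    have "1 = (\<chi> i. poly 1 (a i))" by (simp add: vec_eq_iff)
    then show "1 \<in> Fld" unfolding Fld_def using ring_closed_1[OF ring_closed_coeffs_in[OF ring_closed_Rats]] by blast
    fix x y assume "x \<in> Fld" "y \<in> Fld"
    then obtain h k where hk: "h \<in> coeffs_in \<rat>" "k \<in> coeffs_in \<rat>" "x = (\<chi> i. poly h (a i))" "y = (\<chi> i. poly k (a i))"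
      unfolding Fld_def by blast
    have "x - y = (\<chi> i. poly (h - k) (a i))" "x * y = (\<chi> i. poly (h * k) (a i))" by (simp_all add: hk vec_eq_iff)
    moreover have "h - k \<in> coeffs_in \<rat>" by (rule ring_closed_diff[OF ring_closed_coeffs_in[OF ring_closed_Rats] hk(1,2)])
    moreover have "h * k \<in> coeffs_in \<rat>" by (rule ring_closed_mult[OF ring_closed_coeffs_in[OF ring_closed_Rats] hk(1,2)])
    ultimately show "x - y \<in> Fld" "x * y \<in> Fld" unfolding Fld_def by blast+
  qed
qed

lemma Fld_alt: "Fld = {\<Sum>l<g. vpow l * cst (of_rat (q l)) | q. True}"
proof
  show "Fld \<subseteq> {\<Sum>l<g. vpow l * cst (of_rat (q l)) | q. True}"
  proof
    fix v assume "v \<in> Fld"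
    then obtain h where h: "h \<in> coeffs_in \<rat>" "v = (\<chi> i. poly h (a i))" unfolding Fld_def by blast
    have "cpoly f \<in> coeffs_in \<rat>" by (rule coeffs_inI) simp
    then have "\<exists>b. (\<forall>l. b l \<in> \<rat>) \<and> (\<forall>i. poly h (a i) = (\<Sum>l<g. b l * a i ^ l))"
      by (rule reduce_at_roots[OF ring_closed_Rats _ _ _ root h(1)]) (use monic_f degree_f in simp_all)
    then obtain b where b: "\<And>l. b l \<in> \<rat>" "\<And>i. poly h (a i) = (\<Sum>l<g. b l * a i ^ l)" by blast
    have "\<forall>l. \<exists>q. b l = of_rat q" using b(1) by (metis Rats_cases)
    then obtain q where q: "\<And>l. b l = of_rat (q l)" by metis
    have "v = (\<Sum>l<g. vpow l * cst (of_rat (q l)))"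
      unfolding h(2) by (simp add: vec_eq_iff b(2) q vpow_def cst_def mult.commute)
    then show "v \<in> {\<Sum>l<g. vpow l * cst (of_rat (q l)) | q. True}" by blast
  qed
  show "{\<Sum>l<g. vpow l * cst (of_rat (q l)) | q. True} \<subseteq> Fld"
  proof
    fix v assume "v \<in> {\<Sum>l<g. vpow l * cst (of_rat (q l)) | q. True}"
    then obtain q where v: "v = (\<Sum>l<g. vpow l * cst (of_rat (q l)))" by blast
    let ?h = "\<Sum>l<g. monom (of_rat (q l) :: complex) l"
    have "v = (\<chi> i. poly ?h (a i))" by (simp add: v vec_eq_iff vpow_def cst_def poly_sum poly_monom mult.commute)
    moreover have "?h \<in> coeffs_in \<rat>"
      by (rule coeffs_inI) (auto simp: coeff_sum coeff_monom intro!: ring_closed_sum[OF ring_closed_Rats])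
    ultimately show "v \<in> Fld" unfolding Fld_def by blast
  qed
qed

lemma vpow_Fld: "vpow l \<in> Fld"
proof -
  have "vpow l = (\<chi> i. poly (monom 1 l) (a i))" by (simp add: vpow_def vec_eq_iff poly_monom)
  moreover have "monom (1::complex) l \<in> coeffs_in \<rat>" by (rule coeffs_inI) (simp add: coeff_monom)
  ultimately show ?thesis unfolding Fld_def by blast
qed

lemma cst_Fld: "cst (of_rat q) \<in> Fld"
proof -
  have "cst (of_rat q) = (\<chi> i. poly [:of_rat q:] (a i))" by (simp add: cst_def vec_eq_iff)
  moreover have "[:of_rat q :: complex:] \<in> coeffs_in \<rat>" by (rule coeffs_inI) (simp add: coeff_pCons split: nat.split)
  ultimately show ?thesis unfolding Fld_def by blast
qed

lemma common_denominator: "\<exists>c m. c \<noteq> 0 \<and> (\<forall>l<n. of_int c * (q l :: rat) = of_int (m l))" for n :: nat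
proof (induction n)
  case 0
  show ?case by (rule exI[of _ 1]) simp
next
  case (Suc n)
  then obtain c m where cm: "c \<noteq> 0" "\<And>l. l < n \<Longrightarrow> of_int c * q l = of_int (m l)" by blast
  obtain x y where xy: "quotient_of (q n) = (x, y)" by (cases "quotient_of (q n)")
  have y: "y > 0" "q n = of_int x / of_int y" using quotient_of_denom_pos[OF xy] quotient_of_div[OF xy] by simp_all
  show ?case
  proof (intro exI[of _ "c * y"] exI[of _ "\<lambda>l. if l = n then c * x else y * m l"] conjI allI impI)
    fix l assume "l < Suc n"
    show "of_int (c * y) * q l = of_int (if l = n then c * x else y * m l)"
    proof (cases "l = n")
      case True
      then show ?thesis using y by simp
    next
      case False
      then have "of_int c * q l = of_int (m l)" using cm(2) \<open>l < Suc n\<close> by simp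
      then have "of_int (c * y) * q l = of_int y * of_int (m l)" by (simp add: ac_simps)
      then show ?thesis using False by simp
    qed
  qed (use cm(1) y in simp)
qed

text \<open>Clear denominators to land in the order, where the norm is a multiple of the element,
  and divide by the norm.\<close>

lemma Fld_inverse:
  assumes v: "v \<in> Fld" "v \<noteq> 0" shows "\<exists>w\<in>Fld. v * w = 1"
proof -
  obtain q where q: "v = (\<Sum>l<g. vpow l * cst (of_rat (q l)))" using v(1) unfolding Fld_alt by blast
  obtain c m where cm: "c \<noteq> 0" "\<And>l. l < g \<Longrightarrow> of_int c * q l = of_int (m l)" using common_denominator[of g q] by blast
  have cq: "of_int c * of_rat (q l) = (of_int (m l) :: complex)" if "l < g" for l
    using arg_cong[OF cm(2)[OF that], of "of_rat :: rat \<Rightarrow> complex"] by (simp add: of_rat_mult)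
  have cv: "of_int c * v = cv m"
    unfolding q by (simp add: vec_eq_iff cv_nth vpow_def cst_def of_int_vec_nth sum_distrib_left)
      (intro allI sum.cong refl, simp add: cq[symmetric] ac_simps)
  have c: "of_int c \<noteq> (0::complex)" using cm(1) by simp
  define w where "w = cv m"
  have w: "w \<in> Ord" unfolding w_def by (rule cv_in_Ord)
  have "w \<noteq> 0"
  proof
    assume "w = 0"
    then have "of_int c * v $ i = 0" for i using cv unfolding w_def by (metis of_int_vec_nth vector_mult_component zero_index)
    then have "v = 0" using c by (simp add: vec_eq_iff)
    then show False using v(2) by simp
  qed
  obtain N where N: "(\<Prod>i\<in>UNIV. w $ i) = of_int N" "w \<noteq> 0 \<Longrightarrow> N \<noteq> 0" using norm_Ord[OF w] by blast
  obtain w' where w': "w' \<in> Ord" "w * w' = of_int N" using norm_cofactor[OF w N(1)] .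
  obtain m' where m': "w' = cv m'" using Ord_cv[OF w'(1)] .
  have cvF: "cv m' \<in> Fld" unfolding Fld_alt
    by (intro CollectI exI[of _ "\<lambda>l. of_int (m' l)"]) (simp add: vec_eq_iff cv_nth vpow_def cst_def mult.commute)
  define x where "x = cst (of_rat (of_int c / of_int N)) * w'"
  have "x \<in> Fld" unfolding x_def m' by (rule ring_closed_mult[OF ring_closed_Fld cst_Fld cvF])
  moreover have "v * x = 1"
  proof -
    have "v $ i * (of_int c / of_int N * w' $ i) = 1" for i
    proof -
      have "of_int c * v $ i = w $ i" using cv unfolding w_def by (metis of_int_vec_nth vector_mult_component)
      moreover have "w $ i * w' $ i = of_int N" using w'(2) by (metis of_int_vec_nth vector_mult_component)
      ultimately have "of_int c * v $ i * w' $ i = of_int N" by simp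
      then show ?thesis using N(2)[OF \<open>w \<noteq> 0\<close>] by (simp add: divide_simps ac_simps)
    qed
    then show ?thesis by (simp add: vec_eq_iff x_def cst_def of_rat_divide)
  qed
  ultimately show ?thesis by blast
qed

text \<open>The field-theoretic facts are proved for any commutative ring identified with
  \<open>Fld\<close>. They will be applied to \<open>torus_End0 Lam\<close>, whose elements are
  cosets of formal sums.\<close>

context
  fixes R :: "('b, 'x) ring_scheme" and h :: "'b \<Rightarrow> complex ^ 'n"
  assumes R: "cring R" and h: "h \<in> ring_iso R (vring Fld)"
begin

lemma h_hom: "h \<in> ring_hom R (vring Fld)" "bij_betw h (carrier R) Fld"
  using h by (simp_all add: ring_iso_def)

lemma h_simps: "x \<in> carrier R \<Longrightarrow> y \<in> carrier R \<Longrightarrow> h (x \<oplus>\<^bsub>R\<^esub> y) = h x + h y"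
  "x \<in> carrier R \<Longrightarrow> y \<in> carrier R \<Longrightarrow> h (x \<otimes>\<^bsub>R\<^esub> y) = h x * h y" "h \<one>\<^bsub>R\<^esub> = 1" "x \<in> carrier R \<Longrightarrow> h x \<in> Fld"
  using ring_hom_add[OF h_hom(1)] ring_hom_mult[OF h_hom(1)] ring_hom_one[OF h_hom(1)] ring_hom_closed[OF h_hom(1)]
  by simp_all

lemma h_inj: "x \<in> carrier R \<Longrightarrow> y \<in> carrier R \<Longrightarrow> h x = h y \<Longrightarrow> x = y"
  using h_hom(2) by (auto simp: bij_betw_def inj_on_def)

lemma h_surj: assumes "v \<in> Fld" obtains x where "x \<in> carrier R" "h x = v"
proof -
  have "v \<in> h ` carrier R" using h_hom(2) assms by (simp add: bij_betw_def)
  then show thesis using that by (elim imageE) simp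
qed

lemma h_zero: "h \<zero>\<^bsub>R\<^esub> = 0"
proof -
  interpret cring R by (rule R)
  show ?thesis using h_simps(1)[OF zero_closed zero_closed] by simp
qed

lemma field_R: "field R"
proof -
  interpret cring R by (rule R)
  show ?thesis
  proof (rule cring_fieldI2)
    show "\<zero>\<^bsub>R\<^esub> \<noteq> \<one>\<^bsub>R\<^esub>" using h_zero h_simps(3) by (metis zero_neq_one)
    fix x assume x: "x \<in> carrier R" "x \<noteq> \<zero>\<^bsub>R\<^esub>"
    then have "h x \<noteq> 0" using h_inj[OF x(1) zero_closed] h_zero by auto
    then obtain w where w: "w \<in> Fld" "h x * w = 1" using Fld_inverse[OF h_simps(4)[OF x(1)]] by blast
    obtain y where y: "y \<in> carrier R" "h y = w" using h_surj[OF w(1)] .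
    have "x \<otimes>\<^bsub>R\<^esub> y = \<one>\<^bsub>R\<^esub>" by (rule h_inj) (use x y w in \<open>simp_all add: h_simps\<close>)
    then show "\<exists>b\<in>carrier R. x \<otimes>\<^bsub>R\<^esub> b = \<one>\<^bsub>R\<^esub>" using y(1) by blast
  qed
qed

lemma int_embed_R: "int_embed R n \<in> carrier R" "h (int_embed R n) = of_int n"
  using add_pow_hom[OF cring.axioms(1)[OF R] h_hom(1)] by blast+

lemma of_int_vec_zero: "(of_int n :: complex ^ 'n) = 0 \<longleftrightarrow> n = 0"
  by (auto simp: vec_eq_iff of_int_vec_nth)

lemma rat_embed_R: "rat_embed R q \<in> carrier R" "h (rat_embed R q) = cst (of_rat q)"
proof -
  interpret field R by (rule field_R)
  obtain x y where xy: "quotient_of q = (x, y)" by (cases "quotient_of q")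
  have y: "y > 0" "q = of_int x / of_int y" using quotient_of_denom_pos[OF xy] quotient_of_div[OF xy] by simp_all
  have "h (int_embed R y) \<noteq> 0" using y(1) by (simp add: int_embed_R of_int_vec_zero)
  then have nz: "int_embed R y \<noteq> \<zero>\<^bsub>R\<^esub>" using h_zero by auto
  then have U: "int_embed R y \<in> Units R" using int_embed_R(1) by (simp add: field_Units)
  have e: "rat_embed R q = int_embed R x \<otimes>\<^bsub>R\<^esub> inv\<^bsub>R\<^esub> int_embed R y" by (simp add: rat_embed_def xy)
  show c: "rat_embed R q \<in> carrier R" unfolding e using U int_embed_R(1) by simp
  have "rat_embed R q \<otimes>\<^bsub>R\<^esub> int_embed R y = int_embed R x"
    unfolding e using U int_embed_R(1) by (simp add: m_assoc)
  then have "h (rat_embed R q) * of_int y = of_int x" using h_simps(2)[OF c int_embed_R(1)] int_embed_R(2) by metis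
  then have eq: "h (rat_embed R q) $ i * of_int y = of_int x" for i by (metis of_int_vec_nth vector_mult_component)
  have q': "of_rat q = (of_int x / of_int y :: complex)" unfolding y(2) by (simp add: of_rat_divide)
  have "h (rat_embed R q) $ i = of_int x / of_int y" for i using eq[of i] y(1) by (simp add: eq_divide_eq)
  then show "h (rat_embed R q) = cst (of_rat q)" by (simp add: vec_eq_iff cst_def q')
qed

lemma subfield_rat_embed: "subfield (range (rat_embed R)) R"
proof -
  interpret F: field R by (rule field_R)
  have f: "field rat_ring" unfolding rat_ring_def by (rule field_from_type_algebra)
  interpret Q: field rat_ring by (rule f)
  have Qs: "carrier rat_ring = UNIV" "x \<otimes>\<^bsub>rat_ring\<^esub> y = x * y" "x \<oplus>\<^bsub>rat_ring\<^esub> y = x + y" "\<one>\<^bsub>rat_ring\<^esub> = 1" for x y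
    by (simp_all add: rat_ring_def ring_of_type_algebra_def)
  have hom: "ring_hom_ring rat_ring R (rat_embed R)"
  proof (rule ring_hom_ringI2[OF Q.ring_axioms F.ring_axioms], rule ring_hom_memI)
    fix x y
    show "rat_embed R x \<in> carrier R" by (rule rat_embed_R)
    show "rat_embed R (x \<otimes>\<^bsub>rat_ring\<^esub> y) = rat_embed R x \<otimes>\<^bsub>R\<^esub> rat_embed R y"
      by (rule h_inj) (simp_all add: rat_embed_R h_simps Qs of_rat_mult cst_simps)
    show "rat_embed R (x \<oplus>\<^bsub>rat_ring\<^esub> y) = rat_embed R x \<oplus>\<^bsub>R\<^esub> rat_embed R y"
      by (rule h_inj) (simp_all add: rat_embed_R h_simps Qs of_rat_add cst_simps)
  next
    show "rat_embed R \<one>\<^bsub>rat_ring\<^esub> = \<one>\<^bsub>R\<^esub>"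
      by (rule h_inj) (simp_all add: rat_embed_R h_simps Qs cst_simps)
  qed
  from ring_hom_ring.img_is_subfield(2)[OF hom Q.carrier_is_subfield F.one_not_zero] show ?thesis by (simp add: Qs)
qed

text \<open>Filter by the rational spans of the first n powers of \<alpha>; independence of the
  powers makes every step a proper line extension.\<close>

lemma dimension_R: "ring.dimension R g (range (rat_embed R)) (carrier R)"
proof -
  interpret field R by (rule field_R)
  define E where "E n = {x \<in> carrier R. \<exists>q. h x = (\<Sum>l<n. vpow l * cst (of_rat (q l)))}" for n :: nat
  have "dimension n (range (rat_embed R)) (E n)" if "n \<le> g" for n
    using that
  proof (induction n)
    case 0
    have "E 0 = {\<zero>\<^bsub>R\<^esub>}" using h_zero h_inj[OF _ zero_closed] by (auto simp: E_def)
    then show ?case by (simp only: zero_dim)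
  next
    case (Suc n)
    obtain v where v: "v \<in> carrier R" "h v = vpow n" using h_surj[OF vpow_Fld] .
    have nin: "v \<notin> E n"
    proof
      assume "v \<in> E n"
      then obtain q where q: "vpow n = (\<Sum>l<n. vpow l * cst (of_rat (q l)))" using v(2) by (auto simp: E_def)
      let ?b = "\<lambda>l. if l < n then of_rat (q l) else if l = n then - 1 else (0::complex)"
      have "(\<Sum>l<g. vpow l * cst (?b l)) = (\<Sum>l<Suc n. vpow l * cst (?b l))"
        by (rule sum.mono_neutral_right) (use Suc.prems in \<open>auto simp: cst_simps\<close>)
      also have "\<dots> = (\<Sum>l<n. vpow l * cst (of_rat (q l))) - vpow n"
        by (simp add: vec_eq_iff cst_def)
      finally have "(\<Sum>l<g. vpow l * cst (?b l)) = 0" using q by simp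
      then have "?b n = 0" by (rule vpow_independent) (use Suc.prems in simp)
      then show False by simp
    qed
    have "E (Suc n) = line_extension (range (rat_embed R)) v (E n)"
    proof (rule Set.set_eqI, rule iffI)
      fix x assume "x \<in> E (Suc n)"
      then obtain q where q: "x \<in> carrier R" "h x = (\<Sum>l<Suc n. vpow l * cst (of_rat (q l)))" by (auto simp: E_def)
      have "(\<Sum>l<n. vpow l * cst (of_rat (q l))) \<in> Fld"
        by (intro ring_closed_sum[OF ring_closed_Fld] ring_closed_mult[OF ring_closed_Fld] vpow_Fld cst_Fld)
      then obtain y where y: "y \<in> carrier R" "h y = (\<Sum>l<n. vpow l * cst (of_rat (q l)))" by (rule h_surj)
      have "x = rat_embed R (q n) \<otimes>\<^bsub>R\<^esub> v \<oplus>\<^bsub>R\<^esub> y"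
        by (rule h_inj) (use q y v in \<open>simp_all add: h_simps rat_embed_R ac_simps\<close>)
      moreover have "y \<in> E n" using y by (auto simp: E_def)
      ultimately show "x \<in> line_extension (range (rat_embed R)) v (E n)" unfolding line_extension_mem_iff by blast
    next
      fix x assume "x \<in> line_extension (range (rat_embed R)) v (E n)"
      then obtain p y where py: "y \<in> E n" "x = rat_embed R p \<otimes>\<^bsub>R\<^esub> v \<oplus>\<^bsub>R\<^esub> y" unfolding line_extension_mem_iff by blast
      then obtain q where q: "y \<in> carrier R" "h y = (\<Sum>l<n. vpow l * cst (of_rat (q l)))" by (auto simp: E_def)
      have "h x = (\<Sum>l<Suc n. vpow l * cst (of_rat ((q(n := p)) l)))"
        using v q py(2) by (simp add: h_simps rat_embed_R ac_simps)
      moreover have "x \<in> carrier R" using py(2) v q rat_embed_R(1) by simp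
      ultimately show "x \<in> E (Suc n)" unfolding E_def by blast
    qed
    then show ?case using Suc_dim[OF v(1) nin Suc.IH] Suc.prems by simp
  qed
  from this[of g] have "dimension g (range (rat_embed R)) (E g)" by simp
  moreover have "E g = carrier R" using h_simps(4) unfolding E_def Fld_alt by blast
  ultimately show ?thesis by simp
qed

lemma number_field_R: "number_field R" "field_degree R = g"
proof -
  interpret field R by (rule field_R)
  show "number_field R" unfolding number_field_def
  proof (intro conjI allI impI field_R)
    fix n :: int assume "n \<noteq> 0"
    then have "h (int_embed R n) \<noteq> 0" by (simp add: int_embed_R of_int_vec_zero)
    then show "int_embed R n \<noteq> \<zero>\<^bsub>R\<^esub>" using h_zero by auto
  next
    show "finite_dimension (range (rat_embed R)) (carrier R)" by (rule finite_dimensionI[OF dimension_R])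
  qed
  show "field_degree R = g"
    using dimI[OF subfield_rat_embed dimension_R] by (simp add: field_degree_def over_def)
qed

text \<open>The tensor product is first identified with \<open>SR\<close>. A vector there is
  determined by one coordinate per place: a real one at a real place, an arbitrary complex one at
  the chosen index of a conjugate pair.\<close>

lemma signature_R:
  assumes rs: "card {i. a i \<in> \<real>} = r" "r + 2 * s = g"
  shows "has_signature R r s"
proof -
  interpret F: field R by (rule field_R)
  have RR: "carrier real_ring = UNIV" "x \<otimes>\<^bsub>real_ring\<^esub> y = x * y" "x \<oplus>\<^bsub>real_ring\<^esub> y = x + y" "\<one>\<^bsub>real_ring\<^esub> = 1" "\<zero>\<^bsub>real_ring\<^esub> = 0"
    for x y by (simp_all add: real_ring_def ring_of_type_algebra_def)
  have CC: "carrier complex_ring = UNIV" "x \<otimes>\<^bsub>complex_ring\<^esub> y = x * y" "x \<oplus>\<^bsub>complex_ring\<^esub> y = x + y" "\<one>\<^bsub>complex_ring\<^esub> = 1"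
    for x y by (simp_all add: complex_ring_def ring_of_type_algebra_def)
  have "cring real_ring" unfolding real_ring_def by (rule cring_from_type_algebra)
  have "\<forall>l. \<exists>x. x \<in> carrier R \<and> h x = vpow l" using h_surj[OF vpow_Fld] by metis
  then obtain \<omega> where \<omega>: "\<And>l. \<omega> l \<in> carrier R" "\<And>l. h (\<omega> l) = vpow l" by metis
  have rcS: "ring_closed SR" by (auto simp: ring_closed_def SR_def)
  have "\<exists>h1\<in>ring_iso (tensor_ring rat_ring (rat_embed R) R of_rat real_ring) (vring SR).
      \<forall>x\<in>carrier R. \<forall>y\<in>carrier real_ring. h1 (pure_tensor rat_ring (rat_embed R) R of_rat real_ring x y) = h x * cst (of_real y)"
  proof (rule tensor_ring_iso[where \<omega> = \<omega> and g = g])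
    show "cring R" by (rule R)
    show "cring real_ring" by fact
    show "inj_on h (carrier R)" using h_inj by (auto intro: inj_onI)
    show "h (rat_embed R q) = cst (of_real (of_rat q))" for q
    proof -
      have "q = of_int (fst (quotient_of q)) / of_int (snd (quotient_of q))" by (rule quotient_of_div) simp
      then obtain x y :: int where "q = of_int x / of_int y" by blast
      then have "complex_of_rat q = complex_of_real (of_rat q)" by (simp add: of_rat_divide)
      then show ?thesis by (simp add: rat_embed_R(2))
    qed
    show "ring_closed SR" by (rule rcS)
    show "SR = {\<Sum>l<g. h (\<omega> l) * cst (of_real (b l)) | b. \<forall>l<g. b l \<in> carrier real_ring}"
      by (simp add: SR_alt \<omega> RR)
    show "\<exists>c. (\<forall>l<g. c l \<in> carrier rat_ring) \<and> h x = (\<Sum>l<g. h (\<omega> l) * h (rat_embed R (c l)))" if "x \<in> carrier R" for x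
      using h_simps(4)[OF that] unfolding Fld_alt by (auto simp: \<omega> rat_embed_R rat_ring_def ring_of_type_algebra_def)
    show "b l = \<zero>\<^bsub>real_ring\<^esub>" if "(\<Sum>l<g. h (\<omega> l) * cst (of_real (b l))) = 0" "l < g" for b l
      using vpow_independent[of "\<lambda>l. of_real (b l)" l] that by (simp add: \<omega> RR)
  qed (simp_all add: h_simps RR cst_simps rat_embed_R \<omega>)
  then obtain h1 where h1: "h1 \<in> ring_iso (tensor_ring rat_ring (rat_embed R) R of_rat real_ring) (vring SR)"
    "\<And>y. h1 (pure_tensor rat_ring (rat_embed R) R of_rat real_ring \<one>\<^bsub>R\<^esub> y) = cst (of_real y)"
    by (auto simp: RR h_simps)
  obtain P where P: "\<And>i. i \<in> P \<or> bar i \<in> P" "\<And>p. p \<in> P \<Longrightarrow> bar p \<in> P \<Longrightarrow> bar p = p" "card P = r + s"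
    using representatives[OF rs] by blast
  define Fx where "Fx = {i. bar i = i}"
  have FxP: "Fx \<subseteq> P" using P(1) by (auto simp: Fx_def) metis
  have cF: "card Fx = r" using rs(1) by (simp add: Fx_def bar_fixed_iff)
  have cQ: "card (P - Fx) = s" using card_Diff_subset[OF _ FxP] cF P(3) by simp
  obtain e1 where e1: "bij_betw e1 {0..<card Fx} Fx" using ex_bij_betw_nat_finite[OF finite[of Fx]] by (rule exE)
  obtain e2 where e2: "bij_betw e2 {0..<card (P - Fx)} (P - Fx)" using ex_bij_betw_nat_finite[OF finite[of "P - Fx"]] by (rule exE)
  have e1': "bij_betw e1 {..<r} Fx" using e1 unfolding cF atLeast0LessThan .
  have e2': "bij_betw e2 {..<s} (P - Fx)" using e2 unfolding cQ atLeast0LessThan .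
  define \<Gamma> where "\<Gamma> v = (\<lambda>j\<in>{..<r}. Re (v $ e1 j), \<lambda>j\<in>{..<s}. v $ e2 j)" for v :: "complex ^ 'n"
  let ?T = "RDirProd (product_ring {..<r} (\<lambda>_. real_ring)) (product_ring {..<s} (\<lambda>_. complex_ring))"
  have real1: "Im (v $ e1 j) = 0" if "v \<in> SR" "j < r" for v j
  proof -
    have "bar (e1 j) = e1 j" using bij_betwE[OF e1'] that(2) by (auto simp: Fx_def)
    then have "v $ e1 j = cnj (v $ e1 j)" using that(1) unfolding SR_def by (metis (mono_tags, lifting) mem_Collect_eq)
    then show ?thesis by (simp add: complex_eq_iff)
  qed
  have carT: "carrier ?T = PiE {..<r} (\<lambda>_. UNIV) \<times> PiE {..<s} (\<lambda>_. UNIV)"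
    unfolding RDirProd_carrier by (simp add: product_ring_def RR CC)
  have "\<Gamma> \<in> ring_iso (vring SR) ?T"
  proof (rule ring_iso_memI)
    show "\<Gamma> x \<in> carrier ?T" for x unfolding carT \<Gamma>_def by simp
    show "\<Gamma> (x \<otimes>\<^bsub>vring SR\<^esub> y) = \<Gamma> x \<otimes>\<^bsub>?T\<^esub> \<Gamma> y" if "x \<in> carrier (vring SR)" "y \<in> carrier (vring SR)" for x y
      using that real1 by (auto simp: \<Gamma>_def RDirProd_def DirProd_def monoid.defs product_ring_def RR CC fun_eq_iff restrict_def)
    show "\<Gamma> (x \<oplus>\<^bsub>vring SR\<^esub> y) = \<Gamma> x \<oplus>\<^bsub>?T\<^esub> \<Gamma> y" if "x \<in> carrier (vring SR)" "y \<in> carrier (vring SR)" for x y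
      by (auto simp: \<Gamma>_def RDirProd_def DirProd_def monoid.defs product_ring_def RR CC fun_eq_iff restrict_def)
    show "\<Gamma> \<one>\<^bsub>vring SR\<^esub> = \<one>\<^bsub>?T\<^esub>"
      by (auto simp: \<Gamma>_def RDirProd_def DirProd_def monoid.defs product_ring_def RR CC fun_eq_iff restrict_def)
    show "bij_betw \<Gamma> (carrier (vring SR)) (carrier ?T)"
    proof (rule bij_betw_imageI)
      show "inj_on \<Gamma> (carrier (vring SR))"
      proof (rule inj_onI)
        fix v w assume v: "v \<in> carrier (vring SR)" and w: "w \<in> carrier (vring SR)" and eq: "\<Gamma> v = \<Gamma> w"
        have vw: "v $ bar i = cnj (v $ i)" "w $ bar i = cnj (w $ i)" for i using v w by (simp_all add: SR_def)
        have p1: "(\<lambda>j\<in>{..<r}. Re (v $ e1 j)) = (\<lambda>j\<in>{..<r}. Re (w $ e1 j))" and p2: "(\<lambda>j\<in>{..<s}. v $ e2 j) = (\<lambda>j\<in>{..<s}. w $ e2 j)"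
          using eq by (simp_all only: \<Gamma>_def prod.inject)
        have onP: "v $ i = w $ i" if "i \<in> P" for i
        proof (cases "i \<in> Fx")
          case True
          then obtain j where j: "j < r" "i = e1 j" using e1' by (auto simp: bij_betw_def)
          then show ?thesis using fun_cong[OF p1, of j] real1[of v j] real1[of w j] v w by (simp add: complex_eq_iff)
        next
          case False
          then have "i \<in> e2 ` {..<s}" using e2' that by (auto simp: bij_betw_def)
          then obtain j where j: "j < s" "i = e2 j" by auto
          then show ?thesis using fun_cong[OF p2, of j] by simp
        qed
        have "v $ i = w $ i" for i
        proof (cases "i \<in> P")
          case False
          then have "v $ bar i = w $ bar i" using P(1)[of i] onP by blast
          then show ?thesis unfolding vw by simp
        qed (rule onP)
        then show "v = w" by (simp add: vec_eq_iff)
      qed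
      show "\<Gamma> ` carrier (vring SR) = carrier ?T"
      proof
        show "\<Gamma> ` carrier (vring SR) \<subseteq> carrier ?T"
          by (rule image_subsetI) (simp add: carT \<Gamma>_def)
        show "carrier ?T \<subseteq> \<Gamma> ` carrier (vring SR)"
        proof
          fix z assume "z \<in> carrier ?T"
          then obtain x y where xy: "z = (x, y)" "x \<in> PiE {..<r} (\<lambda>_. UNIV)" "y \<in> PiE {..<s} (\<lambda>_. UNIV)" unfolding carT by auto
          \<comment> \<open>The preimage under \<Gamma>: coordinates at indices outside P are forced
            by conjugation.\<close>
          define v where "v = (\<chi> i. if i \<in> Fx then of_real (x (inv_into {..<r} e1 i))
            else if i \<in> P then y (inv_into {..<s} e2 i) else cnj (y (inv_into {..<s} e2 (bar i))))"
          have "v $ bar i = cnj (v $ i)" for i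
          proof (cases "i \<in> Fx")
            case True
            then have "bar i = i" by (simp add: Fx_def)
            then show ?thesis using True by (simp add: v_def)
          next
            case False
            then have "bar i \<notin> Fx" "bar i \<noteq> i" by (auto simp: Fx_def)
            then have "i \<in> P \<longleftrightarrow> bar i \<notin> P" using P(1)[of i] P(2)[of i] by blast
            then show ?thesis using False \<open>bar i \<notin> Fx\<close> by (auto simp: v_def)
          qed
          then have "v \<in> SR" by (simp add: SR_def)
          moreover have "\<Gamma> v = z"
          proof -
            have 1: "Re (v $ e1 j) = x j" if "j < r" for j
              using bij_betwE[OF e1'] e1' that by (auto simp: v_def bij_betw_def inv_into_f_f)
            have 2: "v $ e2 j = y j" if "j < s" for j
            proof -
              have "e2 j \<in> P - Fx" using bij_betwE[OF e2'] that by blast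
              then show ?thesis using e2' that by (simp add: v_def bij_betw_def inv_into_f_f)
            qed
            have "(\<lambda>j\<in>{..<r}. Re (v $ e1 j)) = x" by (rule PiE_ext[OF _ xy(2)]) (simp_all add: 1)
            moreover have "(\<lambda>j\<in>{..<s}. v $ e2 j) = y" by (rule PiE_ext[OF _ xy(3)]) (simp_all add: 2)
            ultimately show ?thesis by (simp add: \<Gamma>_def xy(1))
          qed
          ultimately show "z \<in> \<Gamma> ` carrier (vring SR)" by (metis imageI vring_simps(1))
        qed
      qed
    qed
  qed
  then have "\<Gamma> \<circ> h1 \<in> ring_iso (tensor_ring rat_ring (rat_embed R) R of_rat real_ring) ?T"
    using ring_iso_set_trans[OF h1(1)] by blast
  moreover have "(\<Gamma> \<circ> h1) (pure_tensor rat_ring (rat_embed R) R of_rat real_ring \<one>\<^bsub>R\<^esub> x)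
      = (\<lambda>i\<in>{..<r}. x, \<lambda>i\<in>{..<s}. complex_of_real x)" for x
    by (simp add: h1(2) \<Gamma>_def cst_def)
  ultimately show ?thesis unfolding has_signature_def by blast
qed

end

end

section \<open>The unit group\<close>

lemma ln_powi: "(x::real) > 0 \<Longrightarrow> ln (x powi n) = of_int n * ln x"
  by (cases "n \<ge> 0") (simp_all add: power_int_def ln_realpow ln_inverse)

lemma powi_add_mult: "(x::'a::field) \<noteq> 0 \<Longrightarrow> x powi (m + n) = x powi m * x powi n"
  by (simp add: power_int_add)

context homog_roots
begin

definition Lg :: "complex ^ 'n \<Rightarrow> real ^ 'n" where "Lg u = (\<chi> i. ln (cmod (u $ i)))"

text \<open>The target of the logarithmic embedding. Coordinates run over all g embeddings, so a
  complex place counts twice in the sum.\<close>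

definition HS :: "(real ^ 'n) set" where "HS = {x. (\<forall>i. x $ bar i = x $ i) \<and> (\<Sum>i\<in>UNIV. x $ i) = 0}"

lemma subspace_HS: "subspace HS"
  unfolding HS_def by (rule subspaceI) (auto simp: sum.distrib sum_distrib_left[symmetric])

lemma Lg_HS: "u \<in> OU \<Longrightarrow> Lg u \<in> HS"
proof -
  assume u: "u \<in> OU"
  then have "u \<in> Ord" "cmod (\<Prod>i\<in>UNIV. u $ i) = 1" by (simp_all add: OU_iff)
  have "(\<Sum>i\<in>UNIV. ln (cmod (u $ i))) = ln (\<Prod>i\<in>UNIV. cmod (u $ i))"
    using OU_nonzero[OF u] by (intro ln_prod[symmetric]) auto
  also have "\<dots> = 0" using \<open>cmod (\<Prod>i\<in>UNIV. u $ i) = 1\<close> by (simp add: prod_norm)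
  finally show "Lg u \<in> HS" using Ord_bar[OF \<open>u \<in> Ord\<close>] by (simp add: HS_def Lg_def)
qed

lemma Lg_mult: "u \<in> OU \<Longrightarrow> v \<in> OU \<Longrightarrow> Lg (u * v) = Lg u + Lg v"
  using OU_nonzero by (simp add: Lg_def vec_eq_iff norm_mult ln_mult)

text \<open>Let y in \<open>HS\<close> be orthogonal to all logarithms and largest at k. A unit that
  is small away from k gives sum_j (y_k - y_j)(- Lg u_j) = 0 with nonnegative terms, so y is
  constant; having sum zero, it vanishes.\<close>

lemma span_Lg: "span (Lg ` OU) = HS"
proof (rule ccontr)
  assume ne: "span (Lg ` OU) \<noteq> HS"
  have "Lg ` OU \<subseteq> HS" using Lg_HS by auto
  then have "span (Lg ` OU) \<subseteq> HS" using subspace_HS by (rule span_minimal)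
  then have ps: "span (Lg ` OU) \<subset> HS" using ne by blast
  have sHS: "span HS = HS" using subspace_HS by (simp only: span_eq_iff)
  have "span (Lg ` OU) \<subset> span HS" unfolding sHS by (rule ps)
  then obtain y where y: "y \<noteq> 0" "y \<in> span HS" "\<And>x. x \<in> span (Lg ` OU) \<Longrightarrow> orthogonal y x"
    by (rule orthogonal_to_subspace_exists_gen) blast
  have yHS: "y \<in> HS" using y(2) unfolding sHS .
  have "finite (range (($) y))" "range (($) y) \<noteq> {}" by auto
  then have "Max (range (($) y)) \<in> range (($) y)" by (rule Max_in)
  then obtain k where k: "Max (range (($) y)) = y $ k" by (rule rangeE)
  have kmax: "y $ j \<le> y $ k" for j unfolding k[symmetric] by (rule Max_ge) auto
  obtain u where u: "u \<in> OU" "\<And>j. j \<noteq> k \<Longrightarrow> j \<noteq> bar k \<Longrightarrow> cmod (u $ j) < 1" using dirichlet_unit[of k] by blast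
  have "y \<bullet> Lg u = 0" using y(3)[OF span_base[OF imageI[OF u(1)]]] by (simp add: orthogonal_def)
  then have 1: "(\<Sum>j\<in>UNIV. y $ j * Lg u $ j) = 0" by (simp add: inner_vec_def)
  have 2: "(\<Sum>j\<in>UNIV. Lg u $ j) = 0" using Lg_HS[OF u(1)] by (simp add: HS_def)
  have s: "(\<Sum>j\<in>UNIV. (y $ k - y $ j) * - (Lg u $ j)) = 0"
    using 1 2 by (simp add: left_diff_distrib sum_subtractf sum_distrib_left[symmetric] sum_negf)
  have ybar: "y $ bar k = y $ k" using yHS by (simp add: HS_def)
  have neg: "Lg u $ j < 0" if "j \<noteq> k" "j \<noteq> bar k" for j
    using u(2)[OF that] OU_nonzero[OF u(1), of j] by (simp add: Lg_def ln_less_zero)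
  have nn: "0 \<le> (y $ k - y $ j) * - (Lg u $ j)" for j
  proof (cases "j = k \<or> j = bar k")
    case False
    then have "Lg u $ j < 0" using neg by blast
    then show ?thesis using kmax[of j] by (intro mult_nonneg_nonneg) auto
  qed (auto simp: ybar)
  have "\<forall>j\<in>UNIV. (y $ k - y $ j) * - (Lg u $ j) = 0"
    using s nn by (subst (asm) sum_nonneg_eq_0_iff) auto
  then have "y $ j = y $ k" for j
  proof (cases "j = k \<or> j = bar k")
    case False
    then have "Lg u $ j \<noteq> 0" using neg by force
    then show ?thesis using \<open>\<forall>j\<in>UNIV. _ j = 0\<close> by force
  qed (auto simp: ybar)
  then have const: "y = (\<chi> j. y $ k)" by (simp add: vec_eq_iff)
  have "(\<Sum>j\<in>UNIV. y $ j) = 0" using yHS by (simp add: HS_def)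
  then have "real g * y $ k = 0" by (subst (asm) const) (simp add: g_card)
  then have "y $ k = 0" using g3 by simp
  then have "y = 0" by (subst const) (simp add: vec_eq_iff)
  then show False using y(1) by simp
qed

text \<open>Vectors supported on representatives of all places but one are made symmetric under
  conjugation and corrected at the remaining place k to have sum zero; this is an isomorphism onto
  \<open>HS\<close>.\<close>

lemma dim_HS:
  assumes rs: "card {i. a i \<in> \<real>} = r" "r + 2 * s = g" shows "dim HS + 1 = r + s"
proof -
  obtain P where cover: "\<And>i. i \<in> P \<or> bar i \<in> P" and Pfix: "\<And>p. p \<in> P \<Longrightarrow> bar p \<in> P \<Longrightarrow> bar p = p" and cP: "card P = r + s"
    using representatives[OF rs] by blast
  have "P \<noteq> {}" using cover by blast
  then obtain k where k: "k \<in> P" by blast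
  define Q where "Q = P - {k}"
  have cQ: "card Q + 1 = r + s" using cP k unfolding Q_def
    by (metis card_Suc_Diff1 finite Suc_eq_plus1)
  define T where "T = {z :: real ^ 'n. \<forall>i. i \<notin> Q \<longrightarrow> z $ i = 0}"
  have dT: "dim T = card Q" unfolding T_def
  proof -
    have "vec.dim {x :: real ^ 'n. \<forall>i. i \<notin> Q \<longrightarrow> x $ i = 0} = card Q" by (rule dim_substandard_cart)
    then show "dim {x :: real ^ 'n. \<forall>i. i \<notin> Q \<longrightarrow> x $ i = 0} = card Q" by (simp add: dim_vec_eq)
  qed
  have sT: "subspace T" unfolding T_def by (rule subspaceI) auto
  \<comment> \<open>Symmetrisation doubles the sum, so the correction has weight 1 at k and at bar
    k, that is weight 2 if k is real.\<close>
  define \<Psi> where "\<Psi> z = (\<chi> i. z $ i + z $ bar i - (\<Sum>j\<in>UNIV. z $ j) * ((if i = k then 1 else 0) + (if bar i = k then 1 else 0)))"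
    for z :: "real ^ 'n"
  have lin: "linear \<Psi>"
    by (rule linearI) (simp_all add: \<Psi>_def vec_eq_iff sum.distrib sum_distrib_left[symmetric] algebra_simps)
  have bsum: "(\<Sum>i\<in>UNIV. h (bar i)) = (\<Sum>i\<in>UNIV. h i)" for h :: "'n \<Rightarrow> real"
    by (rule sum.reindex_bij_witness[of _ bar bar]) auto
  have \<Psi>HS: "\<Psi> z \<in> HS" for z
  proof -
    have b1: "(\<Sum>i\<in>UNIV. if bar i = k then (1::real) else 0) = 1" using bsum[of "\<lambda>i. if i = k then 1 else 0"] by simp
    have "(\<Sum>i\<in>UNIV. \<Psi> z $ i) = (\<Sum>i\<in>UNIV. z $ i) + (\<Sum>i\<in>UNIV. z $ bar i) - (\<Sum>j\<in>UNIV. z $ j) * (1 + 1)"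
      unfolding \<Psi>_def by (simp only: vec_lambda_beta sum_subtractf sum.distrib sum_distrib_left[symmetric] b1) simp
    then show ?thesis by (simp add: HS_def bsum) (simp add: \<Psi>_def)
  qed
  have Qbar: "bar p \<notin> Q" if "p \<in> Q" "bar p \<noteq> p" for p using that Pfix by (auto simp: Q_def)
  have Qk: "p \<noteq> k" "bar p \<noteq> k" if "p \<in> Q" for p
  proof -
    show "p \<noteq> k" using that by (simp add: Q_def)
    show "bar p \<noteq> k"
    proof
      assume b: "bar p = k"
      then have "bar p = p" using Pfix[of p] that k by (simp add: Q_def)
      then show False using b that by (simp add: Q_def)
    qed
  qed
  have inj: "z = 0" if z: "z \<in> T" "\<Psi> z = 0" for z
  proof -
    have "z $ p = 0" for p
    proof (cases "p \<in> Q")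
      case True
      have "\<Psi> z $ p = z $ p + z $ bar p" using Qk[OF True] by (simp add: \<Psi>_def)
      then show ?thesis using z Qbar[OF True] by (cases "bar p = p") (auto simp: T_def)
    next
      case False
      then show ?thesis using z(1) by (simp add: T_def)
    qed
    then show ?thesis by (simp add: vec_eq_iff)
  qed
  have "inj_on \<Psi> (span T)"
  proof (rule inj_onI)
    fix x y assume xy: "x \<in> span T" "y \<in> span T" "\<Psi> x = \<Psi> y"
    have sTe: "span T = T" using sT by (simp only: span_eq_iff)
    have "x \<in> T" using xy(1) unfolding sTe .
    moreover have "y \<in> T" using xy(2) unfolding sTe .
    ultimately have "x - y \<in> T" by (rule subspace_diff[OF sT])
    moreover have "\<Psi> (x - y) = 0" using xy(3) by (simp add: linear_diff[OF lin])
    ultimately have "x - y = 0" by (rule inj)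
    then show "x = y" by simp
  qed
  then have "dim (\<Psi> ` T) = dim T" by (rule dim_image_eq[OF lin])
  moreover have "\<Psi> ` T = HS"
  proof
    show "\<Psi> ` T \<subseteq> HS" using \<Psi>HS by auto
    show "HS \<subseteq> \<Psi> ` T"
    proof
      fix x assume x: "x \<in> HS"
      then have xb: "x $ bar i = x $ i" for i by (simp add: HS_def)
      \<comment> \<open>At real places symmetrisation doubles the entry, hence the division by
        2.\<close>
      define z where "z = (\<chi> p. if p \<in> Q then if bar p = p then x $ p / 2 else x $ p else 0)"
      define w where "w = \<Psi> z - x"
      have w: "w \<in> HS" unfolding w_def by (rule subspace_diff[OF subspace_HS \<Psi>HS x])
      have w0: "w $ i = 0" if "i \<noteq> k" "bar i \<noteq> k" for i
      proof (cases "bar i = i")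
        case True
        then have "i \<in> Q" using cover[of i] that by (auto simp: Q_def)
        then show ?thesis using True that by (simp add: w_def \<Psi>_def z_def)
      next
        case False
        have "i \<in> Q \<longleftrightarrow> bar i \<notin> Q" using cover[of i] Pfix[of i] False that by (auto simp: Q_def)
        then show ?thesis using False that not_sym[OF False] xb[of i] by (auto simp: w_def \<Psi>_def z_def)
      qed
      have wb: "w $ bar i = w $ i" for i using w by (simp add: HS_def)
      have "(\<Sum>i\<in>UNIV. w $ i) = (\<Sum>i\<in>{k, bar k}. w $ i)"
        by (rule sum.mono_neutral_right) (auto intro!: w0)
      then have "(\<Sum>i\<in>{k, bar k}. w $ i) = 0" using w by (simp add: HS_def)
      then have "w $ k = 0" using wb[of k] by (cases "bar k = k") auto
      then have "w $ i = 0" for i using w0[of i] wb[of i] by (cases "i = k"; cases "bar i = k") auto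
      then have "\<Psi> z = x" by (simp add: w_def vec_eq_iff)
      moreover have "z \<in> T" by (simp add: T_def z_def)
      ultimately show "x \<in> \<Psi> ` T" by blast
    qed
  qed
  ultimately show ?thesis using dT cQ by simp
qed

text \<open>At a real embedding the value is 1 or -1. Without one, u_i u_(bar i) = 1 is a rational
  relation between two distinct roots that holds in both orders. Transferred to all pairs, with a
  third index at hand, it forces some conjugate to have square 1.\<close>

lemma unit_on_circle:
  assumes u: "u \<in> OU" "Lg u = 0" shows "u = 1 \<or> u = - 1"
proof -
  have O: "u \<in> Ord" using u(1) by (simp add: OU_iff)
  have n1: "cmod (u $ i) = 1" for i
  proof -
    have "ln (cmod (u $ i)) = 0" using u(2) by (simp add: Lg_def vec_eq_iff)
    then show ?thesis using OU_nonzero[OF u(1), of i] by simp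
  qed
  have pm: "u = 1 \<or> u = - 1" if "u $ i = 1 \<or> u $ i = - 1" for i
  proof -
    have "u - 1 = 0 \<or> u + 1 = 0"
      using that Ord_zero_iff[OF Ord_closed(2)[OF O Ord_closed(4)], of i] Ord_zero_iff[OF Ord_closed(1)[OF O Ord_closed(4)], of i] by auto
    then show ?thesis by (auto simp: eq_neg_iff_add_eq_0)
  qed
  show ?thesis
  proof (cases "\<exists>i. bar i = i")
    case True
    then obtain i where i: "bar i = i" by blast
    have "u $ i = cnj (u $ i)" using Ord_bar[OF O, of i] unfolding i .
    then have "u $ i * u $ i = 1" using complex_norm_square[of "u $ i"] n1[of i] by simp
    then show ?thesis using pm[of i] by (simp add: square_eq_1_iff)
  next
    case False
    obtain m where m: "u = cv m" using Ord_cv[OF O] .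
    \<comment> \<open>The coefficients of u(x) u(y) - 1, with u written in the power basis.\<close>
    define c where "c k l = of_int (m k * m l) - (if k = 0 \<and> l = 0 then 1 else (0::complex))" for k l
    have cR: "c k l \<in> \<rat>" for k l by (simp add: c_def)
    have b: "biv g c (a i) (a j) = u $ i * u $ j - 1" for i j
    proof -
      have 1: "(\<Sum>k<g. \<Sum>l<g. of_int (m k * m l) * a i ^ k * a j ^ l) = u $ i * u $ j"
        unfolding m cv_nth sum_product by (intro sum.cong refl) (simp add: ac_simps)
      have "(\<Sum>l<g. (if k = 0 \<and> l = 0 then 1 else 0) * a i ^ k * a j ^ l) = (if k = 0 then 1 else 0)" for k
        using g3 by (cases "k = 0") (simp_all add: if_distrib[of "\<lambda>q. q * _"] cong: if_cong)
      then have 2: "(\<Sum>k<g. \<Sum>l<g. (if k = 0 \<and> l = 0 then 1 else 0) * a i ^ k * a j ^ l) = 1" using g3 by simp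
      show ?thesis unfolding biv_def c_def left_diff_distrib sum_subtractf 1 2 ..
    qed
    have ub: "u $ i * u $ bar i = 1" for i
      using Ord_bar[OF O, of i] complex_norm_square[of "u $ i"] n1[of i] by simp
    fix i0 :: 'n
    have ne: "i0 \<noteq> bar i0" using False by metis
    have all: "u $ k * u $ l = 1" if "k \<noteq> l" for k l
    proof -
      have "biv g c (a k) (a l) = 0"
      proof (rule hom2[OF cR ne _ _ that])
        show "biv g c (a i0) (a (bar i0)) = 0" unfolding b using ub[of i0] by simp
        show "biv g c (a (bar i0)) (a i0) = 0" unfolding b using ub[of i0] by (simp add: mult.commute)
      qed
      then show ?thesis unfolding b by simp
    qed
    have "card {i0, bar i0} \<le> 2" by (simp add: card_insert_if)
    then have "{i0, bar i0} \<noteq> UNIV" using g3 g_card by auto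
    then obtain l where l: "l \<noteq> i0" "l \<noteq> bar i0" by blast
    have "u $ i0 * (u $ bar i0 - u $ l) = 0" using all[OF ne] all[OF not_sym[OF l(1)]] by (simp add: right_diff_distrib)
    then have "u $ bar i0 = u $ l" using OU_nonzero[OF u(1), of i0] by simp
    then have "u $ l * u $ l = 1" using all[OF l(2)] by simp
    then show ?thesis using pm[of l] by (simp add: square_eq_1_iff)
  qed
qed

definition pw :: "complex ^ 'n \<Rightarrow> int \<Rightarrow> complex ^ 'n" where "pw v n = (\<chi> i. v $ i powi n)"

lemma pw_OU: assumes "v \<in> OU" shows "pw v n \<in> OU"
proof -
  have p: "(\<chi> i. w $ i ^ k) \<in> OU" if "w \<in> OU" for w k
  proof (induction k)
    case 0
    have "(\<chi> i. w $ i ^ 0) = 1" by (simp add: vec_eq_iff)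
    then show ?case using OU_closed(2) by simp
  next
    case (Suc k)
    have "(\<chi> i. w $ i ^ Suc k) = w * (\<chi> i. w $ i ^ k)" by (simp add: vec_eq_iff)
    then show ?case using OU_closed(1)[OF that Suc] by simp
  qed
  show ?thesis
  proof (cases "n \<ge> 0")
    case True
    then show ?thesis using p[OF assms, of "nat n"] by (simp add: pw_def power_int_def)
  next
    case False
    then show ?thesis using p[OF OU_inverse[OF assms], of "nat (- n)"] by (simp add: pw_def power_int_def)
  qed
qed

lemma Lg_pw: "v \<in> OU \<Longrightarrow> Lg (pw v n) = of_int n *\<^sub>R Lg v"
  using OU_nonzero[of v] by (simp add: Lg_def pw_def vec_eq_iff norm_power_int ln_powi)

lemma prod_OU: "(\<And>j. j \<in> F \<Longrightarrow> v j \<in> OU) \<Longrightarrow> prod v F \<in> OU \<and> Lg (prod v F) = (\<Sum>j\<in>F. Lg (v j))"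
proof (induction F rule: infinite_finite_induct)
  case (insert j F)
  then show ?case using OU_closed(1)[of "v j" "prod v F"] Lg_mult[of "v j" "prod v F"] by simp
qed (use OU_closed(2) in \<open>auto simp: Lg_def vec_eq_iff\<close>)

text \<open>Bounded logarithms mean bounded conjugates, so the logarithms form a discrete group, of
  full rank in \<open>HS\<close> by \<open>span_Lg\<close>. Lifting an integral basis splits off the
  kernel, which consists of 1 and -1 by \<open>unit_on_circle\<close>.\<close>

theorem unit_group:
  assumes rs: "card {i. a i \<in> \<real>} = r" "r + 2 * s = g"
  shows "free_Zmod (r + s - 1) \<times>\<times> sign_group \<cong> \<lparr>carrier = OU, monoid.mult = (*), one = 1\<rparr>"
proof -
  let ?G = "Lg ` OU"
  have add: "add_closed ?G" unfolding add_closed_def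
  proof (intro conjI ballI)
    have "Lg 1 = 0" by (simp add: Lg_def vec_eq_iff)
    then show "0 \<in> ?G" using OU_closed(2) by (metis imageI)
    fix x y assume "x \<in> ?G" "y \<in> ?G"
    then obtain v w where vw: "x = Lg v" "y = Lg w" "v \<in> OU" "w \<in> OU" by blast
    have "x - y = Lg (v * pw w (- 1))" using vw by (simp add: Lg_mult pw_OU Lg_pw)
    then show "x - y \<in> ?G" using vw OU_closed(1) pw_OU by blast
  qed
  have fin: "finite {x \<in> ?G. norm x \<le> R}" for R
  proof (rule finite_subset)
    show "finite (Lg ` {v\<in>Ord. \<forall>i. cmod (v $ i) \<le> exp R})" using finite_bounded_Ord by (rule finite_imageI)
    show "{x \<in> ?G. norm x \<le> R} \<subseteq> Lg ` {v\<in>Ord. \<forall>i. cmod (v $ i) \<le> exp R}"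
    proof
      fix x assume "x \<in> {x \<in> ?G. norm x \<le> R}"
      then obtain v where v: "v \<in> OU" "x = Lg v" "norm (Lg v) \<le> R" by auto
      have "cmod (v $ i) \<le> exp R" for i
      proof -
        have "ln (cmod (v $ i)) \<le> R" using component_le_norm_cart[of "Lg v" i] v(3) by (simp add: Lg_def)
        then have "exp (ln (cmod (v $ i))) \<le> exp R" by simp
        then show ?thesis using OU_nonzero[OF v(1), of i] by simp
      qed
      then show "x \<in> Lg ` {v\<in>Ord. \<forall>i. cmod (v $ i) \<le> exp R}" using v(1,2) by (auto simp: OU_iff)
    qed
  qed
  obtain B0 where B0: "B0 \<subseteq> ?G" "independent B0" "?G \<subseteq> span B0" "card B0 = dim ?G" using basis_exists by blast
  have "finite B0" using B0(2) by (rule independent_imp_finite)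
  then obtain B where B: "finite B" "independent B" "B \<subseteq> ?G" "card B = card B0" "?G \<inter> span B0 = int_span B"
    using discrete_group_int_basis[OF add fin _ B0(2,1)] by blast
  have G: "?G = int_span B" using B(5) B0(3) by blast
  define d where "d = r + s - 1"
  have "dim ?G = dim HS" using dim_span[of ?G] span_Lg by simp
  then have cB: "card B = d" using B(4) B0(4) dim_HS[OF rs] unfolding d_def by linarith
  obtain e where e0: "bij_betw e {0..<card B} B" using ex_bij_betw_nat_finite[OF B(1)] by (rule exE)
  have e: "bij_betw e {..<d} B" using e0 unfolding cB atLeast0LessThan .
  have "\<forall>j\<in>{..<d}. \<exists>v\<in>OU. Lg v = e j"
  proof
    fix j assume "j \<in> {..<d}"
    then have "e j \<in> Lg ` OU" using bij_betwE[OF e] B(3) by blast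
    then show "\<exists>v\<in>OU. Lg v = e j" by (elim imageE) auto
  qed
  then obtain \<epsilon> where \<epsilon>: "\<And>j. j < d \<Longrightarrow> \<epsilon> j \<in> OU" "\<And>j. j < d \<Longrightarrow> Lg (\<epsilon> j) = e j" by (metis lessThan_iff)
  define \<Phi>0 where "\<Phi>0 m = (\<Prod>j<d. pw (\<epsilon> j) (m j))" for m
  have \<Phi>0: "\<Phi>0 m \<in> OU" "Lg (\<Phi>0 m) = (\<Sum>j<d. of_int (m j) *\<^sub>R e j)" for m
    using prod_OU[of "{..<d}" "\<lambda>j. pw (\<epsilon> j) (m j)"] \<epsilon> by (simp_all add: \<Phi>0_def pw_OU Lg_pw)
  have \<Phi>0_mult: "\<Phi>0 (\<lambda>j\<in>{..<d}. m j + n j) = \<Phi>0 m * \<Phi>0 n" for m n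
    unfolding \<Phi>0_def prod.distrib[symmetric]
    by (rule prod.cong) (auto simp: vec_eq_iff pw_def powi_add_mult OU_nonzero[OF \<epsilon>(1)])
  have Bsum: "(\<Sum>b\<in>B. of_int (h b) *\<^sub>R b) = (\<Sum>j<d. of_int (h (e j)) *\<^sub>R e j)" for h :: "real ^ 'n \<Rightarrow> int"
    by (rule sum.reindex_bij_betw[OF e, symmetric])
  have ind: "\<forall>v\<in>B. c v = 0" if z: "(\<Sum>v\<in>B. c v *\<^sub>R v) = 0" for c
  proof -
    have "finite B \<and> (\<forall>c. (\<Sum>v\<in>B. c v *\<^sub>R v) = 0 \<longrightarrow> (\<forall>v\<in>B. c v = 0))" using B(2) unfolding independent_explicit .
    then have "(\<Sum>v\<in>B. c v *\<^sub>R v) = 0 \<longrightarrow> (\<forall>v\<in>B. c v = 0)" by (elim conjE) (erule spec)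
    then show ?thesis using z by (rule mp)
  qed
  define \<Phi> where "\<Phi> = (\<lambda>(m, z). of_int z * \<Phi>0 m)"
  have carF: "carrier (free_Zmod d) = PiE {..<d} (\<lambda>_. UNIV)" by (simp add: free_Zmod_def integer_group_def)
  have sgn_OU: "of_int z * v \<in> OU" if "v \<in> OU" "z = 1 \<or> z = - 1" for z v
    using that OU_closed(1)[OF OU_closed(3) that(1)] by auto
  have "\<Phi> \<in> iso (free_Zmod d \<times>\<times> sign_group) \<lparr>carrier = OU, monoid.mult = (*), one = 1\<rparr>"
  proof (rule isoI)
    show "\<Phi> \<in> hom (free_Zmod d \<times>\<times> sign_group) \<lparr>carrier = OU, monoid.mult = (*), one = 1\<rparr>"
    proof (rule homI)
      fix x y :: "(nat \<Rightarrow> int) \<times> int" assume "x \<in> carrier (free_Zmod d \<times>\<times> sign_group)"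
      then show "\<Phi> x \<in> carrier \<lparr>carrier = OU, monoid.mult = (*), one = 1\<rparr>"
        using sgn_OU[OF \<Phi>0(1)] by (auto simp: \<Phi>_def sign_group_def)
      obtain m z n w where xy: "x = (m, z)" "y = (n, w)" by (cases x; cases y)
      show "\<Phi> (x \<otimes>\<^bsub>free_Zmod d \<times>\<times> sign_group\<^esub> y) = \<Phi> x \<otimes>\<^bsub>\<lparr>carrier = OU, monoid.mult = (*), one = 1\<rparr>\<^esub> \<Phi> y"
        using \<Phi>0_mult[of m n] by (simp add: xy \<Phi>_def DirProd_def free_Zmod_def product_group_def integer_group_def sign_group_def ac_simps)
    qed
    show "bij_betw \<Phi> (carrier (free_Zmod d \<times>\<times> sign_group)) (carrier \<lparr>carrier = OU, monoid.mult = (*), one = 1\<rparr>)"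
      unfolding bij_betw_def
    proof
      show "inj_on \<Phi> (carrier (free_Zmod d \<times>\<times> sign_group))"
      proof (rule inj_onI)
        fix x y assume x: "x \<in> carrier (free_Zmod d \<times>\<times> sign_group)" and y: "y \<in> carrier (free_Zmod d \<times>\<times> sign_group)" and eq: "\<Phi> x = \<Phi> y"
        obtain m z n w where xy: "x = (m, z)" "y = (n, w)" by (cases x; cases y)
        have mz: "m \<in> PiE {..<d} (\<lambda>_. UNIV)" "n \<in> PiE {..<d} (\<lambda>_. UNIV)" "z = 1 \<or> z = - 1" "w = 1 \<or> w = - 1"
          using x y by (auto simp: xy carF sign_group_def)
        have Lsgn: "Lg (of_int z * v) = Lg v" if "z = 1 \<or> z = - 1" for z v using that by (auto simp: Lg_def)
        have "Lg (\<Phi>0 m) = Lg (\<Phi>0 n)" using eq Lsgn[OF mz(3)] Lsgn[OF mz(4)] unfolding \<Phi>_def xy by (metis case_prod_conv)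
        then have "(\<Sum>j<d. of_int (m j - n j) *\<^sub>R e j) = 0"
          unfolding \<Phi>0 by (simp add: scaleR_left_diff_distrib sum_subtractf)
        moreover have "(\<Sum>b\<in>B. of_int (m (inv_into {..<d} e b) - n (inv_into {..<d} e b)) *\<^sub>R b) = (\<Sum>j<d. of_int (m j - n j) *\<^sub>R e j)"
          unfolding Bsum using e by (intro sum.cong) (auto simp: bij_betw_def inv_into_f_f)
        ultimately have "(\<Sum>b\<in>B. of_int (m (inv_into {..<d} e b) - n (inv_into {..<d} e b)) *\<^sub>R b) = 0" by simp
        then have zero: "\<forall>b\<in>B. real_of_int (m (inv_into {..<d} e b) - n (inv_into {..<d} e b)) = 0" by (rule ind)
        have "m j = n j" if "j < d" for j
        proof -
          have "e j \<in> B" using bij_betwE[OF e] that by blast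
          from bspec[OF zero this] have "m (inv_into {..<d} e (e j)) = n (inv_into {..<d} e (e j))" by simp
          moreover have "inv_into {..<d} e (e j) = j" using e that by (simp add: bij_betw_def inv_into_f_f)
          ultimately show ?thesis by simp
        qed
        then have mn: "m = n" using mz(1,2) by (intro PiE_ext) auto
        have "z = w"
        proof (rule ccontr)
          assume "z \<noteq> w"
          then have "\<Phi>0 m = - \<Phi>0 m" using eq mz(3,4) mn by (auto simp: \<Phi>_def xy)
          then have "\<Phi>0 m $ i = - \<Phi>0 m $ i" for i by (metis vector_uminus_component)
          moreover have "x = - x \<Longrightarrow> x = 0" for x :: complex by (auto simp: complex_eq_iff)
          ultimately have "\<Phi>0 m $ undefined = 0" by blast
          then show False using OU_nonzero[OF \<Phi>0(1)] by blast
        qed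
        then show "x = y" using mn xy by simp
      qed
      show "\<Phi> ` carrier (free_Zmod d \<times>\<times> sign_group) = carrier \<lparr>carrier = OU, monoid.mult = (*), one = 1\<rparr>"
      proof
        show "\<Phi> ` carrier (free_Zmod d \<times>\<times> sign_group) \<subseteq> carrier \<lparr>carrier = OU, monoid.mult = (*), one = 1\<rparr>"
          using sgn_OU[OF \<Phi>0(1)] by (auto simp: \<Phi>_def sign_group_def)
        show "carrier \<lparr>carrier = OU, monoid.mult = (*), one = 1\<rparr> \<subseteq> \<Phi> ` carrier (free_Zmod d \<times>\<times> sign_group)"
        proof
          fix v assume "v \<in> carrier \<lparr>carrier = OU, monoid.mult = (*), one = 1\<rparr>"
          then have v: "v \<in> OU" by simp
          then have "Lg v \<in> int_span B" using G by blast
          then obtain h where h: "Lg v = (\<Sum>b\<in>B. of_int (h b) *\<^sub>R b)" unfolding int_span_def by blast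
          define m where "m = (\<lambda>j\<in>{..<d}. h (e j))"
          have Lm: "Lg (\<Phi>0 m) = Lg v" unfolding \<Phi>0 h Bsum by (rule sum.cong) (auto simp: m_def)
          \<comment> \<open>The quotient of v by the product of basis units with the same logarithm;
            it can only be a sign.\<close>
          define q where "q = v * pw (\<Phi>0 m) (- 1)"
          have q: "q \<in> OU" "Lg q = 0" unfolding q_def using v \<Phi>0(1) by (simp_all add: OU_closed pw_OU Lg_mult Lg_pw Lm)
          then have "q = 1 \<or> q = - 1" by (rule unit_on_circle)
          then obtain z :: int where z: "z = 1 \<or> z = - 1" "q = of_int z" by (metis of_int_1 of_int_minus)
          have "pw (\<Phi>0 m) (- 1) * \<Phi>0 m = 1" using OU_nonzero[OF \<Phi>0(1)] by (simp add: vec_eq_iff pw_def)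
          then have "v = of_int z * \<Phi>0 m" using z(2) by (metis q_def mult.assoc mult.right_neutral)
          then have "v = \<Phi> (m, z)" by (simp add: \<Phi>_def)
          moreover have "(m, z) \<in> carrier (free_Zmod d \<times>\<times> sign_group)" using z(1) by (auto simp: carF m_def sign_group_def)
          ultimately show "v \<in> \<Phi> ` carrier (free_Zmod d \<times>\<times> sign_group)" by blast
        qed
      qed
    qed
  qed
  then show ?thesis unfolding d_def is_iso_def by blast
qed

end

section \<open>Endomorphisms of the torus\<close>

context generic_torus
begin

text \<open>\<open>generic\<close> for coefficients supported at i and j; when i = j the two
  contributions add up.\<close>

lemma generic_two:
  assumes "A \<in> K" "B \<in> K" "C \<in> K" "A' \<in> K" "B' \<in> K"
    and z: "A * gp (t i) (u i) + B * gq (t i) (u i) + C * gr (t i) (u i) + (A' * gp (t j) (u j) + B' * gq (t j) (u j)) = 0"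
  shows "i \<noteq> j \<Longrightarrow> A = 0 \<and> B = 0 \<and> C = 0 \<and> A' = 0 \<and> B' = 0" "i = j \<Longrightarrow> A + A' = 0 \<and> B + B' = 0 \<and> C = 0"
proof -
  define A1 where "A1 k = (if k = i then A else 0) + (if k = j then A' else 0)" for k
  define B1 where "B1 k = (if k = i then B else 0) + (if k = j then B' else 0)" for k
  define C1 where "C1 k = (if k = i then C else 0)" for k
  have K0: "0 \<in> K" using ring_closed_0[OF K] .
  have inK: "A1 k \<in> K \<and> B1 k \<in> K \<and> C1 k \<in> K" for k
    unfolding A1_def B1_def C1_def by (intro conjI ring_closed_add[OF K]) (simp_all add: assms K0)
  have d: "(\<Sum>k\<in>UNIV. (if k = i' then c else 0) * h k) = c * h i'" for h :: "'n \<Rightarrow> complex" and c i'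
    by (simp add: if_distrib[of "\<lambda>q. q * _"] cong: if_cong)
  have "(\<Sum>k\<in>UNIV. gsum t A1 B1 C1 k) = 0"
    unfolding gsum_def u_def[symmetric] A1_def B1_def C1_def distrib_right sum.distrib d using z by (simp add: algebra_simps)
  then have "A1 k = 0 \<and> B1 k = 0 \<and> C1 k = 0" for k by (rule generic[OF inK])
  from this[of i] this[of j]
  show "i \<noteq> j \<Longrightarrow> A = 0 \<and> B = 0 \<and> C = 0 \<and> A' = 0 \<and> B' = 0" "i = j \<Longrightarrow> A + A' = 0 \<and> B + B' = 0 \<and> C = 0"
    by (auto simp: A1_def B1_def C1_def)
qed

lemma Ord_K: "x \<in> Ord \<Longrightarrow> x $ i \<in> K"
proof -
  assume "x \<in> Ord"
  then obtain m where "x = cv m" by (rule Ord_cv)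
  then show "x $ i \<in> K" unfolding \<open>x = cv m\<close> cv_nth
    by (intro ring_closed_sum[OF K] ring_closed_mult[OF K] ring_closed_power[OF K a_K] Rats_K) simp
qed

lemma ef_Lam_K: "v \<in> Lam \<Longrightarrow> ef (i, b) v \<in> K"
  unfolding Lam_def by (cases b) (auto simp: ef_Lam Ord_K)

text \<open>Commuting with multiplication by \<open>\<i>\<close> gives linear relations with coefficients in \<open>K\<close> between the generic
  parameters; genericity forces the matrix of \<open>D\<close> to be diagonal.\<close>

lemma lattice_endomorphism:
  assumes clin: "\<And>v w. D (v + w) = D v + D w" "\<And>c v. D (c *s v) = c *s D v" and Lam: "\<And>v. v \<in> Lam \<Longrightarrow> D v \<in> Lam"
  shows "\<exists>\<mu>\<in>Ord. \<forall>v. D v = \<mu> * v"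
proof -
  have lin: "linear (\<lambda>v. ef x (D v))" for x
  proof (rule linearI)
    fix r and v :: "complex ^ 'n"
    have "r *\<^sub>R v = of_real r *s v" "r *\<^sub>R D v = of_real r *s D v" by (simp_all add: vec_eq_iff complex_scaleR_of_real)
    then show "ef x (D (r *\<^sub>R v)) = r *\<^sub>R ef x (D v)" using clin(2) linear_cmul[OF linear_ef] by metis
  qed (simp add: clin linear_add[OF linear_ef])
  define m where "m i b = dual (\<lambda>v. ef (i, b) (D v))" for i b
  have mK: "m i b x \<in> K" for i b x
    unfolding m_def dual_def by (intro ring_closed_sum[OF K] ring_closed_mult[OF K] lag_K ef_Lam_K Lam lam_Lam)
  have ex: "ef (i, b) (D v) = (\<Sum>x\<in>UNIV. m i b x * ef x v)" for i b v
    unfolding m_def by (rule linear_dual[OF lin])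
  have unique: "M = M'" if "\<And>v. (\<Sum>x\<in>UNIV. M x * ef x v) = (\<Sum>x\<in>UNIV. M' x * ef x v)" for M M'
  proof
    fix y show "M y = M' y" using dual_ef[of M y] dual_ef[of M' y] that by simp
  qed
  \<comment> \<open>The operator from \<open>ef_ii\<close> is applied after D and before D; the
    coefficients of \<open>ef x\<close> on both sides are compared.\<close>
  have rel: "- gq (t j) (u j) * m i True (j, False) + 2 * gp (t j) (u j) * m i True (j, True)
        = 2 * gp (t i) (u i) * m i False (j, False) + gq (t i) (u i) * m i True (j, False)"
    "- 2 * gr (t j) (u j) * m i True (j, False) + gq (t j) (u j) * m i True (j, True)
        = 2 * gp (t i) (u i) * m i False (j, True) + gq (t i) (u i) * m i True (j, True)" for i j
  proof -
    define M where "M x = (if snd x then - 2 * gr (t (fst x)) (u (fst x)) * m i True (fst x, False) + gq (t (fst x)) (u (fst x)) * m i True (fst x, True)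
      else - gq (t (fst x)) (u (fst x)) * m i True (fst x, False) + 2 * gp (t (fst x)) (u (fst x)) * m i True (fst x, True))" for x :: "'n \<times> bool"
    define M' where "M' x = 2 * gp (t i) (u i) * m i False x + gq (t i) (u i) * m i True x" for x
    have "M = M'"
    proof (rule unique)
      fix v
      have "(\<Sum>x\<in>UNIV. M' x * ef x v) = - \<i> * ef (i, True) (\<i> *s D v)"
        unfolding ef_ii ex M'_def by (simp add: distrib_right sum.distrib sum_distrib_left mult.assoc)
      also have "\<dots> = (\<Sum>x\<in>UNIV. m i True x * (- \<i> * ef x (\<i> *s v)))"
        unfolding clin(2)[symmetric] ex by (simp add: sum_distrib_left mult.left_commute)
      also have "\<dots> = (\<Sum>x\<in>UNIV. M x * ef x v)"
        unfolding sum_bool_pair ef_ii M_def by (intro sum.cong refl) (simp add: algebra_simps)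
      finally show "(\<Sum>x\<in>UNIV. M x * ef x v) = (\<Sum>x\<in>UNIV. M' x * ef x v)" ..
    qed
    from fun_cong[OF this, of "(j, False)"] fun_cong[OF this, of "(j, True)"]
    show "- gq (t j) (u j) * m i True (j, False) + 2 * gp (t j) (u j) * m i True (j, True)
        = 2 * gp (t i) (u i) * m i False (j, False) + gq (t i) (u i) * m i True (j, False)"
      "- 2 * gr (t j) (u j) * m i True (j, False) + gq (t j) (u j) * m i True (j, True)
        = 2 * gp (t i) (u i) * m i False (j, True) + gq (t i) (u i) * m i True (j, True)"
      by (simp_all add: M_def M'_def)
  qed
  have K2: "2 * x \<in> K" "- x \<in> K" if "x \<in> K" for x
    using ring_closed_mult[OF K Rats_K that, of 2] ring_closed_uminus[OF K that] by simp_all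
  have z1: "2 * m i True (j, True) * gp (t j) (u j) + - m i True (j, False) * gq (t j) (u j) + 0 * gr (t j) (u j)
      + (- (2 * m i False (j, False)) * gp (t i) (u i) + - m i True (j, False) * gq (t i) (u i)) = 0" for i j
    using rel(1)[of j i] by (simp add: algebra_simps)
  have z2: "0 * gp (t j) (u j) + m i True (j, True) * gq (t j) (u j) + - (2 * m i True (j, False)) * gr (t j) (u j)
      + (- (2 * m i False (j, True)) * gp (t i) (u i) + - m i True (j, True) * gq (t i) (u i)) = 0" for i j
    using rel(2)[of j i] by (simp add: algebra_simps)
  note g1 = generic_two[OF K2(1)[OF mK] K2(2)[OF mK] ring_closed_0[OF K] K2(2)[OF K2(1)[OF mK]] K2(2)[OF mK] z1]
  note g2 = generic_two[OF ring_closed_0[OF K] mK K2(2)[OF K2(1)[OF mK]] K2(2)[OF K2(1)[OF mK]] K2(2)[OF mK] z2]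
  have off: "m i b (j, d) = 0" if "j \<noteq> i" for i j b d
    using g1(1)[OF that] g2(1)[OF that] by (cases b; cases d) simp_all
  have diag: "m i True (i, False) = 0" "m i True (i, True) = m i False (i, False)" "m i False (i, True) = 0" for i
  proof -
    have "2 * m i True (i, True) + - (2 * m i False (i, False)) = 0 \<and> - m i True (i, False) + - m i True (i, False) = 0 \<and> (0::complex) = 0"
      by (rule g1(2)) (rule refl)
    then show "m i True (i, False) = 0" "m i True (i, True) = m i False (i, False)" by simp_all
    have "0 + - (2 * m i False (i, True)) = 0 \<and> m i True (i, True) + - m i True (i, True) = 0 \<and> - (2 * m i True (i, False)) = 0"
      by (rule g2(2)) (rule refl)
    then show "m i False (i, True) = 0" by simp
  qed
  have efD: "ef (i, b) (D v) = m i False (i, False) * ef (i, b) v" for i b v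
  proof -
    have "(\<Sum>j\<in>UNIV. m i b (j, False) * ef (j, False) v + m i b (j, True) * ef (j, True) v) =
      (\<Sum>j\<in>{i}. m i b (j, False) * ef (j, False) v + m i b (j, True) * ef (j, True) v)"
      by (rule sum.mono_neutral_right) (simp_all add: off)
    then show ?thesis unfolding ex sum_bool_pair by (cases b) (simp_all add: diag)
  qed
  define \<mu> where "\<mu> = (\<chi> i. m i False (i, False))"
  have D: "D v = \<mu> * v" for v
    by (simp add: vec_eq_iff \<mu>_def ef_decomp(1)[of "D v"] efD) (simp add: ef_decomp(1)[of v] algebra_simps)
  \<comment> \<open>D 1 is \<mu> itself; as a lattice vector without t-component it lies in the
    order.\<close>
  have "D 1 \<in> Lam" by (rule Lam[OF Lam_closed(5)[OF Ord_closed(4)]])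
  then obtain x y where xy: "D 1 = x + y * tv" "x \<in> Ord" "y \<in> Ord" unfolding Lam_def by blast
  have "ef (i, True) 1 = 0" for i using ef_Lam(2)[OF Ord_closed(4,5), of i] by simp
  then have "y $ i = 0" for i using ef_Lam(2)[OF xy(2,3), of i] efD[of i True 1] xy(1) by simp
  then have "y = 0" by (simp add: vec_eq_iff)
  then have "\<mu> \<in> Ord" using xy D[of 1] by simp
  then show ?thesis using D by blast
qed

section \<open>The quotient group and lifts of its endomorphisms\<close>

abbreviation proj :: "complex ^ 'n \<Rightarrow> (complex ^ 'n) set" where "proj \<equiv> torus_proj Lam"

lemma mem_proj: "z \<in> proj x \<longleftrightarrow> z - x \<in> Lam"
  unfolding torus_proj_def r_coset_def vec_group_def by (auto intro: bexI[of _ "z - x"])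

lemma proj_eq: "proj x = proj y \<longleftrightarrow> x - y \<in> Lam"
proof
  assume "proj x = proj y"
  then have "x \<in> proj y" using mem_proj[of x x] Lam_closed(1) by simp
  then show "x - y \<in> Lam" by (simp add: mem_proj)
next
  assume "x - y \<in> Lam"
  then have z: "z - x \<in> Lam \<longleftrightarrow> z - y \<in> Lam" for z
    using Lam_closed(2)[of "z - x" "x - y"] Lam_closed(3)[of "z - y" "x - y"] by auto
  show "proj x = proj y" by (rule Set.set_eqI) (simp add: mem_proj z)
qed

lemma carrier_torus: "carrier (torus Lam) = range proj"
  by (auto simp: torus_def FactGroup_def RCOSETS_def torus_proj_def vec_group_def)

lemma one_torus: "\<one>\<^bsub>torus Lam\<^esub> = proj 0"
proof -
  have "z \<in> \<one>\<^bsub>torus Lam\<^esub> \<longleftrightarrow> z \<in> proj 0" for z unfolding mem_proj by (simp add: torus_def FactGroup_def)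
  then show ?thesis by blast
qed

lemma mult_torus: "proj x \<otimes>\<^bsub>torus Lam\<^esub> proj y = proj (x + y)"
proof (rule Set.set_eqI)
  fix z
  have "z \<in> proj x \<otimes>\<^bsub>torus Lam\<^esub> proj y \<longleftrightarrow> (\<exists>h\<in>proj x. \<exists>k\<in>proj y. z = h + k)"
    by (auto simp: torus_def FactGroup_def set_mult_def vec_group_def)
  also have "\<dots> \<longleftrightarrow> z \<in> proj (x + y)"
  proof
    assume "\<exists>h\<in>proj x. \<exists>k\<in>proj y. z = h + k"
    then obtain h k where "h - x \<in> Lam" "k - y \<in> Lam" "z = h + k" by (auto simp: mem_proj)
    then show "z \<in> proj (x + y)" using Lam_closed(2)[of "h - x" "k - y"] by (simp add: mem_proj algebra_simps)
  next
    assume "z \<in> proj (x + y)"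
    then have "z - y \<in> proj x" "y \<in> proj y" using Lam_closed(1) by (simp_all add: mem_proj algebra_simps)
    then show "\<exists>h\<in>proj x. \<exists>k\<in>proj y. z = h + k" by (intro bexI[of _ "z - y"] bexI[of _ y]) simp_all
  qed
  finally show "z \<in> proj x \<otimes>\<^bsub>torus Lam\<^esub> proj y \<longleftrightarrow> z \<in> proj (x + y)" .
qed

lemma Lam_separated: obtains e where "e > 0" "\<And>v. v \<in> Lam \<Longrightarrow> norm v < e \<Longrightarrow> v = 0"
proof -
  have "0 isolated_in Lam" using Lam_discrete Lam_closed(1) by (rule discreteD)
  then obtain e where "e > 0" "\<forall>y\<in>Lam. dist 0 y < e \<longrightarrow> y = 0" unfolding isolated_in_dist_Ex_iff by blast
  then show thesis by (intro that[of e]) auto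
qed

text \<open>A local lift near 0, normalised to k 0 = 0, is additive on small vectors because the
  defect is a short lattice vector. Additivity and differentiability at 0 make it agree with its
  derivative D nearby, and multiples of small vectors extend the description by D to the whole
  torus.\<close>

lemma endomorphism_lift:
  assumes F: "F \<in> carrier (torus_End Lam)"
  shows "\<exists>\<mu>\<in>Ord. \<forall>v. F (proj v) = proj (\<mu> * v)"
proof -
  have hom: "F \<in> hom (torus Lam) (torus Lam)" and hol: "torus_holomorphic Lam F" using F by (auto simp: torus_End_def)
  have Fadd: "F (proj (x + y)) = F (proj x) \<otimes>\<^bsub>torus Lam\<^esub> F (proj y)" for x y
    using hom_mult[OF hom, of "proj x" "proj y"] by (simp add: mult_torus carrier_torus)
  obtain OU' h where h: "open OU'" "0 \<in> OU'" "holomorphic_vec_on OU' h" "\<And>y. y \<in> OU' \<Longrightarrow> F (proj y) = proj (h y)"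
    using hol[unfolded torus_holomorphic_def, rule_format, of 0] by blast
  obtain D where D: "Vector_Spaces.linear (*s) (*s) D" "(h has_derivative D) (at 0)"
    using h(2,3) unfolding holomorphic_vec_on_def by blast
  have clin: "D (v + w) = D v + D w" "D (c *s v) = c *s D v" for v w c using D(1) unfolding Vector_Spaces.linear_iff by simp_all
  have sc: "r *\<^sub>R w = complex_of_real r *s w" for r and w :: "complex ^ 'n" by (simp add: vec_eq_iff complex_scaleR_of_real)
  have Dsc: "D (r *\<^sub>R v) = r *\<^sub>R D v" for r v by (simp only: sc clin(2))
  obtain e where e: "e > 0" "\<And>v. v \<in> Lam \<Longrightarrow> norm v < e \<Longrightarrow> v = 0" using Lam_separated by blast
  have F0: "F (proj 0) = proj 0"
  proof -
    obtain w where w: "F (proj 0) = proj w" using hom_in_carrier[OF hom, of "proj 0"] by (auto simp: carrier_torus)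
    have "proj w = proj (w + w)" using Fadd[of 0 0] w by (simp add: mult_torus)
    then have "w \<in> Lam" using proj_eq[of "w + w" w] by simp
    then show ?thesis using w proj_eq[of w 0] by simp
  qed
  define k where "k y = h y - h 0" for y
  have "h 0 \<in> Lam" using h(4)[OF h(2)] F0 proj_eq[of 0 "h 0"] Lam_closed(4)[of "- h 0"] by simp
  then have Fk: "F (proj y) = proj (k y)" if "y \<in> OU'" for y
    using h(4)[OF that] proj_eq[of "h y" "k y"] by (simp add: k_def)
  have der: "\<And>e. e > 0 \<Longrightarrow> \<exists>d>0. \<forall>y. norm y < d \<longrightarrow> norm (k y - D y) \<le> e * norm y"
    using D(2) unfolding has_derivative_at_alt k_def by simp
  have "isCont h 0" using D(2) by (rule has_derivative_continuous)
  then obtain d where d: "d > 0" "\<And>y. norm y < d \<Longrightarrow> norm (k y) < e / 3"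
    using e(1) unfolding continuous_at_eps_delta k_def by (metis diff_zero dist_norm divide_pos_pos zero_less_numeral)
  obtain r where r: "r > 0" "ball 0 r \<subseteq> OU'" using h(1,2) open_contains_ball by blast
  define \<rho> where "\<rho> = min d r / 2"
  have \<rho>: "\<rho> > 0" "2 * \<rho> \<le> d" "2 * \<rho> \<le> r" using d(1) r(1) by (auto simp: \<rho>_def)
  have kadd: "k (y + z) = k y + k z" if "norm y < \<rho>" "norm z < \<rho>" for y z
  proof -
    have n: "norm (y + z) < 2 * \<rho>" using norm_triangle_ineq[of y z] that by linarith
    have U: "y \<in> OU'" "z \<in> OU'" "y + z \<in> OU'" using r(2) that n \<rho> by (auto simp: subset_iff)
    have "proj (k (y + z)) = proj (k y + k z)"
      using Fadd[of y z] Fk[OF U(1)] Fk[OF U(2)] Fk[OF U(3)] by (simp add: mult_torus)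
    then have L: "k (y + z) - (k y + k z) \<in> Lam" by (simp add: proj_eq)
    have "norm (k (y + z) - (k y + k z)) \<le> norm (k (y + z)) + (norm (k y) + norm (k z))"
      by (rule order_trans[OF norm_triangle_ineq4]) (simp add: norm_triangle_ineq)
    also have "\<dots> < e" using d(2)[of y] d(2)[of z] d(2)[of "y + z"] that n \<rho> by linarith
    finally show ?thesis using e(2)[OF L] by simp
  qed
  have k0: "k 0 = 0" by (simp add: k_def)
  have kn: "k (real m *\<^sub>R y) = real m *\<^sub>R k y" if y: "real n * norm y < \<rho>" and "m \<le> n" for m n y
    using that(2)
  proof (induction m)
    case (Suc m)
    have "real m * norm y \<le> real n * norm y" "1 * norm y \<le> real n * norm y"
      using Suc.prems by (intro mult_right_mono; simp)+
    then have "norm (real m *\<^sub>R y) < \<rho>" "norm y < \<rho>" using y by simp_all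
    then have "k (real m *\<^sub>R y + y) = real m *\<^sub>R k y + k y" using kadd Suc by simp
    then show ?case by (simp add: scaleR_add_left algebra_simps)
  qed (simp add: k0)
  \<comment> \<open>Pass to y/n: the error of the linear approximation there is multiplied by n and
    is still at most \<epsilon> times the norm of y.\<close>
  have kD: "k y = D y" if y: "norm y < \<rho>" for y
  proof -
    have "norm (k y - D y) \<le> \<epsilon> * norm y" if eps: "\<epsilon> > 0" for \<epsilon>
    proof -
      obtain \<delta> where \<delta>: "\<delta> > 0" "\<And>y. norm y < \<delta> \<Longrightarrow> norm (k y - D y) \<le> \<epsilon> * norm y" using der[OF eps] by blast
      obtain n :: nat where n: "norm y / \<delta> < real n" using reals_Archimedean2 by blast
      have n0: "real n > 0" using n \<delta>(1) by (smt (verit) divide_nonneg_pos norm_ge_zero)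
      define w where "w = (1 / real n) *\<^sub>R y"
      have w: "y = real n *\<^sub>R w" "norm w = norm y / real n" using n0 by (simp_all add: w_def)
      have "norm w < \<delta>" using n n0 \<delta>(1) by (simp add: w(2) field_simps)
      have "real n * norm w < \<rho>" using y n0 by (simp add: w(2))
      then have "k y = real n *\<^sub>R k w" unfolding w(1) by (rule kn) simp
      then have "k y - D y = real n *\<^sub>R (k w - D w)" unfolding w(1) Dsc by (simp add: algebra_simps)
      then have "norm (k y - D y) = real n * norm (k w - D w)" by simp
      also have "\<dots> \<le> real n * (\<epsilon> * norm w)" by (intro mult_left_mono \<delta>(2) \<open>norm w < \<delta>\<close>) simp
      also have "\<dots> = \<epsilon> * norm y" using n0 by (simp add: w(2))
      finally show ?thesis .
    qed
    then have le: "norm (k y - D y) \<le> 0 + \<epsilon> * norm y" if "\<epsilon> > 0" for \<epsilon> using that by simp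
    have "norm (k y - D y) \<le> 0"
    proof (rule field_le_epsilon)
      fix x :: real assume x: "x > 0"
      have "norm (k y - D y) \<le> 0 + (x / (norm y + 1)) * norm y" using x by (intro le divide_pos_pos) (auto intro: add_nonneg_pos)
      also have "\<dots> \<le> 0 + x" using x by (simp add: divide_simps add_nonneg_pos)
      finally show "norm (k y - D y) \<le> 0 + x" .
    qed
    then show ?thesis by simp
  qed
  have FD: "F (proj v) = proj (D v)" for v
  proof -
    obtain n :: nat where n: "norm v / \<rho> < real n" using reals_Archimedean2 by blast
    have n0: "real n > 0" using n \<rho>(1) by (smt (verit) divide_nonneg_pos norm_ge_zero)
    define w where "w = (1 / real n) *\<^sub>R v"
    have v: "v = real n *\<^sub>R w" using n0 by (simp add: w_def)
    have nw: "norm w < \<rho>" using n n0 \<rho>(1) by (simp add: w_def field_simps)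
    then have "w \<in> OU'" using r(2) \<rho> by (auto simp: subset_iff)
    then have Fw: "F (proj w) = proj (D w)" using Fk kD[OF nw] by simp
    have "F (proj (real m *\<^sub>R w)) = proj (real m *\<^sub>R D w)" for m :: nat
    proof (induction m)
      case (Suc m)
      have "F (proj (real m *\<^sub>R w + w)) = proj (real m *\<^sub>R D w + D w)" unfolding Fadd Suc Fw by (rule mult_torus)
      then show ?case by (simp add: scaleR_add_left algebra_simps)
    qed (simp add: F0)
    from this[of n] show ?thesis unfolding v Dsc .
  qed
  have "D v \<in> Lam" if "v \<in> Lam" for v
    using FD[of v] F0 proj_eq[of v 0] proj_eq[of "D v" 0] that by simp
  then obtain \<mu> where "\<mu> \<in> Ord" "\<forall>v. D v = \<mu> * v" using lattice_endomorphism[OF clin] by blast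
  then show ?thesis using FD by metis
qed

text \<open>Multiplication by \<mu> on cosets; the choice of a representative is harmless for \<mu>
  in the order, which preserves \<open>Lam\<close>.\<close>

definition Th :: "complex ^ 'n \<Rightarrow> (complex ^ 'n) set \<Rightarrow> (complex ^ 'n) set" where
  "Th \<mu> = (\<lambda>Q\<in>carrier (torus Lam). proj (\<mu> * (SOME v. Q = proj v)))"

lemma Th_proj: assumes "\<mu> \<in> Ord" shows "Th \<mu> (proj v) = proj (\<mu> * v)"
proof -
  define w where "w = (SOME w. proj v = proj w)"
  have "proj v = proj w" unfolding w_def by (rule someI_ex) blast
  then have "\<mu> * (w - v) \<in> Lam" using Lam_closed(6)[OF assms] by (simp add: proj_eq[symmetric])
  then have "proj (\<mu> * w) = proj (\<mu> * v)" by (simp add: proj_eq algebra_simps)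
  then show ?thesis by (simp add: Th_def carrier_torus w_def)
qed

lemma Th_ext: "Th \<mu> \<in> extensional (carrier (torus Lam))" by (simp add: Th_def)

lemma torus_fun_eq:
  assumes "F \<in> extensional (carrier (torus Lam))" "F' \<in> extensional (carrier (torus Lam))" "\<And>v. F (proj v) = F' (proj v)"
  shows "F = F'"
  by (rule extensionalityI[OF assms(1,2)]) (use assms(3) in \<open>auto simp: carrier_torus\<close>)

lemma Th_End: assumes \<mu>: "\<mu> \<in> Ord" shows "Th \<mu> \<in> carrier (torus_End Lam)"
proof -
  have "Th \<mu> \<in> hom (torus Lam) (torus Lam)"
    by (rule homI) (auto simp: carrier_torus Th_proj[OF \<mu>] mult_torus distrib_left)
  have hv: "holomorphic_vec_on UNIV (\<lambda>y. \<mu> * y)"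
    unfolding holomorphic_vec_on_def
  proof
    fix y :: "complex ^ 'n"
    have vs: "vector_space ((*s) :: complex \<Rightarrow> complex ^ 'n \<Rightarrow> complex ^ 'n)" by (rule vec.vector_space_axioms)
    have l: "Vector_Spaces.linear (*s) (*s) (\<lambda>y. \<mu> * y)"
      unfolding Vector_Spaces.linear_iff using vs by (simp add: vec_eq_iff algebra_simps)
    have "linear (\<lambda>y. \<mu> * y)" by (rule linearI) (simp_all add: algebra_simps vec_eq_iff)
    then have "((\<lambda>y. \<mu> * y) has_derivative (\<lambda>y. \<mu> * y)) (at y)" by (rule linear_imp_has_derivative)
    then show "\<exists>D. Vector_Spaces.linear (*s) (*s) D \<and> ((\<lambda>y. \<mu> * y) has_derivative D) (at y)" using l by blast
  qed
  have "torus_holomorphic Lam (Th \<mu>)"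
    unfolding torus_holomorphic_def
  proof
    fix x
    show "\<exists>U h. open U \<and> x \<in> U \<and> holomorphic_vec_on U h \<and> (\<forall>y\<in>U. Th \<mu> (proj y) = proj (h y))"
      by (rule exI[of _ UNIV], rule exI[of _ "\<lambda>y. \<mu> * y"]) (simp add: hv Th_proj[OF \<mu>])
  qed
  with \<open>Th \<mu> \<in> hom (torus Lam) (torus Lam)\<close> show ?thesis using Th_ext by (simp add: torus_End_def)
qed

lemma Th_iso: "Th \<in> ring_iso (vring Ord) (torus_End Lam)"
proof (rule ring_iso_memI)
  show "Th \<mu> \<in> carrier (torus_End Lam)" if "\<mu> \<in> carrier (vring Ord)" for \<mu> using Th_End that by simp
  show "Th (x \<otimes>\<^bsub>vring Ord\<^esub> y) = Th x \<otimes>\<^bsub>torus_End Lam\<^esub> Th y" if "x \<in> carrier (vring Ord)" "y \<in> carrier (vring Ord)" for x y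
  proof (rule torus_fun_eq[OF Th_ext])
    show "Th x \<otimes>\<^bsub>torus_End Lam\<^esub> Th y \<in> extensional (carrier (torus Lam))" by (simp add: torus_End_def)
    show "Th (x \<otimes>\<^bsub>vring Ord\<^esub> y) (proj v) = (Th x \<otimes>\<^bsub>torus_End Lam\<^esub> Th y) (proj v)" for v
      using that by (simp add: torus_End_def compose_def carrier_torus Th_proj Ord_closed mult.assoc)
  qed
  show "Th (x \<oplus>\<^bsub>vring Ord\<^esub> y) = Th x \<oplus>\<^bsub>torus_End Lam\<^esub> Th y" if "x \<in> carrier (vring Ord)" "y \<in> carrier (vring Ord)" for x y
  proof (rule torus_fun_eq[OF Th_ext])
    show "Th x \<oplus>\<^bsub>torus_End Lam\<^esub> Th y \<in> extensional (carrier (torus Lam))" by (simp add: torus_End_def)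
    show "Th (x \<oplus>\<^bsub>vring Ord\<^esub> y) (proj v) = (Th x \<oplus>\<^bsub>torus_End Lam\<^esub> Th y) (proj v)" for v
      using that by (simp add: torus_End_def carrier_torus Th_proj Ord_closed mult_torus distrib_right)
  qed
  show "Th \<one>\<^bsub>vring Ord\<^esub> = \<one>\<^bsub>torus_End Lam\<^esub>"
  proof (rule torus_fun_eq[OF Th_ext])
    show "\<one>\<^bsub>torus_End Lam\<^esub> \<in> extensional (carrier (torus Lam))" by (simp add: torus_End_def)
    show "Th \<one>\<^bsub>vring Ord\<^esub> (proj v) = \<one>\<^bsub>torus_End Lam\<^esub> (proj v)" for v
      by (simp add: torus_End_def carrier_torus Th_proj Ord_closed)
  qed
  show "bij_betw Th (carrier (vring Ord)) (carrier (torus_End Lam))"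
    unfolding bij_betw_def
  proof
    show "inj_on Th (carrier (vring Ord))"
    proof (rule inj_onI)
      fix x y assume "x \<in> carrier (vring Ord)" "y \<in> carrier (vring Ord)" and eq: "Th x = Th y"
      then have xy: "x \<in> Ord" "y \<in> Ord" by simp_all
      \<comment> \<open>If x and y induce the same map, (x - y) v is a lattice vector for every v;
        small scalars in place of v make it too short to be nonzero.\<close>
      have L: "(x - y) * v \<in> Lam" for v
        using eq Th_proj[OF xy(1), of v] Th_proj[OF xy(2), of v] proj_eq[of "x * v" "y * v"] by (simp add: algebra_simps)
      obtain e where e: "e > 0" "\<And>v. v \<in> Lam \<Longrightarrow> norm v < e \<Longrightarrow> v = 0" using Lam_separated by blast
      define c where "c = e / (norm (x - y) + 1)"
      have c: "c > 0" unfolding c_def using e(1) by (intro divide_pos_pos) (auto intro: add_nonneg_pos)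
      have m: "c *\<^sub>R (x - y) = (x - y) * (\<chi> i. of_real c)" by (simp add: vec_eq_iff complex_scaleR_of_real mult.commute)
      have p: "norm (x - y) + 1 > 0" by (intro add_nonneg_pos) auto
      have "norm (c *\<^sub>R (x - y)) = c * norm (x - y)" using c by simp
      also have "\<dots> < c * (norm (x - y) + 1)" using c by simp
      also have "\<dots> = e" using p by (simp add: c_def)
      finally have "c *\<^sub>R (x - y) = 0" using L unfolding m by (intro e(2)) auto
      then show "x = y" using c by simp
    qed
    show "Th ` carrier (vring Ord) = carrier (torus_End Lam)"
    proof
      show "Th ` carrier (vring Ord) \<subseteq> carrier (torus_End Lam)" using Th_End by auto
      show "carrier (torus_End Lam) \<subseteq> Th ` carrier (vring Ord)"
      proof
        fix F assume F: "F \<in> carrier (torus_End Lam)"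
        obtain \<mu> where \<mu>: "\<mu> \<in> Ord" "\<forall>v. F (proj v) = proj (\<mu> * v)" using endomorphism_lift[OF F] by blast
        have "F = Th \<mu>"
          by (rule torus_fun_eq[OF _ Th_ext]) (use F \<mu> in \<open>auto simp: torus_End_def Th_proj\<close>)
        then show "F \<in> Th ` carrier (vring Ord)" using \<mu>(1) by simp
      qed
    qed
  qed
qed

lemma ring_closed_Ord: "ring_closed Ord" unfolding ring_closed_def using Ord_closed by blast

lemma cring_End: "cring (torus_End Lam)"
proof -
  have "Th 0 = \<zero>\<^bsub>torus_End Lam\<^esub>"
  proof (rule torus_fun_eq[OF Th_ext])
    show "\<zero>\<^bsub>torus_End Lam\<^esub> \<in> extensional (carrier (torus Lam))" by (simp add: torus_End_def)
    show "Th 0 (proj v) = \<zero>\<^bsub>torus_End Lam\<^esub> (proj v)" for v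
      by (simp add: torus_End_def carrier_torus Th_proj Ord_closed one_torus)
  qed
  then show ?thesis using cring.ring_iso_imp_img_cring[OF cring_vring[OF ring_closed_Ord] Th_iso] by simp
qed

lemma Aut_iso:
  "Th \<in> iso \<lparr>carrier = OU, monoid.mult = (*), one = 1\<rparr> (torus_Aut Lam)"
proof -
  note E = ring_iso_memE[OF Th_iso]
  have U: "Units (torus_End Lam) = Th ` OU"
  proof
    show "Th ` OU \<subseteq> Units (torus_End Lam)"
    proof (rule image_subsetI)
      fix x assume x: "x \<in> OU"
      then obtain y where y: "y \<in> Ord" "x * y = 1" "x \<in> Ord" unfolding OU_def by blast
      have "Th x \<otimes>\<^bsub>torus_End Lam\<^esub> Th y = \<one>\<^bsub>torus_End Lam\<^esub>" "Th y \<otimes>\<^bsub>torus_End Lam\<^esub> Th x = \<one>\<^bsub>torus_End Lam\<^esub>"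
        using E(2)[of x y] E(2)[of y x] E(4) y by (simp_all add: mult.commute)
      then show "Th x \<in> Units (torus_End Lam)" unfolding Units_def using E(1) y by auto
    qed
    show "Units (torus_End Lam) \<subseteq> Th ` OU"
    proof
      fix F assume "F \<in> Units (torus_End Lam)"
      then obtain F' where F: "F \<in> carrier (torus_End Lam)" "F' \<in> carrier (torus_End Lam)"
        "F' \<otimes>\<^bsub>torus_End Lam\<^esub> F = \<one>\<^bsub>torus_End Lam\<^esub>" unfolding Units_def by auto
      obtain x y where xy: "x \<in> Ord" "y \<in> Ord" "F = Th x" "F' = Th y"
        using F(1,2) E(5) unfolding bij_betw_def by (metis imageE vring_simps(1))
      have "Th (y * x) = Th 1" using E(2)[of y x] E(4) F(3) xy by simp
      then have "y * x = 1" using E(5) xy Ord_closed unfolding bij_betw_def inj_on_def by simp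
      then have "x \<in> OU" using xy unfolding OU_def by (auto simp: mult.commute)
      then show "F \<in> Th ` OU" using xy by blast
    qed
  qed
  have sub: "OU \<subseteq> Ord" unfolding OU_def by blast
  show ?thesis
  proof (rule isoI)
    show "Th \<in> hom \<lparr>carrier = OU, monoid.mult = (*), one = 1\<rparr> (torus_Aut Lam)"
      by (rule homI) (use E(2) sub U in \<open>auto simp: torus_Aut_def units_of_def subset_iff\<close>)
    show "bij_betw Th (carrier \<lparr>carrier = OU, monoid.mult = (*), one = 1\<rparr>) (carrier (torus_Aut Lam))"
      using E(5) sub unfolding bij_betw_def by (auto simp: torus_Aut_def units_of_def U intro: inj_on_subset)
  qed
qed

end

section \<open>The theorem\<close>

context generic_torus
begin

text \<open>\<open>tensor_ring_iso\<close> with the power basis of the order over the integers,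
  which stays independent over the rationals.\<close>

lemma End0_iso: "\<exists>h. h \<in> ring_iso (torus_End0 Lam) (vring Fld)"
proof -
  let ?End = "torus_End Lam"
  define Ti where "Ti = inv_into (carrier (vring Ord)) Th"
  have Ti: "Ti \<in> ring_iso ?End (vring Ord)"
    unfolding Ti_def by (rule ring_iso_set_sym[OF cring.axioms(1)[OF cring_vring[OF ring_closed_Ord]] Th_iso])
  note E = ring_iso_memE[OF Ti]
  have hom: "Ti \<in> ring_hom ?End (vring Ord)" using Ti by (simp add: ring_iso_def)
  have ringE: "ring ?End" using cring_End by (rule cring.axioms(1))
  have RR: "carrier rat_ring = UNIV" "x \<otimes>\<^bsub>rat_ring\<^esub> y = x * y" "x \<oplus>\<^bsub>rat_ring\<^esub> y = x + y" "\<one>\<^bsub>rat_ring\<^esub> = 1" "\<zero>\<^bsub>rat_ring\<^esub> = 0"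
    for x y by (simp_all add: rat_ring_def ring_of_type_algebra_def)
  have cr: "cring rat_ring" unfolding rat_ring_def by (rule cring_from_type_algebra)
  define \<omega> where "\<omega> l = Th (vpow l)" for l
  have vO: "vpow l \<in> Ord" for l unfolding vpow_def by (rule a_power_Ord)
  have \<omega>: "\<omega> l \<in> carrier ?End" "Ti (\<omega> l) = vpow l" for l
  proof -
    show "\<omega> l \<in> carrier ?End" unfolding \<omega>_def by (rule Th_End[OF vO])
    have "inj_on Th (carrier (vring Ord))" using ring_iso_memE(5)[OF Th_iso] by (simp add: bij_betw_def)
    then show "Ti (\<omega> l) = vpow l" unfolding Ti_def \<omega>_def by (rule inv_into_f_f) (simp add: vO)
  qed
  have emb: "int_embed ?End n \<in> carrier ?End" "Ti (int_embed ?End n) = of_int n" for n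
    using add_pow_hom[OF ringE hom] by blast+
  have "\<exists>h\<in>ring_iso (tensor_ring int_ring (int_embed ?End) ?End of_int rat_ring) (vring Fld).
      \<forall>x\<in>carrier ?End. \<forall>y\<in>carrier rat_ring. h (pure_tensor int_ring (int_embed ?End) ?End of_int rat_ring x y) = Ti x * cst (of_rat y)"
  proof (rule tensor_ring_iso[where \<omega> = \<omega> and g = g])
    show "cring ?End" by (rule cring_End)
    show "cring rat_ring" by (rule cr)
    show "inj_on Ti (carrier ?End)" using E(5) by (simp add: bij_betw_def)
    show "Ti (int_embed ?End k) = cst (of_rat (of_int k))" for k by (simp add: emb cst_simps)
    show "ring_closed Fld" by (rule ring_closed_Fld)
    show "Fld = {\<Sum>l<g. Ti (\<omega> l) * cst (of_rat (b l)) | b. \<forall>l<g. b l \<in> carrier rat_ring}"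
      by (simp add: Fld_alt \<omega> RR)
    show "\<exists>c. (\<forall>l<g. c l \<in> carrier int_ring) \<and> Ti x = (\<Sum>l<g. Ti (\<omega> l) * Ti (int_embed ?End (c l)))" if "x \<in> carrier ?End" for x
    proof -
      have "Ti x \<in> Ord" using E(1)[OF that] by simp
      then obtain m where "Ti x = cv m" by (rule Ord_cv)
      moreover have "cv m = (\<Sum>l<g. Ti (\<omega> l) * Ti (int_embed ?End (m l)))"
        by (simp add: vec_eq_iff cv_nth \<omega> emb vpow_def of_int_vec_nth mult.commute)
      ultimately show ?thesis by (intro exI[of _ m]) simp
    qed
    show "b l = \<zero>\<^bsub>rat_ring\<^esub>" if "(\<Sum>l<g. Ti (\<omega> l) * cst (of_rat (b l))) = 0" "l < g" for b l
      using vpow_independent[of "\<lambda>l. of_rat (b l)" l] that by (simp add: \<omega> RR)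
  qed (use E in \<open>simp_all add: RR cst_simps emb \<omega> of_rat_add of_rat_mult\<close>)
  then show ?thesis unfolding torus_End0_def by blast
qed

text \<open>As a quotient by an ideal it is a ring, so the isomorphism to \<open>Fld\<close> can be
  inverted; commutativity is then carried back from \<open>Fld\<close>.\<close>

lemma cring_End0: "cring (torus_End0 Lam)"
proof -
  obtain h where h: "h \<in> ring_iso (torus_End0 Lam) (vring Fld)" using End0_iso by blast
  let ?A = "pair_ring (torus_End Lam) rat_ring"
  let ?I = "tensor_ideal int_ring (int_embed (torus_End Lam)) (torus_End Lam) of_int rat_ring"
  have rB: "ring rat_ring" unfolding rat_ring_def by (rule ring_from_type_algebra)
  have rA: "ring ?A" by (rule ring_pair_ring[OF cring.axioms(1)[OF cring_End] rB])
  have emb: "int_embed (torus_End Lam) n \<in> carrier (torus_End Lam)" for n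
  proof -
    interpret cring "torus_End Lam" by (rule cring_End)
    show ?thesis unfolding int_embed_def by (rule add.int_pow_closed) simp
  qed
  interpret E: cring "torus_End Lam" by (rule cring_End)
  have "tensor_relations int_ring (int_embed (torus_End Lam)) (torus_End Lam) of_int rat_ring \<subseteq> carrier ?A"
    unfolding tensor_relations_def pair_ring_simps
    by (auto intro!: pset_closed emb simp: rat_ring_def ring_of_type_algebra_def)
  then have "ideal ?I ?A" unfolding tensor_ideal_def by (rule ring.genideal_ideal[OF rA])
  then have r0: "ring (torus_End0 Lam)" unfolding torus_End0_def tensor_ring_def by (rule ideal.quotient_is_ring)
  let ?k = "inv_into (carrier (torus_End0 Lam)) h"
  have k: "?k \<in> ring_iso (vring Fld) (torus_End0 Lam)" by (rule ring_iso_set_sym[OF r0 h])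
  have "?k \<zero>\<^bsub>vring Fld\<^esub> = \<zero>\<^bsub>torus_End0 Lam\<^esub>"
    by (rule ring_hom_zero[OF _ cring.axioms(1)[OF cring_vring[OF ring_closed_Fld]] r0]) (use k in \<open>simp add: ring_iso_def\<close>)
  then show ?thesis using cring.ring_iso_imp_img_cring[OF cring_vring[OF ring_closed_Fld] k] by simp
qed

lemma torus_properties:
  assumes rs: "card {i. a i \<in> \<real>} = r" "r + 2 * s = g"
  shows "torus_lattice Lam" "two_simple Lam" "number_field (torus_End0 Lam)" "field_degree (torus_End0 Lam) = g"
    "has_signature (torus_End0 Lam) r s" "torus_Aut Lam \<cong> free_Zmod (r + s - 1) \<times>\<times> sign_group"
proof -
  obtain h where h: "h \<in> ring_iso (torus_End0 Lam) (vring Fld)" using End0_iso by blast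
  show "torus_lattice Lam" by (rule torus_lattice_Lam)
  show "two_simple Lam" by (rule two_simple_Lam)
  show "number_field (torus_End0 Lam)" "field_degree (torus_End0 Lam) = g" by (rule number_field_R[OF cring_End0 h])+
  show "has_signature (torus_End0 Lam) r s" by (rule signature_R[OF cring_End0 h rs])
  let ?Z = "free_Zmod (r + s - 1) \<times>\<times> sign_group"
  have "group (free_Zmod (r + s - 1))" by (simp add: free_Zmod_def)
  moreover have "group sign_group" by (rule groupI) (auto simp: sign_group_def)
  ultimately have gZ: "group ?Z" by (rule DirProd_group)
  have "\<lparr>carrier = OU, monoid.mult = (*), one = 1\<rparr> \<cong> torus_Aut Lam" using Aut_iso by (auto simp: is_iso_def)
  with unit_group[OF rs] have "?Z \<cong> torus_Aut Lam" by (rule iso_trans)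
  then show "torus_Aut Lam \<cong> ?Z" by (rule group.iso_sym[OF gZ])
qed

end

theorem theorem1p9:
  fixes g :: nat
  assumes g_def: "g = CARD('n::finite)" and g_ge: "3 \<le> g"
  shows "(\<forall>r s :: nat. r + 2 * s = g \<longrightarrow>
            (\<exists>\<Lambda> :: (complex ^ 'n) set.
               torus_lattice \<Lambda> \<and> two_simple \<Lambda> \<and>
               number_field (torus_End0 \<Lambda>) \<and>
               field_degree (torus_End0 \<Lambda>) = g \<and>
               has_signature (torus_End0 \<Lambda>) r s)) \<and>
         (\<forall>d :: int. real g / 2 - 1 \<le> real_of_int d \<and> d \<le> int g - 1 \<longrightarrow>
            (\<exists>\<Lambda> :: (complex ^ 'n) set.
               torus_lattice \<Lambda> \<and> two_simple \<Lambda> \<and>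
               torus_Aut \<Lambda> \<cong> free_Zmod (nat d) \<times>\<times> sign_group))"
proof -
  have ex: "\<exists>\<Lambda> :: (complex ^ 'n) set. torus_lattice \<Lambda> \<and> two_simple \<Lambda> \<and> number_field (torus_End0 \<Lambda>) \<and>
      field_degree (torus_End0 \<Lambda>) = g \<and> has_signature (torus_End0 \<Lambda>) r s \<and>
      torus_Aut \<Lambda> \<cong> free_Zmod (r + s - 1) \<times>\<times> sign_group" if rs: "r + 2 * s = g" for r s
  proof -
    obtain f and a :: "'n \<Rightarrow> complex" where fa: "homog_roots f a g" "card {i. a i \<in> \<real>} = r"
      using homog_roots_exist[OF g_def g_ge rs] by blast
    obtain K t where "generic_torus f a g K t" using homog_roots.generic_torus_exists[OF fa(1)] by blast
    from generic_torus.torus_properties[OF this fa(2) rs] show ?thesis by blast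
  qed
  show ?thesis
  proof (intro conjI allI impI)
    fix r s :: nat assume "r + 2 * s = g"
    from ex[OF this] show "\<exists>\<Lambda> :: (complex ^ 'n) set. torus_lattice \<Lambda> \<and> two_simple \<Lambda> \<and>
               number_field (torus_End0 \<Lambda>) \<and> field_degree (torus_End0 \<Lambda>) = g \<and> has_signature (torus_End0 \<Lambda>) r s"
      by blast
  next
    fix d :: int assume d: "real g / 2 - 1 \<le> real_of_int d \<and> d \<le> int g - 1"
    then have "real_of_int (int g - 2) \<le> real_of_int (2 * d)" by simp
    then have dg: "int g - 2 \<le> 2 * d" by (simp only: of_int_le_iff)
    \<comment> \<open>Chosen to make r + s - 1 = d; the upper bound on d gives s \<ge> 0, and the
      lower bound gives 2 s \<le> g.\<close>
    define s where "s = nat (int g - 1 - d)"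
    define r where "r = g - 2 * s"
    have s: "int s = int g - 1 - d" using d by (simp add: s_def)
    then have "2 * s \<le> g" using dg by linarith
    then have rs: "r + 2 * s = g" by (simp add: r_def)
    have "r + s - 1 = nat d" using rs s g_ge by linarith
    then show "\<exists>\<Lambda> :: (complex ^ 'n) set. torus_lattice \<Lambda> \<and> two_simple \<Lambda> \<and> torus_Aut \<Lambda> \<cong> free_Zmod (nat d) \<times>\<times> sign_group"
      using ex[OF rs] by metis
  qed
qed

end
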